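(* Let $V\subset\mathbb{R}^n$ be a semi-algebraic set and let $\mathcal{G}$ be a (possibly infinite) proper family of continuous semi-algebraic functions $V\to\mathbb{R}_{>0}$. Suppose that $\mathcal{G}$ contains an injective family, and let $Q_{\mathcal{G}}\subset P_{\mathcal{G}}$ be the set of all injective families in $\mathcal{G}$. Then each of the maps $C(\partial_{\mathcal{G}}V)\to C(\partial_{\mathcal{F}}V)\subset\mathbb{R}^{\mathcal{F}}$, for $\mathcal{F}\in Q_{\mathcal{G}}$, is a chart for a piecewise linear structure on $C(\partial_{\mathcal{G}}V)$, and all these charts are compatible (the changes of charts are piecewise linear), hence they define a canonical piecewise linear structure on $C(\partial_{\mathcal{G}}V)$. As $C(\partial_{\mathcal{G}}V)$ is the cone on $\partial_{\mathcal{G}}V$, a piecewise linear structure is also defined on $\partial_{\mathcal{G}}V$.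
   Context: For $0<t<1$ let $\mathrm{Log}_{1/t}:(\mathbb{R}_{>0})^m\to\mathbb{R}^m$ be the componentwise logarithm in base $1/t$. For $W\subset(\mathbb{R}_{>0})^m$ the logarithmic limit set $\mathcal{A}_0(W)$ is the set of $x\in\mathbb{R}^m$ for which there are $t_k\to0^+$ and $w_k\in W$ with $\mathrm{Log}_{1/t_k}(w_k)\to x$. For $W$ closed semi-algebraic it is known to be a polyhedral complex (a closed polyhedral cone/fan). A finite family $\mathcal{F}=\{f_1,\dots,f_m\}$ of continuous semi-algebraic functions $V\to\mathbb{R}_{>0}$ is proper if $E_{\mathcal{F}}=(f_1,\dots,f_m):V\to(\mathbb{R}_{>0})^m$ is a proper map; then $C(\partial_{\mathcal{F}}V)=\mathcal{A}_0(E_{\mathcal{F}}(V))\subset\mathbb{R}^{\mathcal{F}}$. An arbitrary family $\mathcal{G}$ is proper if it contains a finite proper subfamily; $P_{\mathcal{G}}$ is the set of finite proper subfamilies, ordered by inclusion. For $\mathcal{F}\subset\mathcal{F}'$ in $P_{\mathcal{G}}$ the coordinate projection restricts to a surjective map $C(\partial_{\mathcal{F}'}V)\to C(\partial_{\mathcal{F}}V)$, and $C(\partial_{\mathcal{G}}V)=\varprojlim_{\mathcal{F}\in P_{\mathcal{G}}}C(\partial_{\mathcal{F}}V)$, which is identified with a closed subset of $\mathbb{R}^{\mathcal{G}}$. $\partial_{\mathcal{G}}V$ is the quotient of $C(\partial_{\mathcal{G}}V)\setminus\{0\}$ by positive scaling; it is the boundary of the compactification of $V$ associated with $\mathcal{G}$.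 An injective family is a finite proper subfamily $\mathcal{F}\subset\mathcal{G}$ such that the canonical surjective map $C(\partial_{\mathcal{G}}V)\to C(\partial_{\mathcal{F}}V)$ is also injective. *)

theory Defs
  imports "HOL-Analysis.Analysis"
begin

section \<open>Semi-algebraic sets and functions\<close>

inductive semialgebraic :: "'a::euclidean_space set \<Rightarrow> bool" where
  pos: "real_polynomial_function p \<Longrightarrow> semialgebraic {x. p x > 0}"
| zero: "real_polynomial_function p \<Longrightarrow> semialgebraic {x. p x = 0}"
| un: "semialgebraic A \<Longrightarrow> semialgebraic B \<Longrightarrow> semialgebraic (A \<union> B)"
| int: "semialgebraic A \<Longrightarrow> semialgebraic B \<Longrightarrow> semialgebraic (A \<inter> B)"
| compl: "semialgebraic A \<Longrightarrow> semialgebraic (- A)"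

definition semialgebraic_function_on :: "'a::euclidean_space set \<Rightarrow> ('a \<Rightarrow> real) \<Rightarrow> bool" where
  "semialgebraic_function_on V f \<longleftrightarrow> semialgebraic ((\<lambda>x. (x, f x)) ` V)"

text \<open>
  A family of functions on \<open>V\<close> is a set of functions, which serves as its own index set, so that
  $\mathbb{R}^{\mathcal{F}}$ is the set of functions on \<open>F\<close> extensional outside of \<open>F\<close>, with the
  product topology \<open>powertop_real F\<close>.  Only the values on \<open>V\<close> of the members are ever used.
\<close>

definition semialgebraic_family :: "'a::euclidean_space set \<Rightarrow> ('a \<Rightarrow> real) set \<Rightarrow> bool" where
  "semialgebraic_family V G \<longleftrightarrow>
     (\<forall>f\<in>G. continuous_on V f \<and> semialgebraic_function_on V f \<and> f ` V \<subseteq> {0<..})"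

section \<open>The cones of the boundary\<close>

definition log_limit_set :: "'i set \<Rightarrow> ('i \<Rightarrow> real) set \<Rightarrow> ('i \<Rightarrow> real) set" where
  "log_limit_set I W =
     {x. \<exists>t w. (\<forall>k. 0 < t k \<and> t k < 1 \<and> w k \<in> W) \<and> t \<longlonglongrightarrow> 0 \<and>
           limitin (powertop_real I) (\<lambda>k. \<lambda>i\<in>I. log (1 / t k) (w k i)) x sequentially}"

definition eval_map :: "('a \<Rightarrow> real) set \<Rightarrow> 'a \<Rightarrow> ('a \<Rightarrow> real) \<Rightarrow> real" where
  "eval_map F x = (\<lambda>f\<in>F. f x)"

definition proper_finite_family :: "'a::euclidean_space set \<Rightarrow> ('a \<Rightarrow> real) set \<Rightarrow> bool" where
  "proper_finite_family V F \<longleftrightarrow> finite F \<and>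
     proper_map (top_of_set V) (subtopology (powertop_real F) (F \<rightarrow>\<^sub>E {0<..})) (eval_map F)"

definition proper_subfamilies :: "'a::euclidean_space set \<Rightarrow> ('a \<Rightarrow> real) set \<Rightarrow> ('a \<Rightarrow> real) set set" where
  "proper_subfamilies V G = {F. F \<subseteq> G \<and> proper_finite_family V F}"

definition proper_family :: "'a::euclidean_space set \<Rightarrow> ('a \<Rightarrow> real) set \<Rightarrow> bool" where
  "proper_family V G \<longleftrightarrow> proper_subfamilies V G \<noteq> {}"

definition finite_cone :: "'a::euclidean_space set \<Rightarrow> ('a \<Rightarrow> real) set \<Rightarrow> (('a \<Rightarrow> real) \<Rightarrow> real) set" where
  "finite_cone V F = log_limit_set F (eval_map F ` V)"

text \<open>
  The inverse limit over \<open>proper_subfamilies V G\<close>, as a closed subset of $\mathbb{R}^{\mathcal{G}}$: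
  adding a member of \<open>G\<close> to a finite proper subfamily gives a finite proper subfamily, so these
  subfamilies cover \<open>G\<close> and a compatible family of points is a single function on \<open>G\<close>.
\<close>

definition limit_cone :: "'a::euclidean_space set \<Rightarrow> ('a \<Rightarrow> real) set \<Rightarrow> (('a \<Rightarrow> real) \<Rightarrow> real) set" where
  "limit_cone V G = {x \<in> G \<rightarrow>\<^sub>E UNIV. \<forall>F\<in>proper_subfamilies V G. restrict x F \<in> finite_cone V F}"

abbreviation cone_top ::
  "'a::euclidean_space set \<Rightarrow> ('a \<Rightarrow> real) set \<Rightarrow> (('a \<Rightarrow> real) \<Rightarrow> real) topology" where
  "cone_top V G \<equiv> subtopology (powertop_real G) (limit_cone V G)"

definition cone_proj ::
  "('a \<Rightarrow> real) set \<Rightarrow> (('a \<Rightarrow> real) \<Rightarrow> real) \<Rightarrow> ('a \<Rightarrow> real) \<Rightarrow> real" where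
  "cone_proj F x = restrict x F"

text \<open>Surjectivity onto \<open>finite_cone V F\<close> is not part of the definition of an injective family.\<close>

definition injective_families :: "'a::euclidean_space set \<Rightarrow> ('a \<Rightarrow> real) set \<Rightarrow> ('a \<Rightarrow> real) set set" where
  "injective_families V G = {F \<in> proper_subfamilies V G. inj_on (cone_proj F) (limit_cone V G)}"

section \<open>The boundary\<close>

definition scale :: "'i set \<Rightarrow> real \<Rightarrow> ('i \<Rightarrow> real) \<Rightarrow> 'i \<Rightarrow> real" where
  "scale I r x = (\<lambda>i\<in>I. r * x i)"

definition punctured_cone ::
  "'a::euclidean_space set \<Rightarrow> ('a \<Rightarrow> real) set \<Rightarrow> (('a \<Rightarrow> real) \<Rightarrow> real) set" where
  "punctured_cone V G = limit_cone V G - {\<lambda>g\<in>G. 0}"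

definition ray_rel ::
  "'a::euclidean_space set \<Rightarrow> ('a \<Rightarrow> real) set \<Rightarrow>
   ((('a \<Rightarrow> real) \<Rightarrow> real) \<times> (('a \<Rightarrow> real) \<Rightarrow> real)) set" where
  "ray_rel V G =
     {(x, y). x \<in> punctured_cone V G \<and> y \<in> punctured_cone V G \<and> (\<exists>r>0. y = scale G r x)}"

definition boundary ::
  "'a::euclidean_space set \<Rightarrow> ('a \<Rightarrow> real) set \<Rightarrow> (('a \<Rightarrow> real) \<Rightarrow> real) set set" where
  "boundary V G = punctured_cone V G // ray_rel V G"

definition quotient_topology :: "'x topology \<Rightarrow> ('x \<Rightarrow> 'y) \<Rightarrow> 'y topology" where
  "quotient_topology X q =
     topology (\<lambda>U. U \<subseteq> q ` topspace X \<and> openin X {x \<in> topspace X. q x \<in> U})"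

lemma openin_quotient_topology:
  "openin (quotient_topology X q) U \<longleftrightarrow>
     U \<subseteq> q ` topspace X \<and> openin X {x \<in> topspace X. q x \<in> U}"
proof -
  have "istopology (\<lambda>U. U \<subseteq> q ` topspace X \<and> openin X {x \<in> topspace X. q x \<in> U})"
    unfolding istopology_def
  proof (intro conjI allI impI)
    fix S T
    assume "S \<subseteq> q ` topspace X \<and> openin X {x \<in> topspace X. q x \<in> S}"
      and "T \<subseteq> q ` topspace X \<and> openin X {x \<in> topspace X. q x \<in> T}"
    moreover have "{x \<in> topspace X. q x \<in> S \<inter> T} =
        {x \<in> topspace X. q x \<in> S} \<inter> {x \<in> topspace X. q x \<in> T}"
      by auto
    ultimately show "S \<inter> T \<subseteq> q ` topspace X" "openin X {x \<in> topspace X. q x \<in> S \<inter> T}"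
      by auto
  next
    fix K
    assume K: "\<forall>S\<in>K. S \<subseteq> q ` topspace X \<and> openin X {x \<in> topspace X. q x \<in> S}"
    then show "\<Union>K \<subseteq> q ` topspace X" by auto
    have "{x \<in> topspace X. q x \<in> \<Union>K} = (\<Union>S\<in>K. {x \<in> topspace X. q x \<in> S})" by auto
    then show "openin X {x \<in> topspace X. q x \<in> \<Union>K}" using K by auto
  qed
  then show ?thesis
    by (simp add: quotient_topology_def topology_inverse')
qed

lemma quotient_map_quotient_topology: "quotient_map X (quotient_topology X q) q"
proof -
  have "openin (quotient_topology X q) (q ` topspace X)"
  proof -
    have "{x \<in> topspace X. q x \<in> q ` topspace X} = topspace X" by auto
    then show ?thesis by (simp add: openin_quotient_topology)
  qed
  then have "topspace (quotient_topology X q) = q ` topspace X"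
    by (metis openin_quotient_topology openin_subset openin_topspace subset_antisym)
  then show ?thesis
    by (auto simp: quotient_map_def openin_quotient_topology)
qed

definition boundary_top ::
  "'a::euclidean_space set \<Rightarrow> ('a \<Rightarrow> real) set \<Rightarrow> (('a \<Rightarrow> real) \<Rightarrow> real) set topology" where
  "boundary_top V G =
     quotient_topology (subtopology (powertop_real G) (punctured_cone V G)) (\<lambda>x. ray_rel V G `` {x})"

section \<open>Piecewise linear structures\<close>

text \<open>
  Polyhedra here live in $\mathbb{R}^I$ for a finite set \<open>I\<close>, that is, in \<open>I \<rightarrow>\<^sub>E UNIV\<close>;
  the library's \<^const>\<open>polyhedron\<close> is about the types of class \<open>euclidean_space\<close>.
\<close>

definition convex_polyhedron :: "'i set \<Rightarrow> ('i \<Rightarrow> real) set \<Rightarrow> bool" where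
  "convex_polyhedron I P \<longleftrightarrow>
     (\<exists>H :: (('i \<Rightarrow> real) \<times> real) set. finite H \<and>
        P = {x \<in> I \<rightarrow>\<^sub>E UNIV. \<forall>(a, b)\<in>H. (\<Sum>i\<in>I. a i * x i) \<le> b})"

definition affine_map_on ::
  "'i set \<Rightarrow> 'j set \<Rightarrow> ('i \<Rightarrow> real) set \<Rightarrow> (('i \<Rightarrow> real) \<Rightarrow> 'j \<Rightarrow> real) \<Rightarrow> bool" where
  "affine_map_on I J P f \<longleftrightarrow>
     (\<exists>a b. \<forall>x\<in>P. \<forall>j\<in>J. f x j = b j + (\<Sum>i\<in>I. a j i * x i))"

text \<open>
  Polyhedral subsets and piecewise linear maps are defined locally, so that open subsets of
  polyhedral subsets are again polyhedral and can be the ranges of charts.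
\<close>

definition polyhedral :: "'i set \<Rightarrow> ('i \<Rightarrow> real) set \<Rightarrow> bool" where
  "polyhedral I A \<longleftrightarrow>
     (\<forall>x\<in>A. \<exists>\<P>. finite \<P> \<and> (\<forall>P\<in>\<P>. convex_polyhedron I P) \<and> \<Union>\<P> \<subseteq> A \<and>
        x \<in> (subtopology (powertop_real I) A) interior_of \<Union>\<P>)"

definition pl_on ::
  "'i set \<Rightarrow> 'j set \<Rightarrow> ('i \<Rightarrow> real) set \<Rightarrow> (('i \<Rightarrow> real) \<Rightarrow> 'j \<Rightarrow> real) \<Rightarrow> bool" where
  "pl_on I J A f \<longleftrightarrow>
     (\<forall>x\<in>A. \<exists>\<P>. finite \<P> \<and> (\<forall>P\<in>\<P>. convex_polyhedron I P \<and> affine_map_on I J P f) \<and>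
        \<Union>\<P> \<subseteq> A \<and> x \<in> (subtopology (powertop_real I) A) interior_of \<Union>\<P>)"

text \<open>
  A chart \<open>(U, I, \<phi>)\<close> has domain \<open>U\<close> and values in $\mathbb{R}^I$.  A piecewise linear structure is
  a maximal atlas; the type of the coordinate indices should be infinite for all dimensions
  to occur.
\<close>

type_synonym ('x, 'i) pl_chart = "'x set \<times> 'i set \<times> ('x \<Rightarrow> 'i \<Rightarrow> real)"

definition is_pl_chart :: "'x topology \<Rightarrow> ('x, 'i) pl_chart \<Rightarrow> bool" where
  "is_pl_chart X = (\<lambda>(U, I, \<phi>).
     openin X U \<and> finite I \<and> polyhedral I (\<phi> ` U) \<and>
     homeomorphic_map (subtopology X U) (subtopology (powertop_real I) (\<phi> ` U)) \<phi>)"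

definition pl_compatible :: "('x, 'i) pl_chart \<Rightarrow> ('x, 'i) pl_chart \<Rightarrow> bool" where
  "pl_compatible = (\<lambda>(U, I, \<phi>) (W, J, \<psi>).
     pl_on I J (\<phi> ` (U \<inter> W)) (\<psi> \<circ> the_inv_into U \<phi>) \<and>
     pl_on J I (\<psi> ` (U \<inter> W)) (\<phi> \<circ> the_inv_into W \<psi>))"

definition pl_atlas :: "'x topology \<Rightarrow> ('x, 'i) pl_chart set \<Rightarrow> bool" where
  "pl_atlas X \<A> \<longleftrightarrow>
     (\<forall>c\<in>\<A>. is_pl_chart X c) \<and> (\<forall>c\<in>\<A>. \<forall>d\<in>\<A>. pl_compatible c d) \<and>
     topspace X \<subseteq> (\<Union>c\<in>\<A>. fst c)"

definition pl_structure :: "'x topology \<Rightarrow> ('x, 'i) pl_chart set \<Rightarrow> bool" where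
  "pl_structure X \<S> \<longleftrightarrow> pl_atlas X \<S> \<and> (\<forall>\<A>. pl_atlas X \<A> \<and> \<S> \<subseteq> \<A> \<longrightarrow> \<A> = \<S>)"

definition pl_map ::
  "'x topology \<Rightarrow> ('x, 'i) pl_chart set \<Rightarrow> 'y topology \<Rightarrow> ('y, 'j) pl_chart set \<Rightarrow> ('x \<Rightarrow> 'y) \<Rightarrow> bool" where
  "pl_map X \<S> Y \<T> f \<longleftrightarrow> continuous_map X Y f \<and>
     (\<forall>(U, I, \<phi>)\<in>\<S>. \<forall>(W, J, \<psi>)\<in>\<T>.
        pl_on I J (\<phi> ` {x \<in> U. f x \<in> W}) (\<psi> \<circ> f \<circ> the_inv_into U \<phi>))"

section \<open>Charts of the cone, and the structure on the boundary\<close>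

definition cone_chart ::
  "'a::euclidean_space set \<Rightarrow> ('a \<Rightarrow> real) set \<Rightarrow> ('a \<Rightarrow> real) set \<Rightarrow>
   (('a \<Rightarrow> real) \<Rightarrow> real, 'a \<Rightarrow> real) pl_chart" where
  "cone_chart V G F = (limit_cone V G, F, cone_proj F)"

text \<open>
  The cone over the boundary: a map \<open>s\<close> choosing a point on each ray identifies the product of the
  boundary with the open half-line with the punctured cone.  The structure \<open>\<T>\<close> on the boundary is
  the one obtained from the structure \<open>\<S>\<close> of the cone if such an \<open>s\<close> can be chosen piecewise linear;
  \<open>\<T>\<close> is then the structure of the cross-section \<open>s ` boundary V G\<close>, carried over by \<open>s\<close>.  The radial
  projection between two cross-sections is only piecewise projective, so \<open>\<T>\<close>, unlike \<open>\<S>\<close>, depends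
  on a choice.
\<close>

definition is_cone_section ::
  "'a::euclidean_space set \<Rightarrow> ('a \<Rightarrow> real) set \<Rightarrow>
   ((('a \<Rightarrow> real) \<Rightarrow> real) set \<Rightarrow> ('a \<Rightarrow> real) \<Rightarrow> real) \<Rightarrow> bool" where
  "is_cone_section V G s \<longleftrightarrow>
     (\<forall>\<rho>\<in>boundary V G. s \<rho> \<in> \<rho>) \<and>
     homeomorphic_map (prod_topology (boundary_top V G) (top_of_set {0<..}))
       (subtopology (powertop_real G) (punctured_cone V G)) (\<lambda>(\<rho>, r). scale G r (s \<rho>))"

definition boundary_structure_from_cone ::
  "'a::euclidean_space set \<Rightarrow> ('a \<Rightarrow> real) set \<Rightarrow>
   (('a \<Rightarrow> real) \<Rightarrow> real, 'a \<Rightarrow> real) pl_chart set \<Rightarrow>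
   ((('a \<Rightarrow> real) \<Rightarrow> real) set, 'a \<Rightarrow> real) pl_chart set \<Rightarrow> bool" where
  "boundary_structure_from_cone V G \<S> \<T> \<longleftrightarrow>
     pl_structure (boundary_top V G) \<T> \<and>
     (\<exists>s. is_cone_section V G s \<and> pl_map (boundary_top V G) \<T> (cone_top V G) \<S> s)"

end

theory Submission
  imports Defs "HOL-Computational_Algebra.Fundamental_Theorem_Algebra"
    "HOL-Library.Multiset"
begin

text \<open>
  Everything rests on one fact about the logarithmic image
  $\{(\ln f(x))_{f \in F} : x \in V\}$ of a semi-algebraic set under a finite family \<open>F\<close> of positive
  semi-algebraic functions: it is at bounded Hausdorff distance, in the maximum norm, from a finite
  union of finitely generated convex cones.  Such sets are called coarsely conic, the union of
  cones a fan, and the fact is \<open>log_image_coarsely_conic\<close>.  Dividing by $\ln (1/t)$ and letting $t \to 0$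
  makes bounded errors disappear, so \<open>finite_cone V F\<close> is the fan itself, and for \<open>F' \<subseteq> F\<close> the projection
  of the same fan is \<open>finite_cone V F'\<close> (\<open>finite_cone_eq_fan\<close>).  Hence the cones are finite unions of
  polyhedra, by Fourier--Motzkin elimination, and the projections between them are surjective.

  Coarse conicity survives projections: if a set of points is coarsely conic, so is its image under
  forgetting some of the coordinates.  This replaces quantifier elimination.  The values of the functions in \<open>F\<close> become new
  coordinates, their graphs become polynomial conditions, and it remains to treat, for sets defined by
  sign conditions on polynomials, the logarithms of polynomials without zeros on the set
  (\<open>definable_conic_logs\<close>).

  That is an induction on the number of coordinates.  In the new coordinate $y$ the set is cut into
  cells lying over definable pieces of the base: graphs of root functions $\xi$, and the strips
  $y = \xi(x) \pm s$ where $s$ is at most half the distance from $\xi(x)$ to the next root function.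
  If all derivatives of the polynomials concerned have their roots among the root functions, then on
  such a strip $|q(x,y)|$ is comparable to $\sum_k |\partial_y^k q(x,\xi(x))| s^k$
  (\<open>taylor_size_le_abs_poly\<close>).  Consequently $\ln |q|$ is, up to a bounded error, a maximum of the
  functions $\ln |\partial_y^k q(x,\xi(x))| + k \ln s$, which is piecewise linear, and a strip is a family of
  half-lines $\ln s \le \ln \rho(x)$, over which coarse conicity is immediate (\<open>coarsely_conic_below\<close>).

  For the induction to close, the values of polynomials at root functions and the distances between
  root functions have to be controlled by polynomials on the base.  They are tame: their
  logarithms are, up to a bounded error, piecewise linear functions of logarithms of absolute
  values of polynomials.  This is \<open>root_decomposition\<close>, which follows the pattern of the
  Cohen--Hoermander algorithm: a root of $r$ that is not yet among the root functions is located
  between neighbouring roots of its derivatives; its distance $s$ to a neighbour $\xi$ solves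
  $|r(\xi)| \asymp \sum_{k \ge 1} |r^{(k)}(\xi)| s^k$ (\<open>taylor_size_at_root\<close>), so $1/s$ is comparable to a sum of
  powers of tame functions (\<open>tame_solve\<close>); and $p$ takes there the value of the polynomial
  $p \bmod r$, which has lower degree.

  Properness of \<open>F\<close> enters by compactness: the part of \<open>V\<close> on which all $\ln f$, \<open>f \<in> F\<close>, are bounded is
  compact, so a point of a larger cone that vanishes on \<open>F\<close> is zero (\<open>proper_kernel\<close>), and therefore the
  coordinates of a point of a larger cone are bounded in terms of those in \<open>F\<close>.  Tychonoff's theorem then
  lifts the points of \<open>finite_cone V F\<close> to the inverse limit (\<open>limit_cone_lift\<close>).  If \<open>F\<close> is injective, the
  lift is unique, and on the projection of each single cone of a fan a coordinate that is determined
  by the others is a linear function of them (\<open>ccone_coordinate_linear\<close>).  So the inverse of the chart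
  is piecewise linear in every coordinate (\<open>lift_from_pl\<close>).  This gives at once that the chart is a
  homeomorphism and that any two of these charts are compatible.

  All these charts are global.  A global chart is contained in exactly one maximal atlas, which
  consists of all charts compatible with it (\<open>pl_structure_of_global_chart\<close>).  The boundary gets its
  structure in the same way from one global chart: the points of the cone where the maximum norm
  of the coordinates in \<open>F\<close> equals 1 form a polyhedral cross-section that meets every ray once
  (\<open>boundary_structure_exists\<close>).
\<close>

section \<open>Finitely generated cones and piecewise linear functions\<close>

text \<open>
  Vectors are functions on a whole type of indices; the coordinates that matter are singled out
  separately, by a set \<open>J\<close> of indices.
\<close>

definition ccone :: "('j \<Rightarrow> real) set \<Rightarrow> ('j \<Rightarrow> real) set" where
  "ccone G = {x. \<exists>c. (\<forall>g\<in>G. 0 \<le> c g) \<and> x = (\<lambda>j. \<Sum>g\<in>G. c g * g j)}"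

lemma cconeI: "(\<And>g. g \<in> G \<Longrightarrow> 0 \<le> c g) \<Longrightarrow> (\<lambda>j. \<Sum>g\<in>G. c g * g j) \<in> ccone G"
  by (auto simp: ccone_def)

lemma zero_in_ccone: "(\<lambda>j. 0) \<in> ccone G"
  using cconeI[of G "\<lambda>_. 0"] by simp

lemma ccone_add: "x \<in> ccone G \<Longrightarrow> y \<in> ccone G \<Longrightarrow> (\<lambda>j. x j + y j) \<in> ccone G"
proof -
  assume "x \<in> ccone G" "y \<in> ccone G"
  then obtain c d where "\<forall>g\<in>G. 0 \<le> c g" "x = (\<lambda>j. \<Sum>g\<in>G. c g * g j)"
    "\<forall>g\<in>G. 0 \<le> d g" "y = (\<lambda>j. \<Sum>g\<in>G. d g * g j)" by (auto simp: ccone_def)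
  then show ?thesis using cconeI[of G "\<lambda>g. c g + d g"]
    by (simp add: sum.distrib distrib_right)
qed

lemma ccone_scale: "x \<in> ccone G \<Longrightarrow> 0 \<le> r \<Longrightarrow> (\<lambda>j. r * x j) \<in> ccone G"
proof -
  assume "x \<in> ccone G" "0 \<le> r"
  then obtain c where "\<forall>g\<in>G. 0 \<le> c g" "x = (\<lambda>j. \<Sum>g\<in>G. c g * g j)" by (auto simp: ccone_def)
  then show ?thesis using cconeI[of G "\<lambda>g. r * c g"] \<open>0 \<le> r\<close>
    by (simp add: sum_distrib_left mult.assoc)
qed

lemma generator_in_ccone: "finite G \<Longrightarrow> g \<in> G \<Longrightarrow> g \<in> ccone G"
  using cconeI[of G "\<lambda>h. if h = g then 1 else 0"]
  by (simp add: if_distrib[of "\<lambda>c. c * _"] cong: if_cong)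

lemma cone_closed_sum:
  assumes "finite G" "(\<lambda>j. 0) \<in> K"
    and "\<And>x y. x \<in> K \<Longrightarrow> y \<in> K \<Longrightarrow> (\<lambda>j. x j + y j) \<in> K"
    and "\<And>x r. x \<in> K \<Longrightarrow> 0 \<le> r \<Longrightarrow> (\<lambda>j. r * x j) \<in> K"
    and "\<And>g. g \<in> G \<Longrightarrow> v g \<in> K" and "\<And>g. g \<in> G \<Longrightarrow> (0::real) \<le> c g"
  shows "(\<lambda>j. \<Sum>g\<in>G. c g * v g j) \<in> K"
  using assms(1,5,6) by (induction G rule: finite_induct) (simp_all add: assms(2-4))

lemma ccone_sum:
  assumes "finite H" and "\<And>h. h \<in> H \<Longrightarrow> v h \<in> ccone G" and "\<And>h. h \<in> H \<Longrightarrow> 0 \<le> c h"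
  shows "(\<lambda>j. \<Sum>h\<in>H. c h * v h j) \<in> ccone G"
  using assms by (intro cone_closed_sum) (auto intro: zero_in_ccone ccone_add ccone_scale)

lemma ccone_least:
  assumes "finite G" "G \<subseteq> K" "(\<lambda>j. 0) \<in> K"
    and "\<And>x y. x \<in> K \<Longrightarrow> y \<in> K \<Longrightarrow> (\<lambda>j. x j + y j) \<in> K"
    and "\<And>x r. x \<in> K \<Longrightarrow> 0 \<le> r \<Longrightarrow> (\<lambda>j. r * x j) \<in> K"
  shows "ccone G \<subseteq> K"
proof
  fix x assume "x \<in> ccone G"
  then obtain c where "\<And>g. g \<in> G \<Longrightarrow> 0 \<le> c g" "x = (\<lambda>j. \<Sum>g\<in>G. c g * g j)" by (auto simp: ccone_def)
  then show "x \<in> K" using cone_closed_sum[of G K "\<lambda>g. g" c] assms by blast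
qed

text \<open>
  Linearity in the sense of convex cones: only nonnegative scalars occur, and nothing is said
  outside of \<open>K\<close>.
\<close>

definition lin_on :: "('j \<Rightarrow> real) set \<Rightarrow> (('j \<Rightarrow> real) \<Rightarrow> real) \<Rightarrow> bool" where
  "lin_on K \<Lambda> \<longleftrightarrow> (\<forall>x\<in>K. \<forall>y\<in>K. \<Lambda> (\<lambda>j. x j + y j) = \<Lambda> x + \<Lambda> y) \<and>
     (\<forall>x\<in>K. \<forall>r\<ge>0. \<Lambda> (\<lambda>j. r * x j) = r * \<Lambda> x)"

lemma lin_on_add: "lin_on K \<Lambda> \<Longrightarrow> x \<in> K \<Longrightarrow> y \<in> K \<Longrightarrow> \<Lambda> (\<lambda>j. x j + y j) = \<Lambda> x + \<Lambda> y"
  by (simp add: lin_on_def)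

lemma lin_on_scale: "lin_on K \<Lambda> \<Longrightarrow> x \<in> K \<Longrightarrow> 0 \<le> r \<Longrightarrow> \<Lambda> (\<lambda>j. r * x j) = r * \<Lambda> x"
  by (simp add: lin_on_def)

lemma lin_on_subset: "lin_on K \<Lambda> \<Longrightarrow> K' \<subseteq> K \<Longrightarrow> lin_on K' \<Lambda>"
  unfolding lin_on_def by blast

lemma lin_on_ccone_sum:
  assumes "lin_on (ccone G) \<Lambda>" "finite H" "\<And>h. h \<in> H \<Longrightarrow> v h \<in> ccone G" "\<And>h. h \<in> H \<Longrightarrow> 0 \<le> c h"
  shows "\<Lambda> (\<lambda>j. \<Sum>h\<in>H. c h * v h j) = (\<Sum>h\<in>H. c h * \<Lambda> (v h))"
  using assms(2-4)
proof (induction H rule: finite_induct)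
  case empty
  have "\<forall>x\<in>ccone G. \<forall>r\<ge>0. \<Lambda> (\<lambda>j. r * x j) = r * \<Lambda> x" using assms(1) by (simp add: lin_on_def)
  from bspec[OF this zero_in_ccone] have "\<Lambda> (\<lambda>j. 0) = 0" by (auto dest: spec[of _ 0])
  then show ?case by simp
next
  case (insert h H)
  have 1: "(\<lambda>j. c h * v h j) \<in> ccone G" using insert by (auto intro: ccone_scale)
  have 2: "(\<lambda>j. \<Sum>h\<in>H. c h * v h j) \<in> ccone G" using insert by (intro ccone_sum) auto
  have "\<Lambda> (\<lambda>j. c h * v h j + (\<Sum>h\<in>H. c h * v h j)) = \<Lambda> (\<lambda>j. c h * v h j) + \<Lambda> (\<lambda>j. \<Sum>h\<in>H. c h * v h j)"
    by (rule lin_on_add[OF assms(1) 1 2])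
  moreover have "\<Lambda> (\<lambda>j. c h * v h j) = c h * \<Lambda> (v h)"
    using insert by (intro lin_on_scale[OF assms(1)]) auto
  ultimately show ?case using insert by simp
qed

lemma lin_on_ccone_eval:
  assumes "lin_on (ccone G) \<Lambda>" "finite G" "\<And>g. g \<in> G \<Longrightarrow> 0 \<le> c g"
  shows "\<Lambda> (\<lambda>j. \<Sum>g\<in>G. c g * g j) = (\<Sum>g\<in>G. c g * \<Lambda> g)"
  using lin_on_ccone_sum[OF assms(1,2), of "\<lambda>g. g" c] assms generator_in_ccone by blast

text \<open>
  The double description step. Generators on which \<open>\<Lambda>\<close> is positive or zero are kept; a generator
  \<open>g\<close> with positive and a generator \<open>h\<close> with negative value are mixed to a vector on which \<open>\<Lambda>\<close>
  vanishes. A nonnegative combination with \<open>0 \<le> \<Lambda> x\<close> has total positive weight \<open>S\<close> and total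
  negative weight \<open>T \<le> S\<close>, so its negative generators can be compensated entirely by the
  fraction \<open>T / S\<close> of the positive ones.
\<close>

lemma ccone_halfspace:
  assumes G: "finite G" and lin: "lin_on (ccone G) \<Lambda>"
  shows "\<exists>H. finite H \<and> ccone H = {x \<in> ccone G. 0 \<le> \<Lambda> x}"
proof -
  define A where "A = {g \<in> G. 0 < \<Lambda> g}"
  define N where "N = {g \<in> G. \<Lambda> g < 0}"
  define E where "E = {g \<in> G. \<Lambda> g = 0}"
  define m where "m = (\<lambda>(g, h) j. \<Lambda> g * h j + (- \<Lambda> h) * g j)"
  define H where "H = A \<union> E \<union> m ` (A \<times> N)"
  have fin: "finite A" "finite N" "finite E" "finite H" using G by (auto simp: A_def N_def E_def H_def)
  have GU: "G = A \<union> (E \<union> N)" by (auto simp: A_def N_def E_def)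
  have disj: "A \<inter> (E \<union> N) = {}" "E \<inter> N = {}" by (auto simp: A_def N_def E_def)
  have add: "\<Lambda> (\<lambda>j. x j + y j) = \<Lambda> x + \<Lambda> y" if "x \<in> ccone G" "y \<in> ccone G" for x y
    by (rule lin_on_add[OF lin that])
  have sc: "\<Lambda> (\<lambda>j. r * x j) = r * \<Lambda> x" if "x \<in> ccone G" "r \<ge> 0" for x r
    by (rule lin_on_scale[OF lin that])
  have z: "\<Lambda> (\<lambda>j. 0) = 0" using sc[of "\<lambda>j. 0" 0] zero_in_ccone[of G] by simp
  have mm: "m (g, h) \<in> ccone G \<and> \<Lambda> (m (g, h)) = 0" if "g \<in> A" "h \<in> N" for g h
  proof -
    have gh: "g \<in> ccone G" "h \<in> ccone G" "0 \<le> \<Lambda> g" "0 \<le> - \<Lambda> h"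
      using that G by (auto simp: A_def N_def intro: generator_in_ccone)
    have 1: "(\<lambda>j. \<Lambda> g * h j) \<in> ccone G" "(\<lambda>j. (- \<Lambda> h) * g j) \<in> ccone G"
      using gh ccone_scale by blast+
    have "\<Lambda> (m (g, h)) = \<Lambda> g * \<Lambda> h + (- \<Lambda> h) * \<Lambda> g"
      using add[OF 1] sc[OF gh(2,3)] sc[OF gh(1,4)] by (simp add: m_def)
    then show ?thesis using ccone_add[OF 1] by (simp add: m_def)
  qed
  have "ccone H \<subseteq> {x \<in> ccone G. 0 \<le> \<Lambda> x}"
  proof (rule ccone_least[OF fin(4)])
    show "H \<subseteq> {x \<in> ccone G. 0 \<le> \<Lambda> x}"
      using mm G generator_in_ccone by (auto simp: H_def A_def E_def N_def)
  qed (auto simp: z add sc zero_in_ccone intro: ccone_add ccone_scale)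
  moreover have "x \<in> ccone H" if x: "x \<in> ccone G" "0 \<le> \<Lambda> x" for x
  proof -
    obtain c where c: "\<forall>g\<in>G. 0 \<le> c g" and xe: "x = (\<lambda>j. \<Sum>g\<in>G. c g * g j)"
      using x by (auto simp: ccone_def)
    define S where "S = (\<Sum>g\<in>A. c g * \<Lambda> g)"
    define T where "T = (\<Sum>h\<in>N. c h * (- \<Lambda> h))"
    have "\<Lambda> x = (\<Sum>g\<in>G. c g * \<Lambda> g)"
      unfolding xe by (rule lin_on_ccone_eval[OF lin G]) (use c in auto)
    also have "\<dots> = S + ((\<Sum>g\<in>E. c g * \<Lambda> g) + (\<Sum>g\<in>N. c g * \<Lambda> g))"
      unfolding S_def GU using fin disj by (subst sum.union_disjoint; auto simp: sum.union_disjoint)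
    also have "(\<Sum>g\<in>E. c g * \<Lambda> g) = 0" by (intro sum.neutral) (auto simp: E_def)
    also have "(\<Sum>g\<in>N. c g * \<Lambda> g) = - T" by (simp add: T_def sum_negf)
    finally have ST: "T \<le> S" using x by simp
    have T0: "0 \<le> T" unfolding T_def using c by (intro sum_nonneg mult_nonneg_nonneg) (auto simp: N_def)
    have xs: "x j = (\<Sum>g\<in>A. c g * g j) + ((\<Sum>g\<in>E. c g * g j) + (\<Sum>g\<in>N. c g * g j))" for j
      unfolding xe GU using fin disj by (subst sum.union_disjoint; auto simp: sum.union_disjoint)
    have gen: "g \<in> ccone H" if "g \<in> A \<union> E \<union> m ` (A \<times> N)" for g
      by (rule generator_in_ccone[OF fin(4)]) (use that in \<open>simp add: H_def\<close>)
    have c0: "0 \<le> c g" if "g \<in> A \<union> E \<union> N" for g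
      using c that by (auto simp: A_def E_def N_def)
    have cO: "(\<lambda>j. \<Sum>g\<in>E. c g * g j) \<in> ccone H"
      by (rule ccone_sum[OF fin(3)]) (simp_all add: gen c0)
    show ?thesis
    proof (cases "S = 0")
      case True
      \<comment> \<open>There are no positive generators to compensate with, but then \<open>T = 0\<close>, and no
          negative ones either.\<close>
      have N0: "c h = 0" if "h \<in> N" for h
      proof -
        have "T = 0" using True ST T0 by simp
        then have "c h * (- \<Lambda> h) = 0"
          unfolding T_def using that fin c
          by (subst (asm) sum_nonneg_eq_0_iff) (auto simp: N_def intro!: mult_nonneg_nonpos)
        then show ?thesis using that by (simp add: N_def)
      qed
      have "x = (\<lambda>j. (\<Sum>g\<in>A. c g * g j) + (\<Sum>g\<in>E. c g * g j))"
        using N0 by (auto simp: xs fun_eq_iff)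
      moreover have "(\<lambda>j. \<Sum>g\<in>A. c g * g j) \<in> ccone H"
        by (rule ccone_sum[OF fin(1)]) (simp_all add: gen c0)
      ultimately show ?thesis using cO ccone_add by blast
    next
      case False
      then have S0: "S > 0" using ST T0 by simp
      have 1: "(\<lambda>j. \<Sum>g\<in>A. ((1 - T / S) * c g) * g j) \<in> ccone H"
        using ST S0 by (intro ccone_sum[OF fin(1)]) (simp_all add: gen c0)
      have 2: "(\<lambda>j. \<Sum>k\<in>A \<times> N. (c (fst k) * c (snd k) / S) * m k j) \<in> ccone H"
        using S0 fin by (intro ccone_sum) (auto simp: c0 intro: gen)
      have "(\<Sum>k\<in>A \<times> N. (c (fst k) * c (snd k) / S) * m k j)
          = (\<Sum>h\<in>N. c h * h j) + (T / S) * (\<Sum>g\<in>A. c g * g j)" for j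
      proof -
        have "(\<Sum>k\<in>A \<times> N. (c (fst k) * c (snd k) / S) * m k j)
          = (\<Sum>g\<in>A. \<Sum>h\<in>N. (c g * \<Lambda> g / S) * (c h * h j) + (c h * (- \<Lambda> h)) * (c g * g j) / S)"
          by (simp add: sum.cartesian_product m_def case_prod_beta algebra_simps add_divide_distrib diff_divide_distrib)
        also have "\<dots> = (\<Sum>g\<in>A. c g * \<Lambda> g / S) * (\<Sum>h\<in>N. c h * h j)
            + (\<Sum>h\<in>N. c h * (- \<Lambda> h)) * (\<Sum>g\<in>A. c g * g j) / S"
          unfolding sum.distrib sum_product sum_divide_distrib
          by (subst (4) sum.swap) (simp add: sum_divide_distrib)
        also have "(\<Sum>g\<in>A. c g * \<Lambda> g / S) = 1" using S0 by (simp add: sum_divide_distrib[symmetric] S_def)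
        finally show ?thesis by (simp add: T_def)
      qed
      then have "x = (\<lambda>j. ((\<Sum>g\<in>A. ((1 - T / S) * c g) * g j) + (\<Sum>g\<in>E. c g * g j)) +
            (\<Sum>k\<in>A \<times> N. (c (fst k) * c (snd k) / S) * m k j))"
        by (auto simp: xs fun_eq_iff sum_distrib_left[symmetric] sum_divide_distrib[symmetric] mult.assoc
            left_diff_distrib sum_subtractf)
      then show ?thesis using ccone_add[OF ccone_add[OF 1 cO] 2] by simp
    qed
  qed
  ultimately show ?thesis using fin(4) by blast
qed

text \<open>
  The pieces may overlap and need not meet in faces; this is enough for properties that pass to
  smaller cones, such as linearity of a function.
\<close>

definition subdivides :: "('j \<Rightarrow> real) set \<Rightarrow> (('j \<Rightarrow> real) set \<Rightarrow> bool) \<Rightarrow> bool" where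
  "subdivides G P \<longleftrightarrow>
     (\<exists>\<H>. finite \<H> \<and> (\<forall>H\<in>\<H>. finite H \<and> P (ccone H)) \<and> ccone G = \<Union>(ccone ` \<H>))"

lemma subdividesI: "finite G \<Longrightarrow> P (ccone G) \<Longrightarrow> subdivides G P"
  unfolding subdivides_def by (rule exI[of _ "{G}"]) auto

lemma subdivides_trans:
  assumes "subdivides G P"
    and "\<And>H. finite H \<Longrightarrow> P (ccone H) \<Longrightarrow> ccone H \<subseteq> ccone G \<Longrightarrow> subdivides H Q"
  shows "subdivides G Q"
proof -
  obtain \<H> where \<H>: "finite \<H>" "\<forall>H\<in>\<H>. finite H \<and> P (ccone H)" "ccone G = \<Union>(ccone ` \<H>)"
    using assms(1) by (auto simp: subdivides_def)
  have "\<forall>H\<in>\<H>. \<exists>\<D>. finite \<D> \<and> (\<forall>D\<in>\<D>. finite D \<and> Q (ccone D)) \<and> ccone H = \<Union>(ccone ` \<D>)"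
  proof
    fix H assume H: "H \<in> \<H>"
    then have "ccone H \<subseteq> ccone G" using \<H>(3) by auto
    then have "subdivides H Q" using assms(2) \<H>(2) H by simp
    then show "\<exists>\<D>. finite \<D> \<and> (\<forall>D\<in>\<D>. finite D \<and> Q (ccone D)) \<and> ccone H = \<Union>(ccone ` \<D>)"
      by (simp add: subdivides_def)
  qed
  then obtain d where "\<forall>H\<in>\<H>. finite (d H) \<and> (\<forall>D\<in>d H. finite D \<and> Q (ccone D)) \<and> ccone H = \<Union>(ccone ` d H)"
    by metis
  then show ?thesis using \<H> unfolding subdivides_def
    by (intro exI[of _ "\<Union>(d ` \<H>)"]) auto
qed

lemma subdivides_by_sign:
  assumes "finite G" "lin_on (ccone G) \<Lambda>"
    and "\<And>C. C \<subseteq> ccone G \<Longrightarrow> (\<forall>x\<in>C. 0 \<le> \<Lambda> x) \<or> (\<forall>x\<in>C. \<Lambda> x \<le> 0) \<Longrightarrow> P C"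
  shows "subdivides G P"
proof -
  have "lin_on (ccone G) (\<lambda>x. - \<Lambda> x)" using assms(2) by (simp add: lin_on_def)
  then obtain H N where "finite H" "ccone H = {x \<in> ccone G. 0 \<le> \<Lambda> x}"
    "finite N" "ccone N = {x \<in> ccone G. 0 \<le> - \<Lambda> x}"
    using ccone_halfspace[OF assms(1,2)] ccone_halfspace[OF assms(1)] by metis
  then show ?thesis using assms(3) unfolding subdivides_def
    by (intro exI[of _ "{H, N}"]) auto
qed

text \<open>
  A function that is linear on the pieces of a subdivision of every finitely generated cone, and
  Lipschitz with respect to the maximum norm of the coordinates in \<open>J\<close>. The Lipschitz condition
  implies that the function depends on these coordinates only, and it turns bounded errors into
  bounded errors.
\<close>

definition PL :: "'j set \<Rightarrow> (('j \<Rightarrow> real) \<Rightarrow> real) \<Rightarrow> bool" where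
  "PL J \<Lambda> \<longleftrightarrow>
     (\<exists>C\<ge>0. \<forall>x y d. 0 \<le> d \<longrightarrow> (\<forall>j\<in>J. \<bar>x j - y j\<bar> \<le> d) \<longrightarrow> \<bar>\<Lambda> x - \<Lambda> y\<bar> \<le> C * d) \<and>
     (\<forall>G. finite G \<longrightarrow> subdivides G (\<lambda>C. lin_on C \<Lambda>))"

lemma PL_mono: "PL J \<Lambda> \<Longrightarrow> J \<subseteq> J' \<Longrightarrow> PL J' \<Lambda>"
  unfolding PL_def by (meson subsetD)

lemma PL_lipschitz:
  assumes "PL J \<Lambda>"
  obtains C where "C \<ge> 0" "\<And>x y d. 0 \<le> d \<Longrightarrow> (\<And>j. j \<in> J \<Longrightarrow> \<bar>x j - y j\<bar> \<le> d) \<Longrightarrow> \<bar>\<Lambda> x - \<Lambda> y\<bar> \<le> C * d"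
  using assms unfolding PL_def by metis

lemma common_subdivision:
  assumes "finite G" "finite K" "\<And>k. k \<in> K \<Longrightarrow> PL J (\<Lambda> k)"
  shows "subdivides G (\<lambda>C. \<forall>k\<in>K. lin_on C (\<Lambda> k))"
  using assms(2,3)
proof (induction K rule: finite_induct)
  case empty
  then show ?case using assms(1) by (auto intro: subdividesI)
next
  case (insert k K)
  have "subdivides G (\<lambda>C. \<forall>k\<in>K. lin_on C (\<Lambda> k))" using insert by auto
  then show ?case
  proof (rule subdivides_trans)
    fix H :: "('a \<Rightarrow> real) set" assume H: "finite H" "\<forall>k\<in>K. lin_on (ccone H) (\<Lambda> k)"
    have "subdivides H (\<lambda>C. lin_on C (\<Lambda> k))" using insert.prems H by (auto simp: PL_def)
    then show "subdivides H (\<lambda>C. \<forall>k\<in>insert k K. lin_on C (\<Lambda> k))"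
      by (rule subdivides_trans) (use H in \<open>auto intro!: subdividesI intro: lin_on_subset\<close>)
  qed
qed

lemma PL_coordinate: "j \<in> J \<Longrightarrow> PL J (\<lambda>x. x j)"
  unfolding PL_def
  by (auto simp: lin_on_def intro!: subdividesI exI[of _ 1])

lemma PL_zero: "PL J (\<lambda>x. 0)"
  unfolding PL_def by (auto simp: lin_on_def intro!: subdividesI exI[of _ 1])

lemma PL_scale:
  assumes "PL J \<Lambda>" shows "PL J (\<lambda>x. r * \<Lambda> x)"
proof -
  obtain C where C: "C \<ge> 0" "\<And>x y d. 0 \<le> d \<Longrightarrow> (\<And>j. j \<in> J \<Longrightarrow> \<bar>x j - y j\<bar> \<le> d) \<Longrightarrow> \<bar>\<Lambda> x - \<Lambda> y\<bar> \<le> C * d"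
    using PL_lipschitz[OF assms] by blast
  have "\<bar>r * \<Lambda> x - r * \<Lambda> y\<bar> \<le> (\<bar>r\<bar> * C) * d" if "0 \<le> d" "\<forall>j\<in>J. \<bar>x j - y j\<bar> \<le> d" for x y d
  proof -
    have "\<bar>r * \<Lambda> x - r * \<Lambda> y\<bar> = \<bar>r\<bar> * \<bar>\<Lambda> x - \<Lambda> y\<bar>" by (simp add: abs_mult[symmetric] right_diff_distrib)
    also have "\<dots> \<le> \<bar>r\<bar> * (C * d)" using C(2)[of d x y] that by (intro mult_left_mono) auto
    finally show ?thesis by simp
  qed
  moreover have "subdivides G (\<lambda>C. lin_on C (\<lambda>x. r * \<Lambda> x))" if "finite G" for G
  proof -
    have "subdivides G (\<lambda>C. lin_on C \<Lambda>)" using assms that by (auto simp: PL_def)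
    then show ?thesis
      by (rule subdivides_trans) (auto intro!: subdividesI simp: lin_on_def algebra_simps)
  qed
  moreover have "0 \<le> \<bar>r\<bar> * C" using C(1) by simp
  ultimately show ?thesis unfolding PL_def by blast
qed

lemma lin_on_cong:
  assumes "lin_on (ccone G) \<Lambda>" "\<And>x. x \<in> ccone G \<Longrightarrow> \<Lambda>' x = \<Lambda> x"
  shows "lin_on (ccone G) \<Lambda>'"
  using assms unfolding lin_on_def by (simp add: ccone_add ccone_scale)

text \<open>
  This covers sums and maxima: both are nonexpansive in each argument, and both become linear
  after a subdivision on which the two arguments are linear.
\<close>

lemma PL_binary:
  assumes "PL J \<Lambda>" "PL J M"
    and lip: "\<And>a b a' b'. \<bar>f a b - f a' b'\<bar> \<le> \<bar>a - a'\<bar> + \<bar>b - b'\<bar>"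
    and sub: "\<And>G. finite G \<Longrightarrow> lin_on (ccone G) \<Lambda> \<Longrightarrow> lin_on (ccone G) M \<Longrightarrow>
       subdivides G (\<lambda>C. lin_on C (\<lambda>x. f (\<Lambda> x) (M x)))"
  shows "PL J (\<lambda>x. f (\<Lambda> x) (M x) :: real)"
proof -
  obtain C where C: "C \<ge> 0" "\<And>x y d. 0 \<le> d \<Longrightarrow> (\<And>j. j \<in> J \<Longrightarrow> \<bar>x j - y j\<bar> \<le> d) \<Longrightarrow> \<bar>\<Lambda> x - \<Lambda> y\<bar> \<le> C * d"
    using PL_lipschitz[OF assms(1)] by metis
  obtain D where D: "D \<ge> 0" "\<And>x y d. 0 \<le> d \<Longrightarrow> (\<And>j. j \<in> J \<Longrightarrow> \<bar>x j - y j\<bar> \<le> d) \<Longrightarrow> \<bar>M x - M y\<bar> \<le> D * d"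
    using PL_lipschitz[OF assms(2)] by metis
  have "\<bar>f (\<Lambda> x) (M x) - f (\<Lambda> y) (M y)\<bar> \<le> (C + D) * d" if "0 \<le> d" "\<forall>j\<in>J. \<bar>x j - y j\<bar> \<le> d" for x y d
  proof -
    have "\<bar>\<Lambda> x - \<Lambda> y\<bar> \<le> C * d" "\<bar>M x - M y\<bar> \<le> D * d" using C D that by auto
    then show ?thesis using lip[of "\<Lambda> x" "M x" "\<Lambda> y" "M y"] by (simp add: distrib_right)
  qed
  moreover have "subdivides G (\<lambda>C. lin_on C (\<lambda>x. f (\<Lambda> x) (M x)))" if "finite G" for G
  proof -
    have "subdivides G (\<lambda>C. \<forall>N\<in>{\<Lambda>, M}. lin_on C N)"
      by (rule common_subdivision[of _ _ J "\<lambda>N. N"]) (use assms that in auto)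
    then show ?thesis by (rule subdivides_trans) (auto intro: sub)
  qed
  moreover have "0 \<le> C + D" using C(1) D(1) by simp
  ultimately show ?thesis unfolding PL_def by blast
qed

lemma PL_add: "PL J \<Lambda> \<Longrightarrow> PL J M \<Longrightarrow> PL J (\<lambda>x. \<Lambda> x + M x)"
  by (rule PL_binary[where f = "(+)"]) (auto intro!: subdividesI simp: lin_on_def algebra_simps)

lemma PL_max:
  assumes "PL J \<Lambda>" "PL J M" shows "PL J (\<lambda>x. max (\<Lambda> x) (M x))"
proof (rule PL_binary[where f = max, OF assms])
  fix G :: "('a \<Rightarrow> real) set"
  assume G: "finite G" and lin: "lin_on (ccone G) \<Lambda>" "lin_on (ccone G) M"
  have "lin_on (ccone G) (\<lambda>x. \<Lambda> x - M x)" using lin by (auto simp: lin_on_def algebra_simps)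
  with G have "subdivides G (\<lambda>C. C \<subseteq> ccone G \<and> ((\<forall>x\<in>C. 0 \<le> \<Lambda> x - M x) \<or> (\<forall>x\<in>C. \<Lambda> x - M x \<le> 0)))"
    by (rule subdivides_by_sign) auto
  then show "subdivides G (\<lambda>C. lin_on C (\<lambda>x. max (\<Lambda> x) (M x)))"
  proof (rule subdivides_trans)
    fix H :: "('a \<Rightarrow> real) set" assume H: "finite H" "ccone H \<subseteq> ccone G \<and> ((\<forall>x\<in>ccone H. 0 \<le> \<Lambda> x - M x) \<or> (\<forall>x\<in>ccone H. \<Lambda> x - M x \<le> 0))"
    then have "lin_on (ccone H) \<Lambda>" "lin_on (ccone H) M" using lin lin_on_subset by blast+
    then have "lin_on (ccone H) (\<lambda>x. max (\<Lambda> x) (M x))"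
      using H(2) by (auto intro: lin_on_cong[where \<Lambda> = \<Lambda>] lin_on_cong[where \<Lambda> = M])
    then show "subdivides H (\<lambda>C. lin_on C (\<lambda>x. max (\<Lambda> x) (M x)))" using H by (auto intro: subdividesI)
  qed
qed (auto simp: max_def)

lemma PL_Max:
  assumes "finite K" "K \<noteq> {}" "\<And>k. k \<in> K \<Longrightarrow> PL J (\<Lambda> k)"
  shows "PL J (\<lambda>x. Max ((\<lambda>k. \<Lambda> k x) ` K))"
  using assms
proof (induction K rule: finite_ne_induct)
  case (insert k K)
  then have "PL J (\<lambda>x. max (\<Lambda> k x) (Max ((\<lambda>k. \<Lambda> k x) ` K)))" by (intro PL_max) auto
  then show ?case using insert by simp
qed simp

section \<open>Coarsely conic sets\<close>

abbreviation fan :: "('j \<Rightarrow> real) set set \<Rightarrow> ('j \<Rightarrow> real) set" where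
  "fan \<H> \<equiv> \<Union>(ccone ` \<H>)"

text \<open>
  Only the coordinates in \<open>J\<close> are compared; the values elsewhere of points of \<open>S\<close> and of the fan
  are arbitrary.
\<close>

definition coarsely_conic :: "'j set \<Rightarrow> ('j \<Rightarrow> real) set \<Rightarrow> bool" where
  "coarsely_conic J S \<longleftrightarrow> (\<exists>\<H> C. finite \<H> \<and> (\<forall>H\<in>\<H>. finite H) \<and>
     (\<forall>x\<in>S. \<exists>p\<in>fan \<H>. \<forall>j\<in>J. \<bar>x j - p j\<bar> \<le> C) \<and>
     (\<forall>p\<in>fan \<H>. \<exists>x\<in>S. \<forall>j\<in>J. \<bar>x j - p j\<bar> \<le> C))"

lemma ball_forward: "\<forall>x\<in>A. P x \<Longrightarrow> (\<And>x. P x \<Longrightarrow> Q x) \<Longrightarrow> \<forall>x\<in>A. Q x"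
  by blast

lemma coarsely_conicE:
  assumes "coarsely_conic J S"
  obtains \<H> C where "finite \<H>" "\<forall>H\<in>\<H>. finite H" "C \<ge> 0"
    "\<forall>x\<in>S. \<exists>p\<in>fan \<H>. \<forall>j\<in>J. \<bar>x j - p j\<bar> \<le> C"
    "\<forall>p\<in>fan \<H>. \<exists>x\<in>S. \<forall>j\<in>J. \<bar>x j - p j\<bar> \<le> C"
proof -
  obtain \<H> C where h: "finite \<H>" "\<forall>H\<in>\<H>. finite H"
    "\<forall>x\<in>S. \<exists>p\<in>fan \<H>. \<forall>j\<in>J. \<bar>x j - p j\<bar> \<le> C"
    "\<forall>p\<in>fan \<H>. \<exists>x\<in>S. \<forall>j\<in>J. \<bar>x j - p j\<bar> \<le> C"
    using assms unfolding coarsely_conic_def by (elim exE conjE) (rule that, auto)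
  have le: "\<forall>j\<in>J. a j \<le> max C 0" if "\<forall>j\<in>J. a j \<le> C" for a :: "'a \<Rightarrow> real"
    using that by (auto simp: le_max_iff_disj)
  show thesis
  proof (rule that[of \<H> "max C 0"])
    show "\<forall>x\<in>S. \<exists>p\<in>fan \<H>. \<forall>j\<in>J. \<bar>x j - p j\<bar> \<le> max C 0"
      using h(3) by (rule ball_forward) (rule bexE, assumption, rule bexI, erule le, assumption)
    show "\<forall>p\<in>fan \<H>. \<exists>x\<in>S. \<forall>j\<in>J. \<bar>x j - p j\<bar> \<le> max C 0"
      using h(4) by (rule ball_forward) (rule bexE, assumption, rule bexI, erule le, assumption)
  qed (use h in auto)
qed

lemma coarsely_conicI:
  assumes "finite \<H>" "\<And>H. H \<in> \<H> \<Longrightarrow> finite H"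
    "\<And>x. x \<in> S \<Longrightarrow> \<exists>p\<in>fan \<H>. \<forall>j\<in>J. \<bar>x j - p j\<bar> \<le> C"
    "\<And>p. p \<in> fan \<H> \<Longrightarrow> \<exists>x\<in>S. \<forall>j\<in>J. \<bar>x j - p j\<bar> \<le> C"
  shows "coarsely_conic J S"
  unfolding coarsely_conic_def by (intro exI[of _ \<H>] exI[of _ C] conjI ballI assms)

lemma coarsely_conic_empty: "coarsely_conic J {}"
  by (rule coarsely_conicI[of "{}"]) auto

lemma coarsely_conic_Un:
  assumes "coarsely_conic J S" "coarsely_conic J T" shows "coarsely_conic J (S \<union> T)"
proof -
  obtain \<H> C where 1: "finite \<H>" "\<forall>H\<in>\<H>. finite H" "C \<ge> 0"
    "\<forall>x\<in>S. \<exists>p\<in>fan \<H>. \<forall>j\<in>J. \<bar>x j - p j\<bar> \<le> C"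
    "\<forall>p\<in>fan \<H>. \<exists>x\<in>S. \<forall>j\<in>J. \<bar>x j - p j\<bar> \<le> C" by (rule coarsely_conicE[OF assms(1)], rule that)
  obtain \<K> D where 2: "finite \<K>" "\<forall>H\<in>\<K>. finite H" "D \<ge> 0"
    "\<forall>x\<in>T. \<exists>p\<in>fan \<K>. \<forall>j\<in>J. \<bar>x j - p j\<bar> \<le> D"
    "\<forall>p\<in>fan \<K>. \<exists>x\<in>T. \<forall>j\<in>J. \<bar>x j - p j\<bar> \<le> D" by (rule coarsely_conicE[OF assms(2)], rule that)
  have le: "a \<le> C \<Longrightarrow> a \<le> C + D" "a \<le> D \<Longrightarrow> a \<le> C + D" for a using 1(3) 2(3) by auto
  show ?thesis
  proof (rule coarsely_conicI[of "\<H> \<union> \<K>"])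
    fix x assume "x \<in> S \<union> T"
    then obtain p where "p \<in> fan (\<H> \<union> \<K>)" "(\<forall>j\<in>J. \<bar>x j - p j\<bar> \<le> C) \<or> (\<forall>j\<in>J. \<bar>x j - p j\<bar> \<le> D)"
      using 1(4) 2(4) by fastforce
    then show "\<exists>p\<in>fan (\<H> \<union> \<K>). \<forall>j\<in>J. \<bar>x j - p j\<bar> \<le> C + D" using le by blast
  next
    fix p assume "p \<in> fan (\<H> \<union> \<K>)"
    then have "p \<in> fan \<H> \<or> p \<in> fan \<K>" by auto
    then show "\<exists>x\<in>S \<union> T. \<forall>j\<in>J. \<bar>x j - p j\<bar> \<le> C + D"
    proof
      assume "p \<in> fan \<H>"
      then show ?thesis using 1(5) le by blast
    next
      assume "p \<in> fan \<K>"
      then show ?thesis using 2(5) le by blast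
    qed
  qed (use 1 2 in auto)
qed

lemma coarsely_conic_UN:
  "finite A \<Longrightarrow> (\<And>a. a \<in> A \<Longrightarrow> coarsely_conic J (S a)) \<Longrightarrow> coarsely_conic J (\<Union>a\<in>A. S a)"
  by (induction A rule: finite_induct) (auto intro: coarsely_conic_empty coarsely_conic_Un)

text \<open>
  Coarse conicity is a property of the set up to bounded error, and a piecewise linear map,
  being Lipschitz and linear on the pieces of a subdivision, maps a fan to a fan. With
  coordinate functions for \<open>\<Lambda>\<close> this contains the stability under coordinate projections.
\<close>

lemma coarsely_conic_PL_image:
  assumes "coarsely_conic J (u ` B)" "finite K" "\<And>k. k \<in> K \<Longrightarrow> PL J (\<Lambda> k)"
    and near: "\<And>k. k \<in> K \<Longrightarrow> \<exists>C. \<forall>b\<in>B. \<bar>v b k - \<Lambda> k (u b)\<bar> \<le> C"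
  shows "coarsely_conic K (v ` B)"
proof -
  obtain \<H> C where \<H>: "finite \<H>" "\<forall>H\<in>\<H>. finite H" "C \<ge> 0"
    "\<forall>x\<in>u ` B. \<exists>p\<in>fan \<H>. \<forall>j\<in>J. \<bar>x j - p j\<bar> \<le> C"
    "\<forall>p\<in>fan \<H>. \<exists>x\<in>u ` B. \<forall>j\<in>J. \<bar>x j - p j\<bar> \<le> C" by (rule coarsely_conicE[OF assms(1)], rule that)
  have "\<forall>k\<in>K. \<exists>L. \<forall>b\<in>B. \<forall>p. (\<forall>j\<in>J. \<bar>u b j - p j\<bar> \<le> C) \<longrightarrow> \<bar>v b k - \<Lambda> k p\<bar> \<le> L"
  proof
    fix k assume k: "k \<in> K"
    obtain L where L: "\<And>x y. (\<And>j. j \<in> J \<Longrightarrow> \<bar>x j - y j\<bar> \<le> C) \<Longrightarrow> \<bar>\<Lambda> k x - \<Lambda> k y\<bar> \<le> L * C"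
      using PL_lipschitz[OF assms(3)[OF k]] \<H>(3) by metis
    obtain D where D: "\<forall>b\<in>B. \<bar>v b k - \<Lambda> k (u b)\<bar> \<le> D" using near[OF k] by blast
    have "\<bar>v b k - \<Lambda> k p\<bar> \<le> D + L * C" if "b \<in> B" "\<forall>j\<in>J. \<bar>u b j - p j\<bar> \<le> C" for b p
      using L[of "u b" p] D that by fastforce
    then show "\<exists>L. \<forall>b\<in>B. \<forall>p. (\<forall>j\<in>J. \<bar>u b j - p j\<bar> \<le> C) \<longrightarrow> \<bar>v b k - \<Lambda> k p\<bar> \<le> L" by blast
  qed
  then obtain L where "\<forall>k\<in>K. \<forall>b\<in>B. \<forall>p. (\<forall>j\<in>J. \<bar>u b j - p j\<bar> \<le> C) \<longrightarrow> \<bar>v b k - \<Lambda> k p\<bar> \<le> L k"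
    by (rule bchoice[THEN exE])
  then have L: "\<bar>v b k - \<Lambda> k p\<bar> \<le> L k" if "k \<in> K" "b \<in> B" "\<forall>j\<in>J. \<bar>u b j - p j\<bar> \<le> C" for k b p
    using that by simp
  define E where "E = (\<Sum>k\<in>K. \<bar>L k\<bar>)"
  have LE: "L k \<le> E" if "k \<in> K" for k
    using member_le_sum[of k K "\<lambda>k. \<bar>L k\<bar>"] that assms(2) by (simp add: E_def)
  have "\<forall>H\<in>\<H>. subdivides H (\<lambda>C. \<forall>k\<in>K. lin_on C (\<Lambda> k))"
    using \<H>(2) by (intro ballI common_subdivision[OF _ assms(2,3)]) auto
  then have "\<forall>H\<in>\<H>. \<exists>\<D>. finite \<D> \<and> (\<forall>D\<in>\<D>. finite D \<and> (\<forall>k\<in>K. lin_on (ccone D) (\<Lambda> k))) \<and> ccone H = fan \<D>"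
    by (simp add: subdivides_def)
  then obtain d where d: "\<forall>H\<in>\<H>. finite (d H) \<and> (\<forall>D\<in>d H. finite D \<and> (\<forall>k\<in>K. lin_on (ccone D) (\<Lambda> k))) \<and> ccone H = fan (d H)"
    by metis
  define \<D> where "\<D> = \<Union>(d ` \<H>)"
  have \<D>: "finite \<D>" "\<And>D. D \<in> \<D> \<Longrightarrow> finite D" "\<And>D k. D \<in> \<D> \<Longrightarrow> k \<in> K \<Longrightarrow> lin_on (ccone D) (\<Lambda> k)"
    "fan \<D> = fan \<H>"
    using d \<H>(1) by (auto simp: \<D>_def)
  \<comment> \<open>The value 0 outside of \<open>K\<close> makes \<open>M\<close> linear as a map of vectors.\<close>
  define M where "M = (\<lambda>x k. if k \<in> K then \<Lambda> k x else 0)"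
  have M: "ccone (M ` D) = M ` ccone D" if "D \<in> \<D>" for D
  proof
    have fin: "finite D" using \<D>(2) that by blast
    have add: "M (\<lambda>j. x j + y j) = (\<lambda>k. M x k + M y k)" if "x \<in> ccone D" "y \<in> ccone D" for x y
      using lin_on_add[OF \<D>(3)[OF \<open>D \<in> \<D>\<close>] that] by (auto simp: M_def fun_eq_iff)
    have sc: "M (\<lambda>j. r * x j) = (\<lambda>k. r * M x k)" if "x \<in> ccone D" "r \<ge> 0" for x r
      using lin_on_scale[OF \<D>(3)[OF \<open>D \<in> \<D>\<close>] that] by (auto simp: M_def fun_eq_iff)
    have z: "M (\<lambda>j. 0) = (\<lambda>k. 0)" using sc[OF zero_in_ccone, of 0] by simp
    show "ccone (M ` D) \<subseteq> M ` ccone D"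
    proof (rule ccone_least)
      show "M ` D \<subseteq> M ` ccone D" using generator_in_ccone[OF fin] by blast
      show "(\<lambda>j. 0) \<in> M ` ccone D" by (rule image_eqI) (rule z[symmetric], rule zero_in_ccone)
    next
      fix x y assume "x \<in> M ` ccone D" "y \<in> M ` ccone D"
      then obtain p q where pq: "p \<in> ccone D" "q \<in> ccone D" "x = M p" "y = M q" by blast
      show "(\<lambda>j. x j + y j) \<in> M ` ccone D"
        by (rule image_eqI[OF _ ccone_add[OF pq(1,2)]]) (simp add: pq(3,4) add[OF pq(1,2)])
    next
      fix x and r :: real assume "x \<in> M ` ccone D" "0 \<le> r"
      then obtain p where p: "p \<in> ccone D" "x = M p" by blast
      show "(\<lambda>j. r * x j) \<in> M ` ccone D"
        by (rule image_eqI[OF _ ccone_scale[OF p(1) \<open>0 \<le> r\<close>]]) (simp add: p(2) sc[OF p(1) \<open>0 \<le> r\<close>])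
    qed (use fin in simp)
    show "M ` ccone D \<subseteq> ccone (M ` D)"
    proof
      fix q assume "q \<in> M ` ccone D"
      then obtain c where c: "\<forall>g\<in>D. 0 \<le> c g" "q = M (\<lambda>j. \<Sum>g\<in>D. c g * g j)" by (auto simp: ccone_def)
      have "q = (\<lambda>k. \<Sum>g\<in>D. c g * M g k)"
        using lin_on_ccone_eval[OF \<D>(3)[OF \<open>D \<in> \<D>\<close>] fin, of _ c] c by (auto simp: M_def fun_eq_iff)
      also have "\<dots> \<in> ccone (M ` D)"
        using c fin by (intro ccone_sum) (auto intro: generator_in_ccone)
      finally show "q \<in> ccone (M ` D)" .
    qed
  qed
  have fanM: "fan ((`) M ` \<D>) = M ` fan \<H>"
    unfolding \<D>(4)[symmetric] image_Union image_image using M by (auto simp: image_image)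
  show ?thesis
  proof (rule coarsely_conicI[of "(`) M ` \<D>" _ _ E])
    fix x assume "x \<in> v ` B"
    then obtain b where b: "b \<in> B" "x = v b" by blast
    then obtain p where p: "p \<in> fan \<H>" "\<forall>j\<in>J. \<bar>u b j - p j\<bar> \<le> C" using \<H>(4) by blast
    then have "\<forall>k\<in>K. \<bar>v b k - M p k\<bar> \<le> E" using L[OF _ b(1) p(2)] LE by (force simp: M_def)
    then show "\<exists>q\<in>fan ((`) M ` \<D>). \<forall>j\<in>K. \<bar>x j - q j\<bar> \<le> E" unfolding fanM b(2) using p(1) by blast
  next
    fix q assume "q \<in> fan ((`) M ` \<D>)"
    then obtain p where p: "p \<in> fan \<H>" "q = M p" unfolding fanM by blast
    then obtain b where b: "b \<in> B" "\<forall>j\<in>J. \<bar>u b j - p j\<bar> \<le> C" using \<H>(5) by blast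
    then have "\<forall>k\<in>K. \<bar>v b k - M p k\<bar> \<le> E" using L[OF _ b] LE by (force simp: M_def)
    then show "\<exists>x\<in>v ` B. \<forall>j\<in>K. \<bar>x j - q j\<bar> \<le> E" unfolding p(2) using b(1) by blast
  qed (use \<D> in auto)
qed

text \<open>
  The points below a coordinate of a cone form again a finitely generated cone: lift each
  generator to the graph of the coordinate and add one generator pointing downwards.
\<close>

lemma coarsely_conic_below:
  assumes "coarsely_conic J S" "j0 \<in> J"
  shows "coarsely_conic (insert None (Some ` J)) {case_option \<sigma> x |x \<sigma>. x \<in> S \<and> \<sigma> \<le> x j0}"
proof -
  obtain \<H> C where \<H>: "finite \<H>" "\<forall>H\<in>\<H>. finite H" "C \<ge> 0"
    "\<forall>x\<in>S. \<exists>p\<in>fan \<H>. \<forall>j\<in>J. \<bar>x j - p j\<bar> \<le> C"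
    "\<forall>p\<in>fan \<H>. \<exists>x\<in>S. \<forall>j\<in>J. \<bar>x j - p j\<bar> \<le> C" by (rule coarsely_conicE[OF assms(1)], rule that)
  define lift where "lift = (\<lambda>h::'a \<Rightarrow> real. case_option (h j0) h)"
  define down where "down = (case_option (-1) (\<lambda>_::'a. 0::real))"
  define N where "N = (\<lambda>H. insert down (lift ` H))"
  have lift_simps: "lift h None = h j0" "lift h (Some j) = h j" "down None = -1" "down (Some j) = 0" for h j
    by (auto simp: lift_def down_def)
  have N: "ccone (N H) = {case_option \<sigma> p |p \<sigma>. p \<in> ccone H \<and> \<sigma> \<le> p j0}" if "H \<in> \<H>" for H
  proof
    have fin: "finite H" using \<H>(2) that by blast
    show "ccone (N H) \<subseteq> {case_option \<sigma> p |p \<sigma>. p \<in> ccone H \<and> \<sigma> \<le> p j0}" (is "_ \<subseteq> ?R")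
    proof (rule ccone_least)
      have "down \<in> ?R" using zero_in_ccone[of H] by (auto simp: down_def intro!: exI[of _ "\<lambda>_. 0"])
      moreover have "lift h \<in> ?R" if "h \<in> H" for h
        using generator_in_ccone[OF fin that] by (auto simp: lift_def)
      ultimately show "N H \<subseteq> ?R" by (auto simp: N_def)
      show "(\<lambda>j. 0) \<in> ?R" using zero_in_ccone[of H]
        by (auto intro!: exI[of _ "\<lambda>_. 0"] exI[of _ 0] split: option.split)
    next
      fix x y assume "x \<in> ?R" "y \<in> ?R"
      then obtain p q \<sigma> \<tau> where "x = case_option \<sigma> p" "y = case_option \<tau> q" "p \<in> ccone H" "q \<in> ccone H"
        "\<sigma> \<le> p j0" "\<tau> \<le> q j0" by blast
      then show "(\<lambda>j. x j + y j) \<in> ?R"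
        using ccone_add[of p H q]
        by (auto intro!: exI[of _ "\<lambda>j. p j + q j"] exI[of _ "\<sigma> + \<tau>"] split: option.split)
    next
      fix x and r :: real assume "x \<in> ?R" "0 \<le> r"
      then obtain p \<sigma> where "x = case_option \<sigma> p" "p \<in> ccone H" "\<sigma> \<le> p j0" by blast
      then show "(\<lambda>j. r * x j) \<in> ?R"
        using ccone_scale[of p H r] \<open>0 \<le> r\<close>
        by (auto intro!: exI[of _ "\<lambda>j. r * p j"] exI[of _ "r * \<sigma>"] mult_left_mono split: option.split)
    qed (use fin in \<open>simp add: N_def\<close>)
    show "?R \<subseteq> ccone (N H)"
    proof
      fix x assume "x \<in> ?R"
      then obtain p \<sigma> where x: "x = case_option \<sigma> p" "p \<in> ccone H" "\<sigma> \<le> p j0" by blast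
      then obtain c where c: "\<forall>g\<in>H. 0 \<le> c g" "p = (\<lambda>j. \<Sum>g\<in>H. c g * g j)" by (auto simp: ccone_def)
      have gen: "g \<in> N H \<Longrightarrow> g \<in> ccone (N H)" for g
        using fin by (intro generator_in_ccone) (auto simp: N_def)
      have 1: "(\<lambda>j. \<Sum>g\<in>H. c g * lift g j) \<in> ccone (N H)"
        using fin c by (intro ccone_sum gen) (auto simp: N_def)
      have 2: "(\<lambda>j. (p j0 - \<sigma>) * down j) \<in> ccone (N H)"
        using x by (intro ccone_scale gen) (auto simp: N_def)
      have "x = (\<lambda>j. (\<Sum>g\<in>H. c g * lift g j) + (p j0 - \<sigma>) * down j)"
        by (auto simp: fun_eq_iff x c lift_simps split: option.split)
      then show "x \<in> ccone (N H)" using ccone_add[OF 1 2] by simp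
    qed
  qed
  have fanN: "fan (N ` \<H>) = {case_option \<sigma> p |p \<sigma>. p \<in> fan \<H> \<and> \<sigma> \<le> p j0}" using N by blast
  show ?thesis
  proof (rule coarsely_conicI[of "N ` \<H>" _ _ C])
    fix y assume "y \<in> {case_option \<sigma> x |x \<sigma>. x \<in> S \<and> \<sigma> \<le> x j0}"
    then obtain x \<sigma> where y: "y = case_option \<sigma> x" "x \<in> S" "\<sigma> \<le> x j0" by blast
    then obtain p where p: "p \<in> fan \<H>" "\<forall>j\<in>J. \<bar>x j - p j\<bar> \<le> C" using \<H>(4) by blast
    \<comment> \<open>The bound by the coordinate \<open>j0\<close> has to hold exactly at the new point, hence the shift
        by \<open>C\<close>.\<close>
    then have "\<sigma> - C \<le> p j0" using assms(2) y(3) by (force dest!: bspec)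
    with p y \<H>(3) show "\<exists>q\<in>fan (N ` \<H>). \<forall>j\<in>insert None (Some ` J). \<bar>y j - q j\<bar> \<le> C"
      unfolding fanN by (intro bexI[of _ "case_option (\<sigma> - C) p"]) auto
  next
    fix q assume "q \<in> fan (N ` \<H>)"
    then obtain p \<sigma> where q: "q = case_option \<sigma> p" "p \<in> fan \<H>" "\<sigma> \<le> p j0" unfolding fanN by blast
    then obtain x where x: "x \<in> S" "\<forall>j\<in>J. \<bar>x j - p j\<bar> \<le> C" using \<H>(5) by blast
    then have "\<sigma> - C \<le> x j0" using assms(2) q(3) by (force dest!: bspec)
    with x q \<H>(3) show "\<exists>y\<in>{case_option \<sigma> x |x \<sigma>. x \<in> S \<and> \<sigma> \<le> x j0}.
        \<forall>j\<in>insert None (Some ` J). \<bar>y j - q j\<bar> \<le> C"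
      by (intro bexI[of _ "case_option (\<sigma> - C) x"]) auto
  qed (use \<H> in \<open>auto simp: N_def\<close>)
qed

section \<open>The size of a polynomial near a point without nearby critical points\<close>

abbreviation nth_pderiv :: "nat \<Rightarrow> real poly \<Rightarrow> real poly" where
  "nth_pderiv k \<equiv> pderiv ^^ k"

text \<open>
  The derivatives enter through their absolute values and without the factors $1/k!$, which
  change the sum by a factor of at most $n!$.
\<close>

definition taylor_size :: "nat \<Rightarrow> real poly \<Rightarrow> real \<Rightarrow> real \<Rightarrow> real" where
  "taylor_size n f a s = (\<Sum>k\<le>n. \<bar>poly (nth_pderiv k f) a\<bar> * s ^ k)"

lemma taylor_size_mono: "0 \<le> s \<Longrightarrow> s \<le> t \<Longrightarrow> taylor_size n f a s \<le> taylor_size n f a t"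
  by (auto simp: taylor_size_def intro!: sum_mono mult_left_mono power_mono)

lemma nth_pderiv_pderiv: "nth_pderiv k (pderiv f) = nth_pderiv (Suc k) f"
  by (metis comp_apply funpow_Suc_right)

lemma taylor_size_Suc:
  "taylor_size (Suc n) f a s = \<bar>poly f a\<bar> + s * taylor_size n (pderiv f) a s"
proof -
  have "taylor_size (Suc n) f a s = \<bar>poly f a\<bar> + (\<Sum>k\<le>n. \<bar>poly (nth_pderiv (Suc k) f) a\<bar> * s ^ Suc k)"
    unfolding taylor_size_def by (subst sum.atMost_Suc_shift) simp
  then show ?thesis
    by (simp add: taylor_size_def nth_pderiv_pderiv sum_distrib_left algebra_simps del: funpow.simps)
qed

lemma taylor_size_scale_ge:
  assumes "0 \<le> s" "0 \<le> c" "c \<le> 1"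
  shows "c ^ n * taylor_size n f a s \<le> taylor_size n f a (c * s)"
  unfolding taylor_size_def sum_distrib_left
proof (rule sum_mono)
  fix k assume "k \<in> {..n}"
  then have "c ^ n \<le> c ^ k" using assms by (intro power_decreasing) auto
  then have "c ^ n * (\<bar>poly (nth_pderiv k f) a\<bar> * s ^ k) \<le> c ^ k * (\<bar>poly (nth_pderiv k f) a\<bar> * s ^ k)"
    using assms by (intro mult_right_mono) auto
  then show "c ^ n * (\<bar>poly (nth_pderiv k f) a\<bar> * s ^ k) \<le> \<bar>poly (nth_pderiv k f) a\<bar> * (c * s) ^ k"
    by (simp add: power_mult_distrib algebra_simps)
qed

lemma poly_MVT_ray:
  assumes "s < t" and "\<bar>e\<bar> = (1::real)"
  obtains \<sigma> where "s < \<sigma>" "\<sigma> < t" "poly f (a + e * t) - poly f (a + e * s) = e * (t - s) * poly (pderiv f) (a + e * \<sigma>)"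
proof -
  consider "e = 1" | "e = -1" using assms(2) by fastforce
  then show thesis
  proof cases
    case 1
    with poly_MVT[of "a + s" "a + t" f] assms(1) obtain x where
      "a + s < x" "x < a + t" "poly f (a + t) - poly f (a + s) = (t - s) * poly (pderiv f) x" by auto
    then show thesis using 1 by (intro that[of "x - a"]) auto
  next
    case 2
    with poly_MVT[of "a - t" "a - s" f] assms(1) obtain x where
      "a - t < x" "x < a - s" "poly f (a - s) - poly f (a - t) = (t - s) * poly (pderiv f) x" by auto
    then show thesis using 2 by (intro that[of "a - x"]) (auto simp: algebra_simps)
  qed
qed

text \<open>
  Taylor's formula with the factors $1/k!$ dropped; by induction on the degree the mean value
  theorem suffices.
\<close>

lemma abs_poly_le_taylor_size:
  assumes "degree f \<le> n" "0 \<le> s" "\<bar>e\<bar> = 1"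
  shows "\<bar>poly f (a + e * s)\<bar> \<le> taylor_size n f a s"
  using assms(1,2)
proof (induction n arbitrary: f s)
  case 0
  then have "degree f = 0" by simp
  then obtain c where "f = [:c:]" by (rule degree_eq_zeroE)
  then show ?case by (simp add: taylor_size_def)
next
  case (Suc n)
  show ?case
  proof (cases "s = 0")
    case True
    then show ?thesis by (simp add: taylor_size_Suc)
  next
    case False
    then have "0 < s" using Suc.prems by simp
    from poly_MVT_ray[OF this assms(3), of f a] obtain \<sigma> where \<sigma>: "0 < \<sigma>" "\<sigma> < s"
      "poly f (a + e * s) - poly f (a + e * 0) = e * (s - 0) * poly (pderiv f) (a + e * \<sigma>)" by metis
    have "\<bar>poly (pderiv f) (a + e * \<sigma>)\<bar> \<le> taylor_size n (pderiv f) a \<sigma>"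
      using Suc.prems \<sigma> by (intro Suc.IH) (auto simp: degree_pderiv)
    also have "\<dots> \<le> taylor_size n (pderiv f) a s" using \<sigma> by (intro taylor_size_mono) auto
    finally have "s * \<bar>poly (pderiv f) (a + e * \<sigma>)\<bar> \<le> s * taylor_size n (pderiv f) a s"
      using \<open>0 < s\<close> by simp
    moreover have "\<bar>poly f (a + e * s) - poly f a\<bar> = s * \<bar>poly (pderiv f) (a + e * \<sigma>)\<bar>"
      using \<sigma>(3) assms(3) \<open>0 < s\<close> by (simp add: abs_mult)
    ultimately show ?thesis unfolding taylor_size_Suc by linarith
  qed
qed

text \<open>
  Derivatives that vanish identically are exempt, since they contribute nothing to the Taylor
  size. The direction \<open>e\<close> is 1 or -1, so that both sides of \<open>a\<close> are treated at once.
\<close>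

definition zero_free :: "nat \<Rightarrow> real poly \<Rightarrow> real \<Rightarrow> real \<Rightarrow> real \<Rightarrow> bool" where
  "zero_free n f a e L \<longleftrightarrow>
     (\<forall>k\<le>n. nth_pderiv k f = 0 \<or> (\<forall>\<sigma>. 0 < \<sigma> \<and> \<sigma> < L \<longrightarrow> poly (nth_pderiv k f) (a + e * \<sigma>) \<noteq> 0))"

lemma zero_free_pderiv: "zero_free (Suc n) f a e L \<Longrightarrow> zero_free n (pderiv f) a e L"
  unfolding zero_free_def nth_pderiv_pderiv by (metis Suc_le_mono)

lemma zero_free_mono: "zero_free n f a e L \<Longrightarrow> L' \<le> L \<Longrightarrow> zero_free n f a e L'"
  unfolding zero_free_def by fastforce

lemma poly_same_sign_ray:
  fixes a e s t :: real
  assumes "\<And>\<sigma>. s < \<sigma> \<Longrightarrow> \<sigma> < t \<Longrightarrow> poly f (a + e * \<sigma>) \<noteq> 0" "s < x" "x < t" "s < y" "y < t"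
  shows "0 < poly f (a + e * x) * poly f (a + e * y)"
proof (rule ccontr)
  assume neg: "\<not> ?thesis"
  have nz: "poly f (a + e * x) \<noteq> 0" "poly f (a + e * y) \<noteq> 0" using assms by auto
  define h where "h = (\<lambda>\<sigma>. poly f (a + e * \<sigma>))"
  have c: "continuous_on A h" for A unfolding h_def by (intro continuous_intros)
  have "\<exists>\<sigma>\<in>closed_segment x y. h \<sigma> = 0"
  proof -
    have "h x < 0 \<and> 0 < h y \<or> h y < 0 \<and> 0 < h x"
      using neg nz unfolding h_def by (auto simp: zero_less_mult_iff not_less) 
    then have "0 \<in> closed_segment (h x) (h y)" by (auto simp: closed_segment_eq_real_ivl)
    then show ?thesis using IVT'_closed_segment_real[OF _ c, of 0 x y] by metis
  qed
  then show False using assms by (auto simp: closed_segment_eq_real_ivl h_def split: if_splits) 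
qed

lemma sign_transfer:
  fixes F e P Q :: real
  assumes "0 < P * Q" shows "0 < F * (e * Q) \<longleftrightarrow> 0 < F * (e * P)" "F * (e * Q) < 0 \<longleftrightarrow> F * (e * P) < 0"
  using assms by (auto simp: zero_less_mult_iff mult_less_0_iff)

text \<open>
  A quantity that moves away from zero without changing its sign moves by at most its final
  size.
\<close>

lemma abs_diff_le_same_sign:
  fixes F G c d :: real
  assumes "0 < F * G" "F - G = c * d" "0 \<le> c" "0 < F * d"
  shows "\<bar>F - G\<bar> \<le> \<bar>F\<bar>"
proof -
  have "(0 < F \<longrightarrow> 0 \<le> c * d) \<and> (F < 0 \<longrightarrow> c * d \<le> 0)"
    using assms(3,4) by (auto simp: zero_less_mult_iff mult_nonneg_nonneg mult_nonneg_nonpos)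
  then show ?thesis using assms(1,2) by (auto simp: zero_less_mult_iff)
qed

text \<open>
  On a segment where no derivative changes sign there is no cancellation in Taylor's formula, as
  long as one stays away from the end of the segment by the factor \<open>\<kappa>\<close>.

  By induction the derivative at a point is at least a constant times its Taylor size. Two cases
  arise. If \<open>\<bar>f\<bar>\<close> increases along the ray, the increase between \<open>s / 2\<close> and \<open>s\<close> bounds
  \<open>\<bar>f (a + e s)\<bar>\<close> from below by \<open>s\<close> times the derivative, and \<open>\<bar>f a\<bar>\<close> is smaller anyway. If
  \<open>\<bar>f\<bar>\<close> decreases, it must not reach zero before \<open>\<mu> s\<close>, where $\mu = \sqrt{\kappa}$; so the loss
  between \<open>s\<close> and \<open>\<mu> s\<close>, which is of the size of \<open>s\<close> times the derivative, is at most
  \<open>\<bar>f (a + e s)\<bar>\<close>. The other factor \<open>\<mu>\<close> is left for the induction hypothesis.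
\<close>

lemma taylor_size_le_abs_poly:
  assumes "1 < \<kappa>"
  shows "\<exists>C>0. \<forall>f a e s. degree f \<le> n \<and> 0 < s \<and> \<bar>e\<bar> = 1 \<and> zero_free n f a e (\<kappa> * s) \<longrightarrow>
    taylor_size n f a s \<le> C * \<bar>poly f (a + e * s)\<bar>"
  using assms
proof (induction n arbitrary: \<kappa>)
  case 0
  have "taylor_size 0 f a s \<le> 1 * \<bar>poly f (a + e * s)\<bar>" if "degree f \<le> 0" for f a e s
  proof -
    have "degree f = 0" using that by simp
    then obtain c where "f = [:c:]" by (rule degree_eq_zeroE)
    then show ?thesis by (simp add: taylor_size_def)
  qed
  then show ?case by (intro exI[of _ 1]) auto
next
  case (Suc n)
  define \<mu> where "\<mu> = sqrt \<kappa>"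
  have \<mu>: "1 < \<mu>" "\<mu> * \<mu> = \<kappa>" "\<mu> < \<kappa>" using Suc.prems by (auto simp: \<mu>_def real_less_lsqrt power2_eq_square)
  obtain C where C: "C > 0" "\<And>f a e s. degree f \<le> n \<Longrightarrow> 0 < s \<Longrightarrow> \<bar>e\<bar> = 1 \<Longrightarrow> zero_free n f a e (\<mu> * s) \<Longrightarrow>
      taylor_size n f a s \<le> C * \<bar>poly f (a + e * s)\<bar>" using Suc.IH[OF \<mu>(1)] by metis
  \<comment> \<open>The last two summands belong to the cases where \<open>\<bar>f\<bar>\<close> increases and where it decreases.\<close>
  define B where "B = 1 + 2 * (2 * 2 ^ n * C) + 2 * C / (\<mu> - 1)"
  have B: "B > 0" "2 * (2 * 2 ^ n * C) + 1 \<le> B" "2 * C / (\<mu> - 1) + 1 \<le> B"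
    using C(1) \<mu> by (auto simp: B_def add_pos_nonneg)
  have "taylor_size (Suc n) f a s \<le> B * \<bar>poly f (a + e * s)\<bar>"
    if f: "degree f \<le> Suc n" and s: "0 < s" and e: "\<bar>e\<bar> = 1" and zf: "zero_free (Suc n) f a e (\<kappa> * s)" for f a e s
  proof (cases "pderiv f = 0")
    case True
    then obtain c where "f = [:c:]" using pderiv_iszero by blast
    then have "taylor_size (Suc n) f a s = \<bar>c\<bar>"  "poly f (a + e * s) = c"
      unfolding taylor_size_Suc True by (simp_all add: taylor_size_def)
    then show ?thesis using B mult_right_mono[of 1 B "\<bar>c\<bar>"] C by (simp add: B_def)
  next
    case False
    let ?M = "s * taylor_size n (pderiv f) a s"
    have df: "degree (pderiv f) \<le> n" using f by (simp add: degree_pderiv)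
    have zf': "zero_free n (pderiv f) a e (\<kappa> * s)" using zf by (rule zero_free_pderiv)
    have "nth_pderiv 0 f \<noteq> 0" "nth_pderiv (Suc 0) f \<noteq> 0" using False by auto
    then have nz: "poly f (a + e * \<sigma>) \<noteq> 0" "poly (pderiv f) (a + e * \<sigma>) \<noteq> 0" if "0 < \<sigma>" "\<sigma> < \<kappa> * s" for \<sigma>
      using zf that unfolding zero_free_def
      by (metis (no_types, lifting) funpow_0 le0, metis nth_pderiv_pderiv One_nat_def Suc_le_mono funpow_0 le0)
    have sk: "s < \<mu> * s" "\<mu> * s < \<kappa> * s" "s < \<kappa> * s" using \<mu> s Suc.prems by auto
    have low: "taylor_size n (pderiv f) a s \<le> 2 ^ n * C * \<bar>poly (pderiv f) (a + e * \<sigma>)\<bar>"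
      if "s / 2 \<le> \<sigma>" "\<mu> * \<sigma> \<le> \<kappa> * s" for \<sigma>
    proof -
      have "(1/2) ^ n * taylor_size n (pderiv f) a s \<le> taylor_size n (pderiv f) a (1 / 2 * s)"
        using s by (intro taylor_size_scale_ge) auto
      also have "\<dots> \<le> taylor_size n (pderiv f) a \<sigma>" using that s by (intro taylor_size_mono) auto
      also have "\<dots> \<le> C * \<bar>poly (pderiv f) (a + e * \<sigma>)\<bar>"
        using that s by (intro C(2) df e zero_free_mono[OF zf']) auto
      finally show ?thesis by (simp add: power_divide field_simps)
    qed
    have low': "taylor_size n (pderiv f) a s \<le> C * \<bar>poly (pderiv f) (a + e * \<sigma>)\<bar>"
      if "s \<le> \<sigma>" "\<mu> * \<sigma> \<le> \<kappa> * s" for \<sigma>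
    proof -
      have "taylor_size n (pderiv f) a s \<le> taylor_size n (pderiv f) a \<sigma>" using that s by (intro taylor_size_mono) auto
      also have "\<dots> \<le> C * \<bar>poly (pderiv f) (a + e * \<sigma>)\<bar>"
        using that s by (intro C(2) df e zero_free_mono[OF zf']) auto
      finally show ?thesis .
    qed
    have fs: "0 < poly f (a + e * x) * poly f (a + e * y)" "0 < poly (pderiv f) (a + e * x) * poly (pderiv f) (a + e * y)"
      if "0 < x" "x < \<kappa> * s" "0 < y" "y < \<kappa> * s" for x y
      using poly_same_sign_ray[of 0 "\<kappa> * s" f a e x y] poly_same_sign_ray[of 0 "\<kappa> * s" "pderiv f" a e x y] nz that by auto
    obtain \<sigma>0 where \<sigma>0: "0 < \<sigma>0" "\<sigma>0 < s"
      "poly f (a + e * s) - poly f (a + e * 0) = e * (s - 0) * poly (pderiv f) (a + e * \<sigma>0)"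
      using poly_MVT_ray[OF s e, of f a] by metis
    have up: "\<bar>poly (pderiv f) (a + e * \<sigma>0)\<bar> \<le> taylor_size n (pderiv f) a s"
      using abs_poly_le_taylor_size[OF df _ e, of \<sigma>0 a] taylor_size_mono[of \<sigma>0 s n "pderiv f" a] \<sigma>0 by auto
    show ?thesis
    proof (cases "0 < poly f (a + e * s) * (e * poly (pderiv f) (a + e * s))")
      case True
      \<comment> \<open>\<open>\<bar>f\<bar>\<close> increases along the ray.\<close>
      have "s / 2 < s" using s by simp
      from poly_MVT_ray[OF this e, of f a] obtain \<sigma> where \<sigma>: "s / 2 < \<sigma>" "\<sigma> < s"
        "poly f (a + e * s) - poly f (a + e * (s / 2)) = e * (s - s / 2) * poly (pderiv f) (a + e * \<sigma>)" by metis
      define F where "F = poly f (a + e * s)"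
      define G where "G = poly f (a + e * (s / 2))"
      have FG: "0 < F * G" using fs(1)[of s "s / 2"] s sk by (simp add: F_def G_def)
      have pos: "0 < F * (e * poly (pderiv f) (a + e * x))" if "0 < x" "x < \<kappa> * s" for x
        using True sign_transfer(1)[OF fs(2)[of x s]] that s sk unfolding F_def by auto
      have dF: "F - G = (s / 2) * (e * poly (pderiv f) (a + e * \<sigma>))"
        using \<sigma>(3) by (simp add: F_def G_def)
      have "\<bar>F - G\<bar> \<le> \<bar>F\<bar>"
        using abs_diff_le_same_sign[OF FG dF] pos[of \<sigma>] \<sigma> s sk by auto
      moreover have "\<bar>F - G\<bar> = (s / 2) * \<bar>poly (pderiv f) (a + e * \<sigma>)\<bar>"
        unfolding dF using e s by (simp add: abs_mult)
      moreover have "\<bar>poly f a\<bar> \<le> \<bar>F\<bar>"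
      proof -
        have d: "F - poly f a = s * (e * poly (pderiv f) (a + e * \<sigma>0))" using \<sigma>0(3) by (simp add: F_def)
        have p: "0 < F * (e * poly (pderiv f) (a + e * \<sigma>0))" using \<sigma>0(1,2) sk(3) by (intro pos) linarith+
        have z: "0 \<le> F * poly f a"
        proof (rule ccontr)
          assume n: "\<not> ?thesis"
          define h where "h = (\<lambda>\<sigma>. poly f (a + e * \<sigma>))"
          have c: "continuous_on A h" for A unfolding h_def by (intro continuous_intros)
          have "0 \<in> closed_segment (h 0) (h s)" using n
            by (auto simp: closed_segment_eq_real_ivl h_def F_def not_le mult_less_0_iff)
          then obtain x where "x \<in> closed_segment 0 s" "h x = 0"
            using IVT'_closed_segment_real[OF _ c, of 0 0 s] by metis
          moreover have "h 0 \<noteq> 0" using n by (auto simp: h_def)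
          ultimately show False using nz(1)[of x] s sk
            by (cases "x = 0") (auto simp: closed_segment_eq_real_ivl h_def)
        qed
        show ?thesis
        proof (cases "F > 0")
          case True
          then have "0 \<le> s * (e * poly (pderiv f) (a + e * \<sigma>0))" "0 \<le> poly f a"
            using p z s by (auto simp: zero_less_mult_iff zero_le_mult_iff)
          then show ?thesis using d True by auto
        next
          case False
          then have "F < 0" using FG by (auto simp: zero_less_mult_iff)
          then have "e * poly (pderiv f) (a + e * \<sigma>0) < 0" and a: "poly f a \<le> 0"
            using p z by (auto simp: zero_less_mult_iff[of F] zero_le_mult_iff[of F])
          then have "s * (e * poly (pderiv f) (a + e * \<sigma>0)) \<le> 0"
            using s by (rule_tac mult_nonneg_nonpos) (simp_all only: less_imp_le)
          then show ?thesis using d a \<open>F < 0\<close> by auto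
        qed
      qed
      moreover have "?M \<le> s * (2 ^ n * C * \<bar>poly (pderiv f) (a + e * \<sigma>)\<bar>)"
      proof (intro mult_left_mono low)
        have "\<mu> * \<sigma> \<le> \<mu> * s" using \<sigma> \<mu> by simp
        then show "\<mu> * \<sigma> \<le> \<kappa> * s" using sk by simp
      qed (use \<sigma> s in auto)
      ultimately have "s * \<bar>poly (pderiv f) (a + e * \<sigma>)\<bar> \<le> 2 * \<bar>F\<bar>"
        and M: "?M \<le> s * (2 ^ n * C * \<bar>poly (pderiv f) (a + e * \<sigma>)\<bar>)" by simp_all
      then have "2 ^ n * C * (s * \<bar>poly (pderiv f) (a + e * \<sigma>)\<bar>) \<le> 2 ^ n * C * (2 * \<bar>F\<bar>)"
        using C(1) by (intro mult_left_mono) auto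
      with M have "?M \<le> 2 * 2 ^ n * C * \<bar>F\<bar>" by (simp add: algebra_simps)
      then have "taylor_size (Suc n) f a s \<le> (1 + 2 * 2 ^ n * C) * \<bar>F\<bar>"
        unfolding taylor_size_Suc using \<open>\<bar>poly f a\<bar> \<le> \<bar>F\<bar>\<close> by (simp add: distrib_right)
      also have "\<dots> \<le> B * \<bar>F\<bar>" using B C(1) by (intro mult_right_mono) (auto simp: B_def)
      finally show ?thesis by (simp add: F_def)
    next
      case False
      \<comment> \<open>\<open>\<bar>f\<bar>\<close> decreases along the ray.\<close>
      from poly_MVT_ray[OF sk(1) e, of f a] obtain \<sigma> where \<sigma>: "s < \<sigma>" "\<sigma> < \<mu> * s"
        "poly f (a + e * (\<mu> * s)) - poly f (a + e * s) = e * (\<mu> * s - s) * poly (pderiv f) (a + e * \<sigma>)" by metis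
      define F where "F = poly f (a + e * s)"
      define G where "G = poly f (a + e * (\<mu> * s))"
      have FG: "0 < F * G" using fs(1)[of s "\<mu> * s"] s sk by (simp add: F_def G_def)
      have F0: "F \<noteq> 0" using FG by auto
      have "F * (e * poly (pderiv f) (a + e * s)) \<noteq> 0" using F0 nz(2)[of s] s sk e by auto
      then have neg: "F * (e * poly (pderiv f) (a + e * s)) < 0"
        using False unfolding F_def by (meson linorder_neqE_linordered_idom)
      have neg: "F * (e * poly (pderiv f) (a + e * x)) < 0" if "0 < x" "x < \<kappa> * s" for x
        using neg sign_transfer(2)[OF fs(2)[of x s]] that s sk by auto
      have d: "G - F = (\<mu> - 1) * s * (e * poly (pderiv f) (a + e * \<sigma>))"
        using \<sigma>(3) by (simp add: F_def G_def algebra_simps)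
      have "(\<mu> - 1) * s * \<bar>poly (pderiv f) (a + e * \<sigma>)\<bar> = \<bar>G - F\<bar>"
        unfolding d using e \<mu> s by (simp add: abs_mult)
      also have "\<dots> \<le> \<bar>F\<bar>"
      proof -
        have p1: "0 < F * (- (e * poly (pderiv f) (a + e * \<sigma>)))"
          using neg[of \<sigma>] \<sigma> sk s by (simp only: mult_minus_right neg_0_less_iff_less) 
        have p2: "F - G = (\<mu> - 1) * s * (- (e * poly (pderiv f) (a + e * \<sigma>)))" using d by simp
        have "\<bar>F - G\<bar> \<le> \<bar>F\<bar>"
          by (rule abs_diff_le_same_sign[OF FG p2 _ p1]) (use \<mu> s in simp)
        then show ?thesis by (simp add: abs_minus_commute)
      qed
      finally have "(\<mu> - 1) * (s * \<bar>poly (pderiv f) (a + e * \<sigma>)\<bar>) \<le> \<bar>F\<bar>" by (simp add: mult.assoc)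
      moreover have "(\<mu> - 1) * ?M \<le> C * ((\<mu> - 1) * (s * \<bar>poly (pderiv f) (a + e * \<sigma>)\<bar>))"
      proof -
        have "\<mu> * \<sigma> \<le> \<kappa> * s" using \<sigma> \<mu>(1) by (simp add: \<mu>(2)[symmetric] mult.assoc)
        from low'[OF _ this] \<sigma> have "(\<mu> - 1) * s * taylor_size n (pderiv f) a s
            \<le> (\<mu> - 1) * s * (C * \<bar>poly (pderiv f) (a + e * \<sigma>)\<bar>)"
          using s \<mu> by (intro mult_left_mono) auto
        then show ?thesis by (simp add: algebra_simps)
      qed
      ultimately have "(\<mu> - 1) * ?M \<le> C * \<bar>F\<bar>" using C(1) by (meson mult_left_mono less_imp_le order_trans)
      then have M: "?M \<le> C / (\<mu> - 1) * \<bar>F\<bar>" using \<mu>(1) by (simp add: field_simps)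
      have "\<bar>poly f a\<bar> \<le> \<bar>F\<bar> + \<bar>F - poly f a\<bar>" by simp
      also have "\<bar>F - poly f a\<bar> = s * \<bar>poly (pderiv f) (a + e * \<sigma>0)\<bar>"
        using \<sigma>0(3) e s by (simp add: F_def abs_mult)
      also have "\<dots> \<le> ?M" using up s by (intro mult_left_mono) auto
      finally have "taylor_size (Suc n) f a s \<le> \<bar>F\<bar> + 2 * ?M" unfolding taylor_size_Suc by simp
      also have "\<dots> \<le> \<bar>F\<bar> + 2 * (C / (\<mu> - 1) * \<bar>F\<bar>)" using M by simp
      also have "\<dots> = (1 + 2 * C / (\<mu> - 1)) * \<bar>F\<bar>" by (simp add: distrib_right)
      also have "\<dots> \<le> B * \<bar>F\<bar>" using B by (intro mult_right_mono) auto
      finally show ?thesis by (simp add: F_def)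
    qed
  qed
  then show ?case using B(1) by metis
qed

text \<open>
  At a root the value at \<open>a\<close> is compensated by the integral of the derivative over the segment.
  The derivative has constant sign there, and on the middle part of the segment, away from the
  end at distance \<open>s\<close>, it is comparable to its Taylor size.
\<close>

lemma taylor_size_at_root:
  "\<exists>C>0. \<forall>r a e s. degree r \<le> Suc n \<and> 0 < s \<and> \<bar>e\<bar> = 1 \<and> zero_free n (pderiv r) a e s \<and> poly r (a + e * s) = 0 \<longrightarrow>
     \<bar>poly r a\<bar> \<le> s * taylor_size n (pderiv r) a s \<and> s * taylor_size n (pderiv r) a s \<le> C * \<bar>poly r a\<bar>"
proof -
  obtain C where C: "C > 0" "\<And>f a e s. degree f \<le> n \<Longrightarrow> 0 < s \<Longrightarrow> \<bar>e\<bar> = 1 \<Longrightarrow> zero_free n f a e (2 * s) \<Longrightarrow>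
      taylor_size n f a s \<le> C * \<bar>poly f (a + e * s)\<bar>" using taylor_size_le_abs_poly[of 2 n] by auto
  have "\<bar>poly r a\<bar> \<le> s * taylor_size n (pderiv r) a s \<and> s * taylor_size n (pderiv r) a s \<le> 4 * 4 ^ n * C * \<bar>poly r a\<bar>"
    if r: "degree r \<le> Suc n" and s: "0 < s" and e: "\<bar>e\<bar> = 1" and zf: "zero_free n (pderiv r) a e s"
      and root: "poly r (a + e * s) = 0" for r a e s
  proof (cases "pderiv r = 0")
    case True
    then obtain c where "r = [:c:]" using pderiv_iszero by blast
    then show ?thesis using root by (simp add: taylor_size_def)
  next
    case False
    define h where "h = (\<lambda>\<sigma>. poly (pderiv r) (a + e * \<sigma>))"
    have dr: "degree (pderiv r) \<le> n" using r by (simp add: degree_pderiv)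
    have "h \<sigma> \<noteq> 0" if "0 < \<sigma>" "\<sigma> < s" for \<sigma>
      using zf False that unfolding zero_free_def h_def by (metis funpow_0 le0)
    then have same: "0 < h x * h y" if "0 < x" "x < s" "0 < y" "y < s" for x y
      using poly_same_sign_ray[of 0 s "pderiv r" a e x y] that by (auto simp: h_def)
    obtain x where x: "0 < x" "x < s" "poly r (a + e * s) - poly r (a + e * 0) = e * (s - 0) * h x"
      using poly_MVT_ray[OF s e, of r a] unfolding h_def by metis
    have "- poly r a = e * s * h x" using x(3) root by simp
    then have "\<bar>poly r a\<bar> = \<bar>e * s * h x\<bar>" by (metis abs_minus_cancel)
    then have ra: "\<bar>poly r a\<bar> = s * \<bar>h x\<bar>" using e s by (simp add: abs_mult)
    have "\<bar>h x\<bar> \<le> taylor_size n (pderiv r) a s"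
      using abs_poly_le_taylor_size[OF dr _ e, of x a] taylor_size_mono[of x s n "pderiv r" a] x
      by (auto simp: h_def)
    then have up: "\<bar>poly r a\<bar> \<le> s * taylor_size n (pderiv r) a s" unfolding ra using s by simp
    \<comment> \<open>The point \<open>v\<close> chosen between \<open>s / 4\<close> and \<open>s / 2\<close> leaves no zeros of the derivatives up
        to the distance \<open>2 * v\<close>.\<close>
    have q: "0 < s / 4" "s / 4 < s / 2" "s / 2 < s" using s by auto
    obtain u where u: "0 < u" "u < s / 4" "poly r (a + e * (s / 4)) - poly r (a + e * 0) = e * (s / 4 - 0) * h u"
      using poly_MVT_ray[OF q(1) e, of r a] unfolding h_def by metis
    obtain v where v: "s / 4 < v" "v < s / 2" "poly r (a + e * (s / 2)) - poly r (a + e * (s / 4)) = e * (s / 2 - s / 4) * h v"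
      using poly_MVT_ray[OF q(2) e, of r a] unfolding h_def by metis
    obtain w where w: "s / 2 < w" "w < s" "poly r (a + e * s) - poly r (a + e * (s / 2)) = e * (s - s / 2) * h w"
      using poly_MVT_ray[OF q(3) e, of r a] unfolding h_def by metis
    have "- poly r a = e * ((s / 4) * h u + (s / 4) * h v + (s / 2) * h w)"
      using u(3) v(3) w(3) root by (simp add: algebra_simps)
    then have "\<bar>poly r a\<bar> = \<bar>e\<bar> * \<bar>(s / 4) * h u + (s / 4) * h v + (s / 2) * h w\<bar>"
      by (metis abs_minus_cancel abs_mult)
    also have "\<dots> = \<bar>(s / 4) * h u + (s / 4) * h v + (s / 2) * h w\<bar>" using e by simp
    also have "\<dots> \<ge> (s / 4) * \<bar>h v\<bar>"
    proof -
      have "0 < h u * h v" "0 < h w * h v" using same u v w q by auto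
      then consider "0 < h u" "0 < h v" "0 < h w" | "h u < 0" "h v < 0" "h w < 0"
        by (auto simp: zero_less_mult_iff)
      then show ?thesis
      proof cases
        case 1
        then have "0 < (s / 4) * h u" "0 < (s / 4) * h v" "0 < (s / 2) * h w" using s by auto
        then show ?thesis using 1 by simp
      next
        case 2
        then have "(s / 4) * h u < 0" "(s / 4) * h v < 0" "(s / 2) * h w < 0" using s by (auto simp: mult_less_0_iff)
        then show ?thesis using 2 by simp
      qed
    qed
    finally have lo: "s * \<bar>h v\<bar> \<le> 4 * \<bar>poly r a\<bar>" by simp
    have "(1/4) ^ n * taylor_size n (pderiv r) a s \<le> taylor_size n (pderiv r) a (1 / 4 * s)"
      using s by (intro taylor_size_scale_ge) auto
    also have "\<dots> \<le> taylor_size n (pderiv r) a v" using v s by (intro taylor_size_mono) auto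
    also have "\<dots> \<le> C * \<bar>h v\<bar>" unfolding h_def
      using v s by (intro C(2) dr e zero_free_mono[OF zf]) auto
    finally have "taylor_size n (pderiv r) a s \<le> 4 ^ n * C * \<bar>h v\<bar>" by (simp add: power_divide field_simps)
    then have "s * taylor_size n (pderiv r) a s \<le> 4 ^ n * C * (s * \<bar>h v\<bar>)" using s
      by (simp add: mult_left_mono mult.left_commute)
    also have "\<dots> \<le> 4 ^ n * C * (4 * \<bar>poly r a\<bar>)" using lo C(1) by (intro mult_left_mono) auto
    finally show ?thesis using up by (simp add: algebra_simps)
  qed
  moreover have "0 < 4 * 4 ^ n * C" using C(1) by simp
  ultimately show ?thesis by metis
qed

section \<open>Polynomials and definable sets in finitely many coordinates\<close>

text \<open>
  Polynomial functions in the coordinates \<open>z i\<close>, \<open>i \<in> I\<close>, of a point \<open>z\<close> of an arbitrary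
  function type, so that an induction can add coordinates one at a time.
\<close>

inductive_set polys :: "'b set \<Rightarrow> (('b \<Rightarrow> real) \<Rightarrow> real) set" for I where
  polys_const: "(\<lambda>_. c) \<in> polys I"
| polys_coord: "i \<in> I \<Longrightarrow> (\<lambda>z. z i) \<in> polys I"
| polys_add: "f \<in> polys I \<Longrightarrow> g \<in> polys I \<Longrightarrow> (\<lambda>z. f z + g z) \<in> polys I"
| polys_mult: "f \<in> polys I \<Longrightarrow> g \<in> polys I \<Longrightarrow> (\<lambda>z. f z * g z) \<in> polys I"

lemma polys_uminus: "f \<in> polys I \<Longrightarrow> (\<lambda>z. - f z) \<in> polys I"
  using polys_mult[OF polys_const[of "-1"]] by simp

lemma polys_sum: "finite A \<Longrightarrow> (\<And>a. a \<in> A \<Longrightarrow> f a \<in> polys I) \<Longrightarrow> (\<lambda>z. \<Sum>a\<in>A. f a z) \<in> polys I"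
  by (induction A rule: finite_induct) (auto intro: polys_const polys_add)

inductive definable :: "'b set \<Rightarrow> ('b \<Rightarrow> real) set \<Rightarrow> bool" for I where
  definable_pos: "f \<in> polys I \<Longrightarrow> definable I {z. 0 < f z}"
| definable_compl: "definable I A \<Longrightarrow> definable I (- A)"
| definable_Int: "definable I A \<Longrightarrow> definable I B \<Longrightarrow> definable I (A \<inter> B)"

lemma definable_UNIV: "definable I UNIV"
  using definable_pos[OF polys_const[of 1]] by simp

lemma definable_Un: "definable I A \<Longrightarrow> definable I B \<Longrightarrow> definable I (A \<union> B)"
  using definable_compl[OF definable_Int[OF definable_compl definable_compl]] by simp

text \<open>
  Rational functions arise as the coefficients of remainders of polynomial division.
\<close>

definition rational :: "'b set \<Rightarrow> ('b \<Rightarrow> real) set \<Rightarrow> (('b \<Rightarrow> real) \<Rightarrow> real) \<Rightarrow> bool" where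
  "rational I Y f \<longleftrightarrow> (\<exists>a\<in>polys I. \<exists>b\<in>polys I. \<forall>x\<in>Y. b x \<noteq> 0 \<and> f x = a x / b x)"

lemma rationalE:
  assumes "rational I Y f"
  obtains a b where "a \<in> polys I" "b \<in> polys I" "\<And>x. x \<in> Y \<Longrightarrow> b x \<noteq> 0" "\<And>x. x \<in> Y \<Longrightarrow> f x = a x / b x"
  using assms unfolding rational_def by metis

lemma rational_polys: "f \<in> polys I \<Longrightarrow> rational I Y f"
  unfolding rational_def by (intro bexI[of _ f] bexI[OF _ polys_const[of 1]]) auto

lemma rational_subset: "rational I Y f \<Longrightarrow> Y' \<subseteq> Y \<Longrightarrow> rational I Y' f"
  unfolding rational_def by (meson subsetD)

lemma rational_cong: "(\<And>x. x \<in> Y \<Longrightarrow> f x = g x) \<Longrightarrow> rational I Y f \<longleftrightarrow> rational I Y g"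
  unfolding rational_def by simp

lemma rational_add:
  assumes "rational I Y f" "rational I Y g" shows "rational I Y (\<lambda>x. f x + g x)"
proof -
  obtain a b where ab: "a \<in> polys I" "b \<in> polys I" "\<And>x. x \<in> Y \<Longrightarrow> b x \<noteq> 0" "\<And>x. x \<in> Y \<Longrightarrow> f x = a x / b x"
    using rationalE[OF assms(1)] by metis
  obtain c d where cd: "c \<in> polys I" "d \<in> polys I" "\<And>x. x \<in> Y \<Longrightarrow> d x \<noteq> 0" "\<And>x. x \<in> Y \<Longrightarrow> g x = c x / d x"
    using rationalE[OF assms(2)] by metis
  show ?thesis unfolding rational_def
    by (intro bexI[OF _ polys_add[OF polys_mult[OF ab(1) cd(2)] polys_mult[OF cd(1) ab(2)]]]
      bexI[OF _ polys_mult[OF ab(2) cd(2)]]) (auto simp: ab(3,4) cd(3,4) add_frac_eq)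
qed

lemma rational_mult:
  assumes "rational I Y f" "rational I Y g" shows "rational I Y (\<lambda>x. f x * g x)"
proof -
  obtain a b where ab: "a \<in> polys I" "b \<in> polys I" "\<And>x. x \<in> Y \<Longrightarrow> b x \<noteq> 0" "\<And>x. x \<in> Y \<Longrightarrow> f x = a x / b x"
    using rationalE[OF assms(1)] by metis
  obtain c d where cd: "c \<in> polys I" "d \<in> polys I" "\<And>x. x \<in> Y \<Longrightarrow> d x \<noteq> 0" "\<And>x. x \<in> Y \<Longrightarrow> g x = c x / d x"
    using rationalE[OF assms(2)] by metis
  show ?thesis unfolding rational_def
    by (intro bexI[OF _ polys_mult[OF ab(1) cd(1)]] bexI[OF _ polys_mult[OF ab(2) cd(2)]])
      (auto simp: ab(3,4) cd(3,4))
qed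

lemma rational_const: "rational I Y (\<lambda>_. c)"
  by (rule rational_polys[OF polys_const])

lemma rational_diff: "rational I Y f \<Longrightarrow> rational I Y g \<Longrightarrow> rational I Y (\<lambda>x. f x - g x)"
  using rational_add[OF _ rational_mult[OF rational_const[of I Y "-1"]], of f g] by simp

lemma rational_divide:
  assumes "rational I Y f" "rational I Y g" "\<And>x. x \<in> Y \<Longrightarrow> g x \<noteq> 0"
  shows "rational I Y (\<lambda>x. f x / g x)"
proof -
  obtain c d where cd: "c \<in> polys I" "d \<in> polys I" "\<And>x. x \<in> Y \<Longrightarrow> d x \<noteq> 0" "\<And>x. x \<in> Y \<Longrightarrow> g x = c x / d x"
    using rationalE[OF assms(2)] by metis
  have "rational I Y (\<lambda>x. 1 / g x)" unfolding rational_def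
    using assms(3) cd by (intro bexI[OF _ cd(2)] bexI[OF _ cd(1)]) auto
  from rational_mult[OF assms(1) this] show ?thesis by simp
qed

lemma definable_rational_pos:
  assumes "definable I Y" "rational I Y f"
  shows "definable I {x\<in>Y. 0 < f x}"
proof -
  obtain a b where ab: "a \<in> polys I" "b \<in> polys I" "\<And>x. x \<in> Y \<Longrightarrow> b x \<noteq> 0" "\<And>x. x \<in> Y \<Longrightarrow> f x = a x / b x"
    using rationalE[OF assms(2)] by metis
  have "{x\<in>Y. 0 < f x} = Y \<inter> {x. 0 < a x * b x}"
    using ab(3,4) by (auto simp: zero_less_divide_iff zero_less_mult_iff)
  then show ?thesis using definable_Int[OF assms(1) definable_pos[OF polys_mult[OF ab(1,2)]]] by simp
qed

section \<open>Tame functions\<close>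

text \<open>
  Tame functions are the ones whose size can be read off from logarithms of polynomials. Bounded
  factors are ignored, and this makes the sum of two tame functions tame, being comparable to
  their maximum.
\<close>

definition tame :: "'b set \<Rightarrow> ('b \<Rightarrow> real) set \<Rightarrow> (('b \<Rightarrow> real) \<Rightarrow> real) \<Rightarrow> bool" where
  "tame I Y h \<longleftrightarrow> (\<forall>x\<in>Y. 0 < h x) \<and> (\<exists>Q \<Lambda> C. finite Q \<and> Q \<subseteq> polys I \<and> (\<forall>q\<in>Q. \<forall>x\<in>Y. q x \<noteq> 0) \<and> PL Q \<Lambda> \<and>
     (\<forall>x\<in>Y. \<bar>ln (h x) - \<Lambda> (\<lambda>q. ln \<bar>q x\<bar>)\<bar> \<le> C))"

lemma tame_pos: "tame I Y h \<Longrightarrow> x \<in> Y \<Longrightarrow> 0 < h x"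
  by (simp add: tame_def)

lemma tameE:
  assumes "tame I Y h"
  obtains Q \<Lambda> C where "finite Q" "Q \<subseteq> polys I" "\<forall>q\<in>Q. \<forall>x\<in>Y. q x \<noteq> 0" "PL Q \<Lambda>"
     "\<forall>x\<in>Y. \<bar>ln (h x) - \<Lambda> (\<lambda>q. ln \<bar>q x\<bar>)\<bar> \<le> C"
  using assms unfolding tame_def by (elim exE conjE) (rule that)

lemma tameI:
  assumes "\<And>x. x \<in> Y \<Longrightarrow> 0 < h x" "finite Q" "Q \<subseteq> polys I" "\<forall>q\<in>Q. \<forall>x\<in>Y. q x \<noteq> 0" "PL Q \<Lambda>"
     "\<And>x. x \<in> Y \<Longrightarrow> \<bar>ln (h x) - \<Lambda> (\<lambda>q. ln \<bar>q x\<bar>)\<bar> \<le> C"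
  shows "tame I Y h"
  unfolding tame_def
  by (intro conjI ballI exI[of _ Q] exI[of _ \<Lambda>] exI[of _ C]) (use assms in simp_all)

lemma tame_comparable:
  assumes h: "tame I Y h" and g: "\<And>x. x \<in> Y \<Longrightarrow> 0 < g x"
    and C: "0 < C" "\<And>x. x \<in> Y \<Longrightarrow> g x \<le> C * h x" "\<And>x. x \<in> Y \<Longrightarrow> h x \<le> C * g x"
  shows "tame I Y g"
proof -
  from h obtain Q \<Lambda> B where q: "finite Q" "Q \<subseteq> polys I" "\<forall>q\<in>Q. \<forall>x\<in>Y. q x \<noteq> 0" "PL Q \<Lambda>"
     "\<forall>x\<in>Y. \<bar>ln (h x) - \<Lambda> (\<lambda>q. ln \<bar>q x\<bar>)\<bar> \<le> B" by (rule tameE)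
  show ?thesis
  proof (rule tameI[OF g q(1-4)])
    fix x assume x: "x \<in> Y"
    have "ln (g x) \<le> ln (C * h x)" "ln (h x) \<le> ln (C * g x)"
      using x C tame_pos[OF h x] g[OF x] by (auto simp: ln_le_cancel_iff)
    then have "\<bar>ln (g x) - ln (h x)\<bar> \<le> ln C"
      using C(1) tame_pos[OF h x] g[OF x] by (simp add: ln_mult abs_le_iff)
    then show "\<bar>ln (g x) - \<Lambda> (\<lambda>q. ln \<bar>q x\<bar>)\<bar> \<le> ln C + B" using q(5) x by fastforce
  qed
qed

lemma tame_cong: "tame I Y h \<Longrightarrow> (\<And>x. x \<in> Y \<Longrightarrow> g x = h x) \<Longrightarrow> tame I Y g"
  by (rule tame_comparable[of I Y h g 1]) (auto simp: tame_pos)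

lemma tame_polys:
  assumes "f \<in> polys I" "\<And>x. x \<in> Y \<Longrightarrow> f x \<noteq> 0" shows "tame I Y (\<lambda>x. \<bar>f x\<bar>)"
  by (rule tameI[of _ _ "{f}" _ "\<lambda>u. u f" 0]) (use assms in \<open>auto intro: PL_coordinate\<close>)

lemma tame_powr:
  assumes h: "tame I Y h" shows "tame I Y (\<lambda>x. h x powr r)"
proof -
  from h obtain Q \<Lambda> B where q: "finite Q" "Q \<subseteq> polys I" "\<forall>q\<in>Q. \<forall>x\<in>Y. q x \<noteq> 0" "PL Q \<Lambda>"
     "\<forall>x\<in>Y. \<bar>ln (h x) - \<Lambda> (\<lambda>q. ln \<bar>q x\<bar>)\<bar> \<le> B" by (rule tameE)
  show ?thesis
  proof (rule tameI[OF _ q(1-3) PL_scale[OF q(4), of r], where C = "\<bar>r\<bar> * B"])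
    fix x assume x: "x \<in> Y"
    then show "0 < h x powr r" using tame_pos[OF h] by force
    have "\<bar>ln (h x powr r) - r * \<Lambda> (\<lambda>q. ln \<bar>q x\<bar>)\<bar> = \<bar>r\<bar> * \<bar>ln (h x) - \<Lambda> (\<lambda>q. ln \<bar>q x\<bar>)\<bar>"
      by (simp add: ln_powr abs_mult[symmetric] right_diff_distrib)
    also have "\<dots> \<le> \<bar>r\<bar> * B" using q(5) x by (intro mult_left_mono) auto
    finally show "\<bar>ln (h x powr r) - r * \<Lambda> (\<lambda>q. ln \<bar>q x\<bar>)\<bar> \<le> \<bar>r\<bar> * B" .
  qed
qed

lemma tame_common:
  assumes "tame I Y h" "tame I Y g"
  obtains Q \<Lambda> M B where "finite Q" "Q \<subseteq> polys I" "\<forall>q\<in>Q. \<forall>x\<in>Y. q x \<noteq> 0" "PL Q \<Lambda>" "PL Q M"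
     "\<forall>x\<in>Y. \<bar>ln (h x) - \<Lambda> (\<lambda>q. ln \<bar>q x\<bar>)\<bar> \<le> B \<and> \<bar>ln (g x) - M (\<lambda>q. ln \<bar>q x\<bar>)\<bar> \<le> B"
proof -
  from assms(1) obtain Q \<Lambda> B where q: "finite Q" "Q \<subseteq> polys I" "\<forall>q\<in>Q. \<forall>x\<in>Y. q x \<noteq> 0" "PL Q \<Lambda>"
     "\<forall>x\<in>Y. \<bar>ln (h x) - \<Lambda> (\<lambda>q. ln \<bar>q x\<bar>)\<bar> \<le> B" by (rule tameE)
  from assms(2) obtain R M C where r: "finite R" "R \<subseteq> polys I" "\<forall>q\<in>R. \<forall>x\<in>Y. q x \<noteq> 0" "PL R M"
     "\<forall>x\<in>Y. \<bar>ln (g x) - M (\<lambda>q. ln \<bar>q x\<bar>)\<bar> \<le> C" by (rule tameE)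
  show thesis
    by (rule that[of "Q \<union> R" \<Lambda> M "max B C"])
      (use q r PL_mono[OF q(4), of "Q \<union> R"] PL_mono[OF r(4), of "Q \<union> R"] in \<open>auto simp: le_max_iff_disj\<close>)
qed

lemma tame_mult:
  assumes "tame I Y h" "tame I Y g" shows "tame I Y (\<lambda>x. h x * g x)"
proof -
  obtain Q \<Lambda> M B where q: "finite Q" "Q \<subseteq> polys I" "\<forall>q\<in>Q. \<forall>x\<in>Y. q x \<noteq> 0" "PL Q \<Lambda>" "PL Q M"
     "\<forall>x\<in>Y. \<bar>ln (h x) - \<Lambda> (\<lambda>q. ln \<bar>q x\<bar>)\<bar> \<le> B \<and> \<bar>ln (g x) - M (\<lambda>q. ln \<bar>q x\<bar>)\<bar> \<le> B"
    by (rule tame_common[OF assms])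
  show ?thesis
  proof (rule tameI[OF _ q(1-3) PL_add[OF q(4,5)], where C = "B + B"])
    fix x assume x: "x \<in> Y"
    show "0 < h x * g x" using assms x by (simp add: tame_pos)
    have "ln (h x * g x) = ln (h x) + ln (g x)" using assms[THEN tame_pos, OF x] by (simp add: ln_mult)
    then show "\<bar>ln (h x * g x) - (\<Lambda> (\<lambda>q. ln \<bar>q x\<bar>) + M (\<lambda>q. ln \<bar>q x\<bar>))\<bar> \<le> B + B"
      using bspec[OF q(6) x] by linarith
  qed
qed

lemma tame_max:
  assumes "tame I Y h" "tame I Y g" shows "tame I Y (\<lambda>x. max (h x) (g x))"
proof -
  obtain Q \<Lambda> M B where q: "finite Q" "Q \<subseteq> polys I" "\<forall>q\<in>Q. \<forall>x\<in>Y. q x \<noteq> 0" "PL Q \<Lambda>" "PL Q M"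
     "\<forall>x\<in>Y. \<bar>ln (h x) - \<Lambda> (\<lambda>q. ln \<bar>q x\<bar>)\<bar> \<le> B \<and> \<bar>ln (g x) - M (\<lambda>q. ln \<bar>q x\<bar>)\<bar> \<le> B"
    by (rule tame_common[OF assms])
  show ?thesis
  proof (rule tameI[OF _ q(1-3) PL_max[OF q(4,5)], where C = B])
    fix x assume x: "x \<in> Y"
    show "0 < max (h x) (g x)" using tame_pos[OF assms(1) x] by auto
    have "ln (max (h x) (g x)) = max (ln (h x)) (ln (g x))"
      using assms[THEN tame_pos, OF x] by (auto simp: max_def)
    then show "\<bar>ln (max (h x) (g x)) - max (\<Lambda> (\<lambda>q. ln \<bar>q x\<bar>)) (M (\<lambda>q. ln \<bar>q x\<bar>))\<bar> \<le> B"
      using bspec[OF q(6) x] by linarith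
  qed
qed

lemma tame_add:
  assumes "tame I Y h" "tame I Y g" shows "tame I Y (\<lambda>x. h x + g x)"
proof (rule tame_comparable[OF tame_max[OF assms], of _ 2])
  fix x assume x: "x \<in> Y"
  have "0 < h x" "0 < g x" using assms[THEN tame_pos, OF x] by auto
  then show "0 < h x + g x" "h x + g x \<le> 2 * max (h x) (g x)" "max (h x) (g x) \<le> 2 * (h x + g x)"
    by (auto simp: max_def)
qed simp

lemma tame_const: "0 < c \<Longrightarrow> tame I Y (\<lambda>_. c)"
  using tame_polys[OF polys_const, of Y c I] by simp

lemma tame_sum:
  assumes "finite K" "K \<noteq> {}" "\<And>k. k \<in> K \<Longrightarrow> tame I Y (h k)"
  shows "tame I Y (\<lambda>x. \<Sum>k\<in>K. h k x)"
  using assms by (induction K rule: finite_ne_induct) (auto intro: tame_add)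

lemma tame_inverse: "tame I Y h \<Longrightarrow> tame I Y (\<lambda>x. 1 / h x)"
  by (rule tame_cong[OF tame_powr[of I Y h "-1"]]) (auto simp: powr_minus_divide dest: tame_pos)

lemma tame_divide: "tame I Y h \<Longrightarrow> tame I Y g \<Longrightarrow> tame I Y (\<lambda>x. h x / g x)"
  using tame_mult[OF _ tame_inverse, of I Y h g] by simp

lemma tame_power: "tame I Y h \<Longrightarrow> tame I Y (\<lambda>x. h x ^ k)"
  by (rule tame_cong[OF tame_powr[of I Y h "real k"]]) (auto simp: powr_realpow dest: tame_pos)

lemma tame_rational:
  assumes "rational I Y f" "\<And>x. x \<in> Y \<Longrightarrow> f x \<noteq> 0" shows "tame I Y (\<lambda>x. \<bar>f x\<bar>)"
proof -
  obtain a b where ab: "a \<in> polys I" "b \<in> polys I" "\<And>x. x \<in> Y \<Longrightarrow> b x \<noteq> 0" "\<And>x. x \<in> Y \<Longrightarrow> f x = a x / b x"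
    using rationalE[OF assms(1)] by metis
  have "tame I Y (\<lambda>x. \<bar>a x\<bar> / \<bar>b x\<bar>)"
    by (intro tame_divide tame_polys ab(1,2)) (use ab(3,4) assms(2) in force)+
  then show ?thesis by (rule tame_cong) (simp add: ab(4) abs_divide)
qed

text \<open>
  If $h \asymp \sum_k w_k s^{k+1}$, then each $v_k s$ with $v_k = (w_k/h)^{1/(k+1)}$ is bounded,
  and at every point at least one of them is bounded away from zero. So $s$ is comparable to
  $1/\sum_k v_k$, which is tame.
\<close>

lemma tame_solve:
  assumes K: "finite K" "K \<noteq> {}" and h: "tame I Y h" and w: "\<And>k. k \<in> K \<Longrightarrow> tame I Y (w k)"
    and s: "\<And>x. x \<in> Y \<Longrightarrow> 0 < s x" and C: "1 \<le> C"
    and up: "\<And>x. x \<in> Y \<Longrightarrow> h x \<le> C * (\<Sum>k\<in>K. w k x * s x ^ Suc k)"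
    and lo: "\<And>x. x \<in> Y \<Longrightarrow> (\<Sum>k\<in>K. w k x * s x ^ Suc k) \<le> C * h x"
  shows "tame I Y s"
proof -
  define v where "v = (\<lambda>k x. (w k x / h x) powr (1 / real (Suc k)))"
  define S where "S = (\<lambda>x. \<Sum>k\<in>K. v k x)"
  have tv: "tame I Y (v k)" if "k \<in> K" for k
    unfolding v_def by (intro tame_powr tame_divide w h that)
  have tS: "tame I Y S" unfolding S_def by (intro tame_sum K tv)
  have vs: "(v k x * s x) ^ Suc k = w k x * s x ^ Suc k / h x" if "k \<in> K" "x \<in> Y" for k x
  proof -
    have "v k x ^ Suc k = v k x powr real (Suc k)" by (rule powr_realpow[symmetric]) (use tame_pos[OF tv] that in auto)
    also have "\<dots> = w k x / h x"
      using tame_pos[OF w[OF that(1)] that(2)] tame_pos[OF h that(2)] by (simp add: v_def powr_powr del: of_nat_Suc)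
    finally show ?thesis unfolding power_mult_distrib by simp
  qed
  let ?n = "real (card K)"
  have n: "1 \<le> ?n" using K by (simp add: Suc_le_eq card_gt_0_iff)
  have "v k x * s x \<le> C" if kx: "k \<in> K" "x \<in> Y" for k x
  proof (rule ccontr)
    assume "\<not> ?thesis"
    then have c: "C < v k x * s x" by simp
    have "C ^ Suc k < (v k x * s x) ^ Suc k" using c C by (intro power_strict_mono) auto
    moreover have "C \<le> C ^ Suc k" using C by (intro self_le_power) auto
    moreover have "0 \<le> w k x * s x ^ Suc k" if "k \<in> K" for k
      using less_imp_le[OF tame_pos[OF w[OF that] kx(2)]] less_imp_le[OF s[OF kx(2)]] by simp
    then have "w k x * s x ^ Suc k \<le> (\<Sum>k\<in>K. w k x * s x ^ Suc k)"
      using K(1) kx(1) by (intro member_le_sum) simp_all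
    then have "w k x * s x ^ Suc k / h x \<le> C"
      using lo[OF kx(2)] tame_pos[OF h kx(2)] by (simp add: field_simps)
    ultimately show False using vs[OF kx] by simp
  qed
  then have S1: "S x * s x \<le> ?n * C" if "x \<in> Y" for x
    unfolding S_def sum_distrib_right using that by (intro sum_bounded_above) auto
  have S2: "1 \<le> ?n * C * (S x * s x)" if x: "x \<in> Y" for x
  proof -
    \<comment> \<open>The largest of the \<open>card K\<close> summands is at least their mean.\<close>
    have "\<exists>k\<in>K. h x \<le> ?n * C * (w k x * s x ^ Suc k)"
    proof (rule ccontr)
      assume "\<not> ?thesis"
      then have "?n * C * (w k x * s x ^ Suc k) < h x" if "k \<in> K" for k using that by auto
      then have "C * (w k x * s x ^ Suc k) < h x / ?n" if "k \<in> K" for k using that n by (simp add: field_simps)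
      then have "(\<Sum>k\<in>K. C * (w k x * s x ^ Suc k)) < ?n * (h x / ?n)"
        using K by (intro sum_bounded_above_strict) (auto simp: card_gt_0_iff)
      then show False using up[OF x] n by (simp add: sum_distrib_left)
    qed
    then obtain k where k: "k \<in> K" "h x \<le> ?n * C * (w k x * s x ^ Suc k)" by blast
    have vpos: "0 < v k x * s x" using tame_pos[OF tv[OF k(1)] x] s[OF x] by simp
    have nC: "1 \<le> ?n * C" using n C mult_mono[of 1 ?n 1 C] by simp
    have "1 \<le> ?n * C * (v k x * s x) ^ Suc k"
      unfolding vs[OF k(1) x] using k(2) tame_pos[OF h x] by (simp add: field_simps)
    also have "\<dots> \<le> (?n * C) ^ Suc k * (v k x * s x) ^ Suc k"
      using nC vpos by (intro mult_right_mono self_le_power) auto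
    also have "\<dots> = (?n * C * (v k x * s x)) ^ Suc k" by (simp only: power_mult_distrib)
    finally have "1 \<le> ?n * C * (v k x * s x)"
      using nC vpos power_Suc_less_one[of "?n * C * (v k x * s x)" k] by fastforce
    also have "v k x * s x \<le> S x * s x"
      unfolding S_def using K(1) k(1) less_imp_le[OF s[OF x]] less_imp_le[OF tame_pos[OF tv x]]
      by (intro mult_right_mono member_le_sum) simp_all
    finally show ?thesis using nC by (simp add: mult_left_mono)
  qed
  have "tame I Y (\<lambda>x. 1 / S x)" by (rule tame_inverse[OF tS])
  then show ?thesis
  proof (rule tame_comparable[where C = "?n * C"])
    fix x assume x: "x \<in> Y"
    show "s x \<le> ?n * C * (1 / S x)" using S1[OF x] tame_pos[OF tS x] by (simp add: field_simps)
    show "1 / S x \<le> ?n * C * s x" using S2[OF x] tame_pos[OF tS x] by (simp add: field_simps)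
  qed (use s n C in auto)
qed

section \<open>Decomposition into definable pieces\<close>

text \<open>
  The pieces are nonempty so that functions of constant sign on a piece have a well-defined
  sign.
\<close>

definition piecewise :: "'b set \<Rightarrow> ('b \<Rightarrow> real) set \<Rightarrow> (('b \<Rightarrow> real) set \<Rightarrow> bool) \<Rightarrow> bool" where
  "piecewise I Y P \<longleftrightarrow> (\<exists>\<Y>. finite \<Y> \<and> \<Union>\<Y> = Y \<and> (\<forall>Y'\<in>\<Y>. definable I Y' \<and> Y' \<noteq> {} \<and> P Y'))"

lemma piecewise_cover:
  assumes "finite \<Y>" "\<Union>\<Y> = Y" "\<forall>Y'\<in>\<Y>. definable I Y' \<and> P Y'"
  shows "piecewise I Y P"
proof -
  have "\<Union>(\<Y> - {{}}) = \<Union>\<Y>" by auto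
  then show ?thesis using assms unfolding piecewise_def by (intro exI[of _ "\<Y> - {{}}"]) auto
qed

lemma piecewiseI: "definable I Y \<Longrightarrow> (Y \<noteq> {} \<Longrightarrow> P Y) \<Longrightarrow> piecewise I Y P"
  unfolding piecewise_def by (rule exI[of _ "{Y} - {{}}"]) auto

lemma piecewise_trans:
  assumes "piecewise I Y P"
    and "\<And>Y'. definable I Y' \<Longrightarrow> Y' \<noteq> {} \<Longrightarrow> Y' \<subseteq> Y \<Longrightarrow> P Y' \<Longrightarrow> piecewise I Y' Q"
  shows "piecewise I Y Q"
proof -
  obtain \<Y> where \<Y>: "finite \<Y>" "\<Union>\<Y> = Y" "\<forall>Y'\<in>\<Y>. definable I Y' \<and> Y' \<noteq> {} \<and> P Y'"
    using assms(1) unfolding piecewise_def by auto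
  have "\<forall>Y'\<in>\<Y>. \<exists>\<D>. finite \<D> \<and> \<Union>\<D> = Y' \<and> (\<forall>X\<in>\<D>. definable I X \<and> X \<noteq> {} \<and> Q X)"
  proof
    fix Y' assume "Y' \<in> \<Y>"
    then have "piecewise I Y' Q" using assms(2) \<Y> by auto
    then show "\<exists>\<D>. finite \<D> \<and> \<Union>\<D> = Y' \<and> (\<forall>X\<in>\<D>. definable I X \<and> X \<noteq> {} \<and> Q X)"
      by (simp add: piecewise_def)
  qed
  then obtain d where d: "\<forall>Y'\<in>\<Y>. finite (d Y') \<and> \<Union>(d Y') = Y' \<and> (\<forall>X\<in>d Y'. definable I X \<and> X \<noteq> {} \<and> Q X)"
    by (rule bchoice[THEN exE])
  have "\<Union>(\<Union>(d ` \<Y>)) = \<Union>\<Y>"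
  proof -
    have "\<Union>(\<Union>(d ` \<Y>)) = (\<Union>Y'\<in>\<Y>. \<Union>(d Y'))" by auto
    also have "\<dots> = (\<Union>Y'\<in>\<Y>. Y')" by (rule SUP_cong) (use d in auto)
    finally show ?thesis by simp
  qed
  then show ?thesis using d \<Y>(1,2) unfolding piecewise_def
    by (intro exI[of _ "\<Union>(d ` \<Y>)"]) auto
qed

lemma piecewise_mono:
  assumes "piecewise I Y P"
    and "\<And>Y'. definable I Y' \<Longrightarrow> Y' \<noteq> {} \<Longrightarrow> Y' \<subseteq> Y \<Longrightarrow> P Y' \<Longrightarrow> Q Y'"
  shows "piecewise I Y Q"
  using assms(1) by (rule piecewise_trans) (auto intro!: piecewiseI assms(2))

definition const_sign :: "'a set \<Rightarrow> ('a \<Rightarrow> real) \<Rightarrow> bool" where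
  "const_sign Y f \<longleftrightarrow> (\<forall>x\<in>Y. f x = 0) \<or> (\<forall>x\<in>Y. 0 < f x) \<or> (\<forall>x\<in>Y. f x < 0)"

lemma const_sign_subset: "const_sign Y f \<Longrightarrow> Y' \<subseteq> Y \<Longrightarrow> const_sign Y' f"
  unfolding const_sign_def by blast

lemma const_sign_transfer:
  assumes "const_sign Y f" "x \<in> Y" "x' \<in> Y"
  shows "0 < c * f x \<longleftrightarrow> 0 < c * f x'" "c * f x < 0 \<longleftrightarrow> c * f x' < 0" "f x = 0 \<longleftrightarrow> f x' = 0"
    "0 < f x \<longleftrightarrow> 0 < f x'" "f x < 0 \<longleftrightarrow> f x' < 0"
  using assms by (auto simp: const_sign_def zero_less_mult_iff mult_less_0_iff)

lemma piecewise_sign: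
  assumes "definable I Y" "rational I Y f"
  shows "piecewise I Y (\<lambda>Y'. const_sign Y' f)"
proof -
  define A where "A = {x\<in>Y. 0 < f x}"
  define B where "B = {x\<in>Y. 0 < 0 - f x}"
  have "definable I A" "definable I B"
    unfolding A_def B_def by (intro definable_rational_pos rational_diff rational_const assms)+
  moreover have "definable I (Y \<inter> (- A \<inter> - B))"
    using assms calculation by (intro definable_Int definable_compl)
  moreover have "\<Union>{A, B, Y \<inter> (- A \<inter> - B)} = Y" unfolding A_def B_def by fastforce
  moreover have "const_sign A f" "const_sign B f" "const_sign (Y \<inter> (- A \<inter> - B)) f"
    by (auto simp: const_sign_def A_def B_def)
  ultimately show ?thesis
    by (intro piecewise_cover[of "{A, B, Y \<inter> (- A \<inter> - B)}"]) simp_all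
qed

lemma piecewise_signs:
  assumes "definable I Y" "finite F" "\<And>f. f \<in> F \<Longrightarrow> rational I Y f"
  shows "piecewise I Y (\<lambda>Y'. \<forall>f\<in>F. const_sign Y' f)"
  using assms(2,3)
proof (induction F rule: finite_induct)
  case empty
  then show ?case using assms(1) by (auto intro: piecewiseI)
next
  case (insert f F)
  then have "piecewise I Y (\<lambda>Y'. \<forall>f\<in>F. const_sign Y' f)" by auto
  then show ?case
  proof (rule piecewise_trans)
    fix Y' assume Y': "definable I Y'" "Y' \<subseteq> Y" and s: "\<forall>f\<in>F. const_sign Y' f"
    have "piecewise I Y' (\<lambda>Y'. const_sign Y' f)"
      using Y'(1) rational_subset[OF insert.prems Y'(2), of f] by (intro piecewise_sign) simp_all
    then show "piecewise I Y' (\<lambda>Y'. \<forall>f\<in>insert f F. const_sign Y' f)"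
      by (rule piecewise_mono) (metis const_sign_subset insert_iff s)
  qed
qed

definition signed_tame :: "'b set \<Rightarrow> ('b \<Rightarrow> real) set \<Rightarrow> (('b \<Rightarrow> real) \<Rightarrow> real) \<Rightarrow> bool" where
  "signed_tame I Y h \<longleftrightarrow> (\<forall>x\<in>Y. h x = 0) \<or> tame I Y h \<or> tame I Y (\<lambda>x. - h x)"

lemma signed_tame_const_sign: "signed_tame I Y h \<Longrightarrow> const_sign Y h"
  unfolding signed_tame_def const_sign_def by (auto dest: tame_pos)

lemma signed_tame_cong:
  "signed_tame I Y h \<Longrightarrow> (\<And>x. x \<in> Y \<Longrightarrow> g x = h x) \<Longrightarrow> signed_tame I Y g"
  unfolding signed_tame_def by (auto intro: tame_cong)

lemma signed_tame_uminus: "signed_tame I Y h \<Longrightarrow> signed_tame I Y (\<lambda>x. - h x)"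
  unfolding signed_tame_def by auto

lemma signed_tame_pos: "signed_tame I Y h \<Longrightarrow> x \<in> Y \<Longrightarrow> 0 < h x \<Longrightarrow> tame I Y h"
  unfolding signed_tame_def by (auto dest: tame_pos)

lemma signed_tame_neg: "signed_tame I Y h \<Longrightarrow> x \<in> Y \<Longrightarrow> h x < 0 \<Longrightarrow> tame I Y (\<lambda>x. - h x)"
  unfolding signed_tame_def by (auto dest: tame_pos)

lemma signed_tame_sgn:
  assumes "signed_tame I Y h" "x \<in> Y" "0 < e * h x" "\<bar>e\<bar> = 1"
  shows "tame I Y (\<lambda>x. e * h x)"
proof -
  have "e = 1 \<or> e = -1" using assms(4) by linarith
  then show ?thesis using assms signed_tame_pos signed_tame_neg by auto
qed

lemma signed_tame_abs:
  assumes "signed_tame I Y h" "x \<in> Y" "h x \<noteq> 0" shows "tame I Y (\<lambda>x. \<bar>h x\<bar>)"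
proof -
  have "tame I Y h \<or> tame I Y (\<lambda>x. - h x)" using assms unfolding signed_tame_def by blast
  then show ?thesis
  proof
    assume t: "tame I Y h"
    show ?thesis by (rule tame_cong[OF t]) (use tame_pos[OF t] in force)
  next
    assume t: "tame I Y (\<lambda>x. - h x)"
    show ?thesis by (rule tame_cong[OF t]) (use tame_pos[OF t] in force)
  qed
qed

lemma signed_tameI:
  assumes "const_sign Y h" "x0 \<in> Y" "h x0 \<noteq> 0 \<Longrightarrow> tame I Y (\<lambda>x. \<bar>h x\<bar>)"
  shows "signed_tame I Y h"
proof (cases "h x0 = 0")
  case True
  then show ?thesis using assms(1,2) unfolding const_sign_def signed_tame_def by force
next
  case False
  then have t: "tame I Y (\<lambda>x. \<bar>h x\<bar>)" by (rule assms(3))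
  consider "\<forall>x\<in>Y. 0 < h x" | "\<forall>x\<in>Y. h x < 0" using assms(1,2) False unfolding const_sign_def by blast
  then show ?thesis
  proof cases
    case 1
    have "tame I Y h" by (rule tame_cong[OF t]) (use 1 in force)
    then show ?thesis by (simp add: signed_tame_def)
  next
    case 2
    have "tame I Y (\<lambda>x. - h x)" by (rule tame_cong[OF t]) (use 2 in force)
    then show ?thesis by (simp add: signed_tame_def)
  qed
qed

lemma signed_tame_rational: "rational I Y f \<Longrightarrow> const_sign Y f \<Longrightarrow> signed_tame I Y f"
proof (cases "Y = {}")
  case False
  then obtain x0 where x0: "x0 \<in> Y" by blast
  assume f: "rational I Y f" "const_sign Y f"
  show ?thesis
    by (rule signed_tameI[OF f(2) x0], rule tame_rational[OF f(1)])
      (use const_sign_transfer(3)[OF f(2) _ x0] in simp)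
qed (simp add: signed_tame_def)

section \<open>Polynomials in one variable over a base\<close>

definition rpoly :: "'b set \<Rightarrow> ('b \<Rightarrow> real) set \<Rightarrow> nat \<Rightarrow> (('b \<Rightarrow> real) \<Rightarrow> real poly) \<Rightarrow> bool" where
  "rpoly I Y n p \<longleftrightarrow> (\<forall>x\<in>Y. degree (p x) \<le> n) \<and> (\<forall>k. rational I Y (\<lambda>x. coeff (p x) k))"

lemma rpoly_subset: "rpoly I Y n p \<Longrightarrow> Y' \<subseteq> Y \<Longrightarrow> rpoly I Y' n p"
  unfolding rpoly_def by (auto intro: rational_subset)

lemma rpoly_mono: "rpoly I Y n p \<Longrightarrow> n \<le> m \<Longrightarrow> rpoly I Y m p"
  unfolding rpoly_def by force

lemma rpoly_nth_pderiv: "rpoly I Y n p \<Longrightarrow> rpoly I Y (n - k) (\<lambda>x. nth_pderiv k (p x))"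
  unfolding rpoly_def by (auto simp: degree_higher_pderiv coeff_higher_pderiv
    intro!: rational_mult rational_const diff_le_mono)

text \<open>
  One division step, with the leading coefficient of the divisor invertible on \<open>Y\<close>, lowers the
  degree bound and keeps the coefficients rational.
\<close>

lemma rpoly_mod:
  assumes r: "rpoly I Y m r" "\<And>x. x \<in> Y \<Longrightarrow> degree (r x) = m" and m: "0 < m"
  shows "rpoly I Y n p \<Longrightarrow> rpoly I Y (m - 1) (\<lambda>x. p x mod r x)"
proof (induction n arbitrary: p)
  case 0
  then have "p x mod r x = p x" if "x \<in> Y" for x using that assms by (intro mod_poly_less) (auto simp: rpoly_def)
  then have "rpoly I Y 0 (\<lambda>x. p x mod r x)" using 0 by (auto simp: rpoly_def cong: rational_cong)
  then show ?case by (rule rpoly_mono) simp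
next
  case (Suc n)
  show ?case
  proof (cases "Suc n < m")
    case True
    then have "p x mod r x = p x" if "x \<in> Y" for x
      using that assms Suc.prems by (intro mod_poly_less) (auto simp: rpoly_def le_less_trans)
    then have "rpoly I Y (Suc n) (\<lambda>x. p x mod r x)" using Suc.prems by (auto simp: rpoly_def cong: rational_cong)
    then show ?thesis by (rule rpoly_mono) (use True in simp)
  next
    case False
    define a where "a = (\<lambda>x. coeff (p x) (Suc n) / coeff (r x) m)"
    define q where "q = (\<lambda>x. p x - monom (a x) (Suc n - m) * r x)"
    have lc: "coeff (r x) m \<noteq> 0" if "x \<in> Y" for x
      using r(2)[OF that] m leading_coeff_0_iff[of "r x"] by auto
    have ra: "rational I Y a" unfolding a_def using Suc.prems r lc by (intro rational_divide) (auto simp: rpoly_def)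
    have cq: "coeff (q x) k = coeff (p x) k - (if k < Suc n - m then 0 else a x * coeff (r x) (k - (Suc n - m)))" for x k
      by (simp add: q_def coeff_monom_mult)
    have "rpoly I Y n q"
      unfolding rpoly_def
    proof (intro conjI ballI allI)
      fix x assume x: "x \<in> Y"
      show "degree (q x) \<le> n"
      proof (rule degree_le, intro allI impI)
        fix k assume k: "n < k"
        show "coeff (q x) k = 0"
        proof (cases "k = Suc n")
          case True
          then show ?thesis using lc[OF x] False by (simp add: cq a_def)
        next
          case False
          then have "Suc n < k" using k by simp
          moreover have "m < k - (Suc n - m)" using calculation \<open>\<not> Suc n < m\<close> by simp
          ultimately have "coeff (p x) k = 0" "coeff (r x) (k - (Suc n - m)) = 0"
            using x r Suc.prems by (auto simp: rpoly_def intro!: coeff_eq_0 le_less_trans[of _ "Suc n" k])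
          then show ?thesis by (simp add: cq)
        qed
      qed
    next
      fix k show "rational I Y (\<lambda>x. coeff (q x) k)"
        unfolding cq using Suc.prems r ra
        by (cases "k < Suc n - m") (auto simp: rpoly_def intro!: rational_diff rational_mult)
    qed
    then have "rpoly I Y (m - 1) (\<lambda>x. q x mod r x)" by (rule Suc.IH)
    moreover have "q x mod r x = p x mod r x" for x
      by (simp add: q_def poly_mod_diff_left)
    ultimately show ?thesis by simp
  qed
qed

section \<open>Root functions and the strips beside them\<close>

text \<open>
  A finite set of functions on \<open>Y\<close> whose graphs are pairwise either equal or disjoint, with tame
  distances.
\<close>

definition sections :: "'b set \<Rightarrow> ('b \<Rightarrow> real) set \<Rightarrow> (('b \<Rightarrow> real) \<Rightarrow> real) set \<Rightarrow> bool" where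
  "sections I Y Z \<longleftrightarrow> finite Z \<and> Z \<noteq> {} \<and> (\<forall>\<xi>\<in>Z. \<forall>\<eta>\<in>Z. signed_tame I Y (\<lambda>x. \<xi> x - \<eta> x))"

text \<open>
  A polynomial that vanishes identically over \<open>Y\<close> has no useful roots and is let through;
  otherwise it vanishes identically over no point of \<open>Y\<close>.
\<close>

definition roots_in :: "('b \<Rightarrow> real) set \<Rightarrow> (('b \<Rightarrow> real) \<Rightarrow> real poly) \<Rightarrow> (('b \<Rightarrow> real) \<Rightarrow> real) set \<Rightarrow> bool" where
  "roots_in Y p Z \<longleftrightarrow> (\<forall>x\<in>Y. p x = 0) \<or>
     (\<forall>x\<in>Y. p x \<noteq> 0 \<and> (\<forall>y. poly (p x) y = 0 \<longrightarrow> (\<exists>\<xi>\<in>Z. \<xi> x = y)))"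

definition tame_on :: "'b set \<Rightarrow> ('b \<Rightarrow> real) set \<Rightarrow> (('b \<Rightarrow> real) \<Rightarrow> real poly) \<Rightarrow> (('b \<Rightarrow> real) \<Rightarrow> real) set \<Rightarrow> bool" where
  "tame_on I Y p Z \<longleftrightarrow> (\<forall>\<xi>\<in>Z. signed_tame I Y (\<lambda>x. poly (p x) (\<xi> x)))"

text \<open>
  Derivatives are included because the signs and sizes of \<open>f\<close> beside a root function are found
  from them; those of order above \<open>n\<close> vanish.
\<close>

definition settled :: "'b set \<Rightarrow> ('b \<Rightarrow> real) set \<Rightarrow> (('b \<Rightarrow> real) \<Rightarrow> real) set \<Rightarrow> nat \<Rightarrow> (('b \<Rightarrow> real) \<Rightarrow> real poly) \<Rightarrow> bool" where
  "settled I Y Z n f \<longleftrightarrow> (\<forall>x\<in>Y. degree (f x) \<le> n) \<and>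
     (\<forall>k\<le>n. roots_in Y (\<lambda>x. nth_pderiv k (f x)) Z \<and> tame_on I Y (\<lambda>x. nth_pderiv k (f x)) Z)"

lemma settled_degree: "settled I Y Z n f \<Longrightarrow> x \<in> Y \<Longrightarrow> degree (f x) \<le> n"
  by (simp add: settled_def)

lemma settled_roots: "settled I Y Z n f \<Longrightarrow> k \<le> n \<Longrightarrow> roots_in Y (\<lambda>x. nth_pderiv k (f x)) Z"
  by (simp add: settled_def)

lemma settled_value:
  "settled I Y Z n f \<Longrightarrow> k \<le> n \<Longrightarrow> \<xi> \<in> Z \<Longrightarrow> signed_tame I Y (\<lambda>x. poly (nth_pderiv k (f x)) (\<xi> x))"
  by (simp add: settled_def tame_on_def)

lemma settled_pderiv: "settled I Y Z (Suc n) f \<Longrightarrow> settled I Y Z n (\<lambda>x. pderiv (f x))"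
  unfolding settled_def nth_pderiv_pderiv by (auto simp: degree_pderiv simp del: funpow.simps)

text \<open>
  Seen from \<open>\<xi> x\<close> in the direction \<open>e\<close>, where \<open>e\<close> is 1 or -1, no other root function comes
  before distance \<open>L\<close>.
\<close>

definition clear :: "(('b \<Rightarrow> real) \<Rightarrow> real) set \<Rightarrow> (('b \<Rightarrow> real) \<Rightarrow> real) \<Rightarrow> real \<Rightarrow> ('b \<Rightarrow> real) \<Rightarrow> real \<Rightarrow> bool" where
  "clear Z \<xi> e x L \<longleftrightarrow> (\<forall>\<eta>\<in>Z. 0 < e * (\<eta> x - \<xi> x) \<longrightarrow> L \<le> e * (\<eta> x - \<xi> x))"

text \<open>
  The point \<open>y\<close> lies in the open interval between \<open>\<xi> x\<close> and the next root function in the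
  direction \<open>e\<close>.
\<close>

definition gap :: "(('b \<Rightarrow> real) \<Rightarrow> real) set \<Rightarrow> (('b \<Rightarrow> real) \<Rightarrow> real) \<Rightarrow> real \<Rightarrow> ('b \<Rightarrow> real) \<Rightarrow> real \<Rightarrow> bool" where
  "gap Z \<xi> e x y \<longleftrightarrow> 0 < e * (y - \<xi> x) \<and>
     (\<forall>\<eta>\<in>Z. 0 < e * (\<eta> x - \<xi> x) \<longrightarrow> e * (y - \<xi> x) < e * (\<eta> x - \<xi> x))"

lemma gap_imp_clear: "gap Z \<xi> e x y \<Longrightarrow> clear Z \<xi> e x (e * (y - \<xi> x))"
  unfolding gap_def clear_def by auto

lemma unit_square: "\<bar>e\<bar> = (1::real) \<Longrightarrow> e * e = 1"
  by (metis abs_mult_self_eq mult_1)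

lemma unit_cancel: "\<bar>e\<bar> = (1::real) \<Longrightarrow> e * (a + e * \<sigma> - a) = \<sigma>" "\<bar>e\<bar> = (1::real) \<Longrightarrow> a + e * (e * (y - a)) = y"
  using unit_square[of e] by (auto simp: mult.assoc[symmetric])

lemma clear_gap:
  assumes "clear Z \<xi> e x L" "\<bar>e\<bar> = 1" "0 < \<sigma>" "\<sigma> < L"
  shows "gap Z \<xi> e x (\<xi> x + e * \<sigma>)"
  unfolding gap_def unit_cancel(1)[OF assms(2)]
  using assms(1,3,4) unfolding clear_def by (meson less_le_trans)

lemma gap_between:
  assumes "gap Z \<xi> e x y" "\<bar>e\<bar> = 1" "0 < \<sigma>" "\<sigma> \<le> e * (y - \<xi> x)"
  shows "gap Z \<xi> e x (\<xi> x + e * \<sigma>)"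
  unfolding gap_def unit_cancel(1)[OF assms(2)]
  using assms(1,3,4) unfolding gap_def by (meson le_less_trans)

lemma clear_zero_free:
  assumes "\<And>k. k \<le> n \<Longrightarrow> roots_in Y (\<lambda>x. nth_pderiv k (f x)) Z" "x \<in> Y" "clear Z \<xi> e x L" "\<bar>e\<bar> = 1"
  shows "zero_free n (f x) (\<xi> x) e L"
  unfolding zero_free_def
proof (intro allI impI)
  fix k assume k: "k \<le> n"
  have "poly (nth_pderiv k (f x)) (\<xi> x + e * \<sigma>) \<noteq> 0" if nz: "nth_pderiv k (f x) \<noteq> 0" and \<sigma>: "0 < \<sigma>" "\<sigma> < L" for \<sigma>
  proof
    assume "poly (nth_pderiv k (f x)) (\<xi> x + e * \<sigma>) = 0"
    with assms(1)[OF k] assms(2) nz obtain \<eta> where "\<eta> \<in> Z" "\<eta> x = \<xi> x + e * \<sigma>"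
      unfolding roots_in_def by metis
    then show False using assms(3) \<sigma> unit_square[OF assms(4)]
      by (auto simp: clear_def mult.assoc[symmetric] dest!: bspec[of Z _ \<eta>])
  qed
  then show "nth_pderiv k (f x) = 0 \<or> (\<forall>\<sigma>. 0 < \<sigma> \<and> \<sigma> < L \<longrightarrow> poly (nth_pderiv k (f x)) (\<xi> x + e * \<sigma>) \<noteq> 0)" by blast
qed

lemma gap_nonroot:
  assumes "roots_in Y f Z" "x \<in> Y" "f x \<noteq> 0" "gap Z \<xi> e x y"
  shows "poly (f x) y \<noteq> 0"
proof
  assume "poly (f x) y = 0"
  with assms(1-3) obtain \<eta> where "\<eta> \<in> Z" "\<eta> x = y" unfolding roots_in_def by metis
  then show False using assms(4) by (auto simp: gap_def)
qed

lemma ray_IVT: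
  fixes a e s t :: real
  assumes "poly f (a + e * s) * poly f (a + e * t) < 0" "s \<le> t"
  obtains \<sigma> where "s < \<sigma>" "\<sigma> < t" "poly f (a + e * \<sigma>) = 0"
proof -
  define h where "h = (\<lambda>\<sigma>. poly f (a + e * \<sigma>))"
  have c: "continuous_on A h" for A unfolding h_def by (intro continuous_intros)
  have "0 \<in> closed_segment (h s) (h t)"
    using assms by (auto simp: closed_segment_eq_real_ivl h_def mult_less_0_iff)
  then obtain x where "x \<in> closed_segment s t" "h x = 0"
    using IVT'_closed_segment_real[OF _ c, of 0 s t] by metis
  moreover have "h s \<noteq> 0" "h t \<noteq> 0" using assms by (auto simp: h_def)
  ultimately show thesis using assms(2)
    by (intro that[of x]) (auto simp: closed_segment_eq_real_ivl h_def order.order_iff_strict)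
qed

text \<open>
  The sign of a settled polynomial on the interval beside a root function is the same over all
  of \<open>Y\<close>: it is the sign at the root function itself, and if that is zero, the sign next to it
  is the sign of the derivative, up to \<open>e\<close>.
\<close>

lemma gap_sign:
  assumes "settled I Y Z n f" "\<xi> \<in> Z" "\<bar>e\<bar> = 1"
  shows "(\<forall>x\<in>Y. \<forall>y. gap Z \<xi> e x y \<longrightarrow> poly (f x) y = 0) \<or>
         (\<forall>x\<in>Y. \<forall>y. gap Z \<xi> e x y \<longrightarrow> 0 < poly (f x) y) \<or>
         (\<forall>x\<in>Y. \<forall>y. gap Z \<xi> e x y \<longrightarrow> poly (f x) y < 0)"
  using assms(1)
proof (induction n arbitrary: f)
  case 0
  have p: "poly (f x) y = coeff (f x) 0" if "x \<in> Y" for x y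
  proof -
    have "degree (f x) = 0" using 0 that by (auto simp: settled_def)
    then obtain c where "f x = [:c:]" by (rule degree_eq_zeroE)
    then show ?thesis by simp
  qed
  have "const_sign Y (\<lambda>x. poly (nth_pderiv 0 (f x)) (\<xi> x))"
    by (rule signed_tame_const_sign[OF settled_value[OF 0 _ assms(2)]]) simp
  then show ?case unfolding const_sign_def by (elim disjE) (simp_all add: p)
next
  case (Suc n)
  have e: "e = 1 \<or> e = -1" using assms(3) by linarith
  have "const_sign Y (\<lambda>x. poly (nth_pderiv 0 (f x)) (\<xi> x))"
    by (rule signed_tame_const_sign[OF settled_value[OF Suc.prems _ assms(2)]]) simp
  then have cs: "const_sign Y (\<lambda>x. poly (f x) (\<xi> x))" by simp
  have ri: "roots_in Y f Z" using settled_roots[OF Suc.prems le0] by simp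
  have pos: "0 < poly (f x) (\<xi> x) * poly (f x) y" if x: "x \<in> Y" and nz: "poly (f x) (\<xi> x) \<noteq> 0" and g: "gap Z \<xi> e x y" for x y
  proof (rule ccontr)
    let ?s = "e * (y - \<xi> x)"
    have f0: "f x \<noteq> 0" using nz by auto
    assume "\<not> ?thesis"
    then have "poly (f x) (\<xi> x) * poly (f x) y < 0"
      using nz gap_nonroot[OF ri x f0 g] by (meson linorder_neqE_linordered_idom mult_eq_0_iff)
    then have "poly (f x) (\<xi> x + e * 0) * poly (f x) (\<xi> x + e * ?s) < 0" by (simp add: unit_cancel[OF assms(3)])
    then obtain \<sigma> where "0 < \<sigma>" "\<sigma> < ?s" "poly (f x) (\<xi> x + e * \<sigma>) = 0"
      by (rule ray_IVT) (use g in \<open>auto simp: gap_def\<close>)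
    then show False using gap_nonroot[OF ri x f0 gap_between[OF g assms(3)]] by auto
  qed
  show ?case
  proof (cases "\<forall>x\<in>Y. poly (f x) (\<xi> x) = 0")
    case False
    with cs consider "\<forall>x\<in>Y. 0 < poly (f x) (\<xi> x)" | "\<forall>x\<in>Y. poly (f x) (\<xi> x) < 0"
      unfolding const_sign_def by blast
    then show ?thesis
    proof cases
      case 1
      then have "0 < poly (f x) y" if "x \<in> Y" "gap Z \<xi> e x y" for x y
        using pos[of x y] that by (force simp: zero_less_mult_iff)
      then show ?thesis by blast
    next
      case 2
      then have "poly (f x) y < 0" if "x \<in> Y" "gap Z \<xi> e x y" for x y
        using pos[of x y] that by (force simp: zero_less_mult_iff)
      then show ?thesis by blast
    qed
  next
    case True
    have step: "\<exists>c. gap Z \<xi> e x c \<and> poly (f x) y = e * (e * (y - \<xi> x)) * poly (pderiv (f x)) c \<and> 0 < e * (y - \<xi> x)"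
      if x: "x \<in> Y" and g: "gap Z \<xi> e x y" for x y
    proof -
      let ?s = "e * (y - \<xi> x)"
      have s: "0 < ?s" using g by (simp add: gap_def)
      from poly_MVT_ray[OF s assms(3), of "f x" "\<xi> x"] obtain \<sigma> where "0 < \<sigma>" "\<sigma> < ?s"
        "poly (f x) (\<xi> x + e * ?s) - poly (f x) (\<xi> x + e * 0) = e * (?s - 0) * poly (pderiv (f x)) (\<xi> x + e * \<sigma>)"
        by metis
      then show ?thesis using True x gap_between[OF g assms(3), of \<sigma>] s
        by (intro exI[of _ "\<xi> x + e * \<sigma>"]) (simp add: unit_cancel[OF assms(3)])
    qed
    consider "\<forall>x\<in>Y. \<forall>y. gap Z \<xi> e x y \<longrightarrow> poly (pderiv (f x)) y = 0"
      | "\<forall>x\<in>Y. \<forall>y. gap Z \<xi> e x y \<longrightarrow> 0 < poly (pderiv (f x)) y"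
      | "\<forall>x\<in>Y. \<forall>y. gap Z \<xi> e x y \<longrightarrow> poly (pderiv (f x)) y < 0"
      using Suc.IH[OF settled_pderiv[OF Suc.prems]] by blast
    then show ?thesis
    proof cases
      case 1
      then have "\<forall>x\<in>Y. \<forall>y. gap Z \<xi> e x y \<longrightarrow> poly (f x) y = 0" using step by fastforce
      then show ?thesis by blast
    next
      case 2
      have "0 < e * poly (f x) y" if xy: "x \<in> Y" "gap Z \<xi> e x y" for x y
      proof -
        obtain c where c: "gap Z \<xi> e x c" "poly (f x) y = e * (e * (y - \<xi> x)) * poly (pderiv (f x)) c" "0 < e * (y - \<xi> x)"
          using step[OF xy] by blast
        have eq: "e * poly (f x) y = (e * e) * ((e * (y - \<xi> x)) * poly (pderiv (f x)) c)"
          unfolding c(2) by (simp only: mult.assoc)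
        have "0 < poly (pderiv (f x)) c" using 2 c(1) xy(1) by blast
        then show ?thesis unfolding eq unit_square[OF assms(3)] using c(3) by simp
      qed
      then show ?thesis using e by force
    next
      case 3
      have "e * poly (f x) y < 0" if xy: "x \<in> Y" "gap Z \<xi> e x y" for x y
      proof -
        obtain c where c: "gap Z \<xi> e x c" "poly (f x) y = e * (e * (y - \<xi> x)) * poly (pderiv (f x)) c" "0 < e * (y - \<xi> x)"
          using step[OF xy] by blast
        have eq: "e * poly (f x) y = (e * e) * ((e * (y - \<xi> x)) * poly (pderiv (f x)) c)"
          unfolding c(2) by (simp only: mult.assoc)
        have "poly (pderiv (f x)) c < 0" using 3 c(1) xy(1) by blast
        then show ?thesis unfolding eq unit_square[OF assms(3)] using c(3) mult_pos_neg by simp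
      qed
      then show ?thesis using e by force
    qed
  qed
qed

text \<open>
  A summand whose weight vanishes somewhere vanishes everywhere and can be dropped; the others
  are tame.
\<close>

lemma tame_weighted_sum:
  assumes "finite A" "\<And>k. k \<in> A \<Longrightarrow> signed_tame I Y (w k)" "\<And>k. k \<in> A \<Longrightarrow> tame I Y (v k)" "Y \<noteq> {}"
  shows "(\<forall>x\<in>Y. (\<Sum>k\<in>A. \<bar>w k x\<bar> * v k x) = 0) \<or> tame I Y (\<lambda>x. \<Sum>k\<in>A. \<bar>w k x\<bar> * v k x)"
proof -
  obtain x0 where x0: "x0 \<in> Y" using assms(4) by blast
  define K where "K = {k\<in>A. w k x0 \<noteq> 0}"
  have K: "finite K" "K \<subseteq> A" using assms(1) by (auto simp: K_def)
  have z: "w k x = 0" if "k \<in> A - K" "x \<in> Y" for k x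
    using that const_sign_transfer(3)[OF signed_tame_const_sign[OF assms(2)], of k x x0] x0 by (auto simp: K_def)
  have eq: "(\<Sum>k\<in>A. \<bar>w k x\<bar> * v k x) = (\<Sum>k\<in>K. \<bar>w k x\<bar> * v k x)" if "x \<in> Y" for x
    using z that K assms(1) by (intro sum.mono_neutral_right) auto
  show ?thesis
  proof (cases "K = {}")
    case True
    then show ?thesis using eq by simp
  next
    case False
    have "tame I Y (\<lambda>x. \<Sum>k\<in>K. \<bar>w k x\<bar> * v k x)"
      using K x0 by (intro tame_sum False tame_mult) (auto simp: K_def intro!: signed_tame_abs assms(2,3))
    then show ?thesis using eq by (auto intro: tame_cong)
  qed
qed

lemma tame_taylor_size:
  assumes "settled I Y Z n f" "\<xi> \<in> Z" "tame I Y s" "Y \<noteq> {}"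
  shows "(\<forall>x\<in>Y. taylor_size n (f x) (\<xi> x) (s x) = 0) \<or> tame I Y (\<lambda>x. taylor_size n (f x) (\<xi> x) (s x))"
  unfolding taylor_size_def
  by (rule tame_weighted_sum) (simp_all add: settled_value[OF assms(1) _ assms(2)] tame_power[OF assms(3)] assms(4))

text \<open>
  The value at \<open>\<zeta>\<close> is bounded by the Taylor sizes from all the neighbours in \<open>N\<close>, and it is
  comparable to the one from the nearest neighbour. Which neighbour is nearest depends on the
  point; so the value is comparable to the minimum of these Taylor sizes, or equivalently to the
  inverse of the sum of their inverses.
\<close>

lemma tame_value:
  assumes f: "settled I Y Z n f" and Y: "Y \<noteq> {}"
    and N: "finite N" "N \<noteq> {}" "\<And>\<xi> e. (\<xi>, e) \<in> N \<Longrightarrow> \<xi> \<in> Z \<and> \<bar>e\<bar> = 1"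
    and g: "\<And>\<xi> e x. (\<xi>, e) \<in> N \<Longrightarrow> x \<in> Y \<Longrightarrow> gap Z \<xi> e x (\<zeta> x)"
    and t: "\<And>\<xi> e. (\<xi>, e) \<in> N \<Longrightarrow> tame I Y (\<lambda>x. e * (\<zeta> x - \<xi> x))"
    and near: "\<And>x. x \<in> Y \<Longrightarrow> \<exists>(\<xi>, e)\<in>N. clear Z \<xi> e x (2 * (e * (\<zeta> x - \<xi> x)))"
  shows "signed_tame I Y (\<lambda>x. poly (f x) (\<zeta> x))"
proof -
  obtain x0 where x0: "x0 \<in> Y" using Y by blast
  obtain \<xi>0 e0 where N0: "(\<xi>0, e0) \<in> N" using N(2) by (metis all_not_in_conv surj_pair)
  have cs: "const_sign Y (\<lambda>x. poly (f x) (\<zeta> x))"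
    using gap_sign[OF f, of \<xi>0 e0] N(3)[OF N0] g[OF N0] unfolding const_sign_def by blast
  show ?thesis
  proof (rule signed_tameI[OF cs x0])
    assume nz0: "poly (f x0) (\<zeta> x0) \<noteq> 0"
    have nz: "poly (f x) (\<zeta> x) \<noteq> 0" if "x \<in> Y" for x
      using const_sign_transfer(3)[OF cs that x0] nz0 by simp
    define T where "T = (\<lambda>(\<xi>, e) x. taylor_size n (f x) (\<xi> x) (e * (\<zeta> x - \<xi> x)))"
    have deg: "degree (f x) \<le> n" if "x \<in> Y" for x using f that by (simp add: settled_def)
    have up: "\<bar>poly (f x) (\<zeta> x)\<bar> \<le> T p x" if p: "p \<in> N" and x: "x \<in> Y" for p x
    proof -
      obtain \<xi> e where pe: "p = (\<xi>, e)" by force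
      have e: "\<bar>e\<bar> = 1" using N(3) p pe by blast
      have "0 \<le> e * (\<zeta> x - \<xi> x)" using g[of \<xi> e x] p pe x by (simp add: gap_def)
      from abs_poly_le_taylor_size[OF deg[OF x] this e, of "\<xi> x"] show ?thesis
        by (simp add: pe T_def unit_cancel[OF e])
    qed
    have Tpos: "0 < T p x" if "p \<in> N" "x \<in> Y" for p x
      using up[OF that] nz[OF that(2)] by linarith
    have tT: "tame I Y (T p)" if p: "p \<in> N" for p
    proof -
      obtain \<xi> e where pe: "p = (\<xi>, e)" by force
      have "(\<forall>x\<in>Y. T p x = 0) \<or> tame I Y (T p)"
        using tame_taylor_size[OF f _ t Y, of \<xi> \<xi> e] N(3) p unfolding pe T_def by simp
      then show ?thesis using Tpos[OF p x0] x0 by force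
    qed
    obtain C where C: "C > 0" "\<And>f a e s. degree f \<le> n \<Longrightarrow> 0 < s \<Longrightarrow> \<bar>e\<bar> = 1 \<Longrightarrow> zero_free n f a e (2 * s) \<Longrightarrow>
      taylor_size n f a s \<le> C * \<bar>poly f (a + e * s)\<bar>" using taylor_size_le_abs_poly[of 2 n] by auto
    define S where "S = (\<lambda>x. \<Sum>p\<in>N. 1 / T p x)"
    have tS: "tame I Y S" unfolding S_def by (intro tame_sum N tame_inverse tT)
    have lo: "1 \<le> C * \<bar>poly (f x) (\<zeta> x)\<bar> * S x" if x: "x \<in> Y" for x
    proof -
      obtain \<xi> e where p: "(\<xi>, e) \<in> N" and cl: "clear Z \<xi> e x (2 * (e * (\<zeta> x - \<xi> x)))" using near[OF x] by blast
      have e: "\<bar>e\<bar> = 1" using N(3) p by blast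
      have s: "0 < e * (\<zeta> x - \<xi> x)" using g[OF p x] by (simp add: gap_def)
      have "zero_free n (f x) (\<xi> x) e (2 * (e * (\<zeta> x - \<xi> x)))"
        by (rule clear_zero_free[OF _ x cl e]) (use f in \<open>simp add: settled_def\<close>)
      from C(2)[OF deg[OF x] s e this] have "T (\<xi>, e) x \<le> C * \<bar>poly (f x) (\<zeta> x)\<bar>"
        by (simp add: T_def unit_cancel[OF e])
      then have "1 \<le> C * \<bar>poly (f x) (\<zeta> x)\<bar> * (1 / T (\<xi>, e) x)" using Tpos[OF p x] by (simp add: field_simps)
      also have "1 / T (\<xi>, e) x \<le> S x"
        unfolding S_def using N(1) p less_imp_le[OF Tpos[OF _ x]] by (intro member_le_sum) simp_all
      finally show ?thesis using C(1) by (simp add: mult_left_mono)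
    qed
    have hi: "\<bar>poly (f x) (\<zeta> x)\<bar> * S x \<le> real (card N)" if x: "x \<in> Y" for x
    proof -
      have "\<bar>poly (f x) (\<zeta> x)\<bar> * S x = (\<Sum>p\<in>N. \<bar>poly (f x) (\<zeta> x)\<bar> / T p x)" by (simp add: S_def sum_distrib_left)
      also have "\<dots> \<le> real (card N) * 1"
        using up x Tpos by (intro sum_bounded_above) simp
      finally show ?thesis by simp
    qed
    define B where "B = max C (real (card N))"
    have B: "0 < B" "C \<le> B" "real (card N) \<le> B" using C(1) by (auto simp: B_def)
    show "tame I Y (\<lambda>x. \<bar>poly (f x) (\<zeta> x)\<bar>)"
    proof (rule tame_comparable[OF tame_inverse[OF tS] _ B(1)])
      fix x assume x: "x \<in> Y"
      have S0: "0 < S x" using tame_pos[OF tS x] .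
      show "0 < \<bar>poly (f x) (\<zeta> x)\<bar>" using nz[OF x] by simp
      show "\<bar>poly (f x) (\<zeta> x)\<bar> \<le> B * (1 / S x)" using hi[OF x] B(3) S0 by (simp add: field_simps)
      have "1 \<le> C * \<bar>poly (f x) (\<zeta> x)\<bar> * S x" by (rule lo[OF x])
      also have "\<dots> \<le> B * \<bar>poly (f x) (\<zeta> x)\<bar> * S x" using B(2) S0 by (intro mult_right_mono) auto
      finally show "1 / S x \<le> B * \<bar>poly (f x) (\<zeta> x)\<bar>" using S0 by (simp add: field_simps)
    qed
  qed
qed

text \<open>
  Beside the nearest root function there is room to go twice as far, since the next one beyond
  \<open>y\<close> is at least as far from \<open>y\<close>.
\<close>

lemma nearest_gap:
  assumes Z: "finite Z" "Z \<noteq> {}" and y: "\<And>\<xi>. \<xi> \<in> Z \<Longrightarrow> \<xi> x \<noteq> y"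
  obtains \<xi> e where "\<xi> \<in> Z" "\<bar>e\<bar> = 1" "gap Z \<xi> e x y" "clear Z \<xi> e x (2 * (e * (y - \<xi> x)))"
proof -
  obtain \<xi> where \<xi>: "\<xi> \<in> Z" "\<And>\<eta>. \<eta> \<in> Z \<Longrightarrow> \<bar>y - \<xi> x\<bar> \<le> \<bar>y - \<eta> x\<bar>"
    using ex_is_arg_min_if_finite[OF Z, of "\<lambda>\<xi>. \<bar>y - \<xi> x\<bar>"] by (auto simp: is_arg_min_linorder)
  define e where "e = sgn (y - \<xi> x)"
  have ne: "y - \<xi> x \<noteq> 0" using y[OF \<xi>(1)] by simp
  then have e: "e = 1 \<and> 0 < y - \<xi> x \<or> e = -1 \<and> y - \<xi> x < 0" by (auto simp: e_def sgn_real_def)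
  have d: "2 * (e * (y - \<xi> x)) \<le> e * (\<eta> x - \<xi> x)" if "\<eta> \<in> Z" "0 < e * (\<eta> x - \<xi> x)" for \<eta>
    using \<xi>(2)[OF that(1)] that(2) e by auto
  have pos: "0 < e * (y - \<xi> x)" using e by auto
  show thesis
  proof (rule that[OF \<xi>(1)])
    show "\<bar>e\<bar> = 1" using e by auto
    show "clear Z \<xi> e x (2 * (e * (y - \<xi> x)))" unfolding clear_def using d by simp
    show "gap Z \<xi> e x y" unfolding gap_def using d pos by fastforce
  qed
qed

section \<open>Adjoining the roots of one polynomial\<close>

text \<open>
  The situation after the recursion has dealt with polynomials of smaller degree: the
  derivatives of \<open>r\<close> are settled and the values of \<open>r\<close> at the root functions are known, but the
  roots of \<open>r\<close> itself are still missing.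
\<close>

locale root_step =
  fixes I :: "'b set" and Y Z r m
  assumes Y: "Y \<noteq> {}" and Z: "sections I Y Z"
    and deg: "\<And>x. x \<in> Y \<Longrightarrow> degree (r x) = Suc m"
    and dr: "settled I Y Z m (\<lambda>x. pderiv (r x))"
    and rZ: "tame_on I Y r Z"
begin

lemma finZ: "finite Z" "Z \<noteq> {}"
  using Z by (auto simp: sections_def)

lemma Z_tame: "\<xi> \<in> Z \<Longrightarrow> \<eta> \<in> Z \<Longrightarrow> signed_tame I Y (\<lambda>x. \<xi> x - \<eta> x)"
  using Z by (simp add: sections_def)

lemma Z_sign: "\<xi> \<in> Z \<Longrightarrow> \<eta> \<in> Z \<Longrightarrow> const_sign Y (\<lambda>x. \<xi> x - \<eta> x)"
  by (rule signed_tame_const_sign[OF Z_tame])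

lemma r_tame: "\<xi> \<in> Z \<Longrightarrow> signed_tame I Y (\<lambda>x. poly (r x) (\<xi> x))"
  using rZ by (simp add: tame_on_def)

lemma dr_nonzero: "x \<in> Y \<Longrightarrow> pderiv (r x) \<noteq> 0"
  using deg by (simp add: pderiv_eq_0_iff)

lemma dr_roots: "roots_in Y (\<lambda>x. pderiv (r x)) Z"
  using settled_roots[OF dr le0] by simp

text \<open>
  Two new roots are always separated by a known root function, a root of the derivative.
\<close>

lemma rolle:
  assumes "x \<in> Y" "poly (r x) y1 = 0" "poly (r x) y2 = 0" "y1 < y2"
  obtains \<xi> where "\<xi> \<in> Z" "y1 < \<xi> x" "\<xi> x < y2"
proof -
  obtain c where c: "y1 < c" "c < y2" "poly (r x) y2 - poly (r x) y1 = (y2 - y1) * poly (pderiv (r x)) c"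
    using poly_MVT[OF assms(4)] by blast
  then have "poly (pderiv (r x)) c = 0" using assms by simp
  with dr_roots dr_nonzero[OF assms(1)] assms(1) obtain \<xi> where "\<xi> \<in> Z" "\<xi> x = c"
    unfolding roots_in_def by metis
  then show thesis using c that by blast
qed

text \<open>
  Since \<open>r\<close> is strictly monotonic in the interval beside \<open>\<xi>\<close>, it has a root there if and only if
  its values at the two ends have opposite signs, or, if the interval is infinite, the value at
  \<open>\<xi>\<close> and the direction of monotonicity do not fit together. These signs do not depend on the
  point of \<open>Y\<close>.
\<close>

lemma gap_root_persists:
  assumes \<xi>: "\<xi> \<in> Z" and e: "\<bar>e\<bar> = 1" and x1: "x1 \<in> Y" and g1: "gap Z \<xi> e x1 y1"
    and root: "poly (r x1) y1 = 0" and x: "x \<in> Y"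
  shows "\<exists>y. gap Z \<xi> e x y \<and> poly (r x) y = 0"
proof -
  have ee: "e * e = 1" by (rule unit_square[OF e])
  have nz: "poly (pderiv (r x)) y \<noteq> 0" if "x \<in> Y" "gap Z \<xi> e x y" for x y
    by (rule gap_nonroot[OF dr_roots that(1) dr_nonzero[OF that(1)] that(2)])
  obtain \<delta> :: real where \<delta>: "\<bar>\<delta>\<bar> = 1" "\<And>x y. x \<in> Y \<Longrightarrow> gap Z \<xi> e x y \<Longrightarrow> 0 < \<delta> * poly (pderiv (r x)) y"
  proof -
    consider "\<forall>x\<in>Y. \<forall>y. gap Z \<xi> e x y \<longrightarrow> 0 < poly (pderiv (r x)) y"
      | "\<forall>x\<in>Y. \<forall>y. gap Z \<xi> e x y \<longrightarrow> poly (pderiv (r x)) y < 0"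
      using gap_sign[OF dr \<xi> e] nz[OF x1 g1] x1 g1 by blast
    then show thesis
    proof cases
      case 1 then show thesis by (intro that[of 1]) auto
    next
      case 2 then show thesis by (intro that[of "-1"]) auto
    qed
  qed
  \<comment> \<open>By the choice of \<open>w\<close>, the function \<open>w * r\<close> increases with the distance from \<open>\<xi>\<close>, over
      every point of \<open>Y\<close>.\<close>
  define w where "w = e * \<delta>"
  have w: "\<bar>w\<bar> = 1" using e \<delta>(1) by (simp add: w_def abs_mult)
  have MVT: "\<exists>c. gap Z \<xi> e x c \<and> s < e * (c - \<xi> x) \<and> e * (c - \<xi> x) < t \<and>
      0 < w * (poly (r x) (\<xi> x + e * t) - poly (r x) (\<xi> x + e * s))"
    if a: "x \<in> Y" "0 \<le> s" "s < t" "clear Z \<xi> e x t" for x s t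
  proof -
    obtain \<sigma> where \<sigma>: "s < \<sigma>" "\<sigma> < t"
      "poly (r x) (\<xi> x + e * t) - poly (r x) (\<xi> x + e * s) = e * (t - s) * poly (pderiv (r x)) (\<xi> x + e * \<sigma>)"
      by (rule poly_MVT_ray[OF a(3) e])
    have g: "gap Z \<xi> e x (\<xi> x + e * \<sigma>)" using \<sigma> a by (intro clear_gap[OF a(4) e]) auto
    have "w * (poly (r x) (\<xi> x + e * t) - poly (r x) (\<xi> x + e * s)) =
        (e * e) * ((t - s) * (\<delta> * poly (pderiv (r x)) (\<xi> x + e * \<sigma>)))"
      unfolding \<sigma>(3) w_def by (simp only: mult_ac)
    also have "\<dots> > 0" unfolding ee using \<delta>(2)[OF a(1) g] a(3) by simp
    finally show ?thesis using g \<sigma>(1,2)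
      by (intro exI[of _ "\<xi> x + e * \<sigma>"] conjI) (simp_all only: unit_cancel(1)[OF e])
  qed
  let ?s1 = "e * (y1 - \<xi> x1)"
  have s1: "0 < ?s1" using g1 by (simp add: gap_def)
  have y1: "\<xi> x1 + e * ?s1 = y1" by (rule unit_cancel(2)[OF e])
  have "w * poly (r x1) (\<xi> x1) < 0"
    using MVT[OF x1 order.refl s1 gap_imp_clear[OF g1]] root by (auto simp: y1)
  then have neg: "w * poly (r x) (\<xi> x) < 0" if "x \<in> Y" for x
    using const_sign_transfer(2)[OF signed_tame_const_sign[OF r_tame[OF \<xi>]] x1 that] by simp
  have "\<exists>t. 0 < t \<and> clear Z \<xi> e x t \<and> 0 < w * poly (r x) (\<xi> x + e * t)"
  proof (cases "\<exists>\<eta>\<in>Z. 0 < e * (\<eta> x1 - \<xi> x1)")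
    case True
    \<comment> \<open>The next root function in the direction \<open>e\<close> is the same one over all of \<open>Y\<close>, since
        differences of root functions have constant signs.\<close>
    define U where "U = {\<eta>\<in>Z. 0 < e * (\<eta> x1 - \<xi> x1)}"
    have "finite U" "U \<noteq> {}" using True finZ by (auto simp: U_def)
    then obtain \<eta> where \<eta>: "\<eta> \<in> U" "\<And>\<eta>'. \<eta>' \<in> U \<Longrightarrow> e * \<eta> x1 \<le> e * \<eta>' x1"
      using ex_is_arg_min_if_finite[of U "\<lambda>\<eta>. e * \<eta> x1"] by (auto simp: is_arg_min_linorder)
    have \<eta>Z: "\<eta> \<in> Z" and \<eta>1: "0 < e * (\<eta> x1 - \<xi> x1)" using \<eta>(1) by (auto simp: U_def)
    have cl: "clear Z \<xi> e x (e * (\<eta> x - \<xi> x))" if x: "x \<in> Y" for x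
      unfolding clear_def
    proof (intro ballI impI)
      fix \<eta>' assume \<eta>': "\<eta>' \<in> Z" "0 < e * (\<eta>' x - \<xi> x)"
      then have "\<eta>' \<in> U"
        using const_sign_transfer(1)[OF Z_sign[OF \<eta>'(1) \<xi>] x x1] by (simp add: U_def)
      then have "\<not> 0 < e * (\<eta> x1 - \<eta>' x1)" using \<eta>(2)[of \<eta>'] by (simp add: right_diff_distrib)
      then have "\<not> 0 < e * (\<eta> x - \<eta>' x)"
        using const_sign_transfer(1)[OF Z_sign[OF \<eta>Z \<eta>'(1)] x x1] by simp
      then show "e * (\<eta> x - \<xi> x) \<le> e * (\<eta>' x - \<xi> x)" by (simp add: right_diff_distrib)
    qed
    have "?s1 < e * (\<eta> x1 - \<xi> x1)" using g1 \<eta>Z \<eta>1 by (auto simp: gap_def)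
    from MVT[OF x1 less_imp_le[OF s1] this cl[OF x1]] have "0 < w * poly (r x1) (\<eta> x1)"
      using root by (auto simp: y1 unit_cancel(2)[OF e])
    then have "0 < w * poly (r x) (\<eta> x)"
      using const_sign_transfer(1)[OF signed_tame_const_sign[OF r_tame[OF \<eta>Z]] x1 x] by simp
    moreover have "0 < e * (\<eta> x - \<xi> x)"
      using const_sign_transfer(1)[OF Z_sign[OF \<eta>Z \<xi>] x x1] \<eta>1 by simp
    ultimately show ?thesis using cl[OF x]
      by (intro exI[of _ "e * (\<eta> x - \<xi> x)"]) (simp add: unit_cancel(2)[OF e])
  next
    case False
    then have cl: "clear Z \<xi> e x t" for t
      unfolding clear_def using const_sign_transfer(1)[OF Z_sign[OF _ \<xi>] x x1] by auto
    obtain a p where rp: "r x = pCons a p" by (cases "r x") auto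
    then have "p \<noteq> 0" using deg[OF x] by auto
    from poly_infinity[OF this, of "\<bar>poly (r x) (\<xi> x)\<bar> + 1" a] obtain R where
      R: "\<And>z. R \<le> \<bar>z\<bar> \<Longrightarrow> \<bar>poly (r x) (\<xi> x)\<bar> + 1 \<le> \<bar>poly (r x) z\<bar>" unfolding rp by auto
    \<comment> \<open>So far out, \<open>\<bar>r\<bar>\<close> exceeds its value at \<open>\<xi>\<close>, so the increasing function \<open>w * r\<close> cannot
        still be negative.\<close>
    define t where "t = \<bar>\<xi> x\<bar> + \<bar>R\<bar> + 1"
    have "\<bar>e * t\<bar> = t" using e by (simp add: abs_mult t_def)
    then have "R \<le> \<bar>\<xi> x + e * t\<bar>" unfolding t_def by linarith
    from R[OF this] have big: "\<bar>w * poly (r x) (\<xi> x)\<bar> + 1 \<le> \<bar>w * poly (r x) (\<xi> x + e * t)\<bar>"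
      using w by (simp add: abs_mult)
    have t0: "0 < t" by (simp add: t_def)
    have "0 < w * poly (r x) (\<xi> x + e * t) - w * poly (r x) (\<xi> x)"
      using MVT[OF x order.refl t0 cl] by (auto simp: right_diff_distrib)
    then have "0 < w * poly (r x) (\<xi> x + e * t)" using big neg[OF x] by linarith
    then show ?thesis using t0 cl by blast
  qed
  then obtain t where t: "0 < t" "clear Z \<xi> e x t" "0 < w * poly (r x) (\<xi> x + e * t)" by blast
  have "(w * w) * (poly (r x) (\<xi> x) * poly (r x) (\<xi> x + e * t)) < 0"
    using mult_neg_pos[OF neg[OF x] t(3)] by (simp only: mult_ac)
  then have "poly (r x) (\<xi> x + e * 0) * poly (r x) (\<xi> x + e * t) < 0" using unit_square[OF w] by simp
  then obtain \<sigma> where "0 < \<sigma>" "\<sigma> < t" "poly (r x) (\<xi> x + e * \<sigma>) = 0"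
    by (rule ray_IVT) (use t in simp)
  then show ?thesis using clear_gap[OF t(2) e] by blast
qed

definition newroot :: "(('b \<Rightarrow> real) \<Rightarrow> real) \<Rightarrow> bool" where
  "newroot \<zeta> \<longleftrightarrow> (\<forall>x\<in>Y. poly (r x) (\<zeta> x) = 0) \<and> (\<exists>\<xi>\<in>Z. \<exists>e. \<bar>e\<bar> = 1 \<and> (\<forall>x\<in>Y. gap Z \<xi> e x (\<zeta> x)))"

lemma newroot_sign:
  assumes "newroot \<zeta>" "\<eta> \<in> Z" shows "const_sign Y (\<lambda>x. \<zeta> x - \<eta> x)" "x \<in> Y \<Longrightarrow> \<zeta> x \<noteq> \<eta> x"
proof -
  obtain \<xi> e where \<xi>: "\<xi> \<in> Z" and e: "\<bar>e\<bar> = 1" and g: "\<And>x. x \<in> Y \<Longrightarrow> gap Z \<xi> e x (\<zeta> x)"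
    using assms(1) unfolding newroot_def by blast
  obtain x0 where x0: "x0 \<in> Y" using Y by blast
  have s: "if 0 < e * (\<eta> x0 - \<xi> x0) then e * (\<zeta> x - \<eta> x) < 0 else 0 < e * (\<zeta> x - \<eta> x)" if x: "x \<in> Y" for x
    using g[OF x] assms(2) const_sign_transfer(1)[OF Z_sign[OF assms(2) \<xi>] x x0, of e]
    by (auto simp: gap_def right_diff_distrib)
  then have "(\<forall>x\<in>Y. e * (\<zeta> x - \<eta> x) < 0) \<or> (\<forall>x\<in>Y. 0 < e * (\<zeta> x - \<eta> x))"
    by (cases "0 < e * (\<eta> x0 - \<xi> x0)") simp_all
  moreover have "e = 1 \<or> e = -1" using e by linarith
  ultimately show "const_sign Y (\<lambda>x. \<zeta> x - \<eta> x)" unfolding const_sign_def by auto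
  show "x \<in> Y \<Longrightarrow> \<zeta> x \<noteq> \<eta> x" using s by (force split: if_splits)
qed

lemma newroot_gap_transfer:
  assumes \<zeta>: "newroot \<zeta>" and \<eta>: "\<eta> \<in> Z" and x0: "x0 \<in> Y" and g: "gap Z \<eta> d x0 (\<zeta> x0)" and x: "x \<in> Y"
  shows "gap Z \<eta> d x (\<zeta> x)"
  unfolding gap_def
proof (intro conjI ballI impI)
  show "0 < d * (\<zeta> x - \<eta> x)"
    using g const_sign_transfer(1)[OF newroot_sign(1)[OF \<zeta> \<eta>] x x0] by (simp add: gap_def)
next
  fix \<eta>' assume \<eta>': "\<eta>' \<in> Z" "0 < d * (\<eta>' x - \<eta> x)"
  then have "0 < d * (\<eta>' x0 - \<eta> x0)" using const_sign_transfer(1)[OF Z_sign[OF \<eta>'(1) \<eta>] x x0] by simp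
  then have "d * (\<zeta> x0 - \<eta>' x0) < 0" using g \<eta>'(1) by (auto simp: gap_def right_diff_distrib)
  then have "d * (\<zeta> x - \<eta>' x) < 0" using const_sign_transfer(2)[OF newroot_sign(1)[OF \<zeta> \<eta>'(1)] x x0] by simp
  then show "d * (\<zeta> x - \<eta> x) < d * (\<eta>' x - \<eta> x)" by (simp add: right_diff_distrib)
qed

text \<open>
  The distance \<open>s\<close> of the new root from its neighbour \<open>\<xi>\<close> satisfies an equation of the form
  treated in \<open>tame_solve\<close>, because \<open>\<bar>r (\<xi>)\<bar>\<close> is comparable to the rest of the Taylor size at
  distance \<open>s\<close>.
\<close>

lemma newroot_distance_tame:
  assumes \<zeta>: "newroot \<zeta>" and \<xi>: "\<xi> \<in> Z" and e: "\<bar>e\<bar> = 1" and g: "\<And>x. x \<in> Y \<Longrightarrow> gap Z \<xi> e x (\<zeta> x)"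
  shows "tame I Y (\<lambda>x. e * (\<zeta> x - \<xi> x))"
proof -
  define s where "s = (\<lambda>x. e * (\<zeta> x - \<xi> x))"
  define u where "u = (\<lambda>k x. \<bar>poly (nth_pderiv k (pderiv (r x))) (\<xi> x)\<bar>)"
  have s: "0 < s x" if "x \<in> Y" for x using g[OF that] by (simp add: gap_def s_def)
  obtain x0 where x0: "x0 \<in> Y" using Y by blast
  obtain C where C: "C > 0" "\<And>r a e s. degree r \<le> Suc m \<Longrightarrow> 0 < s \<Longrightarrow> \<bar>e\<bar> = 1 \<Longrightarrow> zero_free m (pderiv r) a e s \<Longrightarrow>
      poly r (a + e * s) = 0 \<Longrightarrow>
      \<bar>poly r a\<bar> \<le> s * taylor_size m (pderiv r) a s \<and> s * taylor_size m (pderiv r) a s \<le> C * \<bar>poly r a\<bar>"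
    using taylor_size_at_root[of m] by auto
  have st: "s x * taylor_size m (pderiv (r x)) (\<xi> x) (s x) = (\<Sum>k\<le>m. u k x * s x ^ Suc k)" for x
    by (simp add: taylor_size_def sum_distrib_left u_def algebra_simps)
  have bd: "\<bar>poly (r x) (\<xi> x)\<bar> \<le> (\<Sum>k\<le>m. u k x * s x ^ Suc k) \<and> (\<Sum>k\<le>m. u k x * s x ^ Suc k) \<le> C * \<bar>poly (r x) (\<xi> x)\<bar>"
    if x: "x \<in> Y" for x
    unfolding st[symmetric]
  proof (rule C(2)[OF _ s[OF x] e])
    show "degree (r x) \<le> Suc m" using deg x by simp
    have "poly (r x) (\<zeta> x) = 0" using \<zeta> x by (simp add: newroot_def)
    then show "poly (r x) (\<xi> x + e * s x) = 0" by (simp add: s_def unit_cancel(2)[OF e])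
    show "zero_free m (pderiv (r x)) (\<xi> x) e (s x)"
      unfolding s_def by (rule clear_zero_free[OF settled_roots[OF dr] x gap_imp_clear[OF g[OF x]] e])
  qed
  have ut: "signed_tame I Y (\<lambda>x. poly (nth_pderiv k (pderiv (r x))) (\<xi> x))" if "k \<le> m" for k
    by (rule settled_value[OF dr that \<xi>])
  define K where "K = {k. k \<le> m \<and> u k x0 \<noteq> 0}"
  have tu: "tame I Y (u k)" if "k \<in> K" for k
    unfolding u_def using that x0 by (intro signed_tame_abs[OF ut]) (auto simp: K_def u_def)
  have uz: "u k x = 0" if "k \<le> m" "k \<notin> K" "x \<in> Y" for k x
    using const_sign_transfer(3)[OF signed_tame_const_sign[OF ut[OF that(1)]] that(3) x0] that by (simp add: K_def u_def)
  have sumK: "(\<Sum>k\<le>m. u k x * s x ^ Suc k) = (\<Sum>k\<in>K. u k x * s x ^ Suc k)" if "x \<in> Y" for x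
    using uz[OF _ _ that] by (intro sum.mono_neutral_right) (auto simp: K_def)
  \<comment> \<open>The derivative of highest order is a nonzero constant, so at least one summand remains.\<close>
  have "u m x0 \<noteq> 0"
  proof -
    have "degree (nth_pderiv m (pderiv (r x0))) = 0" using deg[OF x0] by (simp add: degree_higher_pderiv degree_pderiv)
    then obtain c where c: "nth_pderiv m (pderiv (r x0)) = [:c:]" by (rule degree_eq_zeroE)
    have "r x0 \<noteq> 0" using deg[OF x0] by auto
    then have "coeff (r x0) (Suc m) \<noteq> 0" using deg[OF x0] leading_coeff_neq_0[of "r x0"] by simp
    then have "coeff (nth_pderiv m (pderiv (r x0))) 0 \<noteq> 0"
      by (simp add: nth_pderiv_pderiv coeff_higher_pderiv pochhammer_eq_0_iff del: funpow.simps)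
    then show ?thesis by (simp add: u_def c)
  qed
  then have mK: "m \<in> K" by (simp add: K_def)
  have r0: "poly (r x) (\<xi> x) \<noteq> 0" if x: "x \<in> Y" for x
  proof
    assume "poly (r x) (\<xi> x) = 0"
    then have "(\<Sum>k\<in>K. u k x * s x ^ Suc k) \<le> 0" using bd[OF x] sumK[OF x] by simp
    moreover have "0 < (\<Sum>k\<in>K. u k x * s x ^ Suc k)"
      using mK s[OF x] tame_pos[OF tu x] by (intro sum_pos) (auto simp: K_def)
    ultimately show False by simp
  qed
  have "tame I Y s"
  proof (rule tame_solve[where K = K and w = u and C = "max C 1" and h = "\<lambda>x. \<bar>poly (r x) (\<xi> x)\<bar>"])
    show "finite K" "K \<noteq> {}" using mK by (auto simp: K_def)
    show "tame I Y (\<lambda>x. \<bar>poly (r x) (\<xi> x)\<bar>)"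
      by (rule signed_tame_abs[where h = "\<lambda>x. poly (r x) (\<xi> x)" and x = x0]) (simp_all only: r_tame[OF \<xi>] x0 r0[OF x0] not_False_eq_True)
    fix x assume x: "x \<in> Y"
    have S0: "0 \<le> (\<Sum>k\<in>K. u k x * s x ^ Suc k)"
      using less_imp_le[OF s[OF x]] by (intro sum_nonneg) (simp add: u_def)
    have "\<bar>poly (r x) (\<xi> x)\<bar> \<le> 1 * (\<Sum>k\<in>K. u k x * s x ^ Suc k)" using bd[OF x] sumK[OF x] by simp
    also have "\<dots> \<le> max C 1 * (\<Sum>k\<in>K. u k x * s x ^ Suc k)" using S0 by (intro mult_right_mono) auto
    finally show "\<bar>poly (r x) (\<xi> x)\<bar> \<le> max C 1 * (\<Sum>k\<in>K. u k x * s x ^ Suc k)" .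
    have "(\<Sum>k\<in>K. u k x * s x ^ Suc k) \<le> C * \<bar>poly (r x) (\<xi> x)\<bar>" using bd[OF x] sumK[OF x] by simp
    also have "\<dots> \<le> max C 1 * \<bar>poly (r x) (\<xi> x)\<bar>" by (intro mult_right_mono) auto
    finally show "(\<Sum>k\<in>K. u k x * s x ^ Suc k) \<le> max C 1 * \<bar>poly (r x) (\<xi> x)\<bar>" .
  qed (use tu s in auto)
  then show ?thesis by (simp add: s_def)
qed

lemma newroot_value:
  assumes \<zeta>: "newroot \<zeta>" and f: "settled I Y Z n f"
  shows "signed_tame I Y (\<lambda>x. poly (f x) (\<zeta> x))"
proof -
  define N where "N = {(\<eta>, d). \<eta> \<in> Z \<and> \<bar>d\<bar> = 1 \<and> (\<forall>x\<in>Y. gap Z \<eta> d x (\<zeta> x))}"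
  have "N \<subseteq> Z \<times> {1, -1}" by (auto simp: N_def)
  then have finN: "finite N" by (rule finite_subset) (simp add: finZ(1))
  have Ne: "N \<noteq> {}" using \<zeta> unfolding newroot_def N_def by auto
  show ?thesis
  proof (rule tame_value[OF f Y finN Ne])
    fix x assume x: "x \<in> Y"
    obtain \<eta> d where n: "\<eta> \<in> Z" "\<bar>d\<bar> = 1" "gap Z \<eta> d x (\<zeta> x)" "clear Z \<eta> d x (2 * (d * (\<zeta> x - \<eta> x)))"
      using nearest_gap[OF finZ, of x "\<zeta> x"] newroot_sign(2)[OF \<zeta> _ x] by metis
    then have "(\<eta>, d) \<in> N" using newroot_gap_transfer[OF \<zeta> n(1) x n(3)] by (simp add: N_def)
    then show "\<exists>(\<xi>, e)\<in>N. clear Z \<xi> e x (2 * (e * (\<zeta> x - \<xi> x)))" using n(4) by blast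
  next
    fix \<xi> e assume "(\<xi>, e) \<in> N"
    then show "tame I Y (\<lambda>x. e * (\<zeta> x - \<xi> x))" using newroot_distance_tame[OF \<zeta>] by (simp add: N_def)
  qed (auto simp: N_def)
qed

text \<open>
  The distance to the neighbouring root function is known to be tame, and the distance from
  there to \<open>\<eta>\<close> is a difference of old root functions pointing in the same direction, so the two
  add up.
\<close>

lemma newroot_old_diff:
  assumes \<zeta>: "newroot \<zeta>" and \<eta>: "\<eta> \<in> Z" and x0: "x0 \<in> Y" and d: "\<bar>d\<bar> = 1" and pos: "0 < d * (\<zeta> x0 - \<eta> x0)"
  shows "tame I Y (\<lambda>x. d * (\<zeta> x - \<eta> x))"
proof -
  define U where "U = {\<nu>\<in>Z. 0 < d * (\<zeta> x0 - \<nu> x0)}"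
  have "finite U" "U \<noteq> {}" using finZ \<eta> pos by (auto simp: U_def)
  \<comment> \<open>\<open>\<mu>\<close> is the root function next to \<open>\<zeta>\<close> on the side of \<open>\<eta>\<close>.\<close>
  then obtain \<mu> where \<mu>: "\<mu> \<in> U" "\<And>\<eta>'. \<eta>' \<in> U \<Longrightarrow> - (d * \<mu> x0) \<le> - (d * \<eta>' x0)"
    using ex_is_arg_min_if_finite[of U "\<lambda>\<mu>. - (d * \<mu> x0)"] by (auto simp: is_arg_min_linorder)
  have \<mu>Z: "\<mu> \<in> Z" using \<mu>(1) by (simp add: U_def)
  have g0: "gap Z \<mu> d x0 (\<zeta> x0)"
    unfolding gap_def
  proof (intro conjI ballI impI)
    show "0 < d * (\<zeta> x0 - \<mu> x0)" using \<mu>(1) by (simp add: U_def)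
    fix \<eta>' assume e': "\<eta>' \<in> Z" "0 < d * (\<eta>' x0 - \<mu> x0)"
    then have "\<eta>' \<notin> U" using \<mu>(2)[of \<eta>'] by (auto simp: right_diff_distrib)
    then have "\<not> 0 < d * (\<zeta> x0 - \<eta>' x0)" using e' by (simp add: U_def)
    moreover have "d * (\<zeta> x0 - \<eta>' x0) \<noteq> 0" using newroot_sign(2)[OF \<zeta> e'(1) x0] d by auto
    ultimately show "d * (\<zeta> x0 - \<mu> x0) < d * (\<eta>' x0 - \<mu> x0)" unfolding right_diff_distrib by linarith
  qed
  have t: "tame I Y (\<lambda>x. d * (\<zeta> x - \<mu> x))"
    by (rule newroot_distance_tame[OF \<zeta> \<mu>Z d newroot_gap_transfer[OF \<zeta> \<mu>Z x0 g0]])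
  show ?thesis
  proof (cases "\<mu> x0 = \<eta> x0")
    case True
    then have "\<mu> x = \<eta> x" if "x \<in> Y" for x
      using const_sign_transfer(3)[OF Z_sign[OF \<mu>Z \<eta>] that x0] by simp
    then show ?thesis by (intro tame_cong[OF t]) simp
  next
    case False
    have "\<eta> \<in> U" using \<eta> pos by (simp add: U_def)
    then have "0 \<le> d * (\<mu> x0 - \<eta> x0)" using \<mu>(2) by (auto simp: right_diff_distrib)
    then have "0 < d * (\<mu> x0 - \<eta> x0)" using False d by (auto simp: order_less_le)
    then have "tame I Y (\<lambda>x. d * (\<mu> x - \<eta> x))" by (rule signed_tame_sgn[OF Z_tame[OF \<mu>Z \<eta>] x0 _ d])
    from tame_add[OF t this] show ?thesis by (rule tame_cong) (simp add: right_diff_distrib)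
  qed
qed

lemma signed_tame_from_sgn:
  assumes "tame I Y (\<lambda>x. d * h x)" "\<bar>d\<bar> = 1" shows "signed_tame I Y h"
proof -
  have "d = 1 \<or> d = -1" using assms(2) by linarith
  then show ?thesis using assms(1) unfolding signed_tame_def by auto
qed

lemma sgn_unit: "(a::real) \<noteq> 0 \<Longrightarrow> \<bar>sgn a\<bar> = 1 \<and> 0 < sgn a * a"
  by (auto simp: sgn_real_def)

lemma newroot_old_signed: "newroot \<zeta> \<Longrightarrow> \<eta> \<in> Z \<Longrightarrow> signed_tame I Y (\<lambda>x. \<zeta> x - \<eta> x)"
proof -
  assume \<zeta>: "newroot \<zeta>" and \<eta>: "\<eta> \<in> Z"
  obtain x0 where x0: "x0 \<in> Y" using Y by blast
  have u: "\<bar>sgn (\<zeta> x0 - \<eta> x0)\<bar> = 1 \<and> 0 < sgn (\<zeta> x0 - \<eta> x0) * (\<zeta> x0 - \<eta> x0)"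
    using newroot_sign(2)[OF \<zeta> \<eta> x0] by (intro sgn_unit) simp
  show ?thesis
    by (rule signed_tame_from_sgn[OF newroot_old_diff[OF \<zeta> \<eta> x0]]) (use u in auto)
qed

text \<open>
  By Rolle's theorem a root function lies between two different new roots, so their distance is
  a sum of two distances treated before.
\<close>

lemma newroot_new_signed:
  assumes \<zeta>1: "newroot \<zeta>1" and \<zeta>2: "newroot \<zeta>2" shows "signed_tame I Y (\<lambda>x. \<zeta>1 x - \<zeta>2 x)"
proof (cases "\<forall>x\<in>Y. \<zeta>1 x = \<zeta>2 x")
  case True
  then show ?thesis by (simp add: signed_tame_def)
next
  case False
  then obtain x0 where x0: "x0 \<in> Y" "\<zeta>1 x0 \<noteq> \<zeta>2 x0" by blast
  have r: "poly (r x0) (\<zeta>1 x0) = 0" "poly (r x0) (\<zeta>2 x0) = 0" using \<zeta>1 \<zeta>2 x0 by (auto simp: newroot_def)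
  define d where "d = sgn (\<zeta>1 x0 - \<zeta>2 x0)"
  have d: "\<bar>d\<bar> = 1" using x0(2) sgn_unit[of "\<zeta>1 x0 - \<zeta>2 x0"] by (simp add: d_def)
  have "\<exists>\<eta>\<in>Z. 0 < d * (\<zeta>1 x0 - \<eta> x0) \<and> 0 < d * (\<eta> x0 - \<zeta>2 x0)"
  proof (cases "\<zeta>1 x0 < \<zeta>2 x0")
    case True
    then obtain \<eta> where "\<eta> \<in> Z" "\<zeta>1 x0 < \<eta> x0" "\<eta> x0 < \<zeta>2 x0" using rolle[OF x0(1) r True] by blast
    then show ?thesis using True by (intro bexI[of _ \<eta>]) (auto simp: d_def)
  next
    case False
    then have lt: "\<zeta>2 x0 < \<zeta>1 x0" using x0 by simp
    then obtain \<eta> where "\<eta> \<in> Z" "\<zeta>2 x0 < \<eta> x0" "\<eta> x0 < \<zeta>1 x0" using rolle[OF x0(1) r(2,1) lt] by blast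
    then show ?thesis using lt by (intro bexI[of _ \<eta>]) (auto simp: d_def)
  qed
  then obtain \<eta> where \<eta>: "\<eta> \<in> Z" "0 < d * (\<zeta>1 x0 - \<eta> x0)" "0 < (- d) * (\<zeta>2 x0 - \<eta> x0)" by (auto simp: right_diff_distrib)
  have "tame I Y (\<lambda>x. d * (\<zeta>1 x - \<eta> x))" by (rule newroot_old_diff[OF \<zeta>1 \<eta>(1) x0(1) d \<eta>(2)])
  moreover have "tame I Y (\<lambda>x. (- d) * (\<zeta>2 x - \<eta> x))" by (rule newroot_old_diff[OF \<zeta>2 \<eta>(1) x0(1) _ \<eta>(3)]) (use d in simp)
  ultimately have "tame I Y (\<lambda>x. d * (\<zeta>1 x - \<eta> x) + (- d) * (\<zeta>2 x - \<eta> x))" by (rule tame_add)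
  then have "tame I Y (\<lambda>x. d * (\<zeta>1 x - \<zeta>2 x))" by (rule tame_cong) (simp add: right_diff_distrib)
  then show ?thesis using d by (rule signed_tame_from_sgn)
qed

text \<open>
  For each root function and each side on which \<open>r\<close> has a root there is one new root function.
  The value of \<open>p\<close> there is the value of its remainder modulo \<open>r\<close>, and that is settled.
\<close>

lemma add_roots:
  assumes \<Psi>: "\<And>p. p \<in> \<Psi> \<Longrightarrow> tame_on I Y p Z \<and> settled I Y Z m (\<lambda>x. p x mod r x)"
  shows "\<exists>Z'. sections I Y Z' \<and> Z \<subseteq> Z' \<and> roots_in Y r Z' \<and> (\<forall>p\<in>\<Psi>. tame_on I Y p Z')"
proof -
  \<comment> \<open>A root over one point of \<open>Y\<close> persists over all of \<open>Y\<close>, by \<open>gap_root_persists\<close>.\<close>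
  define G where "G = {(\<xi>, e). \<xi> \<in> Z \<and> \<bar>e\<bar> = 1 \<and> (\<exists>x\<in>Y. \<exists>y. gap Z \<xi> e x y \<and> poly (r x) y = 0)}"
  define zt where "zt = (\<lambda>(\<xi>, e) x. SOME y. gap Z \<xi> e x y \<and> poly (r x) y = 0)"
  have "G \<subseteq> Z \<times> {1, -1}" by (auto simp: G_def)
  then have finG: "finite G" by (rule finite_subset) (simp add: finZ(1))
  have zt: "gap Z \<xi> e x (zt (\<xi>, e) x) \<and> poly (r x) (zt (\<xi>, e) x) = 0" if "(\<xi>, e) \<in> G" "x \<in> Y" for \<xi> e x
  proof -
    have "\<exists>y. gap Z \<xi> e x y \<and> poly (r x) y = 0" using that gap_root_persists unfolding G_def by blast
    then show ?thesis unfolding zt_def prod.case by (rule someI_ex)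
  qed
  have new: "newroot \<zeta>" if "\<zeta> \<in> zt ` G" for \<zeta>
  proof -
    obtain z where "z \<in> G" "\<zeta> = zt z" using \<open>\<zeta> \<in> zt ` G\<close> by blast
    then obtain \<xi> e where \<xi>e: "(\<xi>, e) \<in> G" "\<zeta> = zt (\<xi>, e)" by (cases z) simp
    moreover have "\<xi> \<in> Z" "\<bar>e\<bar> = 1" using \<xi>e by (auto simp: G_def)
    ultimately show ?thesis unfolding newroot_def using zt by blast
  qed
  let ?Z = "Z \<union> zt ` G"
  have "signed_tame I Y (\<lambda>x. \<xi> x - \<eta> x)" if "\<xi> \<in> ?Z" "\<eta> \<in> ?Z" for \<xi> \<eta>
  proof -
    have "signed_tame I Y (\<lambda>x. \<xi> x - \<eta> x)" if "\<xi> \<in> Z" "newroot \<eta>"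
      by (rule signed_tame_cong[OF signed_tame_uminus[OF newroot_old_signed[OF that(2,1)]]]) simp
    then show ?thesis using that new Z_tame newroot_old_signed newroot_new_signed by blast
  qed
  then have "sections I Y ?Z" using finZ finG by (simp add: sections_def)
  moreover have "roots_in Y r ?Z"
    unfolding roots_in_def
  proof (intro disjI2 ballI conjI allI impI)
    fix x assume x: "x \<in> Y"
    show "r x \<noteq> 0" using deg[OF x] by auto
    fix y assume y: "poly (r x) y = 0"
    show "\<exists>\<xi>\<in>?Z. \<xi> x = y"
    proof (cases "\<exists>\<xi>\<in>Z. \<xi> x = y")
      case False
      then obtain \<xi> e where n: "\<xi> \<in> Z" "\<bar>e\<bar> = 1" "gap Z \<xi> e x y"
        using nearest_gap[OF finZ, of x y] by metis
      then have G: "(\<xi>, e) \<in> G" using x y by (auto simp: G_def)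
      let ?y = "zt (\<xi>, e) x"
      have y': "gap Z \<xi> e x ?y" "poly (r x) ?y = 0" using zt[OF G x] by auto
      have "?y = y"
      proof (rule ccontr)
        assume "?y \<noteq> y"
        then obtain \<eta> where \<eta>: "\<eta> \<in> Z" "min y ?y < \<eta> x" "\<eta> x < max y ?y"
          using rolle[OF x y y'(2)] rolle[OF x y'(2) y] by (cases "y < ?y") (auto simp: min_def max_def)
        have e: "e = 1 \<or> e = -1" using n(2) by linarith
        have "0 < e * (\<eta> x - \<xi> x) \<longrightarrow> e * (y - \<xi> x) < e * (\<eta> x - \<xi> x)" "0 < e * (y - \<xi> x)"
          "0 < e * (\<eta> x - \<xi> x) \<longrightarrow> e * (?y - \<xi> x) < e * (\<eta> x - \<xi> x)" "0 < e * (?y - \<xi> x)"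
          using n(3) y'(1) \<eta>(1) unfolding gap_def by auto
        then show False using e \<eta>(2,3) by auto
      qed
      then show ?thesis using G by blast
    qed blast
  qed
  moreover have "tame_on I Y p ?Z" if p: "p \<in> \<Psi>" for p
    unfolding tame_on_def
  proof
    fix \<xi> assume "\<xi> \<in> ?Z"
    then consider "\<xi> \<in> Z" | "newroot \<xi>" using new by blast
    then show "signed_tame I Y (\<lambda>x. poly (p x) (\<xi> x))"
    proof cases
      case 1
      then show ?thesis using \<Psi>[OF p] by (simp add: tame_on_def)
    next
      case 2
      have "poly (p x) (\<xi> x) = poly (p x mod r x) (\<xi> x)" if "x \<in> Y" for x
      proof -
        have "poly (r x) (\<xi> x) = 0" using 2 that by (simp add: newroot_def)
        then have "poly (p x div r x * r x + p x mod r x) (\<xi> x) = poly (p x mod r x) (\<xi> x)"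
          unfolding poly_add poly_mult by simp
        then show ?thesis by simp
      qed
      then show ?thesis using newroot_value[OF 2, of m "\<lambda>x. p x mod r x"] \<Psi>[OF p]
        by (auto intro: signed_tame_cong)
    qed
  qed
  ultimately show ?thesis by (intro exI[of _ ?Z]) auto
qed

end

section \<open>Root decomposition\<close>

lemma roots_in_mono: "roots_in Y p Z \<Longrightarrow> Z \<subseteq> Z' \<Longrightarrow> roots_in Y p Z'"
  unfolding roots_in_def by blast

text \<open>
  The polynomials whose roots are wanted form a multiset \<open>\<Phi>\<close> of pairs of a degree bound and a
  polynomial. To remove \<open>r\<close> of degree \<open>n\<close> from \<open>\<Phi>\<close>, one asks instead for the roots of the
  derivatives of \<open>r\<close> and of the remainders \<open>p mod r\<close>, \<open>p \<in> \<Psi>\<close>, together with all their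
  derivatives, and adds the roots of \<open>r\<close> afterwards by \<open>add_roots\<close>. All the polynomials that
  replace \<open>r\<close> have smaller degree; so the multiset of degree bounds decreases. The set \<open>\<Psi>\<close> of
  polynomials whose values are wanted is allowed to grow, because an empty \<open>\<Phi>\<close> leaves only a
  sign decomposition of constant terms.
\<close>

theorem root_decomposition:
  assumes "definable I Y" "finite \<Psi>" "\<And>p. p \<in> \<Psi> \<Longrightarrow> \<exists>n. rpoly I Y n p"
    and "\<And>n p. (n, p) \<in># \<Phi> \<Longrightarrow> rpoly I Y n p"
  shows "piecewise I Y (\<lambda>Y'. \<exists>Z. sections I Y' Z \<and> (\<forall>(n, p)\<in>#\<Phi>. roots_in Y' p Z) \<and> (\<forall>p\<in>\<Psi>. tame_on I Y' p Z))"
proof -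
  have "wf (mult {(m, n). m < (n::nat)})" by (intro wf_mult wf)
  then show ?thesis using assms
  proof (induction "image_mset fst \<Phi>" arbitrary: \<Phi> \<Psi> Y rule: wf_induct_rule)
    case less
    show ?case
    proof (cases \<Phi>)
      case empty
      have "piecewise I Y (\<lambda>Y'. \<forall>f\<in>(\<lambda>p x. coeff (p x) 0) ` \<Psi>. const_sign Y' f)"
        using less.prems by (intro piecewise_signs) (auto simp: rpoly_def)
      then show ?thesis
      proof (rule piecewise_mono)
        fix Y' assume Y': "Y' \<subseteq> Y" and s: "\<forall>f\<in>(\<lambda>p x. coeff (p x) 0) ` \<Psi>. const_sign Y' f"
        \<comment> \<open>A set of root functions must not be empty; the zero function serves as its only
            member.\<close>
        have "tame_on I Y' p {\<lambda>_. 0}" if p: "p \<in> \<Psi>" for p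
        proof -
          obtain n where "rpoly I Y' n p" using less.prems(3)[OF p] rpoly_subset[OF _ Y'] by blast
          then have "signed_tame I Y' (\<lambda>x. coeff (p x) 0)"
            using s p by (intro signed_tame_rational) (auto simp: rpoly_def)
          then show ?thesis by (simp add: tame_on_def poly_0_coeff_0)
        qed
        moreover have "sections I Y' {\<lambda>_. 0}" by (simp add: sections_def signed_tame_def)
        ultimately show "\<exists>Z. sections I Y' Z \<and> (\<forall>(n, p)\<in>#\<Phi>. roots_in Y' p Z) \<and> (\<forall>p\<in>\<Psi>. tame_on I Y' p Z)"
          using empty by auto
      qed
    next
      case (add nr \<Phi>0)
      obtain n r where nr: "nr = (n, r)" by force
      have r: "rpoly I Y n r" using less.prems(4) add nr by simp
      have \<Phi>0: "rpoly I Y k p" if "(k, p) \<in># \<Phi>0" for k p using less.prems(4) add that by simp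
      \<comment> \<open>Removing an entry \<open>n\<close>, or replacing it by entries smaller than \<open>n\<close>, decreases a
          multiset of numbers.\<close>
      have drop: "(image_mset fst \<Phi>0, image_mset fst \<Phi>) \<in> mult {(m, n). m < n}"
        using one_step_implies_mult[of "{#n#}" "{#}" "{(m, n). m < (n::nat)}" "image_mset fst \<Phi>0"] add nr by simp
      have repl: "(image_mset fst (\<Phi>0 + \<Delta>), image_mset fst \<Phi>) \<in> mult {(m, n). m < n}"
        if "\<forall>k\<in>#image_mset fst \<Delta>. k < n" for \<Delta> :: "(nat \<times> (('a \<Rightarrow> real) \<Rightarrow> real poly)) multiset"
        using one_step_implies_mult[of "{#n#}" "image_mset fst \<Delta>" "{(m, n). m < (n::nat)}" "image_mset fst \<Phi>0"] that add nr by auto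
      have "piecewise I Y (\<lambda>Y'. const_sign Y' (\<lambda>x. coeff (r x) n))"
        using less.prems(1) r by (intro piecewise_sign) (auto simp: rpoly_def)
      then show ?thesis
      proof (rule piecewise_trans)
        fix Y' assume Y': "definable I Y'" "Y' \<noteq> {}" "Y' \<subseteq> Y" and cs: "const_sign Y' (\<lambda>x. coeff (r x) n)"
        have r': "rpoly I Y' n r" and \<Phi>0': "\<And>k p. (k, p) \<in># \<Phi>0 \<Longrightarrow> rpoly I Y' k p"
          and \<Psi>': "\<And>p. p \<in> \<Psi> \<Longrightarrow> \<exists>k. rpoly I Y' k p"
          using r \<Phi>0 less.prems(3) rpoly_subset[OF _ Y'(3)] by blast+
        let ?goal = "piecewise I Y' (\<lambda>Y'. \<exists>Z. sections I Y' Z \<and> (\<forall>(n, p)\<in>#\<Phi>. roots_in Y' p Z) \<and> (\<forall>p\<in>\<Psi>. tame_on I Y' p Z))"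
        \<comment> \<open>In these two cases the roots of \<open>r\<close> impose no condition on the root functions.\<close>
        have forget: ?goal if c: "(\<forall>x\<in>Y'. r x = 0) \<or> (\<forall>x\<in>Y'. r x \<noteq> 0 \<and> (\<forall>y. poly (r x) y \<noteq> 0))"
        proof -
          have "piecewise I Y' (\<lambda>Y'. \<exists>Z. sections I Y' Z \<and> (\<forall>(n, p)\<in>#\<Phi>0. roots_in Y' p Z) \<and> (\<forall>p\<in>\<Psi>. tame_on I Y' p Z))"
            by (rule less.hyps[OF drop Y'(1) less.prems(2) \<Psi>' \<Phi>0'])
          then show ?thesis
          proof (rule piecewise_mono)
            fix X assume X: "X \<subseteq> Y'" and "\<exists>Z. sections I X Z \<and> (\<forall>(n, p)\<in>#\<Phi>0. roots_in X p Z) \<and> (\<forall>p\<in>\<Psi>. tame_on I X p Z)"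
            moreover have "roots_in X r Z" for Z using c X unfolding roots_in_def by blast
            ultimately show "\<exists>Z. sections I X Z \<and> (\<forall>(n, p)\<in>#\<Phi>. roots_in X p Z) \<and> (\<forall>p\<in>\<Psi>. tame_on I X p Z)"
              using add nr by auto
          qed
        qed
        show ?goal
        proof (cases "\<forall>x\<in>Y'. coeff (r x) n = 0")
          case True
          show ?thesis
          proof (cases n)
            case 0
            have "r x = 0" if "x \<in> Y'" for x
            proof -
              have "degree (r x) = 0" using r' that 0 by (auto simp: rpoly_def)
              then obtain c where "r x = [:c:]" by (rule degree_eq_zeroE)
              then show ?thesis using True that 0 by auto
            qed
            then show ?thesis by (intro forget) simp
          next
            case (Suc k)
            \<comment> \<open>The coefficient of the degree \<open>n\<close> vanishes over \<open>Y'\<close>, so the degree bound of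
                \<open>r\<close> can be lowered.\<close>
            have rk: "rpoly I Y' k r"
              unfolding rpoly_def
            proof (intro conjI ballI)
              fix x assume x: "x \<in> Y'"
              have "degree (r x) \<le> Suc k" using r' x Suc by (simp add: rpoly_def)
              moreover have "degree (r x) \<noteq> Suc k" using True x Suc leading_coeff_neq_0[of "r x"] by (metis degree_0 nat.distinct(1))
              ultimately show "degree (r x) \<le> k" by simp
            qed (use r' in \<open>simp add: rpoly_def\<close>)
            have "piecewise I Y' (\<lambda>Y'. \<exists>Z. sections I Y' Z \<and> (\<forall>(n, p)\<in>#\<Phi>0 + {#(k, r)#}. roots_in Y' p Z) \<and> (\<forall>p\<in>\<Psi>. tame_on I Y' p Z))"
              by (rule less.hyps[OF repl Y'(1) less.prems(2) \<Psi>']) (use Suc \<Phi>0' rk in auto)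
            then show ?thesis by (rule piecewise_mono) (use add nr in auto)
          qed
        next
          case False
          then have lc: "coeff (r x) n \<noteq> 0" if "x \<in> Y'" for x using cs that unfolding const_sign_def by force
          have deg: "degree (r x) = n" if "x \<in> Y'" for x
            using le_degree[OF lc[OF that]] r' that by (auto simp: rpoly_def intro: antisym)
          show ?thesis
          proof (cases n)
            case 0
            have "r x \<noteq> 0 \<and> (\<forall>y. poly (r x) y \<noteq> 0)" if "x \<in> Y'" for x
            proof -
              have "degree (r x) = 0" using deg that 0 by simp
              then obtain c where "r x = [:c:]" by (rule degree_eq_zeroE)
              then show ?thesis using lc[OF that] 0 by auto
            qed
            then show ?thesis by (intro forget) simp
          next
            case (Suc m)
            define \<Theta> where "\<Theta> = (\<lambda>p x. p x mod r x) ` \<Psi> \<union> {\<lambda>x. pderiv (r x)}"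
            define \<Delta> where "\<Delta> = (\<lambda>(f, k) x. nth_pderiv k (f x)) ` (\<Theta> \<times> {..m})"
            have fin: "finite \<Theta>" "finite \<Delta>" using less.prems(2) by (auto simp: \<Theta>_def \<Delta>_def)
            have mod: "rpoly I Y' m (\<lambda>x. p x mod r x)" if "p \<in> \<Psi>" for p
              using \<Psi>'[OF that] rpoly_mod[OF r' deg, of _ p] Suc by auto
            have "rpoly I Y' m (\<lambda>x. pderiv (r x))" using rpoly_nth_pderiv[OF r', of 1] Suc by simp
            then have \<Theta>: "rpoly I Y' m f" if "f \<in> \<Theta>" for f using that mod by (auto simp: \<Theta>_def)
            have \<Delta>: "rpoly I Y' m g" if "g \<in> \<Delta>" for g
            proof -
              obtain z where z: "z \<in> \<Theta> \<times> {..m}" "g = (\<lambda>(f, k) x. nth_pderiv k (f x)) z"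
                using \<open>g \<in> \<Delta>\<close> unfolding \<Delta>_def by blast
              obtain f k where "z = (f, k)" by force
              then show ?thesis using z rpoly_mono[OF rpoly_nth_pderiv[OF \<Theta>, of f k]] by simp
            qed
            define \<Psi>1 where "\<Psi>1 = \<Psi> \<union> {r} \<union> \<Delta>"
            have "piecewise I Y' (\<lambda>Y'. \<exists>Z. sections I Y' Z \<and>
                (\<forall>(n, p)\<in>#\<Phi>0 + image_mset (Pair m) (mset_set \<Delta>). roots_in Y' p Z) \<and> (\<forall>p\<in>\<Psi>1. tame_on I Y' p Z))"
            proof (rule less.hyps[OF repl Y'(1)])
              show "finite \<Psi>1" using less.prems(2) fin by (simp add: \<Psi>1_def)
              show "\<exists>n. rpoly I Y' n p" if "p \<in> \<Psi>1" for p using that \<Psi>' r' \<Delta> unfolding \<Psi>1_def by blast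
            qed (use Suc \<Phi>0' \<Delta> fin in auto)
            then show ?thesis
            proof (rule piecewise_mono)
              fix X assume X: "X \<noteq> {}" "X \<subseteq> Y'" and "\<exists>Z. sections I X Z \<and>
                (\<forall>(n, p)\<in>#\<Phi>0 + image_mset (Pair m) (mset_set \<Delta>). roots_in X p Z) \<and> (\<forall>p\<in>\<Psi>1. tame_on I X p Z)"
              then obtain Z where Z: "sections I X Z" and tm: "\<forall>p\<in>\<Psi>1. tame_on I X p Z"
                and all: "\<forall>(n, p)\<in>#\<Phi>0 + image_mset (Pair m) (mset_set \<Delta>). roots_in X p Z"
                by (elim exE conjE) (rule that)
              have rt: "\<forall>(n, p)\<in>#\<Phi>0. roots_in X p Z" "\<forall>p\<in>\<Delta>. roots_in X p Z"
                using all fin by auto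
              have settled: "settled I X Z m f" if f: "f \<in> \<Theta>" for f
                unfolding settled_def
              proof (intro conjI ballI allI impI)
                show "degree (f x) \<le> m" if "x \<in> X" for x using \<Theta>[OF f] that X(2) by (auto simp: rpoly_def)
                fix k assume "k \<le> m"
                then have "(\<lambda>x. nth_pderiv k (f x)) \<in> \<Delta>" using f unfolding \<Delta>_def by (intro image_eqI[of _ _ "(f, k)"]) auto
                then show "roots_in X (\<lambda>x. nth_pderiv k (f x)) Z" "tame_on I X (\<lambda>x. nth_pderiv k (f x)) Z"
                  using rt(2) tm by (auto simp: \<Psi>1_def)
              qed
              interpret root_step I X Z r m
              proof
                show "degree (r x) = Suc m" if "x \<in> X" for x using deg that X(2) Suc by auto
                show "settled I X Z m (\<lambda>x. pderiv (r x))" by (rule settled) (simp add: \<Theta>_def)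
                show "tame_on I X r Z" using tm by (simp add: \<Psi>1_def)
              qed (use X Z in auto)
              obtain Z' where Z': "sections I X Z'" "Z \<subseteq> Z'" "roots_in X r Z'" "\<forall>p\<in>\<Psi>. tame_on I X p Z'"
                using add_roots[of \<Psi>] settled tm by (auto simp: \<Theta>_def \<Psi>1_def)
              then have "\<forall>(n, p)\<in>#\<Phi>. roots_in X p Z'" using rt(1) roots_in_mono[OF _ Z'(2)] add nr by auto
              then show "\<exists>Z. sections I X Z \<and> (\<forall>(n, p)\<in>#\<Phi>. roots_in X p Z) \<and> (\<forall>p\<in>\<Psi>. tame_on I X p Z)"
                using Z' by blast
            qed
          qed
        qed
      qed
    qed
  qed
qed

section \<open>Half-lines and lines over coarsely conic sets\<close>

lemma coarsely_conic_cong: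
  assumes "coarsely_conic J (u ` B)" "finite J" "\<And>b j. b \<in> B \<Longrightarrow> j \<in> J \<Longrightarrow> v b j = u b j"
  shows "coarsely_conic J (v ` B)"
  by (rule coarsely_conic_PL_image[OF assms(1,2), of "\<lambda>j u. u j"])
    (use assms(3) in \<open>auto intro!: PL_coordinate exI[of _ 0]\<close>)

lemma coarsely_conic_half_line:
  assumes "coarsely_conic J (u ` Y)" "j0 \<in> J"
  shows "coarsely_conic (insert None (Some ` J)) ((\<lambda>(x, \<sigma>). case_option \<sigma> (u x)) ` {(x, \<sigma>). x \<in> Y \<and> \<sigma> \<le> u x j0})"
proof -
  have "(\<lambda>(x, \<sigma>). case_option \<sigma> (u x)) ` {(x, \<sigma>). x \<in> Y \<and> \<sigma> \<le> u x j0} =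
      {case_option \<sigma> x |x \<sigma>. x \<in> u ` Y \<and> \<sigma> \<le> x j0}" by (auto simp: image_iff)
  then show ?thesis using coarsely_conic_below[OF assms] by simp
qed

text \<open>
  The full line is obtained from two half-lines: every \<open>\<sigma>\<close> is a difference of two nonpositive
  numbers, and the difference of two coordinates is a linear map.
\<close>

lemma coarsely_conic_line:
  assumes "coarsely_conic J (u ` Y)" "finite J"
  shows "coarsely_conic (insert None (Some ` J)) ((\<lambda>(x, \<sigma>). case_option \<sigma> (u x)) ` (Y \<times> UNIV))"
proof -
  define u1 where "u1 = (\<lambda>x. case_option (0::real) (u x))"
  let ?J1 = "insert None (Some ` J)"
  have 1: "coarsely_conic ?J1 (u1 ` Y)"
  proof (rule coarsely_conic_PL_image[OF assms(1), of _ "case_option (\<lambda>_. 0) (\<lambda>j v. v j)"])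
    fix k assume "k \<in> ?J1"
    then show "PL J (case_option (\<lambda>_. 0) (\<lambda>j v. v j) k)" by (auto intro: PL_zero PL_coordinate)
    show "\<exists>C. \<forall>b\<in>Y. \<bar>u1 b k - case_option (\<lambda>_. 0) (\<lambda>j v. v j) k (u b)\<bar> \<le> C"
      by (rule exI[of _ 0]) (auto simp: u1_def split: option.split)
  qed (use assms(2) in simp)
  define B2 where "B2 = {(x, \<sigma>). x \<in> Y \<and> \<sigma> \<le> u1 x None}"
  define u2 where "u2 = (\<lambda>(x, \<sigma>::real). case_option \<sigma> (u1 x))"
  let ?J2 = "insert None (Some ` ?J1)"
  have 2: "coarsely_conic ?J2 (u2 ` B2)" unfolding u2_def B2_def
    by (rule coarsely_conic_half_line[OF 1]) simp
  define B3 where "B3 = {(b, \<tau>). b \<in> B2 \<and> \<tau> \<le> u2 b (Some None)}"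
  define u3 where "u3 = (\<lambda>(b, \<tau>::real). case_option \<tau> (u2 b))"
  let ?J3 = "insert None (Some ` ?J2)"
  have 3: "coarsely_conic ?J3 (u3 ` B3)" unfolding u3_def B3_def
    by (rule coarsely_conic_half_line[OF 2]) simp
  define \<Lambda> where "\<Lambda> = (\<lambda>k (v :: 'a option option option \<Rightarrow> real).
      case k of None \<Rightarrow> v (Some None) + (-1) * v None | Some j \<Rightarrow> v (Some (Some (Some j))))"
  define v where "v = (\<lambda>((x, \<sigma>), \<tau>::real). case_option (\<sigma> - \<tau>) (u x))"
  have "coarsely_conic ?J1 (v ` B3)"
  proof (rule coarsely_conic_PL_image[OF 3, of _ \<Lambda>])
    fix k assume "k \<in> ?J1"
    have "PL ?J3 (\<lambda>v. v (Some None) + (-1) * v None)"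
      by (intro PL_add PL_scale PL_coordinate) simp_all
    then show "PL ?J3 (\<Lambda> k)"
      using \<open>k \<in> ?J1\<close> unfolding \<Lambda>_def by (cases k) (simp_all only: option.case, auto intro: PL_coordinate)
    show "\<exists>C. \<forall>b\<in>B3. \<bar>v b k - \<Lambda> k (u3 b)\<bar> \<le> C"
      by (rule exI[of _ 0]) (auto simp: v_def \<Lambda>_def u3_def u2_def u1_def split: option.split)
  qed (use assms(2) in simp)
  moreover have "v ` B3 = (\<lambda>(x, \<sigma>). case_option \<sigma> (u x)) ` (Y \<times> UNIV)"
  proof
    show "v ` B3 \<subseteq> (\<lambda>(x, \<sigma>). case_option \<sigma> (u x)) ` (Y \<times> UNIV)"
      by (auto simp: v_def B3_def B2_def)
    show "(\<lambda>(x, \<sigma>). case_option \<sigma> (u x)) ` (Y \<times> UNIV) \<subseteq> v ` B3"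
    proof clarify
      fix x and \<sigma> :: real assume "x \<in> Y"
      then have "((x, min \<sigma> 0), min (- \<sigma>) 0) \<in> B3" by (auto simp: B3_def B2_def u2_def u1_def)
      moreover have "case_option \<sigma> (u x) = v ((x, min \<sigma> 0), min (- \<sigma>) 0)"
        by (auto simp: v_def min_def)
      ultimately show "case_option \<sigma> (u x) \<in> v ` B3" by blast
    qed
  qed
  ultimately show ?thesis by simp
qed

section \<open>Logarithms of polynomials on definable sets\<close>

text \<open>
  Only polynomials without zeros on \<open>Y\<close> are allowed, as $\ln 0$ has no meaningful value.
\<close>

definition conic_logs :: "'b set \<Rightarrow> ('b \<Rightarrow> real) set \<Rightarrow> bool" where
  "conic_logs I Y \<longleftrightarrow> (\<forall>Q. finite Q \<longrightarrow> Q \<subseteq> polys I \<longrightarrow> (\<forall>q\<in>Q. \<forall>x\<in>Y. q x \<noteq> 0) \<longrightarrow>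
     coarsely_conic Q ((\<lambda>x q. ln \<bar>q x\<bar>) ` Y))"

text \<open>
  The logarithms of tame functions are piecewise linear in logarithms of polynomials, up to
  bounded errors.
\<close>

lemma conic_logs_tame:
  assumes Y: "conic_logs I Y" and K: "finite K" "\<And>k. k \<in> K \<Longrightarrow> tame I Y (h k)"
  shows "coarsely_conic K ((\<lambda>x k. ln (h k x)) ` Y)"
proof -
  have "\<forall>k\<in>K. \<exists>t. finite (fst t) \<and> fst t \<subseteq> polys I \<and> (\<forall>q\<in>fst t. \<forall>x\<in>Y. q x \<noteq> 0) \<and> PL (fst t) (fst (snd t)) \<and>
     (\<forall>x\<in>Y. \<bar>ln (h k x) - fst (snd t) (\<lambda>q. ln \<bar>q x\<bar>)\<bar> \<le> snd (snd t))"
  proof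
    fix k assume "k \<in> K"
    then have "tame I Y (h k)" by (rule K)
    then obtain Q \<Lambda> C where "finite Q" "Q \<subseteq> polys I" "\<forall>q\<in>Q. \<forall>x\<in>Y. q x \<noteq> 0" "PL Q \<Lambda>"
      "\<forall>x\<in>Y. \<bar>ln (h k x) - \<Lambda> (\<lambda>q. ln \<bar>q x\<bar>)\<bar> \<le> C" by (rule tameE)
    then show "\<exists>t. finite (fst t) \<and> fst t \<subseteq> polys I \<and> (\<forall>q\<in>fst t. \<forall>x\<in>Y. q x \<noteq> 0) \<and> PL (fst t) (fst (snd t)) \<and>
     (\<forall>x\<in>Y. \<bar>ln (h k x) - fst (snd t) (\<lambda>q. ln \<bar>q x\<bar>)\<bar> \<le> snd (snd t))"
      by (intro exI[of _ "(Q, \<Lambda>, C)"]) simp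
  qed
  then obtain t where t: "\<forall>k\<in>K. finite (fst (t k)) \<and> fst (t k) \<subseteq> polys I \<and> (\<forall>q\<in>fst (t k). \<forall>x\<in>Y. q x \<noteq> 0) \<and>
     PL (fst (t k)) (fst (snd (t k))) \<and>
     (\<forall>x\<in>Y. \<bar>ln (h k x) - fst (snd (t k)) (\<lambda>q. ln \<bar>q x\<bar>)\<bar> \<le> snd (snd (t k)))"
    by (rule bchoice[THEN exE])
  define Q where "Q = (\<Union>k\<in>K. fst (t k))"
  have Q: "finite Q" "Q \<subseteq> polys I" "\<forall>q\<in>Q. \<forall>x\<in>Y. q x \<noteq> 0" using t K(1) by (auto simp: Q_def)
  have "coarsely_conic Q ((\<lambda>x q. ln \<bar>q x\<bar>) ` Y)" using Y Q unfolding conic_logs_def by simp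
  then show ?thesis
  proof (rule coarsely_conic_PL_image[OF _ K(1), of _ _ _ "\<lambda>k. fst (snd (t k))"])
    fix k assume k: "k \<in> K"
    have "PL (fst (t k)) (fst (snd (t k)))" using t k by simp
    then show "PL Q (fst (snd (t k)))" by (rule PL_mono) (use k in \<open>auto simp: Q_def\<close>)
    show "\<exists>C. \<forall>b\<in>Y. \<bar>ln (h k b) - fst (snd (t k)) (\<lambda>q. ln \<bar>q b\<bar>)\<bar> \<le> C"
      using t k by (intro exI[of _ "snd (snd (t k))"]) simp
  qed
qed

lemma rational_sum: "finite A \<Longrightarrow> (\<And>a. a \<in> A \<Longrightarrow> rational I Y (f a)) \<Longrightarrow> rational I Y (\<lambda>x. \<Sum>a\<in>A. f a x)"
  by (induction A rule: finite_induct) (auto intro: rational_const rational_add)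

lemma polys_insert_as_rpoly:
  assumes "f \<in> polys (insert i I)" "i \<notin> I"
  shows "\<exists>p n. rpoly I UNIV n p \<and> (\<forall>x y. f (x(i := y)) = poly (p x) y)"
  using assms(1)
proof (induction rule: polys.induct)
  case (polys_const c)
  have "rpoly I UNIV 0 (\<lambda>_. [:c:])" by (simp add: rpoly_def rational_const)
  then show ?case by (intro exI[of _ "\<lambda>_. [:c:]"] exI[of _ 0]) simp
next
  case (polys_coord j)
  show ?case
  proof (cases "j = i")
    case True
    have "rpoly I UNIV 1 (\<lambda>_. [:0, 1:])" by (simp add: rpoly_def rational_const)
    then show ?thesis using True by (intro exI[of _ "\<lambda>_. [:0, 1:]"] exI[of _ 1]) simp
  next
    case False
    then have "rational I UNIV (\<lambda>x. coeff [:x j:] k)" for k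
      using polys_coord by (cases k) (auto intro!: rational_const rational_polys polys.polys_coord)
    then have "rpoly I UNIV 0 (\<lambda>x. [:x j:])" by (simp add: rpoly_def)
    then show ?thesis using False by (intro exI[of _ "\<lambda>x. [:x j:]"] exI[of _ 0]) simp
  qed
next
  case (polys_add f g)
  then obtain p n q m where "rpoly I UNIV n p" and fp: "\<forall>x y. f (x(i := y)) = poly (p x) y"
    and "rpoly I UNIV m q" and gq: "\<forall>x y. g (x(i := y)) = poly (q x) y" by blast
  moreover from this have "rpoly I UNIV (max n m) (\<lambda>x. p x + q x)"
    by (auto simp: rpoly_def intro!: rational_add degree_add_le) (meson le_max_iff_disj)+
  ultimately show ?case
    by (intro exI[of _ "\<lambda>x. p x + q x"] exI[of _ "max n m"] conjI) (assumption, simp only: fp gq poly_add simp_thms)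
next
  case (polys_mult f g)
  then obtain p n q m where "rpoly I UNIV n p" and fp: "\<forall>x y. f (x(i := y)) = poly (p x) y"
    and "rpoly I UNIV m q" and gq: "\<forall>x y. g (x(i := y)) = poly (q x) y" by blast
  moreover from this have "rpoly I UNIV (n + m) (\<lambda>x. p x * q x)"
    by (auto simp: rpoly_def coeff_mult intro!: rational_sum rational_mult order.trans[OF degree_mult_le add_mono])
  ultimately show ?case
    by (intro exI[of _ "\<lambda>x. p x * q x"] exI[of _ "n + m"] conjI) (assumption, simp only: fp gq poly_mult simp_thms)
qed

text \<open>
  A definable set is a union of classes of points at which finitely many polynomials have the
  same signs.
\<close>

lemma definable_by_signs:
  assumes "definable I X"
  shows "\<exists>F. finite F \<and> F \<subseteq> polys I \<and> (\<forall>z z'. (\<forall>f\<in>F. sgn (f z) = sgn (f z')) \<longrightarrow> (z \<in> X \<longleftrightarrow> z' \<in> X))"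
  using assms
proof induction
  case (definable_pos f)
  show ?case
  proof (intro exI[of _ "{f}"] conjI allI impI)
    show "{f} \<subseteq> polys I" using definable_pos by simp
    fix z z' assume "\<forall>g\<in>{f}. sgn (g z) = sgn (g z')"
    then have "sgn (f z) = sgn (f z')" by simp
    then show "(z \<in> {z. 0 < f z}) = (z' \<in> {z. 0 < f z})"
      unfolding mem_Collect_eq by (metis sgn_greater)
  qed simp
next
  case (definable_compl A)
  then show ?case by auto
next
  case (definable_Int A B)
  then obtain F G where "finite F" "F \<subseteq> polys I" "\<forall>z z'. (\<forall>f\<in>F. sgn (f z) = sgn (f z')) \<longrightarrow> (z \<in> A \<longleftrightarrow> z' \<in> A)"
    "finite G" "G \<subseteq> polys I" "\<forall>z z'. (\<forall>f\<in>G. sgn (f z) = sgn (f z')) \<longrightarrow> (z \<in> B \<longleftrightarrow> z' \<in> B)" by blast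
  then show ?case by (intro exI[of _ "F \<union> G"]) (simp, blast)
qed

lemma ln_sum_near_Max:
  assumes "finite K" "K \<noteq> {}" "\<And>k. k \<in> K \<Longrightarrow> (0::real) < a k"
  shows "Max ((\<lambda>k. ln (a k)) ` K) \<le> ln (sum a K)" "ln (sum a K) \<le> Max ((\<lambda>k. ln (a k)) ` K) + ln (real (card K))"
proof -
  let ?M = "Max ((\<lambda>k. ln (a k)) ` K)"
  have "?M \<in> (\<lambda>k. ln (a k)) ` K" using assms by (intro Max_in) auto
  then obtain k where k: "k \<in> K" "?M = ln (a k)" by auto
  have c: "0 < real (card K)" using assms by (simp add: card_gt_0_iff)
  have "a k \<le> sum a K" using assms(1,3) k(1) by (intro member_le_sum) (auto intro: less_imp_le)
  then show "?M \<le> ln (sum a K)" using assms(3)[OF k(1)] by (simp add: k(2))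
  have "a j \<le> exp ?M" if "j \<in> K" for j
  proof -
    have "ln (a j) \<le> ?M" using assms(1) that by (intro Max_ge) auto
    then show ?thesis using assms(3)[OF that] by (metis exp_le_cancel_iff exp_ln)
  qed
  then have "sum a K \<le> real (card K) * exp ?M" by (intro sum_bounded_above) auto
  moreover have "0 < sum a K" using assms by (intro sum_pos) auto
  ultimately have "ln (sum a K) \<le> ln (real (card K) * exp ?M)" by simp
  also have "\<dots> = ?M + ln (real (card K))" using c by (simp add: ln_mult)
  finally show "ln (sum a K) \<le> ?M + ln (real (card K))" .
qed

text \<open>
  For \<open>e = 0\<close> the graph of \<open>\<xi>\<close>; for \<open>e = 1\<close> and \<open>e = -1\<close> the points in the strip beside \<open>\<xi>\<close> in
  this direction, up to half its width. The factor 2 leaves the room that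
  \<open>taylor_size_le_abs_poly\<close> asks for.
\<close>

definition cell where
  "cell Y Z \<xi> e = (if e = 0 then {(x, \<xi> x) |x. x \<in> Y}
     else {(x, y). x \<in> Y \<and> 0 < e * (y - \<xi> x) \<and> clear Z \<xi> e x (2 * (e * (y - \<xi> x)))})"

lemma cell_gap: "(x, y) \<in> cell Y Z \<xi> e \<Longrightarrow> e \<noteq> 0 \<Longrightarrow> gap Z \<xi> e x y"
  unfolding cell_def gap_def clear_def by fastforce

lemma cells_cover:
  assumes "finite Z" "Z \<noteq> {}" "x \<in> Y"
  shows "\<exists>\<xi>\<in>Z. \<exists>e\<in>{0, 1, -1}. (x, y) \<in> cell Y Z \<xi> e"
proof (cases "\<exists>\<xi>\<in>Z. \<xi> x = y")
  case True
  then show ?thesis using assms(3) by (force simp: cell_def)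
next
  case False
  then obtain \<xi> e where n: "\<xi> \<in> Z" "\<bar>e\<bar> = 1" "gap Z \<xi> e x y" "clear Z \<xi> e x (2 * (e * (y - \<xi> x)))"
    using nearest_gap[OF assms(1,2), of x y] by metis
  then have "e \<noteq> 0" "e \<in> {0, 1, -1}" by auto
  then show ?thesis using n assms(3) by (intro bexI[OF _ n(1)] bexI[of _ e]) (auto simp: cell_def gap_def)
qed

lemma cell_sign:
  assumes f: "settled I Y Z n f" and \<xi>: "\<xi> \<in> Z" and e: "e \<in> {0, 1, -1}"
    and "(x, y) \<in> cell Y Z \<xi> e" "(x', y') \<in> cell Y Z \<xi> e"
  shows "sgn (poly (f x) y) = sgn (poly (f x') y')"
proof (cases "e = 0")
  case True
  have "const_sign Y (\<lambda>x. poly (nth_pderiv 0 (f x)) (\<xi> x))"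
    by (rule signed_tame_const_sign[OF settled_value[OF f _ \<xi>]]) simp
  then have "const_sign Y (\<lambda>x. poly (f x) (\<xi> x))" by simp
  moreover have "x \<in> Y" "x' \<in> Y" "y = \<xi> x" "y' = \<xi> x'" using assms(4,5) True by (auto simp: cell_def)
  ultimately show ?thesis unfolding const_sign_def by auto
next
  case False
  have "x \<in> Y" "x' \<in> Y" using assms(4,5) False by (auto simp: cell_def)
  moreover have "\<bar>e\<bar> = 1" using e False by auto
  note gap_sign[OF f \<xi> this]
  ultimately show ?thesis using cell_gap[OF assms(4) False] cell_gap[OF assms(5) False] by (elim disjE) auto
qed

text \<open>
  On a strip the logarithm \<open>\<sigma>\<close> of the distance from \<open>\<xi>\<close> is a new coordinate that runs over a
  half-line, or over the whole line if no root function bounds the strip. The logarithms of the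
  polynomials are, up to bounded errors, maxima of $\ln |\partial^k q(\xi)| + k \sigma$, and the
  cell is coarsely conic as a piecewise linear image.
\<close>

lemma conic_cell:
  assumes Y: "conic_logs I Y" "Y \<noteq> {}" and Z: "sections I Y Z" and \<xi>: "\<xi> \<in> Z" and e: "e \<in> {0, 1, -1}"
    and Q: "finite Q" "\<And>q. q \<in> Q \<Longrightarrow> settled I Y Z n (p q)"
    and nz: "\<And>q x y. q \<in> Q \<Longrightarrow> (x, y) \<in> cell Y Z \<xi> e \<Longrightarrow> poly (p q x) y \<noteq> 0"
  shows "coarsely_conic Q ((\<lambda>(x, y) q. ln \<bar>poly (p q x) y\<bar>) ` cell Y Z \<xi> e)"
proof (cases "e = 0")
  case True
  obtain x0 where x0: "x0 \<in> Y" using Y(2) by blast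
  have "tame I Y (\<lambda>x. \<bar>poly (p q x) (\<xi> x)\<bar>)" if q: "q \<in> Q" for q
  proof (rule signed_tame_abs[where h = "\<lambda>x. poly (p q x) (\<xi> x)" and x = x0])
    show "signed_tame I Y (\<lambda>x. poly (p q x) (\<xi> x))" using settled_value[OF Q(2)[OF q] le0 \<xi>] by simp
    show "poly (p q x0) (\<xi> x0) \<noteq> 0" using nz[OF q, of x0 "\<xi> x0"] x0 True by (simp add: cell_def)
  qed (rule x0)
  then have "coarsely_conic Q ((\<lambda>x q. ln \<bar>poly (p q x) (\<xi> x)\<bar>) ` Y)"
    by (rule conic_logs_tame[OF Y(1) Q(1), of "\<lambda>q x. \<bar>poly (p q x) (\<xi> x)\<bar>"])
  moreover have "(\<lambda>(x, y) q. ln \<bar>poly (p q x) y\<bar>) ` cell Y Z \<xi> e = (\<lambda>x q. ln \<bar>poly (p q x) (\<xi> x)\<bar>) ` Y"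
    unfolding cell_def using True by (auto simp: image_iff)
  ultimately show ?thesis by simp
next
  case False
  then have e1: "\<bar>e\<bar> = 1" using e by auto
  have finZ: "finite Z" using Z by (simp add: sections_def)
  have Zst: "signed_tame I Y (\<lambda>x. \<eta> x - \<xi> x)" if "\<eta> \<in> Z" for \<eta> using Z \<xi> that by (simp add: sections_def)
  obtain x0 where x0: "x0 \<in> Y" using Y(2) by blast
  define U where "U = {\<eta>\<in>Z. 0 < e * (\<eta> x0 - \<xi> x0)}"
  have U: "\<eta> \<in> U \<longleftrightarrow> 0 < e * (\<eta> x - \<xi> x)" if "\<eta> \<in> Z" "x \<in> Y" for \<eta> x
    using const_sign_transfer(1)[OF signed_tame_const_sign[OF Zst[OF that(1)]] that(2) x0] that(1) by (simp add: U_def)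
  \<comment> \<open>The function \<open>\<eta>\<close> is the next root function in the direction \<open>e\<close>, if there is one.\<close>
  have "\<exists>\<eta>. U \<noteq> {} \<longrightarrow> \<eta> \<in> U \<and> (\<forall>\<eta>'\<in>U. \<forall>x\<in>Y. e * (\<eta> x - \<xi> x) \<le> e * (\<eta>' x - \<xi> x))"
  proof (cases "U = {}")
    case False
    have "finite U" using finZ by (simp add: U_def)
    then obtain \<eta> where \<eta>: "\<eta> \<in> U" "\<And>\<eta>'. \<eta>' \<in> U \<Longrightarrow> e * \<eta> x0 \<le> e * \<eta>' x0"
      using ex_is_arg_min_if_finite[of U "\<lambda>\<eta>. e * \<eta> x0"] False by (auto simp: is_arg_min_linorder)
    have "e * (\<eta> x - \<xi> x) \<le> e * (\<eta>' x - \<xi> x)" if "\<eta>' \<in> U" "x \<in> Y" for \<eta>' x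
    proof -
      have "\<eta> \<in> Z" "\<eta>' \<in> Z" using \<eta>(1) that by (auto simp: U_def)
      then have "const_sign Y (\<lambda>x. \<eta> x - \<eta>' x)"
        using Z by (intro signed_tame_const_sign[of I]) (simp add: sections_def)
      from const_sign_transfer(1)[OF this that(2) x0, of e] \<eta>(2)[OF that(1)]
      show ?thesis by (simp add: right_diff_distrib)
    qed
    then show ?thesis using \<eta>(1) by blast
  qed simp
  then obtain \<eta> where \<eta>: "U \<noteq> {} \<Longrightarrow> \<eta> \<in> U" "\<And>\<eta>' x. \<eta>' \<in> U \<Longrightarrow> x \<in> Y \<Longrightarrow> e * (\<eta> x - \<xi> x) \<le> e * (\<eta>' x - \<xi> x)"
    by (metis empty_iff)
  \<comment> \<open>Without a next root function there is no bound; the value 1 only keeps \<open>\<rho>\<close> tame.\<close>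
  define \<rho> where "\<rho> = (\<lambda>x. if U = {} then 1 else e * (\<eta> x - \<xi> x) / 2)"
  have t\<rho>: "tame I Y \<rho>"
  proof (cases "U = {}")
    case True
    then show ?thesis unfolding \<rho>_def by (simp add: tame_const)
  next
    case False
    then have "\<eta> \<in> Z" "0 < e * (\<eta> x0 - \<xi> x0)" using \<eta>(1) by (auto simp: U_def)
    then have "tame I Y (\<lambda>x. e * (\<eta> x - \<xi> x))" by (intro signed_tame_sgn[OF Zst x0 _ e1])
    from tame_divide[OF this tame_const[of 2]] show ?thesis unfolding \<rho>_def using False by simp
  qed
  have clearU: "clear Z \<xi> e x (2 * s) \<longleftrightarrow> (U = {} \<or> s \<le> \<rho> x)" if x: "x \<in> Y" for x s
  proof (cases "U = {}")
    case True
    then show ?thesis using U[OF _ x] by (auto simp: clear_def)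
  next
    case False
    have "clear Z \<xi> e x (2 * s) \<longleftrightarrow> (\<forall>\<eta>'\<in>U. 2 * s \<le> e * (\<eta>' x - \<xi> x))"
      unfolding clear_def using U[OF _ x] by (auto simp: U_def)
    also have "\<dots> \<longleftrightarrow> 2 * s \<le> e * (\<eta> x - \<xi> x)" using \<eta>(1)[OF False] \<eta>(2)[OF _ x] by force
    finally show ?thesis using False by (simp add: \<rho>_def mult.commute[of s])
  qed
  define w where "w = (\<lambda>(q, k) x. \<bar>poly (nth_pderiv k (p q x)) (\<xi> x)\<bar>)"
  define K where "K = {(q, k). q \<in> Q \<and> k \<le> n \<and> w (q, k) x0 \<noteq> 0}"
  have finK: "finite K"
    by (rule finite_subset[of _ "Q \<times> {..n}"]) (use Q(1) in \<open>auto simp: K_def\<close>)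
  have st: "signed_tame I Y (\<lambda>x. poly (nth_pderiv k (p q x)) (\<xi> x))" if "q \<in> Q" "k \<le> n" for q k
    by (rule settled_value[OF Q(2)[OF that(1)] that(2) \<xi>])
  have tw: "tame I Y (w qk)" if "qk \<in> K" for qk
  proof -
    obtain q k where qk: "qk = (q, k)" by force
    show ?thesis unfolding qk w_def prod.case
      by (rule signed_tame_abs[where h = "\<lambda>x. poly (nth_pderiv k (p q x)) (\<xi> x)" and x = x0])
        (use that st x0 in \<open>auto simp: K_def qk w_def\<close>)
  qed
  have w0: "w (q, k) x = 0" if "q \<in> Q" "k \<le> n" "(q, k) \<notin> K" "x \<in> Y" for q k x
    using const_sign_transfer(3)[OF signed_tame_const_sign[OF st[OF that(1,2)]] that(4) x0] that
    by (simp add: K_def w_def)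
  define J where "J = insert None (Some ` K)"
  define u where "u = (\<lambda>x. case_option (ln (\<rho> x)) (\<lambda>qk. ln (w qk x)))"
  have cu0: "coarsely_conic J ((\<lambda>x k. ln (case_option \<rho> w k x)) ` Y)"
    by (rule conic_logs_tame[OF Y(1)]) (use finK t\<rho> tw in \<open>auto simp: J_def\<close>)
  have u_eq: "u = (\<lambda>x k. ln (case_option \<rho> w k x))" by (auto simp: u_def fun_eq_iff split: option.split)
  have cu: "coarsely_conic J (u ` Y)" unfolding u_eq by (rule cu0)
  define P where "P = {(x, \<sigma>). x \<in> Y \<and> (U = {} \<or> \<sigma> \<le> ln (\<rho> x))}"
  have cP: "coarsely_conic (insert None (Some ` J)) ((\<lambda>(x, \<sigma>). case_option \<sigma> (u x)) ` P)"
  proof (cases "U = {}")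
    case True
    then have "P = Y \<times> UNIV" by (auto simp: P_def)
    then show ?thesis using coarsely_conic_line[OF cu] finK by (simp add: J_def)
  next
    case False
    then have "P = {(x, \<sigma>). x \<in> Y \<and> \<sigma> \<le> u x None}" by (auto simp: P_def u_def)
    then show ?thesis using coarsely_conic_half_line[OF cu, of None] by (simp add: J_def)
  qed
  have cellP: "cell Y Z \<xi> e = (\<lambda>(x, \<sigma>). (x, \<xi> x + e * exp \<sigma>)) ` P"
  proof
    show "cell Y Z \<xi> e \<subseteq> (\<lambda>(x, \<sigma>). (x, \<xi> x + e * exp \<sigma>)) ` P"
    proof clarify
      fix x y assume "(x, y) \<in> cell Y Z \<xi> e"
      then have c: "x \<in> Y" "0 < e * (y - \<xi> x)" "clear Z \<xi> e x (2 * (e * (y - \<xi> x)))"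
        using False by (auto simp: cell_def)
      have "(x, ln (e * (y - \<xi> x))) \<in> P"
        using c clearU[OF c(1)] tame_pos[OF t\<rho> c(1)] by (auto simp: P_def)
      moreover have "(x, y) = (\<lambda>(x, \<sigma>). (x, \<xi> x + e * exp \<sigma>)) (x, ln (e * (y - \<xi> x)))"
        using c(2) by (simp add: unit_cancel(2)[OF e1])
      ultimately show "(x, y) \<in> (\<lambda>(x, \<sigma>). (x, \<xi> x + e * exp \<sigma>)) ` P" by (rule rev_image_eqI)
    qed
    show "(\<lambda>(x, \<sigma>). (x, \<xi> x + e * exp \<sigma>)) ` P \<subseteq> cell Y Z \<xi> e"
    proof clarify
      fix x \<sigma> assume p: "(x, \<sigma>) \<in> P"
      then have x: "x \<in> Y" by (simp add: P_def)
      have "exp \<sigma> \<le> \<rho> x \<longleftrightarrow> \<sigma> \<le> ln (\<rho> x)" using tame_pos[OF t\<rho> x] by (simp add: ln_ge_iff)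
      then have cl: "clear Z \<xi> e x (2 * exp \<sigma>)" using p clearU[OF x] by (auto simp: P_def)
      show "(x, \<xi> x + e * exp \<sigma>) \<in> cell Y Z \<xi> e"
        unfolding cell_def if_not_P[OF False] mem_Collect_eq prod.case unit_cancel(1)[OF e1]
        using x cl by simp
    qed
  qed
  show ?thesis
  proof (cases "cell Y Z \<xi> e = {}")
    case True
    then show ?thesis by (simp add: coarsely_conic_empty)
  next
    case nonempty: False
    define Kq where "Kq = (\<lambda>q. {k. (q, k) \<in> K})"
    have finKq: "finite (Kq q)" for q
      by (rule finite_subset[of _ "snd ` K"]) (use finK in \<open>force simp: Kq_def image_iff\<close>)+
    define \<Lambda> where "\<Lambda> = (\<lambda>q (t :: _ option option \<Rightarrow> real). Max ((\<lambda>k. t (Some (Some (q, k))) + real k * t None) ` Kq q))"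
    obtain C where C: "C > 0" "\<And>f a e s. degree f \<le> n \<Longrightarrow> 0 < s \<Longrightarrow> \<bar>e\<bar> = 1 \<Longrightarrow> zero_free n f a e (2 * s) \<Longrightarrow>
      taylor_size n f a s \<le> C * \<bar>poly f (a + e * s)\<bar>" using taylor_size_le_abs_poly[of 2 n] by auto
    have size: "taylor_size n (p q x) (\<xi> x) (exp \<sigma>) = (\<Sum>k\<in>Kq q. w (q, k) x * exp \<sigma> ^ k)"
      if "q \<in> Q" "x \<in> Y" for q x \<sigma>
    proof -
      have "taylor_size n (p q x) (\<xi> x) (exp \<sigma>) = (\<Sum>k\<le>n. w (q, k) x * exp \<sigma> ^ k)"
        by (simp add: taylor_size_def w_def)
      also have "\<dots> = (\<Sum>k\<in>Kq q. w (q, k) x * exp \<sigma> ^ k)"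
        using w0[OF that(1) _ _ that(2)] by (intro sum.mono_neutral_right) (auto simp: Kq_def K_def)
      finally show ?thesis .
    qed
    have val: "\<bar>poly (p q x) (\<xi> x + e * exp \<sigma>)\<bar> \<le> taylor_size n (p q x) (\<xi> x) (exp \<sigma>)"
      "taylor_size n (p q x) (\<xi> x) (exp \<sigma>) \<le> C * \<bar>poly (p q x) (\<xi> x + e * exp \<sigma>)\<bar>"
      "poly (p q x) (\<xi> x + e * exp \<sigma>) \<noteq> 0"
      if q: "q \<in> Q" and P: "(x, \<sigma>) \<in> P" for q x \<sigma>
    proof -
      have c: "(x, \<xi> x + e * exp \<sigma>) \<in> cell Y Z \<xi> e" using P unfolding cellP by force
      then have x: "x \<in> Y" and cl: "clear Z \<xi> e x (2 * exp \<sigma>)"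
        unfolding cell_def if_not_P[OF False] mem_Collect_eq prod.case unit_cancel(1)[OF e1] by simp_all
      show "poly (p q x) (\<xi> x + e * exp \<sigma>) \<noteq> 0" by (rule nz[OF q c])
      have d: "degree (p q x) \<le> n" by (rule settled_degree[OF Q(2)[OF q] x])
      show "\<bar>poly (p q x) (\<xi> x + e * exp \<sigma>)\<bar> \<le> taylor_size n (p q x) (\<xi> x) (exp \<sigma>)"
        by (rule abs_poly_le_taylor_size[OF d _ e1]) simp
      show "taylor_size n (p q x) (\<xi> x) (exp \<sigma>) \<le> C * \<bar>poly (p q x) (\<xi> x + e * exp \<sigma>)\<bar>"
        by (rule C(2)[OF d _ e1 clear_zero_free[OF settled_roots[OF Q(2)[OF q]] x cl e1]]) simp_all
    qed
    \<comment> \<open>So the maximum in \<open>\<Lambda>\<close> is not over the empty set: the cell contains no zero of \<open>q\<close>.\<close>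
    have Kne: "Kq q \<noteq> {}" if q: "q \<in> Q" for q
    proof
      assume em: "Kq q = {}"
      obtain x \<sigma> where P: "(x, \<sigma>) \<in> P" using nonempty unfolding cellP by auto
      then have "taylor_size n (p q x) (\<xi> x) (exp \<sigma>) = 0" using size[OF q, of x \<sigma>] em by (simp add: P_def)
      then show False using val[OF q P] by simp
    qed
    have "coarsely_conic Q ((\<lambda>(x, \<sigma>) q. ln \<bar>poly (p q x) (\<xi> x + e * exp \<sigma>)\<bar>) ` P)"
    proof (rule coarsely_conic_PL_image[OF cP Q(1), of \<Lambda>])
      fix q assume q: "q \<in> Q"
      show "PL (insert None (Some ` J)) (\<Lambda> q)"
        unfolding \<Lambda>_def using Kne[OF q] finKq
        by (intro PL_Max PL_add PL_scale PL_coordinate) (auto simp: J_def Kq_def)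
      have "\<bar>ln \<bar>poly (p q x) (\<xi> x + e * exp \<sigma>)\<bar> - \<Lambda> q (case_option \<sigma> (u x))\<bar> \<le> \<bar>ln C\<bar> + ln (real (card (Kq q)))"
        if P: "(x, \<sigma>) \<in> P" for x \<sigma>
      proof -
        have x: "x \<in> Y" using P by (simp add: P_def)
        let ?a = "\<lambda>k. w (q, k) x * exp \<sigma> ^ k"
        let ?v = "\<bar>poly (p q x) (\<xi> x + e * exp \<sigma>)\<bar>"
        have wp: "0 < w (q, k) x" if "k \<in> Kq q" for k using tame_pos[OF tw x] that by (simp add: Kq_def)
        have "ln (?a k) = u x (Some (q, k)) + real k * \<sigma>" if "k \<in> Kq q" for k
          using wp[OF that] by (simp add: ln_mult u_def exp_of_nat_mult[symmetric])
        then have "(\<lambda>k. ln (?a k)) ` Kq q = (\<lambda>k. u x (Some (q, k)) + real k * \<sigma>) ` Kq q" by (intro image_cong) auto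
        then have \<Lambda>: "\<Lambda> q (case_option \<sigma> (u x)) = Max ((\<lambda>k. ln (?a k)) ` Kq q)" by (simp add: \<Lambda>_def)
        have v: "0 < ?v" "?v \<le> sum ?a (Kq q)" "sum ?a (Kq q) \<le> C * ?v"
          using val[OF q P] size[OF q x] by auto
        have "ln ?v \<le> ln (sum ?a (Kq q))" "ln (sum ?a (Kq q)) \<le> ln (C * ?v)" using v by (simp_all add: less_le_trans)
        moreover have "ln (C * ?v) = ln C + ln ?v" using v(1) C(1) by (simp add: ln_mult)
        moreover have "Max ((\<lambda>k. ln (?a k)) ` Kq q) \<le> ln (sum ?a (Kq q))"
          "ln (sum ?a (Kq q)) \<le> Max ((\<lambda>k. ln (?a k)) ` Kq q) + ln (real (card (Kq q)))"
          using ln_sum_near_Max[OF finKq Kne[OF q], of ?a] wp by simp_all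
        moreover have "0 \<le> ln (real (card (Kq q)))"
          using finKq[of q] Kne[OF q] by (intro ln_ge_zero) (simp add: Suc_le_eq card_gt_0_iff)
        ultimately show ?thesis unfolding \<Lambda> by linarith
      qed
      then show "\<exists>C. \<forall>b\<in>P. \<bar>(case b of (x, \<sigma>) \<Rightarrow> \<lambda>q. ln \<bar>poly (p q x) (\<xi> x + e * exp \<sigma>)\<bar>) q
          - \<Lambda> q (case b of (x, \<sigma>) \<Rightarrow> case_option \<sigma> (u x))\<bar> \<le> C" by (intro exI[of _ "\<bar>ln C\<bar> + ln (real (card (Kq q)))"]) auto
    qed
    moreover have "(\<lambda>(x, y) q. ln \<bar>poly (p q x) y\<bar>) ` cell Y Z \<xi> e = (\<lambda>(x, \<sigma>) q. ln \<bar>poly (p q x) (\<xi> x + e * exp \<sigma>)\<bar>) ` P"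
      unfolding cellP image_image by (simp add: case_prod_beta)
    ultimately show ?thesis by simp
  qed
qed

text \<open>
  The signs of the polynomials that define \<open>X\<close> are constant on cells, so \<open>X\<close> is a finite union
  of cells.
\<close>

lemma conic_logs_insert:
  assumes IH: "\<And>Y. definable I Y \<Longrightarrow> conic_logs I Y" and i: "i \<notin> I" and X: "definable (insert i I) X"
  shows "conic_logs (insert i I) X"
  unfolding conic_logs_def
proof (intro allI impI)
  fix Q assume Q: "finite Q" "Q \<subseteq> polys (insert i I)" "\<forall>q\<in>Q. \<forall>x\<in>X. q x \<noteq> 0"
  obtain F where F: "finite F" "F \<subseteq> polys (insert i I)"
    "\<And>z z'. \<forall>f\<in>F. sgn (f z) = sgn (f z') \<Longrightarrow> (z \<in> X \<longleftrightarrow> z' \<in> X)"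
    using definable_by_signs[OF X] by metis
  have "\<forall>f\<in>F \<union> Q. \<exists>p. \<exists>n. rpoly I UNIV n p \<and> (\<forall>x y. f (x(i := y)) = poly (p x) y)"
  proof
    fix f assume "f \<in> F \<union> Q"
    then have "f \<in> polys (insert i I)" using F(2) Q(2) by auto
    then show "\<exists>p. \<exists>n. rpoly I UNIV n p \<and> (\<forall>x y. f (x(i := y)) = poly (p x) y)"
      by (rule polys_insert_as_rpoly[OF _ i])
  qed
  then obtain p where "\<forall>f\<in>F \<union> Q. \<exists>n. rpoly I UNIV n (p f) \<and> (\<forall>x y. f (x(i := y)) = poly (p f x) y)"
    by (rule bchoice[THEN exE])
  then have "\<forall>f\<in>F \<union> Q. \<exists>n. rpoly I UNIV n (p f)" and p: "\<And>f x y. f \<in> F \<union> Q \<Longrightarrow> f (x(i := y)) = poly (p f x) y"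
    by auto
  then obtain nn where nn: "\<forall>f\<in>F \<union> Q. rpoly I UNIV (nn f) (p f)" by (metis (no_types, lifting))
  define n where "n = (\<Sum>f\<in>F \<union> Q. nn f)"
  have n: "rpoly I UNIV n (p f)" if "f \<in> F \<union> Q" for f
  proof -
    have "rpoly I UNIV (nn f) (p f)" using nn that by simp
    moreover have "nn f \<le> n" unfolding n_def using F(1) Q(1) that by (intro member_le_sum) auto
    ultimately show ?thesis by (rule rpoly_mono)
  qed
  define \<Psi> where "\<Psi> = (\<lambda>(f, k) x. nth_pderiv k (p f x)) ` ((F \<union> Q) \<times> {..n})"
  have fin\<Psi>: "finite \<Psi>" using F(1) Q(1) by (simp add: \<Psi>_def)
  have r\<Psi>: "rpoly I UNIV n g" if "g \<in> \<Psi>" for g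
  proof -
    from that[unfolded \<Psi>_def] obtain z where z: "g = (\<lambda>(f, k) x. nth_pderiv k (p f x)) z" "z \<in> (F \<union> Q) \<times> {..n}"
      by (rule imageE)
    obtain f k where "z = (f, k)" by force
    then show ?thesis using z rpoly_mono[OF rpoly_nth_pderiv[OF n, of f k]] by simp
  qed
  have "piecewise I UNIV (\<lambda>Y'. \<exists>Z. sections I Y' Z \<and>
      (\<forall>(n, p)\<in>#image_mset (Pair n) (mset_set \<Psi>). roots_in Y' p Z) \<and> (\<forall>p\<in>\<Psi>. tame_on I Y' p Z))"
    by (rule root_decomposition[OF definable_UNIV fin\<Psi>]) (use r\<Psi> fin\<Psi> in auto)
  then have "piecewise I UNIV (\<lambda>Y. \<exists>Z. sections I Y Z \<and> (\<forall>f\<in>F \<union> Q. settled I Y Z n (p f)))"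
  proof (rule piecewise_mono)
    fix Y assume "\<exists>Z. sections I Y Z \<and>
      (\<forall>(n, p)\<in>#image_mset (Pair n) (mset_set \<Psi>). roots_in Y p Z) \<and> (\<forall>p\<in>\<Psi>. tame_on I Y p Z)"
    then obtain Z where Z: "sections I Y Z" "\<forall>p\<in>\<Psi>. tame_on I Y p Z"
      "\<forall>(n, p)\<in>#image_mset (Pair n) (mset_set \<Psi>). roots_in Y p Z" by (elim exE conjE) (rule that)
    have rt: "\<forall>p\<in>\<Psi>. roots_in Y p Z" using Z(3) fin\<Psi> by auto
    have "settled I Y Z n (p f)" if f: "f \<in> F \<union> Q" for f
      unfolding settled_def
    proof (intro conjI ballI allI impI)
      show "degree (p f x) \<le> n" for x using n[OF f] by (simp add: rpoly_def)
      fix k assume "k \<le> n"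
      then have "(\<lambda>x. nth_pderiv k (p f x)) \<in> \<Psi>" using f unfolding \<Psi>_def by (intro image_eqI[of _ _ "(f, k)"]) auto
      then show "roots_in Y (\<lambda>x. nth_pderiv k (p f x)) Z" "tame_on I Y (\<lambda>x. nth_pderiv k (p f x)) Z"
        using rt Z(2) by auto
    qed
    then show "\<exists>Z. sections I Y Z \<and> (\<forall>f\<in>F \<union> Q. settled I Y Z n (p f))" using Z(1) by blast
  qed
  then obtain \<Y> where \<Y>: "finite \<Y>" "\<Union>\<Y> = UNIV"
    "\<forall>Y\<in>\<Y>. definable I Y \<and> Y \<noteq> {} \<and> (\<exists>Z. sections I Y Z \<and> (\<forall>f\<in>F \<union> Q. settled I Y Z n (p f)))"
    unfolding piecewise_def by (elim exE conjE) (rule that)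
  have "\<forall>Y\<in>\<Y>. \<exists>Z. sections I Y Z \<and> (\<forall>f\<in>F \<union> Q. settled I Y Z n (p f))" using \<Y>(3) by simp
  then obtain Zf where Zf: "\<forall>Y\<in>\<Y>. sections I Y (Zf Y) \<and> (\<forall>f\<in>F \<union> Q. settled I Y (Zf Y) n (p f))"
    by (rule bchoice[THEN exE])
  have finZ: "finite (Zf Y)" "Zf Y \<noteq> {}" if "Y \<in> \<Y>" for Y using Zf that by (auto simp: sections_def)
  define B where "B = {(x, y). x(i := y) \<in> X}"
  \<comment> \<open>The cells that lie in \<open>X\<close>; all other cells are disjoint from \<open>X\<close>.\<close>
  define T where "T = {(Y, \<xi>, e). Y \<in> \<Y> \<and> \<xi> \<in> Zf Y \<and> e \<in> {0, 1, -1::real} \<and> cell Y (Zf Y) \<xi> e \<subseteq> B}"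
  have "T \<subseteq> Sigma \<Y> (\<lambda>Y. Zf Y \<times> {0, 1, -1})" by (auto simp: T_def)
  then have finT: "finite T" by (rule finite_subset) (use \<Y>(1) finZ in auto)
  let ?c = "\<lambda>(Y, \<xi>, e). cell Y (Zf Y) \<xi> e"
  have "B = (\<Union>t\<in>T. ?c t)"
  proof
    show "(\<Union>t\<in>T. ?c t) \<subseteq> B" unfolding T_def by auto
    show "B \<subseteq> (\<Union>t\<in>T. ?c t)"
    proof clarify
      fix x y assume xy: "(x, y) \<in> B"
      have "x \<in> \<Union>\<Y>" using \<Y>(2) by simp
      then obtain Y where Y: "Y \<in> \<Y>" "x \<in> Y" by (rule UnionE)
      obtain \<xi> e where c: "\<xi> \<in> Zf Y" "e \<in> {0, 1, -1::real}" "(x, y) \<in> cell Y (Zf Y) \<xi> e"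
        using cells_cover[OF finZ[OF Y(1)] Y(2)] by metis
      have "(x', y') \<in> B" if c': "(x', y') \<in> cell Y (Zf Y) \<xi> e" for x' y'
      proof -
        have "sgn (f (x(i := y))) = sgn (f (x'(i := y')))" if f: "f \<in> F" for f
        proof -
          have "settled I Y (Zf Y) n (p f)" using Zf Y(1) f by simp
          from cell_sign[OF this c(1,2,3) c'] show ?thesis using p[of f] f by simp
        qed
        then show ?thesis using F(3) xy by (auto simp: B_def)
      qed
      then have "cell Y (Zf Y) \<xi> e \<subseteq> B" by auto
      then have "(Y, \<xi>, e) \<in> T" using Y(1) c(1,2) by (simp add: T_def)
      then show "(x, y) \<in> (\<Union>t\<in>T. ?c t)" using c(3) by (intro UN_I) auto
    qed
  qed
  moreover have "coarsely_conic Q ((\<lambda>(x, y) q. ln \<bar>poly (p q x) y\<bar>) ` ?c t)" if t: "t \<in> T" for t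
  proof -
    obtain Y \<xi> e where te: "t = (Y, \<xi>, e)" by (cases t)
    have Y: "Y \<in> \<Y>" "\<xi> \<in> Zf Y" "e \<in> {0, 1, -1}" "cell Y (Zf Y) \<xi> e \<subseteq> B" using t by (auto simp: te T_def)
    have "coarsely_conic Q ((\<lambda>(x, y) q. ln \<bar>poly (p q x) y\<bar>) ` cell Y (Zf Y) \<xi> e)"
    proof (rule conic_cell[OF IH _ _ Y(2,3) Q(1)])
      show "definable I Y" "Y \<noteq> {}" using \<Y>(3) Y(1) by auto
      show "sections I Y (Zf Y)" using Zf Y(1) by simp
      show "settled I Y (Zf Y) n (p q)" if "q \<in> Q" for q using Zf Y(1) that by simp
      fix q x y assume q: "q \<in> Q" and "(x, y) \<in> cell Y (Zf Y) \<xi> e"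
      then have "x(i := y) \<in> X" using Y(4) by (auto simp: B_def)
      then show "poly (p q x) y \<noteq> 0" using p[of q x y] bspec[OF bspec[OF Q(3) q], of "x(i := y)"] q by simp
    qed
    then show ?thesis by (simp add: te)
  qed
  then have "coarsely_conic Q (\<Union>t\<in>T. (\<lambda>(x, y) q. ln \<bar>poly (p q x) y\<bar>) ` ?c t)"
    by (intro coarsely_conic_UN finT)
  ultimately have "coarsely_conic Q ((\<lambda>(x, y) q. ln \<bar>poly (p q x) y\<bar>) ` B)" by (simp add: image_UN)
  then have cB: "coarsely_conic Q ((\<lambda>(x, y) q. ln \<bar>q (x(i := y))\<bar>) ` B)"
    by (rule coarsely_conic_cong[OF _ Q(1)]) (use p in auto)
  have eq: "(\<lambda>(x, y) q. ln \<bar>q (x(i := y))\<bar>) ` B = (\<lambda>x q. ln \<bar>q x\<bar>) ` X"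
  proof
    show "(\<lambda>(x, y) q. ln \<bar>q (x(i := y))\<bar>) ` B \<subseteq> (\<lambda>x q. ln \<bar>q x\<bar>) ` X" by (auto simp: B_def)
    show "(\<lambda>x q. ln \<bar>q x\<bar>) ` X \<subseteq> (\<lambda>(x, y) q. ln \<bar>q (x(i := y))\<bar>) ` B"
    proof clarify
      fix z assume "z \<in> X"
      then have "(z, z i) \<in> B" by (simp add: B_def)
      then show "(\<lambda>q. ln \<bar>q z\<bar>) \<in> (\<lambda>(x, y) q. ln \<bar>q (x(i := y))\<bar>) ` B"
        by (rule rev_image_eqI) simp
    qed
  qed
  show "coarsely_conic Q ((\<lambda>x q. ln \<bar>q x\<bar>) ` X)"
    unfolding eq[symmetric] by (rule cB)
qed

lemma polys_empty: "f \<in> polys {} \<Longrightarrow> \<exists>c. f = (\<lambda>_. c)"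
  by (induction rule: polys.induct) auto

text \<open>
  Induction on the number of coordinates, with \<open>conic_logs_insert\<close> as the step. Without
  coordinates all polynomials are constant; their logarithms are at bounded distance from the
  cone without generators, which consists of the origin only.
\<close>

theorem definable_conic_logs:
  assumes "finite I" "definable I Y"
  shows "conic_logs I Y"
  using assms
proof (induction I arbitrary: Y rule: finite_induct)
  case empty
  show ?case
    unfolding conic_logs_def
  proof (intro allI impI)
    fix Q :: "(('a \<Rightarrow> real) \<Rightarrow> real) set"
    assume Q: "finite Q" "Q \<subseteq> polys {}"
    show "coarsely_conic Q ((\<lambda>x q. ln \<bar>q x\<bar>) ` Y)"
    proof (cases "Y = {}")
      case True
      then show ?thesis by (simp add: coarsely_conic_empty)
    next
      case False
      \<comment> \<open>The polynomials are constant here, so they may be evaluated anywhere.\<close>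
      define C where "C = (\<Sum>q\<in>Q. \<bar>ln \<bar>q undefined\<bar>\<bar>)"
      have "\<bar>ln \<bar>q x\<bar>\<bar> \<le> C" if "q \<in> Q" for q x
      proof -
        have "q x = q undefined" using polys_empty[of q] Q(2) that by auto
        then show ?thesis
          using member_le_sum[of q Q "\<lambda>q. \<bar>ln \<bar>q undefined\<bar>\<bar>"] that Q(1) by (simp add: C_def)
      qed
      moreover have "fan {{} :: ((('a \<Rightarrow> real) \<Rightarrow> real) \<Rightarrow> real) set} = {\<lambda>j. 0}" by (auto simp: ccone_def)
      ultimately show ?thesis using False by (intro coarsely_conicI[of "{{}}" _ _ C]) auto
    qed
  qed
next
  case (insert i I)
  then show ?case by (intro conic_logs_insert) auto
qed

section \<open>Projections of cones and convex polyhedra\<close>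

lemma ccone_insert:
  assumes "finite G" "g \<notin> G"
  shows "p \<in> ccone (insert g G) \<longleftrightarrow> (\<exists>s\<ge>0. \<exists>q\<in>ccone G. p = (\<lambda>j. q j + s * g j))"
proof
  assume "p \<in> ccone (insert g G)"
  then obtain c where c: "\<forall>h\<in>insert g G. 0 \<le> c h" "p = (\<lambda>j. \<Sum>h\<in>insert g G. c h * h j)" by (auto simp: ccone_def)
  then have "p = (\<lambda>j. (\<Sum>h\<in>G. c h * h j) + c g * g j)" using assms by (simp add: add.commute)
  moreover have "(\<lambda>j. \<Sum>h\<in>G. c h * h j) \<in> ccone G" using c by (intro cconeI) simp
  ultimately show "\<exists>s\<ge>0. \<exists>q\<in>ccone G. p = (\<lambda>j. q j + s * g j)" using c(1) by (intro exI[of _ "c g"]) auto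
next
  assume "\<exists>s\<ge>0. \<exists>q\<in>ccone G. p = (\<lambda>j. q j + s * g j)"
  then obtain s q where s: "0 \<le> s" and q: "q \<in> ccone G" and p: "p = (\<lambda>j. q j + s * g j)" by blast
  have fin: "finite (insert g G)" using assms by simp
  from q obtain c where c: "\<forall>h\<in>G. 0 \<le> c h" "q = (\<lambda>j. \<Sum>h\<in>G. c h * h j)" by (auto simp: ccone_def)
  have 1: "q \<in> ccone (insert g G)" unfolding c(2)
    by (rule ccone_sum[OF assms(1)]) (use c(1) in \<open>simp_all add: generator_in_ccone[OF fin]\<close>)
  have "(\<lambda>j. s * g j) \<in> ccone (insert g G)" by (rule ccone_scale[OF generator_in_ccone[OF fin] s]) simp
  from ccone_add[OF 1 this] show "p \<in> ccone (insert g G)" by (simp add: p)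
qed

lemma interval_point_exists:
  fixes L U :: "real set"
  assumes "finite L" "L \<noteq> {}" "\<And>l u. l \<in> L \<Longrightarrow> u \<in> U \<Longrightarrow> l \<le> u"
  shows "\<exists>s. (\<forall>l\<in>L. l \<le> s) \<and> (\<forall>u\<in>U. s \<le> u)"
  using assms by (intro exI[of _ "Max L"]) auto

lemma sum_unit_vector:
  assumes "finite I" "i \<in> I"
  shows "(\<Sum>j\<in>I. (if j = i then c else 0) * x j) = c * (x i :: real)"
  using assms by (simp add: if_distrib[of "\<lambda>c. c * _"] cong: if_cong)

text \<open>
  Fourier--Motzkin elimination, with the coefficients of the generators as the variables to be
  eliminated: the coefficient \<open>s\<close> of the generator \<open>g\<close> is bounded below and above by the
  inequalities \<open>a\<close> with positive and negative \<open>a g\<close>, and it exists if and only if no lower bound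
  exceeds an upper bound.
\<close>

lemma ccone_projection_halfspaces:
  assumes "finite G" "finite I"
  shows "\<exists>A. finite A \<and> (\<forall>x. (\<exists>p\<in>ccone G. \<forall>i\<in>I. x i = p i) \<longleftrightarrow> (\<forall>a\<in>A. (\<Sum>i\<in>I. a i * x i) \<le> (0::real)))"
  using assms(1)
proof (induction G rule: finite_induct)
  case empty
  define A where "A = (\<Union>i\<in>I. {\<lambda>j. if j = i then 1 else 0, \<lambda>j. if j = i then - 1 else (0::real)})"
  have "(\<forall>a\<in>A. (\<Sum>i\<in>I. a i * x i) \<le> 0) \<longleftrightarrow> (\<forall>i\<in>I. x i = 0)" for x
  proof -
    have "(\<forall>a\<in>A. (\<Sum>i\<in>I. a i * x i) \<le> 0) \<longleftrightarrow> (\<forall>i\<in>I. x i \<le> 0 \<and> - x i \<le> 0)"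
      unfolding A_def using sum_unit_vector[OF assms(2), of _ 1 x] sum_unit_vector[OF assms(2), of _ "-1" x] by simp
    then show ?thesis by force
  qed
  moreover have "(\<exists>p\<in>ccone {}. \<forall>i\<in>I. x i = p i) \<longleftrightarrow> (\<forall>i\<in>I. x i = 0)" for x :: "'a \<Rightarrow> real"
    by (simp add: ccone_def)
  moreover have "finite A" using assms(2) by (simp add: A_def)
  ultimately show ?case by (intro exI[of _ A]) simp
next
  case (insert g G)
  from insert.IH obtain A where A: "finite A"
    and A0: "\<forall>x. (\<exists>p\<in>ccone G. \<forall>i\<in>I. x i = p i) \<longleftrightarrow> (\<forall>a\<in>A. (\<Sum>i\<in>I. a i * x i) \<le> 0)"
    by (elim exE conjE) (rule that)
  have A2: "(\<exists>p\<in>ccone G. \<forall>i\<in>I. x i = p i) \<longleftrightarrow> (\<forall>a\<in>A. (\<Sum>i\<in>I. a i * x i) \<le> 0)" for x by (rule A0[THEN spec])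
  define dot where "dot = (\<lambda>a x :: 'a \<Rightarrow> real. \<Sum>i\<in>I. a i * x i)"
  define P where "P = {a\<in>A. 0 < dot a g}"
  define N where "N = {a\<in>A. dot a g < 0}"
  define mix where "mix = (\<lambda>(a, b) i. dot a g * b i - dot b g * a i)"
  define B where "B = {a\<in>A. dot a g \<le> 0} \<union> mix ` (P \<times> N)"
  have dmix: "dot (mix (a, b)) x = dot a g * dot b x - dot b g * dot a x" for a b x
    by (simp add: dot_def mix_def left_diff_distrib sum_subtractf sum_distrib_left sum_distrib_right mult.assoc)
  have "(\<exists>p\<in>ccone (insert g G). \<forall>i\<in>I. x i = p i) \<longleftrightarrow> (\<forall>a\<in>B. dot a x \<le> 0)" for x
  proof -
    have "(\<exists>p\<in>ccone (insert g G). \<forall>i\<in>I. x i = p i) \<longleftrightarrow> (\<exists>s\<ge>0. \<exists>q\<in>ccone G. \<forall>i\<in>I. x i = q i + s * g i)"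
    proof
      assume "\<exists>p\<in>ccone (insert g G). \<forall>i\<in>I. x i = p i"
      then obtain p where p: "p \<in> ccone (insert g G)" "\<forall>i\<in>I. x i = p i" by (rule bexE)
      then obtain s q where "0 \<le> s" "q \<in> ccone G" "p = (\<lambda>j. q j + s * g j)"
        unfolding ccone_insert[OF insert.hyps(1,2)] by (elim exE bexE conjE) (rule that)
      then show "\<exists>s\<ge>0. \<exists>q\<in>ccone G. \<forall>i\<in>I. x i = q i + s * g i"
        using p(2) by (intro exI[of _ s] conjI bexI[of _ q]) simp_all
    next
      assume "\<exists>s\<ge>0. \<exists>q\<in>ccone G. \<forall>i\<in>I. x i = q i + s * g i"
      then obtain s q where sq: "0 \<le> s" "q \<in> ccone G" "\<forall>i\<in>I. x i = q i + s * g i"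
        by (elim exE bexE conjE) (rule that)
      have "(\<lambda>j. q j + s * g j) \<in> ccone (insert g G)"
        unfolding ccone_insert[OF insert.hyps(1,2)]
        by (intro exI[of _ s] conjI bexI[of _ q] sq(1,2) refl)
      then show "\<exists>p\<in>ccone (insert g G). \<forall>i\<in>I. x i = p i" by (rule bexI[rotated]) (rule sq(3))
    qed
    also have "\<dots> \<longleftrightarrow> (\<exists>s\<ge>0. \<exists>q\<in>ccone G. \<forall>i\<in>I. x i - s * g i = q i)" by (simp add: algebra_simps)
    also have "\<dots> \<longleftrightarrow> (\<exists>s\<ge>0. \<forall>a\<in>A. (\<Sum>i\<in>I. a i * (x i - s * g i)) \<le> 0)"
      by (simp only: A2)
    also have "\<dots> \<longleftrightarrow> (\<exists>s\<ge>0. \<forall>a\<in>A. dot a x \<le> s * dot a g)"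
      by (simp add: dot_def right_diff_distrib sum_subtractf sum_distrib_left mult.left_commute)
    also have "\<dots> \<longleftrightarrow> (\<forall>a\<in>B. dot a x \<le> 0)"
    proof
      assume "\<exists>s\<ge>0. \<forall>a\<in>A. dot a x \<le> s * dot a g"
      then obtain s where s: "0 \<le> s" "\<And>a. a \<in> A \<Longrightarrow> dot a x \<le> s * dot a g" by blast
      show "\<forall>a\<in>B. dot a x \<le> 0"
      proof
        fix b assume "b \<in> B"
        then consider "b \<in> A" "dot b g \<le> 0" | p n where "p \<in> P" "n \<in> N" "b = mix (p, n)" by (auto simp: B_def)
        then show "dot b x \<le> 0"
        proof cases
          case 1
          then show ?thesis using s(2)[of b] mult_nonneg_nonpos[OF s(1), of "dot b g"] by linarith
        next
          case 2
          then have pn: "p \<in> A" "n \<in> A" "0 < dot p g" "dot n g < 0" by (auto simp: P_def N_def)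
          have "dot p g * dot n x \<le> dot p g * (s * dot n g)" using s(2)[OF pn(2)] pn(3) by simp
          moreover have "(- dot n g) * dot p x \<le> (- dot n g) * (s * dot p g)"
            using s(2)[OF pn(1)] pn(4) by (intro mult_left_mono) auto
          ultimately show ?thesis unfolding 2(3) dmix by (simp add: algebra_simps)
        qed
      qed
    next
      assume B: "\<forall>a\<in>B. dot a x \<le> 0"
      define L where "L = insert 0 ((\<lambda>a. dot a x / dot a g) ` P)"
      define U where "U = (\<lambda>a. dot a x / dot a g) ` N"
      have "l \<le> u" if "l \<in> L" "u \<in> U" for l u
      proof -
        obtain n where n: "n \<in> N" "u = dot n x / dot n g" using \<open>u \<in> U\<close> by (auto simp: U_def)
        then have n': "dot n g < 0" "n \<in> B" by (auto simp: N_def B_def)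
        consider "l = 0" | p where "p \<in> P" "l = dot p x / dot p g" using \<open>l \<in> L\<close> by (auto simp: L_def)
        then show ?thesis
        proof cases
          case 1
          then show ?thesis using n n' B by (auto intro: divide_nonpos_nonpos)
        next
          case 2
          then have "mix (p, n) \<in> B" "0 < dot p g" using n(1) by (auto simp: B_def P_def)
          then have "dot p g * dot n x \<le> dot n g * dot p x" using B dmix[of p n x] by auto
          moreover have "dot n x = u * dot n g" using n(2) n'(1) by simp
          ultimately have "dot n g * (dot p g * u) \<le> dot n g * dot p x" by (simp add: mult_ac)
          then have "dot p x \<le> dot p g * u" using n'(1) by (simp add: mult_le_cancel_left_neg)
          then show ?thesis using 2(2) \<open>0 < dot p g\<close> by (simp add: pos_divide_le_eq mult.commute)
        qed
      qed
      moreover have "finite L" "L \<noteq> {}" using A by (auto simp: L_def P_def)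
      ultimately obtain s where s: "\<forall>l\<in>L. l \<le> s" "\<forall>u\<in>U. s \<le> u" using interval_point_exists[of L U] by blast
      have "dot a x \<le> s * dot a g" if "a \<in> A" for a
      proof (cases "dot a g" "0::real" rule: linorder_cases)
        case less
        then have "s \<le> dot a x / dot a g" using that s(2) by (auto simp: U_def N_def)
        then show ?thesis using less by (simp add: divide_simps mult.commute split: if_splits)
      next
        case equal
        then show ?thesis using that B by (auto simp: B_def)
      next
        case greater
        then have "dot a x / dot a g \<le> s" using that s(1) by (auto simp: L_def P_def)
        then show ?thesis using greater by (simp add: divide_simps mult.commute split: if_splits)
      qed
      moreover have "0 \<le> s" using s(1) by (simp add: L_def)
      ultimately show "\<exists>s\<ge>0. \<forall>a\<in>A. dot a x \<le> s * dot a g" by blast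
    qed
    finally show ?thesis .
  qed
  moreover have "finite B" using A by (simp add: B_def P_def N_def)
  ultimately show ?case unfolding dot_def by (intro exI[of _ B]) simp
qed

lemma convex_polyhedronI:
  "finite H \<Longrightarrow> P = {x \<in> I \<rightarrow>\<^sub>E UNIV. \<forall>(a, b)\<in>H. (\<Sum>i\<in>I. a i * x i) \<le> b} \<Longrightarrow> convex_polyhedron I P"
  unfolding convex_polyhedron_def by blast

lemma convex_polyhedronE:
  assumes "convex_polyhedron I P"
  obtains H where "finite H" "P = {x \<in> I \<rightarrow>\<^sub>E UNIV. \<forall>(a, b)\<in>H. (\<Sum>i\<in>I. a i * x i) \<le> b}"
  using assms unfolding convex_polyhedron_def by blast

lemma convex_polyhedron_extensional: "convex_polyhedron I P \<Longrightarrow> P \<subseteq> I \<rightarrow>\<^sub>E UNIV"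
  unfolding convex_polyhedron_def by blast

lemma convex_polyhedron_ccone:
  assumes "finite G" "finite I"
  shows "convex_polyhedron I ((\<lambda>p. restrict p I) ` ccone G)"
proof -
  from ccone_projection_halfspaces[OF assms] obtain A where A: "finite A"
    "\<forall>x. (\<exists>p\<in>ccone G. \<forall>i\<in>I. x i = p i) \<longleftrightarrow> (\<forall>a\<in>A. (\<Sum>i\<in>I. a i * x i) \<le> 0)"
    by (elim exE conjE) (rule that)
  show ?thesis
  proof (rule convex_polyhedronI[of "(\<lambda>a. (a, 0)) ` A"])
    have "x \<in> (\<lambda>p. restrict p I) ` ccone G \<longleftrightarrow> x \<in> I \<rightarrow>\<^sub>E UNIV \<and> (\<exists>p\<in>ccone G. \<forall>i\<in>I. x i = p i)" for x
    proof
      assume r: "x \<in> I \<rightarrow>\<^sub>E UNIV \<and> (\<exists>p\<in>ccone G. \<forall>i\<in>I. x i = p i)"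
      then obtain p where p: "p \<in> ccone G" "\<forall>i\<in>I. x i = p i" by blast
      then have "x = restrict p I" using r by (auto simp: fun_eq_iff PiE_def extensional_def restrict_def)
      then show "x \<in> (\<lambda>p. restrict p I) ` ccone G" using p(1) by blast
    qed auto
    then show "(\<lambda>p. restrict p I) ` ccone G = {x \<in> I \<rightarrow>\<^sub>E UNIV. \<forall>(a, b)\<in>(\<lambda>a. (a, 0)) ` A. (\<Sum>i\<in>I. a i * x i) \<le> b}"
      using A(2) by auto
  qed (use A(1) in simp)
qed

lemma convex_polyhedron_Int:
  assumes "convex_polyhedron I P" "convex_polyhedron I Q" shows "convex_polyhedron I (P \<inter> Q)"
proof -
  obtain H K where "finite H" "P = {x \<in> I \<rightarrow>\<^sub>E UNIV. \<forall>(a, b)\<in>H. (\<Sum>i\<in>I. a i * x i) \<le> b}"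
    "finite K" "Q = {x \<in> I \<rightarrow>\<^sub>E UNIV. \<forall>(a, b)\<in>K. (\<Sum>i\<in>I. a i * x i) \<le> b}"
    using assms unfolding convex_polyhedron_def by blast
  then show ?thesis by (intro convex_polyhedronI[of "H \<union> K"]) auto
qed

lemma convex_polyhedron_box:
  assumes "finite I" shows "convex_polyhedron I {y \<in> I \<rightarrow>\<^sub>E UNIV. \<forall>i\<in>I. \<bar>y i - x i\<bar> \<le> r}"
proof (rule convex_polyhedronI)
  let ?H = "(\<lambda>i. (\<lambda>j. if j = i then 1 else 0, x i + r)) ` I \<union> (\<lambda>i. (\<lambda>j. if j = i then - 1 else 0, r - x i)) ` I"
  show "finite ?H" using assms by simp
  show "{y \<in> I \<rightarrow>\<^sub>E UNIV. \<forall>i\<in>I. \<bar>y i - x i\<bar> \<le> r} = {y \<in> I \<rightarrow>\<^sub>E UNIV. \<forall>(a, b)\<in>?H. (\<Sum>i\<in>I. a i * y i) \<le> b}"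
    by (simp add: ball_Un sum_unit_vector[OF assms] abs_le_iff) (auto simp: algebra_simps)
qed

lemma convex_polyhedron_coordinate:
  assumes "finite I" "i \<in> I" shows "convex_polyhedron I {y \<in> I \<rightarrow>\<^sub>E UNIV. y i = c}"
proof (rule convex_polyhedronI)
  let ?H = "{(\<lambda>j. if j = i then 1 else 0, c), (\<lambda>j. if j = i then - 1 else 0, - c)}"
  show "{y \<in> I \<rightarrow>\<^sub>E UNIV. y i = c} = {y \<in> I \<rightarrow>\<^sub>E UNIV. \<forall>(a, b)\<in>?H. (\<Sum>i\<in>I. a i * y i) \<le> b}"
    by (auto simp: sum_unit_vector[OF assms])
qed simp

lemma affine_map_onE:
  assumes "affine_map_on I J P f"
  obtains a b where "\<forall>x\<in>P. \<forall>j\<in>J. f x j = b j + (\<Sum>i\<in>I. a j i * x i)"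
  using assms unfolding affine_map_on_def by (elim exE) (rule that)

lemma affine_map_on_subset: "affine_map_on I J P f \<Longrightarrow> P' \<subseteq> P \<Longrightarrow> affine_map_on I J P' f"
  unfolding affine_map_on_def by (meson subsetD)

lemma affine_map_on_cong:
  "affine_map_on I J P f \<Longrightarrow> (\<And>x j. x \<in> P \<Longrightarrow> j \<in> J \<Longrightarrow> g x j = f x j) \<Longrightarrow> affine_map_on I J P g"
  unfolding affine_map_on_def by simp

lemma convex_polyhedron_vimage:
  assumes P: "convex_polyhedron I P" and Q: "convex_polyhedron J Q" and f: "affine_map_on I J P f"
    and ext: "\<And>x. x \<in> P \<Longrightarrow> f x \<in> J \<rightarrow>\<^sub>E UNIV"
  shows "convex_polyhedron I {x \<in> P. f x \<in> Q}"
proof -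
  obtain H where H: "finite H" "P = {x \<in> I \<rightarrow>\<^sub>E UNIV. \<forall>(a, b)\<in>H. (\<Sum>i\<in>I. a i * x i) \<le> b}" by (rule convex_polyhedronE[OF P])
  obtain K where K: "finite K" "Q = {x \<in> J \<rightarrow>\<^sub>E UNIV. \<forall>(a, b)\<in>K. (\<Sum>i\<in>J. a i * x i) \<le> b}" by (rule convex_polyhedronE[OF Q])
  obtain a b where ab0: "\<forall>x\<in>P. \<forall>j\<in>J. f x j = b j + (\<Sum>i\<in>I. a j i * x i)"
    by (rule affine_map_onE[OF f])
  note ab = ab0[rule_format]
  define pull where "pull = (\<lambda>(c, d). (\<lambda>i. \<Sum>j\<in>J. c j * a j i, d - (\<Sum>j\<in>J. c j * b j :: real)))"
  have "(\<Sum>j\<in>J. c j * f x j) = (\<Sum>j\<in>J. c j * b j) + (\<Sum>i\<in>I. (\<Sum>j\<in>J. c j * a j i) * x i)" if "x \<in> P" for c x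
  proof -
    have "(\<Sum>j\<in>J. c j * f x j) = (\<Sum>j\<in>J. c j * b j + (\<Sum>i\<in>I. c j * a j i * x i))"
      using ab[OF that] by (simp add: distrib_left sum_distrib_left mult.assoc)
    then show ?thesis by (simp add: sum.distrib sum_distrib_right sum.swap[of _ I J])
  qed
  then have "f x \<in> Q \<longleftrightarrow> (\<forall>(c, d)\<in>pull ` K. (\<Sum>i\<in>I. c i * x i) \<le> d)" if "x \<in> P" for x
    using that ext unfolding K(2) by (auto simp: pull_def algebra_simps)
  then have "{x \<in> P. f x \<in> Q} = P \<inter> {x \<in> I \<rightarrow>\<^sub>E UNIV. \<forall>(c, d)\<in>pull ` K. (\<Sum>i\<in>I. c i * x i) \<le> d}"
    using H(2) by blast
  moreover have "convex_polyhedron I {x \<in> I \<rightarrow>\<^sub>E UNIV. \<forall>(c, d)\<in>pull ` K. (\<Sum>i\<in>I. c i * x i) \<le> d}"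
    by (rule convex_polyhedronI[OF _ refl]) (use K(1) in simp)
  ultimately show ?thesis using convex_polyhedron_Int[OF P] by simp
qed

section \<open>Piecewise linear maps between polyhedral sets\<close>

text \<open>
  In finite dimension the open boxes around \<open>x\<close> are a basis of neighbourhoods; with them the
  topological conditions in the definitions of polyhedral sets and piecewise linear maps turn
  into estimates.
\<close>

abbreviation near :: "'i set \<Rightarrow> real \<Rightarrow> ('i \<Rightarrow> real) \<Rightarrow> ('i \<Rightarrow> real) \<Rightarrow> bool" where
  "near I r x y \<equiv> \<forall>i\<in>I. \<bar>y i - x i\<bar> < r"

lemma openin_powertop_near:
  assumes "finite I"
  shows "openin (powertop_real I) U \<longleftrightarrow> U \<subseteq> I \<rightarrow>\<^sub>E UNIV \<and> (\<forall>x\<in>U. \<exists>r>0. \<forall>y\<in>I \<rightarrow>\<^sub>E UNIV. near I r x y \<longrightarrow> y \<in> U)"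
proof
  assume U: "openin (powertop_real I) U"
  show "U \<subseteq> I \<rightarrow>\<^sub>E UNIV \<and> (\<forall>x\<in>U. \<exists>r>0. \<forall>y\<in>I \<rightarrow>\<^sub>E UNIV. near I r x y \<longrightarrow> y \<in> U)"
  proof (intro conjI ballI)
    show "U \<subseteq> I \<rightarrow>\<^sub>E UNIV" using openin_subset[OF U] by simp
    fix x assume "x \<in> U"
    then obtain W where W: "\<forall>i\<in>I. openin euclideanreal (W i)" "x \<in> Pi\<^sub>E I W" "Pi\<^sub>E I W \<subseteq> U"
      using U unfolding openin_product_topology_alt by blast
    have "\<forall>i\<in>I. \<exists>r>0. ball (x i) r \<subseteq> W i"
    proof
      fix i assume "i \<in> I"
      then have "open (W i)" "x i \<in> W i" using W by (auto simp: PiE_iff)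
      then show "\<exists>r>0. ball (x i) r \<subseteq> W i" by (rule openE) auto
    qed
    then obtain r where r: "\<forall>i\<in>I. 0 < r i \<and> ball (x i) (r i) \<subseteq> W i" by (rule bchoice[THEN exE])
    define \<rho> where "\<rho> = Min (insert 1 (r ` I))"
    have \<rho>: "0 < \<rho>" "\<And>i. i \<in> I \<Longrightarrow> \<rho> \<le> r i" using r assms by (auto simp: \<rho>_def)
    have "y \<in> U" if "y \<in> I \<rightarrow>\<^sub>E UNIV" "near I \<rho> x y" for y
    proof -
      have "y i \<in> W i" if "i \<in> I" for i
      proof -
        have "y i \<in> ball (x i) (r i)" using \<open>near I \<rho> x y\<close> \<rho>(2)[OF that] that by (force simp: dist_real_def)
        then show ?thesis using r that by blast
      qed
      then have "y \<in> Pi\<^sub>E I W" using that(1) by (auto simp: PiE_iff)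
      then show ?thesis using W(3) by blast
    qed
    then show "\<exists>r>0. \<forall>y\<in>I \<rightarrow>\<^sub>E UNIV. near I r x y \<longrightarrow> y \<in> U" using \<rho>(1) by blast
  qed
next
  assume U: "U \<subseteq> I \<rightarrow>\<^sub>E UNIV \<and> (\<forall>x\<in>U. \<exists>r>0. \<forall>y\<in>I \<rightarrow>\<^sub>E UNIV. near I r x y \<longrightarrow> y \<in> U)"
  show "openin (powertop_real I) U"
    unfolding openin_product_topology_alt
  proof
    fix x assume x: "x \<in> U"
    from bspec[OF conjunct2[OF U] x] obtain r where r: "0 < r" "\<forall>y\<in>I \<rightarrow>\<^sub>E UNIV. near I r x y \<longrightarrow> y \<in> U"
      by (elim exE conjE) (rule that)
    have "Pi\<^sub>E I (\<lambda>i. ball (x i) r) \<subseteq> U"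
    proof
      fix y assume "y \<in> Pi\<^sub>E I (\<lambda>i. ball (x i) r)"
      then show "y \<in> U"
        by (intro bspec[OF r(2), THEN mp]) (auto simp: PiE_iff dist_real_def abs_minus_commute)
    qed
    moreover have "x \<in> Pi\<^sub>E I (\<lambda>i. ball (x i) r)" using x U r(1) by (auto simp: PiE_iff)
    ultimately show "\<exists>W. finite {i \<in> I. W i \<noteq> topspace euclideanreal} \<and> (\<forall>i\<in>I. openin euclideanreal (W i)) \<and>
        x \<in> Pi\<^sub>E I W \<and> Pi\<^sub>E I W \<subseteq> U"
      using assms by (intro exI[of _ "\<lambda>i. ball (x i) r"]) auto
  qed
qed

lemma openin_subtopology_near:
  assumes "finite I" "A \<subseteq> I \<rightarrow>\<^sub>E UNIV"
  shows "openin (subtopology (powertop_real I) A) U \<longleftrightarrow> U \<subseteq> A \<and> (\<forall>x\<in>U. \<exists>r>0. \<forall>y\<in>A. near I r x y \<longrightarrow> y \<in> U)"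
proof
  assume "openin (subtopology (powertop_real I) A) U"
  then obtain T where T: "openin (powertop_real I) T" "U = T \<inter> A" by (auto simp: openin_subtopology)
  have "\<exists>r>0. \<forall>y\<in>A. near I r x y \<longrightarrow> y \<in> U" if x: "x \<in> U" for x
  proof -
    have "x \<in> T" using x T(2) by simp
    from bspec[OF conjunct2[OF T(1)[unfolded openin_powertop_near[OF assms(1)]]] this]
    obtain r where r: "0 < r" "\<forall>y\<in>I \<rightarrow>\<^sub>E UNIV. near I r x y \<longrightarrow> y \<in> T" by (elim exE conjE) (rule that)
    have "y \<in> U" if "y \<in> A" "near I r x y" for y
      using bspec[OF r(2) subsetD[OF assms(2) that(1)], THEN mp, OF that(2)] that(1) T(2) by simp
    then show ?thesis using r(1) by (intro exI[of _ r]) simp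
  qed
  then show "U \<subseteq> A \<and> (\<forall>x\<in>U. \<exists>r>0. \<forall>y\<in>A. near I r x y \<longrightarrow> y \<in> U)" using T(2) by blast
next
  assume U: "U \<subseteq> A \<and> (\<forall>x\<in>U. \<exists>r>0. \<forall>y\<in>A. near I r x y \<longrightarrow> y \<in> U)"
  define T where "T = {y \<in> I \<rightarrow>\<^sub>E UNIV. \<exists>x\<in>U. \<exists>r>0. near I r x y \<and> (\<forall>z\<in>A. near I r x z \<longrightarrow> z \<in> U)}"
  have "openin (powertop_real I) T"
    unfolding openin_powertop_near[OF assms(1)]
  proof (intro conjI ballI)
    show "T \<subseteq> I \<rightarrow>\<^sub>E UNIV" by (auto simp: T_def)
    fix y assume "y \<in> T"
    then obtain x r where x: "x \<in> U" "r > 0" "near I r x y" "\<forall>z\<in>A. near I r x z \<longrightarrow> z \<in> U" by (auto simp: T_def)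
    define s where "s = Min (insert r ((\<lambda>i. r - \<bar>y i - x i\<bar>) ` I))"
    have s: "0 < s" "\<And>i. i \<in> I \<Longrightarrow> s \<le> r - \<bar>y i - x i\<bar>" using x(2,3) assms(1) by (auto simp: s_def)
    have "z \<in> T" if z: "z \<in> I \<rightarrow>\<^sub>E UNIV" "near I s y z" for z
    proof -
      have "near I r x z"
      proof
        fix i assume i: "i \<in> I"
        then show "\<bar>z i - x i\<bar> < r" using z(2) s(2)[OF i] by (smt (verit) bspec)
      qed
      then show ?thesis unfolding T_def
        by (intro CollectI conjI z(1) bexI[OF _ x(1)] exI[of _ r] x(2,4))
    qed
    then show "\<exists>r>0. \<forall>z\<in>I \<rightarrow>\<^sub>E UNIV. near I r y z \<longrightarrow> z \<in> T" using s(1) by blast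
  qed
  moreover have "U = T \<inter> A"
  proof
    show "U \<subseteq> T \<inter> A"
    proof
      fix x assume x: "x \<in> U"
      from bspec[OF conjunct2[OF U] x] obtain r where r: "r > 0" "\<forall>y\<in>A. near I r x y \<longrightarrow> y \<in> U"
        by (elim exE conjE) (rule that)
      have xA: "x \<in> A" using x U by blast
      have "x \<in> T" unfolding T_def
        by (intro CollectI conjI bexI[OF _ x] exI[of _ r] r subsetD[OF assms(2) xA]) (simp add: r(1))
      then show "x \<in> T \<inter> A" using xA by simp
    qed
    show "T \<inter> A \<subseteq> U" by (auto simp: T_def)
  qed
  ultimately show "openin (subtopology (powertop_real I) A) U" by (auto simp: openin_subtopology)
qed

lemma interior_near:
  assumes "finite I" "A \<subseteq> I \<rightarrow>\<^sub>E UNIV"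
  shows "x \<in> (subtopology (powertop_real I) A) interior_of S \<longleftrightarrow> x \<in> A \<and> (\<exists>r>0. \<forall>y\<in>A. near I r x y \<longrightarrow> y \<in> S)"
proof
  assume "x \<in> (subtopology (powertop_real I) A) interior_of S"
  then obtain T where "openin (subtopology (powertop_real I) A) T" "x \<in> T" "T \<subseteq> S" by (auto simp: interior_of_def)
  then show "x \<in> A \<and> (\<exists>r>0. \<forall>y\<in>A. near I r x y \<longrightarrow> y \<in> S)"
    unfolding openin_subtopology_near[OF assms] by (meson subsetD)
next
  assume x: "x \<in> A \<and> (\<exists>r>0. \<forall>y\<in>A. near I r x y \<longrightarrow> y \<in> S)"
  define T where "T = {y\<in>A. \<exists>r>0. \<forall>z\<in>A. near I r y z \<longrightarrow> z \<in> S}"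
  have "openin (subtopology (powertop_real I) A) T"
    unfolding openin_subtopology_near[OF assms]
  proof (intro conjI ballI)
    fix y assume "y \<in> T"
    then obtain r where r0: "r > 0" "\<forall>z\<in>A. near I r y z \<longrightarrow> z \<in> S"
      unfolding T_def by (elim CollectE exE conjE) (rule that)
    note r = r0(1) bspec[OF r0(2), THEN mp]
    have "z \<in> T" if z: "z \<in> A" "near I (r / 2) y z" for z
    proof -
      have "u \<in> S" if u: "u \<in> A" "near I (r / 2) z u" for u
      proof (rule r(2)[OF u(1)])
        show "near I r y u"
        proof
          fix i assume i: "i \<in> I"
          show "\<bar>u i - y i\<bar> < r" using bspec[OF z(2) i] bspec[OF u(2) i] by linarith
        qed
      qed
      then show ?thesis using z(1) r(1) unfolding T_def by (intro CollectI conjI exI[of _ "r / 2"]) simp_all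
    qed
    then show "\<exists>r>0. \<forall>z\<in>A. near I r y z \<longrightarrow> z \<in> T" using r(1) by (intro exI[of _ "r / 2"]) simp_all
  qed (auto simp: T_def)
  moreover have "T \<subseteq> S"
  proof
    fix y assume "y \<in> T"
    then obtain r where "y \<in> A" "r > 0" "\<forall>z\<in>A. near I r y z \<longrightarrow> z \<in> S"
      unfolding T_def by (elim CollectE exE conjE) (rule that)
    then show "y \<in> S" by simp
  qed
  moreover have "x \<in> T" using x by (simp add: T_def)
  ultimately show "x \<in> (subtopology (powertop_real I) A) interior_of S" by (auto simp: interior_of_def)
qed

lemma convex_polyhedron_far:
  assumes "finite I" "convex_polyhedron I P" "x \<in> I \<rightarrow>\<^sub>E UNIV" "x \<notin> P"
  shows "\<exists>r>0. \<forall>y\<in>P. \<not> near I r x y"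
proof -
  obtain H where H: "finite H" "P = {x \<in> I \<rightarrow>\<^sub>E UNIV. \<forall>(a, b)\<in>H. (\<Sum>i\<in>I. a i * x i) \<le> b}" by (rule convex_polyhedronE[OF assms(2)])
  then obtain a b where ab: "(a, b) \<in> H" "b < (\<Sum>i\<in>I. a i * x i)" using assms(3,4) by fastforce
  define A where "A = (\<Sum>i\<in>I. \<bar>a i\<bar>) + 1"
  have A: "0 < A" "(\<Sum>i\<in>I. \<bar>a i\<bar>) \<le> A" by (simp_all add: A_def add_nonneg_pos sum_nonneg)
  define r where "r = ((\<Sum>i\<in>I. a i * x i) - b) / A"
  have r: "0 < r" using ab(2) A(1) by (simp add: r_def)
  have "\<not> near I r x y" if y: "y \<in> P" for y
  proof
    assume nr: "near I r x y"
    have "(\<Sum>i\<in>I. a i * x i) - (\<Sum>i\<in>I. a i * y i) = (\<Sum>i\<in>I. a i * (x i - y i))"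
      by (simp add: sum_subtractf right_diff_distrib)
    also have "\<dots> \<le> (\<Sum>i\<in>I. \<bar>a i\<bar> * r)"
    proof (rule sum_mono)
      fix i assume i: "i \<in> I"
      have "a i * (x i - y i) \<le> \<bar>a i\<bar> * \<bar>x i - y i\<bar>" by (metis abs_ge_self abs_mult)
      also have "\<dots> \<le> \<bar>a i\<bar> * r" using bspec[OF nr i] by (intro mult_left_mono) auto
      finally show "a i * (x i - y i) \<le> \<bar>a i\<bar> * r" .
    qed
    also have "\<dots> = (\<Sum>i\<in>I. \<bar>a i\<bar>) * r" by (simp add: sum_distrib_right)
    also have "\<dots> < A * r" using r by (simp add: A_def)
    also have "\<dots> = (\<Sum>i\<in>I. a i * x i) - b" using A(1) by (simp add: r_def)
    finally have "b < (\<Sum>i\<in>I. a i * y i)" by simp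
    then show False using y ab(1) H(2) by fastforce
  qed
  then show ?thesis using r by blast
qed

lemma pl_onE:
  assumes "pl_on I J A f" "finite I" "A \<subseteq> I \<rightarrow>\<^sub>E UNIV" "x \<in> A"
  obtains \<P> r where "finite \<P>" "\<forall>P\<in>\<P>. convex_polyhedron I P" "\<forall>P\<in>\<P>. affine_map_on I J P f"
    "\<Union>\<P> \<subseteq> A" "r > 0" "\<forall>y\<in>A. near I r x y \<longrightarrow> y \<in> \<Union>\<P>"
proof -
  from assms(1)[unfolded pl_on_def, rule_format, OF assms(4)]
  obtain \<P> where P: "finite \<P>" "\<forall>P\<in>\<P>. convex_polyhedron I P \<and> affine_map_on I J P f" "\<Union>\<P> \<subseteq> A"
    "x \<in> (subtopology (powertop_real I) A) interior_of \<Union>\<P>"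
    by (elim exE conjE) (rule that)
  from P(4)[unfolded interior_near[OF assms(2,3)]]
  obtain r where r: "r > 0" "\<forall>y\<in>A. near I r x y \<longrightarrow> y \<in> \<Union>\<P>" by (elim exE conjE) (rule that)
  show thesis by (rule that[OF P(1) _ _ P(3) r(1)]) (use P(2) r(2) in simp_all)
qed

lemma pl_onI:
  assumes "finite I" "A \<subseteq> I \<rightarrow>\<^sub>E UNIV"
    and "\<And>x. x \<in> A \<Longrightarrow> \<exists>\<P> r. finite \<P> \<and> (\<forall>P\<in>\<P>. convex_polyhedron I P \<and> affine_map_on I J P f) \<and>
      \<Union>\<P> \<subseteq> A \<and> r > 0 \<and> (\<forall>y\<in>A. near I r x y \<longrightarrow> y \<in> \<Union>\<P>)"
  shows "pl_on I J A f"
  unfolding pl_on_def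
proof
  fix x assume x: "x \<in> A"
  from assms(3)[OF x] obtain \<P> r where P: "finite \<P>" "\<forall>P\<in>\<P>. convex_polyhedron I P \<and> affine_map_on I J P f"
      "\<Union>\<P> \<subseteq> A" "r > 0" "\<forall>y\<in>A. near I r x y \<longrightarrow> y \<in> \<Union>\<P>" by (elim exE conjE) (rule that)
  then have "x \<in> (subtopology (powertop_real I) A) interior_of \<Union>\<P>"
    unfolding interior_near[OF assms(1,2)] by (intro conjI exI[of _ r] x P)
  then show "\<exists>\<P>. finite \<P> \<and> (\<forall>P\<in>\<P>. convex_polyhedron I P \<and> affine_map_on I J P f) \<and>
        \<Union>\<P> \<subseteq> A \<and> x \<in> (subtopology (powertop_real I) A) interior_of \<Union>\<P>"
    by (intro exI[of _ \<P>] conjI P)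
qed

lemma pl_on_finite_union:
  assumes "finite \<P>" "\<And>P. P \<in> \<P> \<Longrightarrow> convex_polyhedron I P" "\<And>P. P \<in> \<P> \<Longrightarrow> affine_map_on I J P f"
    "A = \<Union>\<P>" "finite I"
  shows "pl_on I J A f"
proof (rule pl_onI[OF assms(5)])
  show "A \<subseteq> I \<rightarrow>\<^sub>E UNIV" using assms(2,4) convex_polyhedron_extensional by blast
  show "\<exists>\<P> r. finite \<P> \<and> (\<forall>P\<in>\<P>. convex_polyhedron I P \<and> affine_map_on I J P f) \<and>
      \<Union>\<P> \<subseteq> A \<and> r > 0 \<and> (\<forall>y\<in>A. near I r x y \<longrightarrow> y \<in> \<Union>\<P>)" for x
    using assms by (intro exI[of _ \<P>] exI[of _ 1]) auto
qed

lemma pl_on_polyhedral: "pl_on I J A f \<Longrightarrow> polyhedral I A"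
  unfolding pl_on_def polyhedral_def by meson

lemma polyhedral_pl_on_id: "finite I \<Longrightarrow> polyhedral I A \<Longrightarrow> pl_on I I A (\<lambda>x. x)"
proof -
  assume I: "finite I" and A: "polyhedral I A"
  have "affine_map_on I I P (\<lambda>x. x)" for P
    unfolding affine_map_on_def
    by (intro exI[of _ "\<lambda>j i. if i = j then 1 else 0"] exI[of _ "\<lambda>_. 0"]) (simp add: sum_unit_vector[OF I])
  then show ?thesis using A unfolding pl_on_def polyhedral_def by simp
qed

lemma pl_on_cong:
  assumes "pl_on I J A f" "\<And>x j. x \<in> A \<Longrightarrow> j \<in> J \<Longrightarrow> g x j = f x j"
  shows "pl_on I J A g"
  unfolding pl_on_def
proof
  fix x assume x: "x \<in> A"
  from assms(1)[unfolded pl_on_def, rule_format, OF x]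
  obtain \<P> where P: "finite \<P>" "\<forall>P\<in>\<P>. convex_polyhedron I P \<and> affine_map_on I J P f" "\<Union>\<P> \<subseteq> A"
    "x \<in> (subtopology (powertop_real I) A) interior_of \<Union>\<P>"
    by (elim exE conjE) (rule that)
  have "affine_map_on I J P g" if "P \<in> \<P>" for P
    by (rule affine_map_on_cong[of I J P f]) (use P that assms(2) in auto)
  then show "\<exists>\<P>. finite \<P> \<and> (\<forall>P\<in>\<P>. convex_polyhedron I P \<and> affine_map_on I J P g) \<and>
        \<Union>\<P> \<subseteq> A \<and> x \<in> (subtopology (powertop_real I) A) interior_of \<Union>\<P>"
    using P by (intro exI[of _ \<P>] conjI) simp_all
qed

text \<open>
  Near \<open>x\<close> only finitely many pieces matter. Those that do not contain \<open>x\<close> are at positive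
  distance from it, and on the others the map is affine and hence Lipschitz.
\<close>

lemma pl_on_continuous:
  assumes f: "pl_on I J A f" and I: "finite I" and J: "finite J" and A: "A \<subseteq> I \<rightarrow>\<^sub>E UNIV" and x: "x \<in> A" and e: "0 < e"
  shows "\<exists>r>0. \<forall>y\<in>A. near I r x y \<longrightarrow> near J e (f x) (f y)"
proof -
  obtain \<P> r where P0: "finite \<P>" "\<forall>P\<in>\<P>. convex_polyhedron I P" "\<forall>P\<in>\<P>. affine_map_on I J P f"
    "\<Union>\<P> \<subseteq> A" "r > 0" "\<forall>y\<in>A. near I r x y \<longrightarrow> y \<in> \<Union>\<P>" by (rule pl_onE[OF f I A x])
  note P = P0(1) bspec[OF P0(2)] bspec[OF P0(3)] P0(4,5) bspec[OF P0(6), THEN mp]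
  have "\<forall>P\<in>\<P>. \<exists>r>0. \<forall>y\<in>P. near I r x y \<longrightarrow> near J e (f x) (f y)"
  proof
    fix P assume Pm: "P \<in> \<P>"
    show "\<exists>r>0. \<forall>y\<in>P. near I r x y \<longrightarrow> near J e (f x) (f y)"
    proof (cases "x \<in> P")
      case False
      have "x \<in> I \<rightarrow>\<^sub>E UNIV" using x A by blast
      from convex_polyhedron_far[OF I P(2)[OF Pm] this False]
      obtain r where r: "0 < r" "\<forall>y\<in>P. \<not> near I r x y" by (elim exE conjE) (rule that)
      show ?thesis
        by (rule exI[of _ r]) (intro conjI ballI impI r(1), erule notE[OF bspec[OF r(2)], rotated])
    next
      case True
      obtain a b where ab0: "\<forall>x\<in>P. \<forall>j\<in>J. f x j = b j + (\<Sum>i\<in>I. a j i * x i)"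
        by (rule affine_map_onE[OF P(3)[OF Pm]])
      note ab = ab0[rule_format]
      \<comment> \<open>The summand 1 makes \<open>M\<close> positive and the next inequality strict.\<close>
      define M where "M = (\<Sum>j\<in>J. \<Sum>i\<in>I. \<bar>a j i\<bar>) + 1"
      have M: "0 < M" by (auto simp: M_def intro!: add_nonneg_pos sum_nonneg)
      have Mj: "(\<Sum>i\<in>I. \<bar>a j i\<bar>) < M" if "j \<in> J" for j
        using member_le_sum[of j J "\<lambda>j. \<Sum>i\<in>I. \<bar>a j i\<bar>"] that J by (simp add: M_def sum_nonneg)
      have "\<bar>f y j - f x j\<bar> < e" if y: "y \<in> P" and n: "near I (e / M) x y" and j: "j \<in> J" for y j
      proof -
        have "\<bar>f y j - f x j\<bar> = \<bar>\<Sum>i\<in>I. a j i * (y i - x i)\<bar>"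
          using ab[OF y j] ab[OF True j] by (simp add: sum_subtractf right_diff_distrib)
        also have "\<dots> \<le> (\<Sum>i\<in>I. \<bar>a j i * (y i - x i)\<bar>)" by (rule sum_abs)
        also have "\<dots> \<le> (\<Sum>i\<in>I. \<bar>a j i\<bar> * (e / M))"
        proof (rule sum_mono)
          fix i assume "i \<in> I"
          then have "\<bar>y i - x i\<bar> \<le> e / M" using n by (meson less_imp_le)
          then show "\<bar>a j i * (y i - x i)\<bar> \<le> \<bar>a j i\<bar> * (e / M)" unfolding abs_mult by (rule mult_left_mono) simp
        qed
        also have "\<dots> = (\<Sum>i\<in>I. \<bar>a j i\<bar>) * (e / M)" by (rule sum_distrib_right[symmetric])
        also have "\<dots> < M * (e / M)" using Mj[OF j] e M by (intro mult_strict_right_mono) auto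
        also have "\<dots> = e" using M by simp
        finally show ?thesis .
      qed
      then show ?thesis using e M by (intro exI[of _ "e / M"]) auto
    qed
  qed
  then obtain \<rho> where \<rho>: "\<forall>P\<in>\<P>. 0 < \<rho> P \<and> (\<forall>y\<in>P. near I (\<rho> P) x y \<longrightarrow> near J e (f x) (f y))" by (rule bchoice[THEN exE])
  define s where "s = Min (insert r (\<rho> ` \<P>))"
  have s: "0 < s" "s \<le> r" "\<And>P. P \<in> \<P> \<Longrightarrow> s \<le> \<rho> P" using \<rho> P(1,5) by (auto simp: s_def)
  have "near J e (f x) (f y)" if y: "y \<in> A" "near I s x y" for y
  proof -
    have "near I r x y" using y(2) s(2) by force
    then obtain P where Pm: "P \<in> \<P>" "y \<in> P" using P(6)[OF y(1)] by blast
    then have "near I (\<rho> P) x y" using y(2) s(3) by force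
    then show ?thesis using \<rho> Pm by blast
  qed
  then show ?thesis using s(1) by blast
qed

lemma pl_on_open_subset:
  assumes f: "pl_on I J A f" and I: "finite I" and A: "A \<subseteq> I \<rightarrow>\<^sub>E UNIV" and B: "openin (subtopology (powertop_real I) A) B"
  shows "pl_on I J B f"
proof (rule pl_onI[OF I])
  have BA: "B \<subseteq> A" and Bo: "\<And>x. x \<in> B \<Longrightarrow> \<exists>r>0. \<forall>y\<in>A. near I r x y \<longrightarrow> y \<in> B"
    using B unfolding openin_subtopology_near[OF I A] by auto
  show "B \<subseteq> I \<rightarrow>\<^sub>E UNIV" using BA A by blast
  fix x assume x: "x \<in> B"
  then have xA: "x \<in> A" using BA by blast
  obtain \<P> r where P0: "finite \<P>" "\<forall>P\<in>\<P>. convex_polyhedron I P" "\<forall>P\<in>\<P>. affine_map_on I J P f"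
    "\<Union>\<P> \<subseteq> A" "r > 0" "\<forall>y\<in>A. near I r x y \<longrightarrow> y \<in> \<Union>\<P>" by (rule pl_onE[OF f I A xA])
  note P = P0(1) bspec[OF P0(2)] bspec[OF P0(3)] P0(4,5) bspec[OF P0(6), THEN mp]
  from Bo[OF x] obtain s where s0: "0 < s" "\<forall>y\<in>A. near I s x y \<longrightarrow> y \<in> B" by (elim exE conjE) (rule that)
  note s = s0(1) bspec[OF s0(2), THEN mp]
  \<comment> \<open>Cutting the pieces off by a closed box around \<open>x\<close> makes them fit into \<open>B\<close>.\<close>
  define C where "C = {y \<in> I \<rightarrow>\<^sub>E UNIV. \<forall>i\<in>I. \<bar>y i - x i\<bar> \<le> s / 2}"
  have C: "convex_polyhedron I C" unfolding C_def by (rule convex_polyhedron_box[OF I])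
  have Cn: "near I s x y" if "y \<in> C" for y using that s(1) by (force simp: C_def)
  define t where "t = min r (s / 2)"
  have "y \<in> \<Union>((\<lambda>P. P \<inter> C) ` \<P>)" if y: "y \<in> B" "near I t x y" for y
  proof -
    have "near I r x y" "\<forall>i\<in>I. \<bar>y i - x i\<bar> \<le> s / 2" using y(2) by (force simp: t_def)+
    moreover have "y \<in> A" "y \<in> I \<rightarrow>\<^sub>E UNIV" using y(1) BA A by auto
    ultimately show ?thesis using P(6)[of y] by (auto simp: C_def)
  qed
  moreover have "0 < t" using P(5) s(1) by (simp add: t_def)
  moreover have "\<Union>((\<lambda>P. P \<inter> C) ` \<P>) \<subseteq> B" using P(4) s(2) Cn by blast
  moreover have "\<forall>P\<in>(\<lambda>P. P \<inter> C) ` \<P>. convex_polyhedron I P \<and> affine_map_on I J P f"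
    using convex_polyhedron_Int[OF P(2) C] affine_map_on_subset[OF P(3)] by auto
  ultimately show "\<exists>\<P> r. finite \<P> \<and> (\<forall>P\<in>\<P>. convex_polyhedron I P \<and> affine_map_on I J P f) \<and>
      \<Union>\<P> \<subseteq> B \<and> r > 0 \<and> (\<forall>y\<in>B. near I r x y \<longrightarrow> y \<in> \<Union>\<P>)"
    using P(1) by (intro exI[of _ "(\<lambda>P. P \<inter> C) ` \<P>"] exI[of _ t]) auto
qed

lemma affine_map_on_compose:
  assumes f: "affine_map_on I J P f" and g: "affine_map_on J K Q g" and "\<And>x. x \<in> P \<Longrightarrow> f x \<in> Q"
  shows "affine_map_on I K P (g \<circ> f)"
proof -
  obtain a b where ab0: "\<forall>x\<in>P. \<forall>j\<in>J. f x j = b j + (\<Sum>i\<in>I. a j i * x i)"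
    by (rule affine_map_onE[OF f])
  note ab = ab0[rule_format]
  obtain c d where cd0: "\<forall>x\<in>Q. \<forall>j\<in>K. g x j = d j + (\<Sum>i\<in>J. c j i * x i)"
    by (rule affine_map_onE[OF g])
  note cd = cd0[rule_format]
  have "(g \<circ> f) x k = (d k + (\<Sum>j\<in>J. c k j * b j)) + (\<Sum>i\<in>I. (\<Sum>j\<in>J. c k j * a j i) * x i)" if "x \<in> P" "k \<in> K" for x k
  proof -
    have "(g \<circ> f) x k = d k + (\<Sum>j\<in>J. c k j * (b j + (\<Sum>i\<in>I. a j i * x i)))"
      using cd[OF assms(3)[OF that(1)] that(2)] ab[OF that(1)] by simp
    also have "\<dots> = d k + ((\<Sum>j\<in>J. c k j * b j) + (\<Sum>j\<in>J. \<Sum>i\<in>I. c k j * a j i * x i))"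
      by (simp add: distrib_left sum.distrib sum_distrib_left mult.assoc)
    finally show ?thesis by (simp add: sum_distrib_right sum.swap[of _ I J])
  qed
  then show ?thesis unfolding affine_map_on_def
    by (intro exI[of _ "\<lambda>k i. \<Sum>j\<in>J. c k j * a j i"] exI[of _ "\<lambda>k. d k + (\<Sum>j\<in>J. c k j * b j)"]) simp
qed

text \<open>
  The pieces of the composition are the preimages, in the pieces of \<open>f\<close>, of the pieces of \<open>g\<close>;
  continuity of \<open>f\<close> ensures that they cover a neighbourhood.
\<close>

lemma pl_on_compose:
  assumes f: "pl_on I J A f" and g: "pl_on J K B g" and I: "finite I" and J: "finite J"
    and A: "A \<subseteq> I \<rightarrow>\<^sub>E UNIV" and B: "B \<subseteq> J \<rightarrow>\<^sub>E UNIV" and fAB: "\<And>x. x \<in> A \<Longrightarrow> f x \<in> B"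
  shows "pl_on I K A (g \<circ> f)"
proof (rule pl_onI[OF I A])
  fix x assume x: "x \<in> A"
  obtain \<P> r where P0: "finite \<P>" "\<forall>P\<in>\<P>. convex_polyhedron I P" "\<forall>P\<in>\<P>. affine_map_on I J P f"
    "\<Union>\<P> \<subseteq> A" "r > 0" "\<forall>y\<in>A. near I r x y \<longrightarrow> y \<in> \<Union>\<P>" by (rule pl_onE[OF f I A x])
  note P = P0(1) bspec[OF P0(2)] bspec[OF P0(3)] P0(4,5) bspec[OF P0(6), THEN mp]
  obtain \<Q> s where Q0: "finite \<Q>" "\<forall>P\<in>\<Q>. convex_polyhedron J P" "\<forall>P\<in>\<Q>. affine_map_on J K P g"
    "\<Union>\<Q> \<subseteq> B" "s > 0" "\<forall>y\<in>B. near J s (f x) y \<longrightarrow> y \<in> \<Union>\<Q>" by (rule pl_onE[OF g J B fAB[OF x]])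
  note Q = Q0(1) bspec[OF Q0(2)] bspec[OF Q0(3)] Q0(4,5) bspec[OF Q0(6), THEN mp]
  from pl_on_continuous[OF f I J A x Q(5)]
  obtain t where t0: "0 < t" "\<forall>y\<in>A. near I t x y \<longrightarrow> near J s (f x) (f y)" by (elim exE conjE) (rule that)
  note t = t0(1) bspec[OF t0(2), THEN mp]
  define R where "R = (\<lambda>(P, Q). {y \<in> P. f y \<in> Q}) ` (\<P> \<times> \<Q>)"
  have "convex_polyhedron I T \<and> affine_map_on I K T (g \<circ> f)" if "T \<in> R" for T
  proof -
    obtain z where z: "T = (\<lambda>(P, Q). {y \<in> P. f y \<in> Q}) z" "z \<in> \<P> \<times> \<Q>" using \<open>T \<in> R\<close> unfolding R_def by (rule imageE)
    then obtain P' Q' where PQ: "P' \<in> \<P>" "Q' \<in> \<Q>" "T = {y \<in> P'. f y \<in> Q'}" by auto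
    have "f y \<in> J \<rightarrow>\<^sub>E UNIV" if "y \<in> P'" for y using that PQ(1) P(4) fAB B by blast
    then have "convex_polyhedron I T" unfolding PQ(3)
      by (rule convex_polyhedron_vimage[OF P(2)[OF PQ(1)] Q(2)[OF PQ(2)] P(3)[OF PQ(1)]])
    moreover have "affine_map_on I K T (g \<circ> f)"
      by (rule affine_map_on_compose[OF affine_map_on_subset[OF P(3)[OF PQ(1)]] Q(3)[OF PQ(2)]]) (auto simp: PQ(3))
    ultimately show ?thesis by simp
  qed
  moreover have "finite R" using P(1) Q(1) by (simp add: R_def)
  moreover have "\<Union>R \<subseteq> A" using P(4) by (auto simp: R_def)
  moreover have "y \<in> \<Union>R" if y: "y \<in> A" "near I (min r t) x y" for y
  proof -
    have "near I r x y" "near I t x y" using y(2) by auto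
    then obtain P' Q' where "P' \<in> \<P>" "y \<in> P'" "Q' \<in> \<Q>" "f y \<in> Q'"
      using P(6)[OF y(1)] Q(6)[OF fAB[OF y(1)] t(2)[OF y(1)]] by auto
    then have "y \<in> (\<lambda>(P, Q). {y \<in> P. f y \<in> Q}) (P', Q')" "(P', Q') \<in> \<P> \<times> \<Q>" by auto
    then show ?thesis unfolding R_def by (meson UN_I)
  qed
  ultimately show "\<exists>\<P> r. finite \<P> \<and> (\<forall>P\<in>\<P>. convex_polyhedron I P \<and> affine_map_on I K P (g \<circ> f)) \<and>
      \<Union>\<P> \<subseteq> A \<and> r > 0 \<and> (\<forall>y\<in>A. near I r x y \<longrightarrow> y \<in> \<Union>\<P>)"
    using P(5) t(1) by (intro exI[of _ R] exI[of _ "min r t"]) auto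
qed

section \<open>Global charts\<close>

lemma is_pl_chart_facts:
  assumes "is_pl_chart X (U, I, \<phi>)"
  shows "openin X U" "finite I" "polyhedral I (\<phi> ` U)" "inj_on \<phi> U" "\<phi> ` U \<subseteq> I \<rightarrow>\<^sub>E UNIV"
    and "openin X W \<Longrightarrow> openin (subtopology (powertop_real I) (\<phi> ` U)) (\<phi> ` (U \<inter> W))"
proof -
  show U: "openin X U" "finite I" "polyhedral I (\<phi> ` U)" using assms by (auto simp: is_pl_chart_def)
  have h: "homeomorphic_map (subtopology X U) (subtopology (powertop_real I) (\<phi> ` U)) \<phi>"
    using assms by (simp add: is_pl_chart_def)
  have t: "topspace (subtopology X U) = U" using openin_subset[OF U(1)] by (simp add: Int_absorb1)
  show "inj_on \<phi> U" using homeomorphic_imp_injective_map[OF h] t by simp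
  have "\<phi> ` U = topspace (subtopology (powertop_real I) (\<phi> ` U))"
    using homeomorphic_imp_surjective_map[OF h] t by simp
  also have "\<dots> \<subseteq> I \<rightarrow>\<^sub>E UNIV" by auto
  finally show "\<phi> ` U \<subseteq> I \<rightarrow>\<^sub>E UNIV" .
  show "openin (subtopology (powertop_real I) (\<phi> ` U)) (\<phi> ` (U \<inter> W))" if "openin X W"
  proof -
    have "openin (subtopology X U) (U \<inter> W)" using that U(1) by (simp add: openin_open_subtopology openin_Int)
    then show ?thesis using homeomorphic_imp_open_map[OF h] by (simp add: open_map_def)
  qed
qed

definition compatible_charts :: "'x topology \<Rightarrow> ('x, 'i) pl_chart \<Rightarrow> ('x, 'i) pl_chart set" where
  "compatible_charts X c = {d. is_pl_chart X d \<and> pl_compatible d c}"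

text \<open>
  Compatibility is not transitive in general, since nothing is known where the middle chart is
  not defined. A global chart is defined everywhere.
\<close>

lemma pl_on_via_global_chart:
  assumes c: "is_pl_chart X (topspace X, K, \<kappa>)" and d: "is_pl_chart X (U, I, \<phi>)" and e: "is_pl_chart X (W, J, \<psi>)"
    and dc: "pl_compatible (U, I, \<phi>) (topspace X, K, \<kappa>)" and ec: "pl_compatible (W, J, \<psi>) (topspace X, K, \<kappa>)"
  shows "pl_on I J (\<phi> ` (U \<inter> W)) (\<psi> \<circ> the_inv_into U \<phi>)"
proof -
  note c' = is_pl_chart_facts[OF c] and d' = is_pl_chart_facts[OF d] and e' = is_pl_chart_facts[OF e]
  have UX: "U \<inter> topspace X = U" "topspace X \<inter> W = W" "W \<inter> topspace X = W"
    using openin_subset[OF d'(1)] openin_subset[OF e'(1)] by auto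
  have 1: "pl_on I K (\<phi> ` U) (\<kappa> \<circ> the_inv_into U \<phi>)" using dc UX by (simp add: pl_compatible_def)
  have 1: "pl_on I K (\<phi> ` (U \<inter> W)) (\<kappa> \<circ> the_inv_into U \<phi>)"
    by (rule pl_on_open_subset[OF 1 d'(2) d'(5) d'(6)[OF e'(1)]])
  have 2: "pl_on K J (\<kappa> ` W) (\<psi> \<circ> the_inv_into (topspace X) \<kappa>)" using ec UX by (simp add: pl_compatible_def Int_commute)
  have "pl_on I J (\<phi> ` (U \<inter> W)) ((\<psi> \<circ> the_inv_into (topspace X) \<kappa>) \<circ> (\<kappa> \<circ> the_inv_into U \<phi>))"
  proof (rule pl_on_compose[OF 1 2 d'(2) c'(2)])
    show "\<phi> ` (U \<inter> W) \<subseteq> I \<rightarrow>\<^sub>E UNIV" using d'(5) by blast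
    show "\<kappa> ` W \<subseteq> K \<rightarrow>\<^sub>E UNIV" using c'(5) openin_subset[OF e'(1)] by blast
    show "(\<kappa> \<circ> the_inv_into U \<phi>) x \<in> \<kappa> ` W" if "x \<in> \<phi> ` (U \<inter> W)" for x
      using that the_inv_into_f_f[OF d'(4)] by auto
  qed
  then show ?thesis
  proof (rule pl_on_cong)
    fix x j assume "x \<in> \<phi> ` (U \<inter> W)"
    then obtain u where u: "u \<in> U" "u \<in> W" "x = \<phi> u" by auto
    then have "u \<in> topspace X" using openin_subset[OF d'(1)] by blast
    then show "(\<psi> \<circ> the_inv_into U \<phi>) x j =
        ((\<psi> \<circ> the_inv_into (topspace X) \<kappa>) \<circ> (\<kappa> \<circ> the_inv_into U \<phi>)) x j"
      using u the_inv_into_f_f[OF d'(4) u(1)] the_inv_into_f_f[OF c'(4)] by simp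
  qed
qed

lemma global_chart_self_compatible:
  assumes "is_pl_chart X (U, K, \<kappa>)" shows "pl_compatible (U, K, \<kappa>) (U, K, \<kappa>)"
proof -
  note c = is_pl_chart_facts[OF assms]
  have "pl_on K K (\<kappa> ` U) (\<kappa> \<circ> the_inv_into U \<kappa>)"
    by (rule pl_on_cong[OF polyhedral_pl_on_id[OF c(2,3)]]) (use f_the_inv_into_f[OF c(4)] in simp)
  then show ?thesis by (simp add: pl_compatible_def)
qed

text \<open>
  Any atlas containing \<open>c\<close> consists of charts compatible with \<open>c\<close>, and these are pairwise
  compatible via \<open>c\<close>. So they form the largest atlas containing \<open>c\<close>.
\<close>

lemma pl_structure_of_global_chart:
  assumes c: "is_pl_chart X c" and top: "fst c = topspace X"
  shows "pl_structure X (compatible_charts X c)" "c \<in> compatible_charts X c"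
    and "pl_structure X \<S> \<Longrightarrow> c \<in> \<S> \<Longrightarrow> \<S> = compatible_charts X c"
proof -
  obtain K \<kappa> where ce: "c = (topspace X, K, \<kappa>)" using top by (metis prod.collapse)
  note c0 = c[unfolded ce]
  show mem: "c \<in> compatible_charts X c"
    using c global_chart_self_compatible[OF c0] by (simp add: compatible_charts_def ce)
  have pairwise: "pl_compatible d e" if "d \<in> compatible_charts X c" "e \<in> compatible_charts X c" for d e
  proof -
    obtain U I \<phi> W J \<psi> where de: "d = (U, I, \<phi>)" "e = (W, J, \<psi>)" by (metis prod_cases3)
    have "is_pl_chart X (U, I, \<phi>)" "is_pl_chart X (W, J, \<psi>)"
      "pl_compatible (U, I, \<phi>) (topspace X, K, \<kappa>)" "pl_compatible (W, J, \<psi>) (topspace X, K, \<kappa>)"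
      using that by (auto simp: compatible_charts_def de ce)
    then show ?thesis
      using pl_on_via_global_chart[OF c0, of U I \<phi> W J \<psi>] pl_on_via_global_chart[OF c0, of W J \<psi> U I \<phi>]
      by (simp add: pl_compatible_def de Int_commute)
  qed
  then have atlas: "pl_atlas X (compatible_charts X c)"
    unfolding pl_atlas_def using mem top by (auto simp: compatible_charts_def)
  have maximal: "\<A> \<subseteq> compatible_charts X c" if "pl_atlas X \<A>" "c \<in> \<A>" for \<A>
    using that by (auto simp: pl_atlas_def compatible_charts_def)
  show "pl_structure X (compatible_charts X c)"
    unfolding pl_structure_def using atlas maximal mem by blast
  show "\<S> = compatible_charts X c" if "pl_structure X \<S>" "c \<in> \<S>"
    using that atlas maximal[of \<S>] unfolding pl_structure_def by metis
qed

text \<open>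
  In the two global charts the map \<open>s\<close> is an inclusion, so in all other charts it is a
  composition of changes of charts.
\<close>

lemma pl_map_of_global_charts:
  assumes c: "is_pl_chart X (topspace X, K, \<kappa>)" and d: "is_pl_chart Y (topspace Y, K, \<mu>)"
    and s: "continuous_map X Y s" and \<kappa>: "\<And>x. x \<in> topspace X \<Longrightarrow> \<kappa> x = \<mu> (s x)"
  shows "pl_map X (compatible_charts X (topspace X, K, \<kappa>)) Y (compatible_charts Y (topspace Y, K, \<mu>)) s"
  unfolding pl_map_def
proof (intro conjI s ballI, clarify)
  fix U I \<phi> W J \<psi>
  assume a: "(U, I, \<phi>) \<in> compatible_charts X (topspace X, K, \<kappa>)" "(W, J, \<psi>) \<in> compatible_charts Y (topspace Y, K, \<mu>)"
  then have a': "is_pl_chart X (U, I, \<phi>)" "is_pl_chart Y (W, J, \<psi>)" by (auto simp: compatible_charts_def)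
  note c' = is_pl_chart_facts[OF c] and d' = is_pl_chart_facts[OF d]
    and u' = is_pl_chart_facts[OF a'(1)] and w' = is_pl_chart_facts[OF a'(2)]
  have UX: "U \<inter> topspace X = U" "W \<inter> topspace Y = W"
    using openin_subset[OF u'(1)] openin_subset[OF w'(1)] by auto
  define T where "T = {x \<in> topspace X. s x \<in> W}"
  have T: "openin X T" unfolding T_def by (rule openin_continuous_map_preimage[OF s w'(1)])
  have UT: "{x \<in> U. s x \<in> W} = U \<inter> T" using UX by (auto simp: T_def)
  have 1: "pl_on I K (\<phi> ` U) (\<kappa> \<circ> the_inv_into U \<phi>)"
    using a(1) UX by (simp add: compatible_charts_def pl_compatible_def)
  have 1: "pl_on I K (\<phi> ` (U \<inter> T)) (\<kappa> \<circ> the_inv_into U \<phi>)"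
    by (rule pl_on_open_subset[OF 1 u'(2) u'(5) u'(6)[OF T]])
  have 2: "pl_on K J (\<mu> ` W) (\<psi> \<circ> the_inv_into (topspace Y) \<mu>)"
    using a(2) UX by (simp add: compatible_charts_def pl_compatible_def Int_commute)
  have val: "\<exists>u\<in>U. u \<in> T \<and> x = \<phi> u \<and> the_inv_into U \<phi> x = u \<and> \<kappa> u = \<mu> (s u) \<and> s u \<in> W
      \<and> the_inv_into (topspace Y) \<mu> (\<mu> (s u)) = s u" if x: "x \<in> \<phi> ` (U \<inter> T)" for x
  proof -
    from x obtain u where u: "u \<in> U" "u \<in> T" "x = \<phi> u" by auto
    then have "s u \<in> topspace Y" "u \<in> topspace X" "s u \<in> W"
      using openin_subset[OF w'(1)] by (auto simp: T_def)
    then show ?thesis using u the_inv_into_f_f[OF u'(4) u(1)] the_inv_into_f_f[OF d'(4)] \<kappa> by blast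
  qed
  have "pl_on I J (\<phi> ` (U \<inter> T)) ((\<psi> \<circ> the_inv_into (topspace Y) \<mu>) \<circ> (\<kappa> \<circ> the_inv_into U \<phi>))"
  proof (rule pl_on_compose[OF 1 2 u'(2) c'(2)])
    show "\<phi> ` (U \<inter> T) \<subseteq> I \<rightarrow>\<^sub>E UNIV" using u'(5) by blast
    show "\<mu> ` W \<subseteq> K \<rightarrow>\<^sub>E UNIV" using d'(5) openin_subset[OF w'(1)] by blast
    show "(\<kappa> \<circ> the_inv_into U \<phi>) x \<in> \<mu> ` W" if "x \<in> \<phi> ` (U \<inter> T)" for x
      using val[OF that] by auto
  qed
  then have "pl_on I J (\<phi> ` (U \<inter> T)) (\<psi> \<circ> s \<circ> the_inv_into U \<phi>)"
  proof (rule pl_on_cong)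
    fix x j assume "x \<in> \<phi> ` (U \<inter> T)"
    from val[OF this] show "(\<psi> \<circ> s \<circ> the_inv_into U \<phi>) x j =
        ((\<psi> \<circ> the_inv_into (topspace Y) \<mu>) \<circ> (\<kappa> \<circ> the_inv_into U \<phi>)) x j" by auto
  qed
  then show "pl_on I J (\<phi> ` {x \<in> U. s x \<in> W}) (\<psi> \<circ> s \<circ> the_inv_into U \<phi>)" by (simp only: UT)
qed

section \<open>Logarithmic images of semi-algebraic sets\<close>

lemma polys_real_polynomial:
  assumes "real_polynomial_function p" and m: "\<And>b. b \<in> Basis \<Longrightarrow> (\<lambda>z. m z \<bullet> b) \<in> polys I"
  shows "(\<lambda>z. p (m z :: 'a::euclidean_space)) \<in> polys I"
  using assms(1)
proof induction
  case (linear f)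
  interpret bounded_linear f by (rule linear)
  have "f (m z) = (\<Sum>b\<in>Basis. (m z \<bullet> b) * f b)" for z
  proof -
    have "f (m z) = f (\<Sum>b\<in>Basis. (m z \<bullet> b) *\<^sub>R b)" by (simp add: euclidean_representation)
    then show ?thesis by (simp add: sum scaleR)
  qed
  then show ?case using m by (simp add: polys_sum polys_mult polys_const)
qed (auto intro: polys_const polys_add polys_mult)

text \<open>
  The point of \<open>'a\<close> is given by coordinates \<open>m z\<close> that are polynomials in \<open>z\<close>; this allows
  several points sharing some coordinates, as are needed for the graphs of several functions
  over the same point.
\<close>

lemma definable_semialgebraic:
  assumes "semialgebraic A" and m: "\<And>b. b \<in> Basis \<Longrightarrow> (\<lambda>z. m z \<bullet> b) \<in> polys I"
  shows "definable I {z. (m z :: 'a::euclidean_space) \<in> A}"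
  using assms(1)
proof induction
  case (pos p)
  show ?case using definable_pos[OF polys_real_polynomial[OF pos m]] by simp
next
  case (zero p)
  have p: "(\<lambda>z. p (m z)) \<in> polys I" by (rule polys_real_polynomial[OF zero m])
  have "definable I (- {z. 0 < p (m z)} \<inter> - {z. 0 < - p (m z)})"
    by (intro definable_Int definable_compl definable_pos p polys_uminus)
  moreover have "- {z. 0 < p (m z)} \<inter> - {z. 0 < - p (m z)} = {z. m z \<in> {x. p x = 0}}" by auto
  ultimately show ?case by simp
next
  case (un A B)
  have "{z. m z \<in> A \<union> B} = {z. m z \<in> A} \<union> {z. m z \<in> B}" by auto
  then show ?case using definable_Un[OF un.IH] by simp
next
  case (int A B)
  have "{z. m z \<in> A \<inter> B} = {z. m z \<in> A} \<inter> {z. m z \<in> B}" by auto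
  then show ?case using definable_Int[OF int.IH] by simp
next
  case (compl A)
  have "{z. m z \<in> - A} = - {z. m z \<in> A}" by auto
  then show ?case using definable_compl[OF compl.IH] by simp
qed

lemma definable_INT: "finite A \<Longrightarrow> (\<And>a. a \<in> A \<Longrightarrow> definable I (S a)) \<Longrightarrow> definable I (\<Inter>a\<in>A. S a)"
  by (induction A rule: finite_induct) (auto intro: definable_UNIV definable_Int)

text \<open>
  The set \<open>X\<close> consists of the points of \<open>V\<close> together with the values of the functions in \<open>F\<close>, as
  coordinates of their own. It is definable since the graphs are semi-algebraic, and on it each
  function in \<open>F\<close> is a coordinate, hence a polynomial without zeros.
\<close>

theorem log_image_coarsely_conic:
  fixes V :: "'a::euclidean_space set"
  assumes V: "semialgebraic V" and F: "finite F" "\<And>f. f \<in> F \<Longrightarrow> semialgebraic_function_on V f"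
    "\<And>f. f \<in> F \<Longrightarrow> f ` V \<subseteq> {0<..}"
  shows "coarsely_conic F ((\<lambda>x f. ln (f x)) ` V)"
proof -
  define I where "I = (Inl ` Basis \<union> Inr ` F :: ('a + ('a \<Rightarrow> real)) set)"
  define base where "base = (\<lambda>z :: 'a + ('a \<Rightarrow> real) \<Rightarrow> real. \<Sum>b\<in>Basis. z (Inl b) *\<^sub>R b)"
  have base_b: "base z \<bullet> b = z (Inl b)" if "b \<in> Basis" for z b using that by (simp add: base_def)
  have base: "(\<lambda>z. base z \<bullet> b) \<in> polys I" if "b \<in> Basis" for b
    using that by (simp add: base_b polys_coord I_def)
  have coord: "(\<lambda>z. z (Inr f)) \<in> polys I" if "f \<in> F" for f using that by (simp add: polys_coord I_def)
  define gr where "gr = (\<lambda>f. {z. (base z, z (Inr f)) \<in> (\<lambda>x. (x, f x)) ` V})"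
  have "definable I (gr f)" if f: "f \<in> F" for f
    unfolding gr_def
  proof (rule definable_semialgebraic)
    show "semialgebraic ((\<lambda>x. (x, f x)) ` V)" using F(2)[OF f] by (simp add: semialgebraic_function_on_def)
    show "(\<lambda>z. (base z, z (Inr f)) \<bullet> b) \<in> polys I" if "b \<in> Basis" for b :: "'a \<times> real"
      using that base coord[OF f] by (auto simp: Basis_prod_def)
  qed
  then have "definable I ({z. base z \<in> V} \<inter> (\<Inter>f\<in>F. gr f))"
    by (intro definable_Int definable_INT F(1) definable_semialgebraic[OF V base])
  moreover define X where "X = {z. base z \<in> V} \<inter> (\<Inter>f\<in>F. gr f)"
  ultimately have X: "definable I X" by simp
  have Xf: "z (Inr f) = f (base z)" "base z \<in> V" if "z \<in> X" "f \<in> F" for z f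
    using that by (auto simp: X_def gr_def)
  have XV: "base z \<in> V" if "z \<in> X" for z using that by (simp add: X_def)
  have pos: "0 < f x" if "f \<in> F" "x \<in> V" for f x using F(3)[OF that(1)] that(2) by auto
  define co :: "('a \<Rightarrow> real) \<Rightarrow> ('a + ('a \<Rightarrow> real) \<Rightarrow> real) \<Rightarrow> real" where "co = (\<lambda>f z. z (Inr f))"
  have "conic_logs I X" by (rule definable_conic_logs[OF _ X]) (simp add: I_def F(1))
  then have "coarsely_conic (co ` F) ((\<lambda>z q. ln \<bar>q z\<bar>) ` X)"
    unfolding conic_logs_def using F(1) coord pos Xf
    by (elim allE[of _ "co ` F"]) (fastforce simp: co_def)
  then have cX: "coarsely_conic F ((\<lambda>z f. ln (f (base z))) ` X)"
  proof (rule coarsely_conic_PL_image[OF _ F(1), of _ _ _ "\<lambda>f u. u (co f)"])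
    fix f assume f: "f \<in> F"
    show "PL (co ` F) (\<lambda>u. u (co f))" using f by (intro PL_coordinate) simp
    show "\<exists>C. \<forall>b\<in>X. \<bar>ln (f (base b)) - ln \<bar>co f b\<bar>\<bar> \<le> C"
    proof (intro exI[of _ 0] ballI)
      fix b assume b: "b \<in> X"
      have "co f b = f (base b)" "0 < f (base b)" using Xf[OF b f] pos[OF f XV[OF b]] by (simp_all add: co_def)
      then show "\<bar>ln (f (base b)) - ln \<bar>co f b\<bar>\<bar> \<le> 0" by simp
    qed
  qed
  have eq: "(\<lambda>z f. ln (f (base z))) ` X = (\<lambda>x f. ln (f x)) ` V"
  proof
    show "(\<lambda>z f. ln (f (base z))) ` X \<subseteq> (\<lambda>x f. ln (f x)) ` V" using XV by auto
    show "(\<lambda>x f. ln (f x)) ` V \<subseteq> (\<lambda>z f. ln (f (base z))) ` X"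
    proof clarify
      fix x assume x: "x \<in> V"
      define z where "z = case_sum (\<lambda>b. x \<bullet> b) (\<lambda>f. f x)"
      have bz: "base z = x" by (simp add: base_def z_def euclidean_representation)
      then have "z \<in> X" using x by (auto simp: X_def gr_def z_def)
      then show "(\<lambda>f. ln (f x)) \<in> (\<lambda>z f. ln (f (base z))) ` X" using bz by force
    qed
  qed
  show ?thesis unfolding eq[symmetric] by (rule cX)
qed

section \<open>Linear functions on cones\<close>

text \<open>
  The vector with \<open>j\<close>-th coordinate \<open>e\<close> and with zeros at \<open>F\<close> is not in the projection of the
  cone, so one of the finitely many inequalities that describe the projection separates it from
  the cone.
\<close>

lemma ccone_separate:
  assumes H: "finite H" and F: "finite F" and j: "j \<notin> F" and e: "\<bar>e\<bar> = 1"
    and none: "\<And>p. p \<in> ccone H \<Longrightarrow> \<forall>f\<in>F. p f = 0 \<Longrightarrow> p j \<noteq> e"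
  shows "\<exists>a. \<forall>p\<in>ccone H. e * p j \<le> (\<Sum>f\<in>F. a f * p f)"
proof -
  from ccone_projection_halfspaces[OF H finite.insertI[OF F, of j]] obtain A where
    A: "\<forall>x. (\<exists>p\<in>ccone H. \<forall>i\<in>insert j F. x i = p i) \<longleftrightarrow> (\<forall>a\<in>A. (\<Sum>i\<in>insert j F. a i * x i) \<le> 0)"
    by (elim exE conjE) (rule that)
  define x where "x = (\<lambda>i. if i = j then e else (0::real))"
  have "\<not> (\<exists>p\<in>ccone H. \<forall>i\<in>insert j F. x i = p i)"
  proof
    assume "\<exists>p\<in>ccone H. \<forall>i\<in>insert j F. x i = p i"
    then obtain p where p: "p \<in> ccone H" "\<forall>i\<in>insert j F. x i = p i" by (rule bexE)
    have xp: "p f = x f" if "f \<in> insert j F" for f using bspec[OF p(2) that] by simp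
    have "p j = e" using xp[of j] by (simp add: x_def)
    moreover have "\<forall>f\<in>F. p f = 0"
    proof
      fix f assume f: "f \<in> F"
      then have "f \<noteq> j" using j by blast
      then show "p f = 0" using xp[of f] f by (simp add: x_def)
    qed
    ultimately show False using none[OF p(1)] by blast
  qed
  then obtain a where a: "a \<in> A" "0 < (\<Sum>i\<in>insert j F. a i * x i)" unfolding A[THEN spec] by (auto simp: not_le)
  have "(\<Sum>i\<in>F. a i * x i) = 0" using j by (intro sum.neutral) (auto simp: x_def)
  then have pos: "0 < a j * e" using a(2) F j by (simp add: x_def)
  show ?thesis
  proof (rule exI[of _ "\<lambda>f. - a f / (a j * e)"], rule ballI)
    fix p assume p: "p \<in> ccone H"
    then have "\<exists>q\<in>ccone H. \<forall>i\<in>insert j F. p i = q i" by blast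
    then have "(\<Sum>i\<in>insert j F. a i * p i) \<le> 0" using A a(1) by blast
    then have "a j * p j \<le> (\<Sum>f\<in>F. - a f * p f)" using F j by (simp add: sum_negf)
    moreover have "a j * p j = (a j * e) * (e * p j)" using unit_square[OF e] by (simp add: mult_ac)
    ultimately have "e * p j \<le> (\<Sum>f\<in>F. - a f * p f) / (a j * e)" using pos by (simp add: pos_le_divide_eq mult.commute)
    then show "e * p j \<le> (\<Sum>f\<in>F. - a f / (a j * e) * p f)" by (simp add: sum_divide_distrib)
  qed
qed

text \<open>
  If the coordinate \<open>j\<close> is determined by the coordinates in \<open>F\<close> on the cone, then differences of
  points of the cone that vanish at \<open>F\<close> vanish at \<open>j\<close>. These differences are the points of the
  linear span of the cone. On the span separation gives an inequality between linear functions,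
  which is an equality because the span is symmetric.
\<close>

lemma ccone_coordinate_linear:
  assumes H: "finite H" and F: "finite F"
    and det: "\<And>p q. p \<in> ccone H \<Longrightarrow> q \<in> ccone H \<Longrightarrow> \<forall>f\<in>F. p f = q f \<Longrightarrow> p j = q j"
  shows "\<exists>a. \<forall>p\<in>ccone H. p j = (\<Sum>f\<in>F. a f * p f)"
proof (cases "j \<in> F")
  case True
  then show ?thesis by (intro exI[of _ "\<lambda>i. if i = j then 1 else 0"]) (simp add: sum_unit_vector[OF F])
next
  case False
  let ?N = "(\<lambda>h i. - h i) ` H"
  have fin: "finite (H \<union> ?N)" using H by simp
  have sub: "p \<in> ccone (H \<union> ?N)" "(\<lambda>i. - p i) \<in> ccone (H \<union> ?N)" if p: "p \<in> ccone H" for p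
  proof -
    obtain c where c: "\<forall>h\<in>H. 0 \<le> c h" "p = (\<lambda>i. \<Sum>h\<in>H. c h * h i)" using p by (auto simp: ccone_def)
    show "p \<in> ccone (H \<union> ?N)"
      unfolding c(2) by (rule ccone_sum[OF H]) (use c(1) generator_in_ccone[OF fin] in auto)
    have "(\<lambda>i. \<Sum>h\<in>H. c h * (- h i)) \<in> ccone (H \<union> ?N)"
      by (rule ccone_sum[OF H, of "\<lambda>h i. - h i"]) (use c(1) generator_in_ccone[OF fin] in auto)
    then show "(\<lambda>i. - p i) \<in> ccone (H \<union> ?N)" unfolding c(2) by (simp add: sum_negf)
  qed
  have diff: "\<exists>p\<in>ccone H. \<exists>q\<in>ccone H. r = (\<lambda>i. p i - q i)" if r: "r \<in> ccone (H \<union> ?N)" for r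
  proof -
    let ?D = "{r. \<exists>p\<in>ccone H. \<exists>q\<in>ccone H. r = (\<lambda>i. p i - q i)}"
    have mem: "(\<lambda>i. p i - q i) \<in> ?D" if "p \<in> ccone H" "q \<in> ccone H" for p q using that by blast
    have "ccone (H \<union> ?N) \<subseteq> ?D"
    proof (rule ccone_least[OF fin])
      have "h \<in> ?D \<and> (\<lambda>i. - h i) \<in> ?D" if "h \<in> H" for h
        using mem[OF generator_in_ccone[OF H that] zero_in_ccone] mem[OF zero_in_ccone generator_in_ccone[OF H that]] by simp
      then show "H \<union> ?N \<subseteq> ?D" by blast
      show "(\<lambda>i. 0) \<in> ?D" using mem[OF zero_in_ccone zero_in_ccone] by simp
    next
      fix x y assume "x \<in> ?D" "y \<in> ?D"
      then obtain p q p' q' where x: "p \<in> ccone H" "q \<in> ccone H" "x = (\<lambda>i. p i - q i)"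
        and y: "p' \<in> ccone H" "q' \<in> ccone H" "y = (\<lambda>i. p' i - q' i)" by blast
      have "(\<lambda>i. x i + y i) = (\<lambda>i. (p i + p' i) - (q i + q' i))" by (simp add: x y algebra_simps)
      then show "(\<lambda>i. x i + y i) \<in> ?D" using mem[OF ccone_add[OF x(1) y(1)] ccone_add[OF x(2) y(2)]] by simp
    next
      fix x and t :: real assume "x \<in> ?D" "0 \<le> t"
      then obtain p q where x: "p \<in> ccone H" "q \<in> ccone H" "x = (\<lambda>i. p i - q i)" by blast
      have "(\<lambda>i. t * x i) = (\<lambda>i. t * p i - t * q i)" by (simp add: x algebra_simps)
      then show "(\<lambda>i. t * x i) \<in> ?D"
        using mem[OF ccone_scale[OF x(1) \<open>0 \<le> t\<close>] ccone_scale[OF x(2) \<open>0 \<le> t\<close>]] by simp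
    qed
    then show ?thesis using r by blast
  qed
  have none: "r j \<noteq> 1" if r: "r \<in> ccone (H \<union> ?N)" and z: "\<forall>f\<in>F. r f = 0" for r
  proof -
    obtain p q where pq: "p \<in> ccone H" "q \<in> ccone H" "r = (\<lambda>i. p i - q i)" using diff[OF r] by blast
    then show ?thesis using det[OF pq(1,2)] z by simp
  qed
  have "\<exists>a. \<forall>p\<in>ccone (H \<union> ?N). 1 * p j \<le> (\<Sum>f\<in>F. a f * p f)"
    by (rule ccone_separate[OF fin F False]) (use none in auto)
  then obtain a where a: "\<forall>p\<in>ccone (H \<union> ?N). 1 * p j \<le> (\<Sum>f\<in>F. a f * p f)" by (rule exE)
  have "p j = (\<Sum>f\<in>F. a f * p f)" if p: "p \<in> ccone H" for p
    using bspec[OF a sub(1)[OF p]] bspec[OF a sub(2)[OF p]] by (simp add: sum_negf)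
  then show ?thesis by blast
qed

lemma closedin_convex_polyhedron:
  assumes I: "finite I" and P: "convex_polyhedron I P" shows "closedin (powertop_real I) P"
proof -
  have "openin (powertop_real I) ((I \<rightarrow>\<^sub>E UNIV) - P)"
    unfolding openin_powertop_near[OF I]
  proof (intro conjI ballI)
    fix x assume x: "x \<in> (I \<rightarrow>\<^sub>E UNIV) - P"
    from convex_polyhedron_far[OF I P, of x] x obtain r where r: "r > 0" "\<forall>y\<in>P. \<not> near I r x y" by auto
    then show "\<exists>r>0. \<forall>y\<in>I \<rightarrow>\<^sub>E UNIV. near I r x y \<longrightarrow> y \<in> (I \<rightarrow>\<^sub>E UNIV) - P" by (intro exI[of _ r]) auto
  qed auto
  then show ?thesis using convex_polyhedron_extensional[OF P] by (simp add: closedin_def)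
qed

section \<open>The cones of finite families and of the whole family\<close>

locale cone_data =
  fixes V :: "'a::euclidean_space set" and G :: "('a \<Rightarrow> real) set"
  assumes V: "semialgebraic V" and G: "semialgebraic_family V G"
begin

lemma G_pos: "f \<in> G \<Longrightarrow> x \<in> V \<Longrightarrow> 0 < f x"
  using G unfolding semialgebraic_family_def by blast

lemma G_continuous: "f \<in> G \<Longrightarrow> continuous_on V f"
  using G unfolding semialgebraic_family_def by blast

text \<open>
  One fan for all of \<open>F\<close> at once; it is used for the subfamilies of \<open>F\<close> as well, and thereby
  relates their cones.
\<close>

definition coarse_fan :: "('a \<Rightarrow> real) set \<Rightarrow> (('a \<Rightarrow> real) \<Rightarrow> real) set set \<Rightarrow> real \<Rightarrow> bool" where
  "coarse_fan F \<H> C \<longleftrightarrow> finite \<H> \<and> (\<forall>H\<in>\<H>. finite H) \<and> 0 \<le> C \<and>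
     (\<forall>x\<in>V. \<exists>p\<in>fan \<H>. \<forall>f\<in>F. \<bar>ln (f x) - p f\<bar> \<le> C) \<and>
     (\<forall>p\<in>fan \<H>. \<exists>x\<in>V. \<forall>f\<in>F. \<bar>ln (f x) - p f\<bar> \<le> C)"

lemma coarse_fan_exists:
  assumes "finite F" "F \<subseteq> G" obtains \<H> C where "coarse_fan F \<H> C"
proof -
  have "coarsely_conic F ((\<lambda>x f. ln (f x)) ` V)"
    by (rule log_image_coarsely_conic[OF V assms(1)]) (use G assms(2) in \<open>auto simp: semialgebraic_family_def subset_iff\<close>)
  then obtain \<H> C where h: "finite \<H>" "\<forall>H\<in>\<H>. finite H" "C \<ge> 0"
    "\<forall>x\<in>(\<lambda>x f. ln (f x)) ` V. \<exists>p\<in>fan \<H>. \<forall>j\<in>F. \<bar>x j - p j\<bar> \<le> C"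
    "\<forall>p\<in>fan \<H>. \<exists>x\<in>(\<lambda>x f. ln (f x)) ` V. \<forall>j\<in>F. \<bar>x j - p j\<bar> \<le> C"
    by (rule coarsely_conicE)
  have "coarse_fan F \<H> C" unfolding coarse_fan_def
  proof (intro conjI h(1-3))
    show "\<forall>x\<in>V. \<exists>p\<in>fan \<H>. \<forall>f\<in>F. \<bar>ln (f x) - p f\<bar> \<le> C" using h(4) unfolding ball_simps by simp
    show "\<forall>p\<in>fan \<H>. \<exists>x\<in>V. \<forall>f\<in>F. \<bar>ln (f x) - p f\<bar> \<le> C" using h(5) unfolding bex_simps by simp
  qed
  then show thesis by (rule that)
qed

lemma fan_scale: "p \<in> fan \<H> \<Longrightarrow> 0 \<le> r \<Longrightarrow> (\<lambda>f. r * p f) \<in> fan \<H>"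
  using ccone_scale by fastforce

text \<open>
  Points of the fan are limits because \<open>T p\<close> is again in the fan for every \<open>T > 0\<close>, hence at
  bounded distance from a logarithm of a value, and this distance disappears after division by
  \<open>T\<close>. Conversely, a limit of rescaled logarithms is a limit of rescaled points of the fan, and
  the projection of the fan is closed.
\<close>

lemma finite_cone_eq_fan:
  assumes h: "coarse_fan F \<H> C" and F: "finite F" "F' \<subseteq> F"
  shows "finite_cone V F' = (\<lambda>p. restrict p F') ` fan \<H>"
proof
  have F': "finite F'" using F by (rule finite_subset[rotated])
  show "(\<lambda>p. restrict p F') ` fan \<H> \<subseteq> finite_cone V F'"
  proof clarify
    fix H p assume "H \<in> \<H>" "p \<in> ccone H"
    then have p: "p \<in> fan \<H>" by blast
    \<comment> \<open>The shift by 2 gives \<open>t k < 1\<close> and \<open>T k > 0\<close> from the start.\<close>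
    define T where "T = (\<lambda>k::nat. ln (real k + 2))"
    have T: "0 < T k" for k by (simp add: T_def)
    have lin: "filterlim (\<lambda>k. real k + 2) at_top sequentially"
      using filterlim_tendsto_add_at_top[OF tendsto_const filterlim_real_sequentially, of 2] by (simp add: add.commute)
    have Tlim: "filterlim T at_top sequentially" unfolding T_def by (rule filterlim_compose[OF ln_at_top lin])
    define t where "t = (\<lambda>k::nat. 1 / (real k + 2))"
    have "\<forall>k. \<exists>x. x \<in> V \<and> (\<forall>f\<in>F. \<bar>ln (f x) - T k * p f\<bar> \<le> C)"
    proof
      fix k
      have "(\<lambda>f. T k * p f) \<in> fan \<H>" by (rule fan_scale[OF p less_imp_le[OF T]])
      then show "\<exists>x. x \<in> V \<and> (\<forall>f\<in>F. \<bar>ln (f x) - T k * p f\<bar> \<le> C)"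
        using h unfolding coarse_fan_def by fast
    qed
    then obtain x where x: "\<forall>k. x k \<in> V \<and> (\<forall>f\<in>F. \<bar>ln (f (x k)) - T k * p f\<bar> \<le> C)" by (rule choice[THEN exE])
    have lim: "(\<lambda>k. ln (f (x k)) / T k) \<longlonglongrightarrow> p f" if f: "f \<in> F'" for f
    proof -
      have b1: "\<bar>ln (f (x k)) / T k - p f\<bar> \<le> C / T k" for k
      proof -
        have "\<bar>ln (f (x k)) - T k * p f\<bar> \<le> C" using x f F(2) by blast
        moreover have "ln (f (x k)) / T k - p f = (ln (f (x k)) - T k * p f) / T k" using T[of k] by (simp add: field_simps)
        ultimately show ?thesis using T[of k] by (simp add: abs_divide divide_right_mono)
      qed
      have b2: "(\<lambda>k. C / T k) \<longlonglongrightarrow> 0"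
        by (rule tendsto_divide_0[OF tendsto_const filterlim_at_top_imp_at_infinity[OF Tlim]])
      have "(\<lambda>k. ln (f (x k)) / T k - p f) \<longlonglongrightarrow> 0"
        by (rule Lim_null_comparison[OF always_eventually b2]) (simp add: b1)
      then show ?thesis by (simp add: LIM_zero_iff)
    qed
    have log: "log (1 / t k) y = ln y / T k" for k y by (simp add: log_def t_def T_def)
    have "limitin (powertop_real F') (\<lambda>k. \<lambda>i\<in>F'. log (1 / t k) (eval_map F' (x k) i)) (restrict p F') sequentially"
      unfolding limitin_componentwise using lim by (auto simp: eval_map_def log)
    moreover have "t \<longlonglongrightarrow> 0" unfolding t_def
      by (rule tendsto_divide_0[OF tendsto_const filterlim_at_top_imp_at_infinity[OF lin]])
    moreover have "\<forall>k. 0 < t k \<and> t k < 1 \<and> eval_map F' (x k) \<in> eval_map F' ` V" using x by (simp add: t_def)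
    ultimately show "restrict p F' \<in> finite_cone V F'"
      unfolding finite_cone_def log_limit_set_def by (intro CollectI exI[of _ t] exI[of _ "\<lambda>k. eval_map F' (x k)"] conjI)
  qed
  show "finite_cone V F' \<subseteq> (\<lambda>p. restrict p F') ` fan \<H>"
  proof
    fix y assume "y \<in> finite_cone V F'"
    then obtain t w where t: "\<forall>k. 0 < t k \<and> t k < 1 \<and> w k \<in> eval_map F' ` V" "t \<longlonglongrightarrow> 0"
      and lim: "limitin (powertop_real F') (\<lambda>k. \<lambda>i\<in>F'. log (1 / t k) (w k i)) y sequentially"
      unfolding finite_cone_def log_limit_set_def by (elim CollectE exE conjE) (rule that)
    have "\<forall>k. \<exists>x. x \<in> V \<and> w k = eval_map F' x" using t(1) by blast
    then obtain x where x: "\<forall>k. x k \<in> V \<and> w k = eval_map F' (x k)" by (rule choice[THEN exE])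
    have "\<forall>k. \<exists>p. p \<in> fan \<H> \<and> (\<forall>f\<in>F. \<bar>ln (f (x k)) - p f\<bar> \<le> C)"
      using h x unfolding coarse_fan_def by fast
    then obtain p where p: "\<forall>k. p k \<in> fan \<H> \<and> (\<forall>f\<in>F. \<bar>ln (f (x k)) - p k f\<bar> \<le> C)" by (rule choice[THEN exE])
    define T where "T = (\<lambda>k. ln (1 / t k))"
    have T: "0 < T k" for k using t(1) by (simp add: T_def)
    have "filterlim t (at_right 0) sequentially"
      using t by (intro filterlim_at_withinI) (auto simp: eventually_sequentially)
    from filterlim_compose[OF ln_at_0 this] have "filterlim (\<lambda>k. - ln (t k)) at_top sequentially"
      by (simp add: filterlim_uminus_at_top)
    moreover have "T = (\<lambda>k. - ln (t k))" using t(1) by (simp add: T_def ln_div fun_eq_iff)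
    ultimately have Tlim: "filterlim T at_top sequentially" by simp
    define q where "q = (\<lambda>k. restrict (\<lambda>f. (1 / T k) * p k f) F')"
    have q: "q k \<in> (\<lambda>p. restrict p F') ` fan \<H>" for k
      unfolding q_def using p T[of k] by (intro imageI fan_scale) (auto intro: less_imp_le)
    have qlim: "(\<lambda>k. q k f) \<longlonglongrightarrow> y f" if f: "f \<in> F'" for f
    proof -
      have "limitin euclideanreal (\<lambda>k. (\<lambda>i\<in>F'. log (1 / t k) (w k i)) f) (y f) sequentially"
        using lim f unfolding limitin_componentwise by blast
      then have 1: "(\<lambda>k. ln (f (x k)) / T k) \<longlonglongrightarrow> y f"
        using f x by (simp add: log_def T_def eval_map_def)
      have b1: "\<bar>ln (f (x k)) / T k - q k f\<bar> \<le> C / T k" for k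
      proof -
        have "\<bar>ln (f (x k)) - p k f\<bar> \<le> C" using p f F(2) by blast
        moreover have "ln (f (x k)) / T k - q k f = (ln (f (x k)) - p k f) / T k" using f by (simp add: q_def diff_divide_distrib)
        ultimately show ?thesis using T[of k] by (simp add: abs_divide divide_right_mono)
      qed
      have b2: "(\<lambda>k. C / T k) \<longlonglongrightarrow> 0"
        by (rule tendsto_divide_0[OF tendsto_const filterlim_at_top_imp_at_infinity[OF Tlim]])
      have "(\<lambda>k. ln (f (x k)) / T k - q k f) \<longlonglongrightarrow> 0"
        by (rule Lim_null_comparison[OF always_eventually b2]) (simp add: b1)
      from tendsto_diff[OF 1 this] show ?thesis by simp
    qed
    have "limitin (powertop_real F') q y sequentially"
      unfolding limitin_componentwise
    proof (intro conjI ballI)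
      show "y \<in> extensional F'" using lim unfolding limitin_componentwise by blast
      show "\<forall>\<^sub>F k in sequentially. q k \<in> topspace (powertop_real F')" by (simp add: q_def)
      show "limitin euclideanreal (\<lambda>k. q k f) (y f) sequentially" if "f \<in> F'" for f using qlim[OF that] by simp
    qed
    moreover have "closedin (powertop_real F') ((\<lambda>p. restrict p F') ` fan \<H>)"
    proof -
      have "closedin (powertop_real F') (\<Union>H\<in>\<H>. (\<lambda>p. restrict p F') ` ccone H)"
        using h unfolding coarse_fan_def
        by (intro closedin_Union) (auto intro!: closedin_convex_polyhedron[OF F'] convex_polyhedron_ccone F')
      then show ?thesis by (simp add: image_UN)
    qed
    ultimately show "y \<in> (\<lambda>p. restrict p F') ` fan \<H>"
      by (rule limitin_closedin) (use q in auto)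
  qed
qed

lemma finite_cone_polyhedra:
  assumes "finite F" "F \<subseteq> G"
  obtains \<P> where "finite \<P>" "\<forall>P\<in>\<P>. convex_polyhedron F P" "finite_cone V F = \<Union>\<P>"
proof -
  obtain \<H> C where h: "coarse_fan F \<H> C" by (rule coarse_fan_exists[OF assms])
  show thesis
  proof (rule that[of "(\<lambda>H. (\<lambda>p. restrict p F) ` ccone H) ` \<H>"])
    show "finite_cone V F = \<Union>((\<lambda>H. (\<lambda>p. restrict p F) ` ccone H) ` \<H>)"
      unfolding finite_cone_eq_fan[OF h assms(1) order.refl] by (rule image_UN)
  qed (use h in \<open>auto simp: coarse_fan_def intro: convex_polyhedron_ccone assms(1)\<close>)
qed

lemma finite_cone_extensional: "finite F \<Longrightarrow> F \<subseteq> G \<Longrightarrow> finite_cone V F \<subseteq> F \<rightarrow>\<^sub>E UNIV"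
  by (rule finite_cone_polyhedra[of F]) (auto dest!: convex_polyhedron_extensional)

lemma closedin_finite_cone:
  assumes "finite F" "F \<subseteq> G" shows "closedin (powertop_real F) (finite_cone V F)"
proof -
  obtain \<P> where P: "finite \<P>" "\<forall>P\<in>\<P>. convex_polyhedron F P" "finite_cone V F = \<Union>\<P>"
    by (rule finite_cone_polyhedra[OF assms])
  show ?thesis unfolding P(3) by (rule closedin_Union[OF P(1)]) (use P(2) closedin_convex_polyhedron[OF assms(1)] in auto)
qed

text \<open>
  Both cones are projections of the same fan.
\<close>

lemma finite_cone_projection:
  assumes "finite F" "F \<subseteq> G" "F' \<subseteq> F"
  shows "finite_cone V F' = (\<lambda>y. restrict y F') ` finite_cone V F"
proof -
  obtain \<H> C where h: "coarse_fan F \<H> C" by (rule coarse_fan_exists[OF assms(1,2)])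
  show ?thesis
    unfolding finite_cone_eq_fan[OF h assms(1,3)] finite_cone_eq_fan[OF h assms(1) order.refl] image_image
    using assms(3) by (simp add: Int_absorb1)
qed

lemma finite_cone_scale:
  assumes "finite F" "F \<subseteq> G" "y \<in> finite_cone V F" "0 \<le> r"
  shows "scale F r y \<in> finite_cone V F"
proof -
  obtain \<H> C where h: "coarse_fan F \<H> C" by (rule coarse_fan_exists[OF assms(1,2)])
  obtain p where p: "p \<in> fan \<H>" "y = restrict p F"
    using assms(3) unfolding finite_cone_eq_fan[OF h assms(1) order.refl] by blast
  have "scale F r y = restrict (\<lambda>f. r * p f) F" by (auto simp: scale_def p(2) fun_eq_iff)
  then show ?thesis
    unfolding finite_cone_eq_fan[OF h assms(1) order.refl] using fan_scale[OF p(1) assms(4)] by blast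
qed

text \<open>
  The ray through \<open>p\<close> is followed at bounded distance by logarithms of values at points where
  the functions in \<open>F\<close> are bounded away from zero and infinity. Properness confines these points
  to a compact set, on which \<open>ln g\<close> is bounded.
\<close>

lemma proper_kernel:
  assumes pr: "proper_finite_family V F" and h: "coarse_fan F1 \<H> C" and FF: "F \<subseteq> F1" "F1 \<subseteq> G" and g: "g \<in> F1"
    and p: "p \<in> fan \<H>" "\<forall>f\<in>F. p f = 0"
  shows "p g = 0"
proof -
  have F: "finite F" "proper_map (top_of_set V) (subtopology (powertop_real F) (F \<rightarrow>\<^sub>E {0<..})) (eval_map F)"
    using pr by (auto simp: proper_finite_family_def)
  define B where "B = (F \<rightarrow>\<^sub>E {exp (- C)..exp C})"
  have "{exp (- C)..exp C} \<subseteq> {0<..}" by (auto intro: less_le_trans[OF exp_gt_zero])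
  then have "B \<subseteq> F \<rightarrow>\<^sub>E {0<..}" unfolding B_def by (rule PiE_mono)
  moreover have "compactin (powertop_real F) B" unfolding B_def by (simp add: compactin_PiE)
  ultimately have "compactin (subtopology (powertop_real F) (F \<rightarrow>\<^sub>E {0<..})) B"
    by (simp add: compactin_subtopology)
  from compactin_proper_map_preimage[OF F(2) this]
  have K: "compact {x \<in> V. eval_map F x \<in> B}" (is "compact ?K") by (simp add: compactin_subtopology)
  have "continuous_on ?K (\<lambda>x. ln (g x))"
    using G_pos[of g] FF(2) g by (intro continuous_intros continuous_on_subset[OF G_continuous[of g]]) (auto dest: order_less_imp_not_eq2)
  then have "compact ((\<lambda>x. ln (g x)) ` ?K)" using K by (rule compact_continuous_image)
  then obtain M where M: "\<forall>y\<in>(\<lambda>x. ln (g x)) ` ?K. \<bar>y\<bar> \<le> M"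
    using compact_imp_bounded bounded_real by blast
  have bd: "\<bar>\<tau> * p g\<bar> \<le> M + C" if \<tau>: "0 \<le> \<tau>" for \<tau>
  proof -
    have "(\<lambda>f. \<tau> * p f) \<in> fan \<H>" by (rule fan_scale[OF p(1) \<tau>])
    then obtain x where x: "x \<in> V" "\<forall>f\<in>F1. \<bar>ln (f x) - \<tau> * p f\<bar> \<le> C" using h unfolding coarse_fan_def by fast
    have "f x \<in> {exp (- C)..exp C}" if f: "f \<in> F" for f
    proof -
      have "\<bar>ln (f x)\<bar> \<le> C" using x(2) p(2) f FF(1) by force
      moreover have "0 < f x" using G_pos FF f x(1) by blast
      ultimately show ?thesis by (metis abs_le_iff atLeastAtMost_iff exp_le_cancel_iff exp_ln minus_le_iff)
    qed
    then have "x \<in> ?K" using x(1) by (auto simp: eval_map_def B_def)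
    then have "\<bar>ln (g x)\<bar> \<le> M" using M by blast
    moreover have "\<bar>ln (g x) - \<tau> * p g\<bar> \<le> C" using x(2) g by blast
    ultimately show ?thesis by linarith
  qed
  show ?thesis
  proof (rule ccontr)
    assume nz: "p g \<noteq> 0"
    have MC: "0 \<le> M + C" using bd[of 0] by simp
    have "\<bar>(M + C + 1) / \<bar>p g\<bar> * p g\<bar> \<le> M + C" using MC by (intro bd divide_nonneg_nonneg) auto
    then show False using nz MC by (simp add: abs_mult abs_divide)
  qed
qed

text \<open>
  On each cone of the fan there is a bound of the coordinate \<open>g\<close> by a linear function of the
  coordinates in \<open>F\<close>, because no point of the cone vanishes at \<open>F\<close> and has the values 1 or -1 at
  \<open>g\<close>.
\<close>

lemma proper_bound:
  assumes pr: "proper_finite_family V F" and F1: "finite F1" "F \<subseteq> F1" "F1 \<subseteq> G" and g: "g \<in> F1"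
  obtains B where "\<forall>y\<in>finite_cone V F1. \<bar>y g\<bar> \<le> B * (\<Sum>f\<in>F. \<bar>y f\<bar>)"
proof -
  have F: "finite F" using F1 finite_subset by blast
  show thesis
  proof (cases "g \<in> F")
    case True
    have "\<bar>y g\<bar> \<le> 1 * (\<Sum>f\<in>F. \<bar>y f\<bar>)" for y :: "('a \<Rightarrow> real) \<Rightarrow> real"
      using member_le_sum[OF True, of "\<lambda>f. \<bar>y f\<bar>"] F by simp
    then show thesis by (intro that[of 1]) blast
  next
    case False
    obtain \<H> C where h: "coarse_fan F1 \<H> C" by (rule coarse_fan_exists[OF F1(1,3)])
    have "\<exists>B. \<forall>p\<in>ccone H. \<bar>p g\<bar> \<le> B * (\<Sum>f\<in>F. \<bar>p f\<bar>)" if H: "H \<in> \<H>" for H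
    proof -
      have finH: "finite H" using h H by (simp add: coarse_fan_def)
      have none: "p g \<noteq> e" if "p \<in> ccone H" "\<forall>f\<in>F. p f = 0" "\<bar>e\<bar> = 1" for p e
      proof -
        have "p \<in> fan \<H>" using that(1) H by blast
        from proper_kernel[OF pr h F1(2,3) g this that(2)] show ?thesis using that(3) by auto
      qed
      have "\<exists>a. \<forall>p\<in>ccone H. 1 * p g \<le> (\<Sum>f\<in>F. a f * p f)"
        by (rule ccone_separate[OF finH F False]) (use none in auto)
      then obtain a where a: "\<forall>p\<in>ccone H. 1 * p g \<le> (\<Sum>f\<in>F. a f * p f)" by (rule exE)
      have "\<exists>b. \<forall>p\<in>ccone H. (-1) * p g \<le> (\<Sum>f\<in>F. b f * p f)"
        by (rule ccone_separate[OF finH F False]) (use none in auto)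
      then obtain b where b: "\<forall>p\<in>ccone H. (-1) * p g \<le> (\<Sum>f\<in>F. b f * p f)" by (rule exE)
      define M where "M = (\<Sum>f\<in>F. \<bar>a f\<bar> + \<bar>b f\<bar>)"
      have le: "(\<Sum>f\<in>F. c f * p f) \<le> M * (\<Sum>f\<in>F. \<bar>p f\<bar>)" if c: "\<forall>f\<in>F. \<bar>c f\<bar> \<le> \<bar>a f\<bar> + \<bar>b f\<bar>" for c p :: "('a \<Rightarrow> real) \<Rightarrow> real"
        unfolding sum_distrib_left
      proof (rule sum_mono)
        fix f assume f: "f \<in> F"
        have "\<bar>a f\<bar> + \<bar>b f\<bar> \<le> M" unfolding M_def using f F by (intro member_le_sum) auto
        then have "\<bar>c f\<bar> \<le> M" using c f by force
        then have "\<bar>c f\<bar> * \<bar>p f\<bar> \<le> M * \<bar>p f\<bar>" by (rule mult_right_mono) simp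
        then show "c f * p f \<le> M * \<bar>p f\<bar>" by (metis abs_ge_self abs_mult order.trans)
      qed
      have "\<bar>p g\<bar> \<le> M * (\<Sum>f\<in>F. \<bar>p f\<bar>)" if "p \<in> ccone H" for p
        using bspec[OF a that] bspec[OF b that] le[of a p] le[of b p] by (auto simp: abs_le_iff)
      then show ?thesis by blast
    qed
    then have "\<forall>H\<in>\<H>. \<exists>B. \<forall>p\<in>ccone H. \<bar>p g\<bar> \<le> B * (\<Sum>f\<in>F. \<bar>p f\<bar>)" by blast
    then obtain B where B: "\<forall>H\<in>\<H>. \<forall>p\<in>ccone H. \<bar>p g\<bar> \<le> B H * (\<Sum>f\<in>F. \<bar>p f\<bar>)" by (rule bchoice[THEN exE])
    define M where "M = (\<Sum>H\<in>\<H>. \<bar>B H\<bar>)"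
    have "\<bar>y g\<bar> \<le> M * (\<Sum>f\<in>F. \<bar>y f\<bar>)" if y: "y \<in> finite_cone V F1" for y
    proof -
      obtain H p where p: "H \<in> \<H>" "p \<in> ccone H" "y = restrict p F1"
        using y unfolding finite_cone_eq_fan[OF h F1(1) order.refl] by blast
      have sum: "(\<Sum>f\<in>F. \<bar>y f\<bar>) = (\<Sum>f\<in>F. \<bar>p f\<bar>)" using F1(2) by (intro sum.cong) (auto simp: p(3))
      have "\<bar>B H\<bar> \<le> M" unfolding M_def using p(1) h by (intro member_le_sum) (auto simp: coarse_fan_def)
      then have "B H * (\<Sum>f\<in>F. \<bar>p f\<bar>) \<le> M * (\<Sum>f\<in>F. \<bar>p f\<bar>)" by (intro mult_right_mono sum_nonneg) auto
      moreover have "\<bar>p g\<bar> \<le> B H * (\<Sum>f\<in>F. \<bar>p f\<bar>)" using B p by blast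
      ultimately show ?thesis using g by (simp add: sum) (simp add: p(3))
    qed
    then show thesis using that by blast
  qed
qed

text \<open>
  The composition of the larger evaluation map with the projection is proper; as the spaces are
  Hausdorff, so is the larger map itself.
\<close>

lemma proper_superset:
  assumes F: "F \<in> proper_subfamilies V G" and F1: "finite F1" "F \<subseteq> F1" "F1 \<subseteq> G"
  shows "F1 \<in> proper_subfamilies V G"
proof -
  let ?T = "\<lambda>F. subtopology (powertop_real F) (F \<rightarrow>\<^sub>E {0<..})"
  have P: "proper_map (top_of_set V) (?T F) (eval_map F)"
    using F by (simp add: proper_subfamilies_def proper_finite_family_def)
  have "proper_map (top_of_set V) (?T F1) (eval_map F1)"
  proof (rule proper_map_from_composition_right[where g = "\<lambda>y. restrict y F" and Z = "?T F"])
    show "Hausdorff_space (?T F1)"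
      by (intro Hausdorff_space_subtopology) (simp add: Hausdorff_space_product_topology)
    have "(\<lambda>y. restrict y F) \<circ> eval_map F1 = eval_map F" using F1(2) by (auto simp: eval_map_def fun_eq_iff)
    then show "proper_map (top_of_set V) (?T F) ((\<lambda>y. restrict y F) \<circ> eval_map F1)" using P by simp
    show "continuous_map (top_of_set V) (?T F1) (eval_map F1)"
      unfolding continuous_map_in_subtopology continuous_map_componentwise
      using G_continuous G_pos F1(3) by (auto simp: eval_map_def subset_iff)
    show "continuous_map (?T F1) (?T F) (\<lambda>y. restrict y F)"
      unfolding continuous_map_in_subtopology continuous_map_componentwise
      using F1(2) by (auto simp: subset_iff intro!: continuous_map_from_subtopology continuous_map_product_projection)
  qed
  then show ?thesis using F1 by (simp add: proper_subfamilies_def proper_finite_family_def)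
qed

lemma limit_cone_restrict:
  assumes "F \<in> proper_subfamilies V G" "x \<in> limit_cone V G" shows "restrict x F \<in> finite_cone V F"
  using assms by (simp add: limit_cone_def)

text \<open>
  A proper family \<open>F2\<close> is contained in the finite family \<open>F \<union> F2\<close>, whose cone projects to the
  cone of \<open>F2\<close>.
\<close>

lemma limit_coneI:
  assumes F: "F \<in> proper_subfamilies V G" and x: "x \<in> G \<rightarrow>\<^sub>E UNIV"
    and all: "\<And>F1. finite F1 \<Longrightarrow> F \<subseteq> F1 \<Longrightarrow> F1 \<subseteq> G \<Longrightarrow> restrict x F1 \<in> finite_cone V F1"
  shows "x \<in> limit_cone V G"
  unfolding limit_cone_def
proof (intro CollectI conjI x ballI)
  fix F2 assume F2: "F2 \<in> proper_subfamilies V G"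
  have U: "finite (F \<union> F2)" "F \<union> F2 \<subseteq> G"
    using F F2 by (auto simp: proper_subfamilies_def proper_finite_family_def)
  have "restrict x (F \<union> F2) \<in> finite_cone V (F \<union> F2)" using U by (intro all) auto
  then have "restrict (restrict x (F \<union> F2)) F2 \<in> finite_cone V F2"
    unfolding finite_cone_projection[OF U Un_upper2] by blast
  then show "restrict x F2 \<in> finite_cone V F2" by (simp add: Int_absorb1)
qed

text \<open>
  For each finite \<open>F1\<close> containing \<open>F\<close>, the set of points over \<open>y\<close> with projection in the cone of
  \<open>F1\<close> is closed. Finitely many of these sets have a common point by surjectivity of
  projections, and it may be taken in the compact product of the intervals given by
  \<open>proper_bound\<close>.
\<close>

lemma limit_cone_lift:
  assumes F: "F \<in> proper_subfamilies V G" and y: "y \<in> finite_cone V F"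
  obtains x where "x \<in> limit_cone V G" "restrict x F = y"
proof -
  have finF: "finite F" "F \<subseteq> G" "proper_finite_family V F"
    using F by (auto simp: proper_subfamilies_def proper_finite_family_def)
  have "\<forall>g\<in>G. \<exists>b. \<forall>z\<in>finite_cone V (insert g F). restrict z F = y \<longrightarrow> \<bar>z g\<bar> \<le> b"
  proof
    fix g assume g: "g \<in> G"
    have gF: "finite (insert g F)" "F \<subseteq> insert g F" "insert g F \<subseteq> G" "g \<in> insert g F" using finF g by auto
    obtain B where B: "\<forall>z\<in>finite_cone V (insert g F). \<bar>z g\<bar> \<le> B * (\<Sum>f\<in>F. \<bar>z f\<bar>)"
      by (rule proper_bound[OF finF(3) gF])
    have "\<bar>z g\<bar> \<le> B * (\<Sum>f\<in>F. \<bar>y f\<bar>)" if z: "z \<in> finite_cone V (insert g F)" "restrict z F = y" for z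
    proof -
      have "(\<Sum>f\<in>F. \<bar>y f\<bar>) = (\<Sum>f\<in>F. \<bar>z f\<bar>)" by (intro sum.cong) (auto simp: z(2)[symmetric])
      then show ?thesis using B z(1) by simp
    qed
    then show "\<exists>b. \<forall>z\<in>finite_cone V (insert g F). restrict z F = y \<longrightarrow> \<bar>z g\<bar> \<le> b" by blast
  qed
  then obtain b where b: "\<forall>g\<in>G. \<forall>z\<in>finite_cone V (insert g F). restrict z F = y \<longrightarrow> \<bar>z g\<bar> \<le> b g"
    by (rule bchoice[THEN exE])
  define K where "K = (\<Pi>\<^sub>E g\<in>G. {- \<bar>b g\<bar>..\<bar>b g\<bar>})"
  have K: "compactin (powertop_real G) K" unfolding K_def by (simp add: compactin_PiE)
  define \<F> where "\<F> = {F1. finite F1 \<and> F \<subseteq> F1 \<and> F1 \<subseteq> G}"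
  define E where "E = (\<lambda>F1. {x \<in> topspace (powertop_real G). restrict x F1 \<in> {z \<in> finite_cone V F1. restrict z F = y}})"
  have closed: "closedin (powertop_real G) (E F1)" if F1: "F1 \<in> \<F>" for F1
    unfolding E_def
  proof (rule closedin_continuous_map_preimage)
    have F1': "finite F1" "F1 \<subseteq> G" "F \<subseteq> F1" using F1 by (auto simp: \<F>_def)
    show "continuous_map (powertop_real G) (powertop_real F1) (\<lambda>x. restrict x F1)"
      unfolding continuous_map_componentwise using F1'
      by (auto simp: subset_iff intro!: continuous_map_product_projection)
    have yF: "y \<in> F \<rightarrow>\<^sub>E UNIV" using finite_cone_extensional finF y by blast
    have "{z \<in> finite_cone V F1. restrict z F = y} = finite_cone V F1 \<inter> {z \<in> topspace (powertop_real F1). restrict z F \<in> {y}}"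
      using finite_cone_extensional[OF F1'(1,2)] by auto
    moreover have "closedin (powertop_real F1) {z \<in> topspace (powertop_real F1). restrict z F \<in> {y}}"
    proof (rule closedin_continuous_map_preimage)
      show "continuous_map (powertop_real F1) (powertop_real F) (\<lambda>x. restrict x F)"
        unfolding continuous_map_componentwise using F1'
        by (auto simp: subset_iff intro!: continuous_map_product_projection)
      show "closedin (powertop_real F) {y}"
        using yF by (intro closedin_Hausdorff_singleton) (auto simp: Hausdorff_space_product_topology)
    qed
    ultimately show "closedin (powertop_real F1) {z \<in> finite_cone V F1. restrict z F = y}"
      using closedin_finite_cone[OF F1'(1,2)] by (simp add: closedin_Int)
  qed
  have fip: "K \<inter> \<Inter>\<G> \<noteq> {}" if \<G>: "finite \<G>" "\<G> \<subseteq> E ` \<F>" for \<G>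
  proof -
    obtain \<D> where \<D>: "finite \<D>" "\<D> \<subseteq> \<F>" "\<G> = E ` \<D>" using finite_subset_image[OF \<G>] by metis
    define S where "S = F \<union> \<Union>\<D>"
    have S: "finite S" "S \<subseteq> G" "F \<subseteq> S" using \<D> finF by (auto simp: S_def \<F>_def)
    obtain p where p: "p \<in> finite_cone V S" "y = restrict p F" using y unfolding finite_cone_projection[OF S] by blast
    \<comment> \<open>Outside of \<open>S\<close> any point of the intervals will do.\<close>
    define x where "x = restrict (\<lambda>g. if g \<in> S then p g else 0) G"
    have xr: "restrict x F1 = restrict p F1" if "F1 \<subseteq> S" for F1
      using that S(2) by (auto simp: x_def fun_eq_iff)
    have "x \<in> E F1" if "F1 \<in> \<D>" for F1
    proof -
      have F1: "F1 \<subseteq> S" "F \<subseteq> F1" using that \<D>(2) by (auto simp: S_def \<F>_def)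
      have "restrict p F1 \<in> finite_cone V F1" using p(1) finite_cone_projection[OF S(1,2) F1(1)] by blast
      moreover have "x \<in> topspace (powertop_real G)" by (simp add: x_def)
      moreover have "restrict (restrict p F1) F = y" using F1(2) by (simp add: p(2) Int_absorb1)
      ultimately show ?thesis unfolding E_def mem_Collect_eq xr[OF F1(1)] by blast
    qed
    moreover have "x \<in> K"
    proof -
      have "\<bar>x g\<bar> \<le> \<bar>b g\<bar>" if g: "g \<in> G" for g
      proof (cases "g \<in> S")
        case True
        have gS: "insert g F \<subseteq> S" using True S(3) by blast
        have "restrict p (insert g F) \<in> finite_cone V (insert g F)"
          using p(1) finite_cone_projection[OF S(1,2) gS] by blast
        moreover have "restrict (restrict p (insert g F)) F = y" by (auto simp: p(2) fun_eq_iff)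
        ultimately have "\<bar>restrict p (insert g F) g\<bar> \<le> b g" using b g by blast
        then show ?thesis using True g by (simp add: x_def)
      qed (simp add: x_def g)
      then have "x g \<in> {- \<bar>b g\<bar>..\<bar>b g\<bar>}" if "g \<in> G" for g
        unfolding atLeastAtMost_iff using that by (simp add: abs_le_iff minus_le_iff)
      moreover have "x \<in> extensional G" by (simp add: x_def)
      ultimately show ?thesis unfolding K_def PiE_iff by blast
    qed
    ultimately show ?thesis unfolding \<D>(3) by blast
  qed
  have "K \<inter> \<Inter>(E ` \<F>) \<noteq> {}"
    using K[unfolded compactin_fip] closed fip by (elim conjE allE[of _ "E ` \<F>"]) blast
  then obtain x where x: "x \<in> \<Inter>(E ` \<F>)" by blast
  have FF: "F \<in> \<F>" using finF by (simp add: \<F>_def)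
  have xE: "x \<in> E F1" if "F1 \<in> \<F>" for F1 using x that by blast
  show thesis
  proof (rule that)
    show "x \<in> limit_cone V G"
    proof (rule limit_coneI[OF F])
      show "x \<in> G \<rightarrow>\<^sub>E UNIV" using xE[OF FF] by (simp add: E_def)
      show "restrict x F1 \<in> finite_cone V F1" if "finite F1" "F \<subseteq> F1" "F1 \<subseteq> G" for F1
        using xE[of F1] that by (simp add: E_def \<F>_def)
    qed
    show "restrict x F = y" using xE[OF FF] by (simp add: E_def)
  qed
qed

lemma limit_cone_scale:
  assumes "x \<in> limit_cone V G" "0 \<le> r" shows "scale G r x \<in> limit_cone V G"
  unfolding limit_cone_def
proof (intro CollectI conjI ballI)
  show "scale G r x \<in> G \<rightarrow>\<^sub>E UNIV" by (simp add: scale_def)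
  fix F assume F: "F \<in> proper_subfamilies V G"
  then have FG: "F \<subseteq> G" "finite F" by (auto simp: proper_subfamilies_def proper_finite_family_def)
  have "restrict (scale G r x) F = scale F r (restrict x F)" using FG(1) by (auto simp: scale_def fun_eq_iff)
  then show "restrict (scale G r x) F \<in> finite_cone V F"
    using finite_cone_scale[OF FG(2,1) limit_cone_restrict[OF F assms(1)] assms(2)] by simp
qed

end

section \<open>The charts\<close>

lemma pl_on_continuous_map:
  assumes f: "pl_on I J A f" and I: "finite I" and J: "finite J" and A: "A \<subseteq> I \<rightarrow>\<^sub>E UNIV" and j: "j \<in> J"
  shows "continuous_map (subtopology (powertop_real I) A) euclideanreal (\<lambda>x. f x j)"
proof -
  have top: "topspace (subtopology (powertop_real I) A) = A" using A by auto
  have "openin (subtopology (powertop_real I) A) {x \<in> A. f x j \<in> U}" if U: "open U" for U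
    unfolding openin_subtopology_near[OF I A]
  proof (intro conjI ballI)
    fix x assume "x \<in> {x \<in> A. f x j \<in> U}"
    then have x: "x \<in> A" "f x j \<in> U" by auto
    then obtain e where e: "e > 0" "ball (f x j) e \<subseteq> U" using U openE by blast
    from pl_on_continuous[OF f I J A x(1) e(1)]
    obtain r where r: "0 < r" "\<forall>y\<in>A. near I r x y \<longrightarrow> near J e (f x) (f y)" by (elim exE conjE) (rule that)
    have "y \<in> {x \<in> A. f x j \<in> U}" if y: "y \<in> A" "near I r x y" for y
    proof -
      have "near J e (f x) (f y)" by (rule bspec[OF r(2) y(1), THEN mp, OF y(2)])
      then have "f y j \<in> ball (f x j) e" using j by (simp add: dist_real_def abs_minus_commute)
      then show ?thesis using e(2) y(1) by blast
    qed
    then show "\<exists>r>0. \<forall>y\<in>A. near I r x y \<longrightarrow> y \<in> {x \<in> A. f x j \<in> U}" using r(1) by (intro exI[of _ r]) simp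
  qed auto
  then show ?thesis unfolding continuous_map_def top by simp
qed

lemma continuous_map_Max_insert:
  assumes "finite A" "\<And>a. a \<in> A \<Longrightarrow> continuous_map X euclideanreal (h a)"
  shows "continuous_map X euclideanreal (\<lambda>x. Max (insert 0 ((\<lambda>a. h a x) ` A)))"
  using assms
proof (induction A rule: finite_induct)
  case (insert a A)
  have "Max (insert 0 ((\<lambda>a. h a x) ` insert a A)) = max (h a x) (Max (insert 0 ((\<lambda>a. h a x) ` A)))" for x
  proof -
    have "insert 0 ((\<lambda>a. h a x) ` insert a A) = insert (h a x) (insert 0 ((\<lambda>a. h a x) ` A))" by auto
    then show ?thesis using insert.hyps(1) by simp
  qed
  then show ?case using insert by (simp add: continuous_map_real_max)
qed simp

lemma scale_scale: "scale G r (scale G s x) = scale G (r * s) x"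
  by (auto simp: scale_def fun_eq_iff)

lemma scale_one: "x \<in> G \<rightarrow>\<^sub>E UNIV \<Longrightarrow> scale G 1 x = x"
  by (auto simp: scale_def fun_eq_iff PiE_def extensional_def)

context cone_data
begin

lemma proper_subfamilies_facts:
  assumes "F \<in> proper_subfamilies V G" shows "finite F" "F \<subseteq> G"
  using assms by (auto simp: proper_subfamilies_def proper_finite_family_def)

lemma injective_family_facts:
  assumes "F \<in> injective_families V G"
  shows "F \<in> proper_subfamilies V G" "finite F" "F \<subseteq> G" "inj_on (cone_proj F) (limit_cone V G)"
  using assms proper_subfamilies_facts by (auto simp: injective_families_def)

lemma limit_cone_extensional: "limit_cone V G \<subseteq> G \<rightarrow>\<^sub>E UNIV"
  by (auto simp: limit_cone_def)

lemma topspace_cone_top: "topspace (cone_top V G) = limit_cone V G"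
  using limit_cone_extensional by auto

lemma cone_proj_image:
  assumes "F \<in> proper_subfamilies V G" shows "cone_proj F ` limit_cone V G = finite_cone V F"
proof
  show "cone_proj F ` limit_cone V G \<subseteq> finite_cone V F"
    using limit_cone_restrict[OF assms] by (auto simp: cone_proj_def)
  show "finite_cone V F \<subseteq> cone_proj F ` limit_cone V G"
  proof
    fix y assume "y \<in> finite_cone V F"
    then obtain x where "x \<in> limit_cone V G" "restrict x F = y" by (rule limit_cone_lift[OF assms])
    then show "y \<in> cone_proj F ` limit_cone V G" by (auto simp: cone_proj_def)
  qed
qed

abbreviation lift_from :: "('a \<Rightarrow> real) set \<Rightarrow> (('a \<Rightarrow> real) \<Rightarrow> real) \<Rightarrow> ('a \<Rightarrow> real) \<Rightarrow> real" where
  "lift_from F \<equiv> the_inv_into (limit_cone V G) (cone_proj F)"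

lemma lift_from_facts:
  assumes F: "F \<in> injective_families V G"
  shows "x \<in> limit_cone V G \<Longrightarrow> lift_from F (restrict x F) = x"
    and "y \<in> finite_cone V F \<Longrightarrow> lift_from F y \<in> limit_cone V G"
    and "y \<in> finite_cone V F \<Longrightarrow> restrict (lift_from F y) F = y"
proof -
  note f = injective_family_facts[OF F]
  show "lift_from F (restrict x F) = x" if "x \<in> limit_cone V G"
    using the_inv_into_f_f[OF f(4) that] by (simp add: cone_proj_def)
  show "lift_from F y \<in> limit_cone V G" if "y \<in> finite_cone V F"
    by (rule the_inv_into_into[OF f(4)]) (use that cone_proj_image[OF f(1)] in auto)
  show "restrict (lift_from F y) F = y" if "y \<in> finite_cone V F"
    using f_the_inv_into_f[OF f(4), of y] that cone_proj_image[OF f(1)] by (simp add: cone_proj_def)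
qed

text \<open>
  To describe finitely many coordinates \<open>J\<close> of the lift it suffices to look at the cone of
  \<open>F \<union> J\<close>. Its points are restrictions of points of the limit cone, so on each cone of a fan for
  \<open>F \<union> J\<close> injectivity of \<open>F\<close> makes the coordinates in \<open>J\<close> functions of those in \<open>F\<close>, and these
  functions are linear.
\<close>

lemma lift_from_pl:
  assumes F: "F \<in> injective_families V G" and J: "finite J" "J \<subseteq> G"
  shows "pl_on F J (finite_cone V F) (lift_from F)"
proof -
  note f = injective_family_facts[OF F]
  define F1 where "F1 = F \<union> J"
  have F1: "finite F1" "F1 \<subseteq> G" "F \<subseteq> F1" using f J by (auto simp: F1_def)
  have pF1: "F1 \<in> proper_subfamilies V G" by (rule proper_superset[OF f(1) F1(1,3,2)])
  obtain \<H> C where h: "coarse_fan F1 \<H> C" by (rule coarse_fan_exists[OF F1(1,2)])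
  have val: "lift_from F (restrict p F) j = p j" if p: "p \<in> fan \<H>" and j: "j \<in> J" for p j
  proof -
    have "restrict p F1 \<in> finite_cone V F1"
      unfolding finite_cone_eq_fan[OF h F1(1) order.refl] using p by (rule imageI)
    then obtain x where x: "x \<in> limit_cone V G" "restrict x F1 = restrict p F1" by (rule limit_cone_lift[OF pF1])
    have xp: "x i = p i" if "i \<in> F1" for i using fun_cong[OF x(2), of i] that by simp
    have "restrict x F = restrict p F" using xp F1(3) by (auto simp: fun_eq_iff)
    then have "lift_from F (restrict p F) = x" using lift_from_facts(1)[OF F x(1)] by simp
    then show ?thesis using xp[of j] j by (simp add: F1_def)
  qed
  show ?thesis
  proof (rule pl_on_finite_union[where \<P> = "(\<lambda>H. (\<lambda>p. restrict p F) ` ccone H) ` \<H>"])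
    show "finite ((\<lambda>H. (\<lambda>p. restrict p F) ` ccone H) ` \<H>)" using h by (simp add: coarse_fan_def)
    show "finite_cone V F = \<Union>((\<lambda>H. (\<lambda>p. restrict p F) ` ccone H) ` \<H>)"
      unfolding finite_cone_eq_fan[OF h F1(1,3)] by (rule image_UN)
    fix P assume "P \<in> (\<lambda>H. (\<lambda>p. restrict p F) ` ccone H) ` \<H>"
    then obtain H where H: "P = (\<lambda>p. restrict p F) ` ccone H" "H \<in> \<H>" by (rule imageE)
    have finH: "finite H" using h H(2) by (simp add: coarse_fan_def)
    show "convex_polyhedron F P" unfolding H(1) by (rule convex_polyhedron_ccone[OF finH f(2)])
    have fan: "p \<in> fan \<H>" if "p \<in> ccone H" for p using that H(2) by blast
    have "\<forall>j\<in>J. \<exists>a. \<forall>p\<in>ccone H. p j = (\<Sum>f\<in>F. a f * p f)"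
    proof
      fix j assume j: "j \<in> J"
      show "\<exists>a. \<forall>p\<in>ccone H. p j = (\<Sum>f\<in>F. a f * p f)"
      proof (rule ccone_coordinate_linear[OF finH f(2)])
        fix p q assume pq: "p \<in> ccone H" "q \<in> ccone H" "\<forall>f\<in>F. p f = q f"
        then have "restrict p F = restrict q F" by (auto simp: fun_eq_iff)
        then show "p j = q j" using val[OF fan[OF pq(1)] j] val[OF fan[OF pq(2)] j] by simp
      qed
    qed
    then obtain a where a: "\<forall>j\<in>J. \<forall>p\<in>ccone H. p j = (\<Sum>f\<in>F. a j f * p f)" by (rule bchoice[THEN exE])
    show "affine_map_on F J P (lift_from F)"
      unfolding affine_map_on_def
    proof (intro exI[of _ a] exI[of _ "\<lambda>_. 0"] ballI)
      fix y j assume y: "y \<in> P" and j: "j \<in> J"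
      then obtain p where p: "y = restrict p F" "p \<in> ccone H" unfolding H(1) by (elim imageE)
      have "lift_from F y j = p j" unfolding p(1) by (rule val[OF fan[OF p(2)] j])
      also have "\<dots> = (\<Sum>f\<in>F. a j f * p f)" by (rule bspec[OF bspec[OF a j] p(2)])
      also have "\<dots> = (\<Sum>f\<in>F. a j f * y f)" by (rule sum.cong) (simp_all add: p(1))
      finally show "lift_from F y j = 0 + (\<Sum>f\<in>F. a j f * y f)" by simp
    qed
  qed (rule f(2))
qed

lemma finite_cone_sub:
  "F \<in> injective_families V G \<Longrightarrow> finite_cone V F \<subseteq> F \<rightarrow>\<^sub>E UNIV"
  by (intro finite_cone_extensional injective_family_facts)

lemma lift_from_continuous:
  assumes F: "F \<in> injective_families V G"
  shows "continuous_map (subtopology (powertop_real F) (finite_cone V F)) (cone_top V G) (lift_from F)"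
  unfolding continuous_map_in_subtopology continuous_map_componentwise
proof (intro conjI ballI)
  note f = injective_family_facts[OF F]
  have top: "topspace (subtopology (powertop_real F) (finite_cone V F)) = finite_cone V F"
    using finite_cone_sub[OF F] by auto
  show "lift_from F \<in> topspace (subtopology (powertop_real F) (finite_cone V F)) \<rightarrow> limit_cone V G"
    unfolding top using lift_from_facts(2)[OF F] by auto
  then show "lift_from F ` topspace (subtopology (powertop_real F) (finite_cone V F)) \<subseteq> extensional G"
    using limit_cone_extensional by (auto simp: PiE_def)
  show "continuous_map (subtopology (powertop_real F) (finite_cone V F)) euclideanreal (\<lambda>y. lift_from F y g)" if "g \<in> G" for g
    by (rule pl_on_continuous_map[OF lift_from_pl[OF F, of "{g}"] f(2) _ finite_cone_sub[OF F]]) (use that in auto)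
qed

lemma cone_proj_continuous:
  assumes F: "F \<subseteq> G" and S: "\<And>x. x \<in> S \<Longrightarrow> x \<in> G \<rightarrow>\<^sub>E UNIV \<Longrightarrow> restrict x F \<in> T"
  shows "continuous_map (subtopology (powertop_real G) S) (subtopology (powertop_real F) T) (cone_proj F)"
  unfolding continuous_map_in_subtopology continuous_map_componentwise
  using assms by (auto simp: cone_proj_def subset_iff intro!: continuous_map_from_subtopology continuous_map_product_projection)

text \<open>
  The inverse of the chart is continuous, as all its coordinates are piecewise linear.
\<close>

theorem cone_chart_is_pl_chart:
  assumes F: "F \<in> injective_families V G" shows "is_pl_chart (cone_top V G) (cone_chart V G F)"
proof -
  note f = injective_family_facts[OF F]
  have top: "topspace (subtopology (powertop_real F) (finite_cone V F)) = finite_cone V F"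
    using finite_cone_sub[OF F] by auto
  have "homeomorphic_maps (cone_top V G) (subtopology (powertop_real F) (finite_cone V F)) (cone_proj F) (lift_from F)"
    unfolding homeomorphic_maps_def top topspace_cone_top
  proof (intro conjI ballI lift_from_continuous[OF F] cone_proj_continuous[OF f(3)])
    show "restrict x F \<in> finite_cone V F" if "x \<in> limit_cone V G" for x by (rule limit_cone_restrict[OF f(1) that])
    show "lift_from F (cone_proj F x) = x" if "x \<in> limit_cone V G" for x
      using lift_from_facts(1)[OF F that] by (simp add: cone_proj_def)
    show "cone_proj F (lift_from F y) = y" if "y \<in> finite_cone V F" for y
      using lift_from_facts(3)[OF F that] by (simp add: cone_proj_def)
  qed
  then have "homeomorphic_map (cone_top V G) (subtopology (powertop_real F) (finite_cone V F)) (cone_proj F)"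
    unfolding homeomorphic_map_maps by (intro exI[of _ "lift_from F"])
  moreover have "subtopology (cone_top V G) (limit_cone V G) = cone_top V G" by (simp add: subtopology_subtopology)
  moreover have "openin (cone_top V G) (limit_cone V G)"
    using openin_topspace[of "cone_top V G"] unfolding topspace_cone_top .
  moreover have "polyhedral F (finite_cone V F)"
    by (rule pl_on_polyhedral[OF lift_from_pl[OF F, of "{}"]]) simp_all
  ultimately show ?thesis
    unfolding is_pl_chart_def cone_chart_def prod.case cone_proj_image[OF f(1)] using f(2) by simp
qed

text \<open>
  A change of charts is the restriction to \<open>F'\<close> of the lift from \<open>F\<close>.
\<close>

theorem cone_charts_compatible:
  assumes F: "F \<in> injective_families V G" and F': "F' \<in> injective_families V G"
  shows "pl_compatible (cone_chart V G F) (cone_chart V G F')"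
proof -
  have "pl_on F F' (finite_cone V F) (cone_proj F' \<circ> lift_from F)"
    if F: "F \<in> injective_families V G" and F': "F' \<in> injective_families V G" for F F'
    by (rule pl_on_cong[OF lift_from_pl[OF F injective_family_facts(2,3)[OF F']]]) (simp add: cone_proj_def)
  then show ?thesis
    using assms unfolding pl_compatible_def cone_chart_def
    by (simp add: cone_proj_image injective_family_facts(1))
qed

section \<open>The boundary\<close>

lemma zero_in_limit_cone: "x \<in> limit_cone V G \<Longrightarrow> (\<lambda>g\<in>G. 0) \<in> limit_cone V G"
  using limit_cone_scale[of x 0] by (simp add: scale_def)

lemma punctured_cone_scale:
  assumes x: "x \<in> punctured_cone V G" and r: "0 < r" shows "scale G r x \<in> punctured_cone V G"
proof -
  have xl: "x \<in> limit_cone V G" "x \<noteq> (\<lambda>g\<in>G. 0)" using x by (auto simp: punctured_cone_def)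
  have "scale G r x \<noteq> (\<lambda>g\<in>G. 0)"
  proof
    assume z: "scale G r x = (\<lambda>g\<in>G. 0)"
    have "x = scale G (1 / r) (scale G r x)"
      using r xl(1) limit_cone_extensional by (simp add: scale_scale scale_one subset_iff)
    also have "\<dots> = (\<lambda>g\<in>G. 0)" unfolding z by (auto simp: scale_def)
    finally show False using xl(2) by simp
  qed
  then show ?thesis using limit_cone_scale[OF xl(1), of r] r by (simp add: punctured_cone_def)
qed

definition ray :: "(('a \<Rightarrow> real) \<Rightarrow> real) \<Rightarrow> (('a \<Rightarrow> real) \<Rightarrow> real) set" where
  "ray x = ray_rel V G `` {x}"

lemma in_ray_iff: "x \<in> punctured_cone V G \<Longrightarrow> y \<in> ray x \<longleftrightarrow> (\<exists>r>0. y = scale G r x)"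
  unfolding ray_def ray_rel_def using punctured_cone_scale by auto

lemma punctured_cone_extensional: "punctured_cone V G \<subseteq> G \<rightarrow>\<^sub>E UNIV"
  using limit_cone_extensional by (auto simp: punctured_cone_def)

lemma self_in_ray:
  assumes "x \<in> punctured_cone V G" shows "x \<in> ray x"
proof -
  have "x = scale G 1 x" using assms punctured_cone_extensional by (auto simp: scale_one)
  then show ?thesis unfolding in_ray_iff[OF assms] by (intro exI[of _ 1]) simp
qed

lemma ray_scale:
  assumes x: "x \<in> punctured_cone V G" and r: "0 < r" shows "ray (scale G r x) = ray x"
proof -
  have "y \<in> ray (scale G r x) \<longleftrightarrow> y \<in> ray x" for y
    unfolding in_ray_iff[OF x] in_ray_iff[OF punctured_cone_scale[OF x r]] scale_scale
  proof
    assume "\<exists>s>0. y = scale G (s * r) x"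
    then obtain s where "s > 0" "y = scale G (s * r) x" by blast
    then show "\<exists>s>0. y = scale G s x" using r by (intro exI[of _ "s * r"]) simp
  next
    assume "\<exists>s>0. y = scale G s x"
    then obtain s where "s > 0" "y = scale G s x" by blast
    then show "\<exists>s>0. y = scale G (s * r) x" using r by (intro exI[of _ "s / r"]) simp
  qed
  then show ?thesis by blast
qed

lemma boundary_eq: "boundary V G = ray ` punctured_cone V G"
  by (auto simp: boundary_def quotient_def ray_def)

abbreviation punctured_top :: "(('a \<Rightarrow> real) \<Rightarrow> real) topology" where
  "punctured_top \<equiv> subtopology (powertop_real G) (punctured_cone V G)"

lemma topspace_punctured_top: "topspace punctured_top = punctured_cone V G"
  using punctured_cone_extensional by auto

lemma ray_quotient_map: "quotient_map punctured_top (boundary_top V G) ray"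
  unfolding boundary_top_def ray_def[abs_def] by (rule quotient_map_quotient_topology)

lemma topspace_boundary_top: "topspace (boundary_top V G) = boundary V G"
  using quotient_imp_surjective_map[OF ray_quotient_map] unfolding topspace_punctured_top boundary_eq by simp

text \<open>
  Let \<open>N\<close> be the maximum norm of the coordinates in \<open>F\<close>. It is positive on the punctured cone
  because \<open>F\<close> is injective. The section \<open>s\<close> takes a ray to its point with \<open>N = 1\<close>. It is
  continuous since normalisation is, and \<open>cone_proj F \<circ> s\<close> is a global chart of the boundary,
  onto the set \<open>\<Sigma>\<close> of points of norm 1 in \<open>finite_cone V F\<close>. The set \<open>\<Sigma>\<close> is polyhedral since the
  unit sphere of the maximum norm consists of the faces of a cube.
\<close>

theorem boundary_structure_exists:
  assumes F: "F \<in> injective_families V G"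
  shows "\<exists>\<T>. boundary_structure_from_cone V G (compatible_charts (cone_top V G) (cone_chart V G F)) \<T>"
proof -
  note f = injective_family_facts[OF F]
  \<comment> \<open>Inserting 0 gives the maximum a meaning also for empty \<open>F\<close>.\<close>
  define N where "N = (\<lambda>x :: ('a \<Rightarrow> real) \<Rightarrow> real. Max (insert 0 ((\<lambda>g. \<bar>x g\<bar>) ` F)))"
  have Nle: "\<bar>x g\<bar> \<le> N x" if "g \<in> F" for x g unfolding N_def using f(2) that by (intro Max_ge) auto
  have N0: "0 \<le> N x" for x unfolding N_def using f(2) by (intro Max_ge) auto
  have Nat: "N x = 0 \<or> (\<exists>g\<in>F. N x = \<bar>x g\<bar>)" for x
  proof -
    have "N x \<in> insert 0 ((\<lambda>g. \<bar>x g\<bar>) ` F)" unfolding N_def using f(2) by (intro Max_in) auto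
    then show ?thesis by auto
  qed
  have Npos: "0 < N x" if x: "x \<in> punctured_cone V G" for x
  proof (rule ccontr)
    assume "\<not> 0 < N x"
    then have "x g = 0" if "g \<in> F" for g using Nle[OF that, of x] by simp
    then have "cone_proj F x = cone_proj F (\<lambda>g\<in>G. 0)" using f(3) by (auto simp: cone_proj_def fun_eq_iff)
    then have "x = (\<lambda>g\<in>G. 0)"
      using inj_onD[OF f(4)] x zero_in_limit_cone by (auto simp: punctured_cone_def)
    then show False using x by (simp add: punctured_cone_def)
  qed
  have Nscale: "N (scale G r x) = r * N x" if r: "0 \<le> r" for r x
  proof -
    have "mono ((*) r)" using r by (intro monoI mult_left_mono)
    then have "r * N x = Max ((*) r ` insert 0 ((\<lambda>g. \<bar>x g\<bar>) ` F))"
      unfolding N_def by (rule mono_Max_commute) (use f(2) in auto)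
    also have "(*) r ` insert 0 ((\<lambda>g. \<bar>x g\<bar>) ` F) = insert 0 ((\<lambda>g. \<bar>scale G r x g\<bar>) ` F)"
      using f(3) r by (auto simp: scale_def abs_mult image_image subset_iff intro!: image_cong)
    finally show ?thesis by (simp add: N_def)
  qed
  have Ncont: "continuous_map (subtopology (powertop_real G) S) euclideanreal N" for S
    unfolding N_def
    by (rule continuous_map_Max_insert[OF f(2), of _ "\<lambda>g x. \<bar>x g\<bar>"])
      (use f(3) in \<open>auto intro!: continuous_map_real_abs continuous_map_from_subtopology continuous_map_product_projection\<close>)
  define n where "n = (\<lambda>x. scale G (1 / N x) x)"
  have n: "n x \<in> punctured_cone V G" "n x \<in> ray x" "N (n x) = 1" "scale G (N x) (n x) = x" "ray (n x) = ray x"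
    if x: "x \<in> punctured_cone V G" for x
  proof -
    have r: "0 < 1 / N x" using Npos[OF x] by simp
    show "n x \<in> punctured_cone V G" unfolding n_def by (rule punctured_cone_scale[OF x r])
    show "n x \<in> ray x" unfolding in_ray_iff[OF x] n_def using r by blast
    show "N (n x) = 1" unfolding n_def using Nscale[OF less_imp_le[OF r]] r by simp
    show "scale G (N x) (n x) = x"
      unfolding n_def scale_scale using r x punctured_cone_extensional by (simp add: scale_one subset_iff)
    show "ray (n x) = ray x" unfolding n_def by (rule ray_scale[OF x r])
  qed
  have n_scale: "n (scale G r x) = n x" if "0 < r" for r x
    unfolding n_def Nscale[OF less_imp_le[OF that]] scale_scale using that by simp
  define s where "s = (\<lambda>\<rho>. n (SOME x. x \<in> \<rho>))"
  have s: "s (ray x) = n x" if x: "x \<in> punctured_cone V G" for x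
  proof -
    have "(SOME y. y \<in> ray x) \<in> ray x" by (rule someI[of "\<lambda>y. y \<in> ray x", OF self_in_ray[OF x]])
    then obtain r where "r > 0" "(SOME y. y \<in> ray x) = scale G r x" unfolding in_ray_iff[OF x] by blast
    then show ?thesis unfolding s_def using n_scale by simp
  qed
  have scale_ext: "scale G r x \<in> extensional G" for r and x :: "('a \<Rightarrow> real) \<Rightarrow> real" by (simp add: scale_def)
  have ncont: "continuous_map punctured_top punctured_top n"
    unfolding continuous_map_in_subtopology continuous_map_componentwise
  proof (intro conjI ballI)
    show "n ` topspace punctured_top \<subseteq> extensional G" using scale_ext by (auto simp: n_def)
    show "n \<in> topspace punctured_top \<rightarrow> punctured_cone V G" unfolding topspace_punctured_top using n(1) by blast
    fix g assume g: "g \<in> G"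
    have "continuous_map punctured_top euclideanreal (\<lambda>x. (1 / N x) * x g)"
      using g Npos unfolding divide_inverse mult_1_left
      by (intro continuous_map_real_mult continuous_map_real_inverse Ncont
          continuous_map_from_subtopology continuous_map_product_projection)
        (auto simp: topspace_punctured_top dest!: order_less_imp_not_eq2)
    then show "continuous_map punctured_top euclideanreal (\<lambda>x. n x g)" using g by (simp add: n_def scale_def)
  qed
  have scont: "continuous_map (boundary_top V G) punctured_top s"
  proof (rule continuous_compose_quotient_map[OF ray_quotient_map])
    show "continuous_map punctured_top punctured_top (s \<circ> ray)"
    proof (rule continuous_map_eq[OF ncont])
      fix x assume "x \<in> topspace punctured_top"
      then show "n x = (s \<circ> ray) x" unfolding topspace_punctured_top using s by simp
    qed
  qed
  have s_punctured: "s \<rho> \<in> punctured_cone V G" if "\<rho> \<in> boundary V G" for \<rho>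
    using that n(1) s by (auto simp: boundary_eq)
  have rcont: "continuous_map punctured_top (boundary_top V G) ray"
    by (rule quotient_imp_continuous_map[OF ray_quotient_map])
  let ?P = "prod_topology (boundary_top V G) (top_of_set {0::real<..})"
  have "homeomorphic_maps ?P punctured_top (\<lambda>(\<rho>, r). scale G r (s \<rho>)) (\<lambda>x. (ray x, N x))"
    unfolding homeomorphic_maps_def
  proof (intro conjI ballI)
    show "continuous_map ?P punctured_top (\<lambda>(\<rho>, r). scale G r (s \<rho>))"
      unfolding continuous_map_in_subtopology continuous_map_componentwise
    proof (intro conjI ballI)
      show "(\<lambda>(\<rho>, r). scale G r (s \<rho>)) ` topspace ?P \<subseteq> extensional G" using scale_ext by auto
      show "(\<lambda>(\<rho>, r). scale G r (s \<rho>)) \<in> topspace ?P \<rightarrow> punctured_cone V G"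
        using s_punctured punctured_cone_scale by (auto simp: topspace_boundary_top)
      fix g assume g: "g \<in> G"
      have "continuous_map (boundary_top V G) euclideanreal (\<lambda>\<rho>. s \<rho> g)"
        using scont g unfolding continuous_map_in_subtopology continuous_map_componentwise by blast
      then have "continuous_map ?P euclideanreal ((\<lambda>\<rho>. s \<rho> g) \<circ> fst)"
        by (rule continuous_map_compose[OF continuous_map_fst])
      moreover have "continuous_map ?P euclideanreal snd"
        using continuous_map_snd[of "boundary_top V G" "top_of_set {0::real<..}"]
        by (simp add: continuous_map_in_subtopology)
      ultimately have "continuous_map ?P euclideanreal (\<lambda>z. snd z * ((\<lambda>\<rho>. s \<rho> g) \<circ> fst) z)"
        by (intro continuous_map_real_mult)
      then show "continuous_map ?P euclideanreal (\<lambda>z. (case z of (\<rho>, r) \<Rightarrow> scale G r (s \<rho>)) g)"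
        using g by (simp add: scale_def case_prod_beta)
    qed
    show "continuous_map punctured_top ?P (\<lambda>x. (ray x, N x))"
      by (intro continuous_map_pairedI rcont continuous_map_into_subtopology Ncont)
        (use Npos topspace_punctured_top in auto)
  next
    fix z assume "z \<in> topspace ?P"
    then obtain x r where z: "z = (ray x, r)" "x \<in> punctured_cone V G" "0 < r"
      by (auto simp: topspace_boundary_top boundary_eq)
    have "ray (scale G r (n x)) = ray x" using ray_scale[OF n(1)[OF z(2)] z(3)] n(5)[OF z(2)] by simp
    moreover have "N (scale G r (n x)) = r" using Nscale[of r] n(3)[OF z(2)] z(3) by simp
    ultimately show "(\<lambda>x. (ray x, N x)) ((\<lambda>(\<rho>, r). scale G r (s \<rho>)) z) = z" by (simp add: z(1) s[OF z(2)])
  next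
    fix x assume "x \<in> topspace punctured_top"
    then have x: "x \<in> punctured_cone V G" unfolding topspace_punctured_top .
    show "(\<lambda>(\<rho>, r). scale G r (s \<rho>)) (ray x, N x) = x" using n(4)[OF x] by (simp add: s[OF x])
  qed
  then have "homeomorphic_map ?P punctured_top (\<lambda>(\<rho>, r). scale G r (s \<rho>))"
    unfolding homeomorphic_map_maps by (intro exI[of _ "\<lambda>x. (ray x, N x)"])
  moreover have "\<forall>\<rho>\<in>boundary V G. s \<rho> \<in> \<rho>" using n(2) s by (auto simp: boundary_eq)
  ultimately have sec: "is_cone_section V G s" by (simp add: is_cone_section_def)
  define \<beta> where "\<beta> = cone_proj F \<circ> s"
  define \<Sigma> where "\<Sigma> = {y \<in> finite_cone V F. Max (insert 0 ((\<lambda>g. \<bar>y g\<bar>) ` F)) = 1}"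
  have N\<Sigma>: "Max (insert 0 ((\<lambda>g. \<bar>restrict x F g\<bar>) ` F)) = N x" for x
    unfolding N_def by (intro arg_cong[of _ _ Max] arg_cong[of _ _ "insert 0"] image_cong) auto
  have zeroN: "N (\<lambda>g\<in>G. 0) = 0"
    using Nat[of "\<lambda>g\<in>G. 0"] f(3) by auto
  have lift\<Sigma>: "lift_from F y \<in> punctured_cone V G" "n (lift_from F y) = lift_from F y" if y: "y \<in> \<Sigma>" for y
  proof -
    have yc: "y \<in> finite_cone V F" using y by (simp add: \<Sigma>_def)
    have N1: "N (lift_from F y) = 1" using y lift_from_facts(3)[OF F yc] N\<Sigma>[of "lift_from F y"] by (simp add: \<Sigma>_def)
    then have "lift_from F y \<noteq> (\<lambda>g\<in>G. 0)" using zeroN by auto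
    then show "lift_from F y \<in> punctured_cone V G" using lift_from_facts(2)[OF F yc] by (simp add: punctured_cone_def)
    show "n (lift_from F y) = lift_from F y"
      unfolding n_def N1 using lift_from_facts(2)[OF F yc] limit_cone_extensional by (simp add: scale_one subset_iff)
  qed
  have s1: "N (s \<rho>) = 1" if "\<rho> \<in> boundary V G" for \<rho>
    using that n(3) s by (auto simp: boundary_eq)
  have \<beta>\<Sigma>: "\<beta> \<rho> \<in> \<Sigma>" if \<rho>: "\<rho> \<in> boundary V G" for \<rho>
    using limit_cone_restrict[OF f(1), of "s \<rho>"] s_punctured[OF \<rho>] s1[OF \<rho>] N\<Sigma>[of "s \<rho>"]
    by (auto simp: \<beta>_def \<Sigma>_def cone_proj_def punctured_cone_def simp del: Max_insert)
  have \<Sigma>sub: "\<Sigma> \<subseteq> finite_cone V F" by (auto simp: \<Sigma>_def)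
  have top\<Sigma>: "topspace (subtopology (powertop_real F) \<Sigma>) = \<Sigma>" using \<Sigma>sub finite_cone_sub[OF F] by auto
  have hm: "homeomorphic_maps (boundary_top V G) (subtopology (powertop_real F) \<Sigma>) \<beta> (ray \<circ> lift_from F)"
    unfolding homeomorphic_maps_def topspace_boundary_top top\<Sigma>
  proof (intro conjI ballI)
    have "continuous_map punctured_top (subtopology (powertop_real F) UNIV) (cone_proj F)"
      by (rule cone_proj_continuous[OF f(3)]) simp
    then have "continuous_map (boundary_top V G) (powertop_real F) \<beta>"
      unfolding \<beta>_def using scont continuous_map_compose by (metis subtopology_UNIV)
    then show "continuous_map (boundary_top V G) (subtopology (powertop_real F) \<Sigma>) \<beta>"
      by (rule continuous_map_into_subtopology) (use \<beta>\<Sigma> topspace_boundary_top in auto)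
    have "continuous_map (subtopology (powertop_real F) \<Sigma>) (cone_top V G) (lift_from F)"
      by (rule continuous_map_from_subtopology_mono[OF lift_from_continuous[OF F] \<Sigma>sub])
    then have "continuous_map (subtopology (powertop_real F) \<Sigma>) punctured_top (lift_from F)"
      using lift\<Sigma>(1) top\<Sigma> by (auto simp: continuous_map_in_subtopology)
    then show "continuous_map (subtopology (powertop_real F) \<Sigma>) (boundary_top V G) (ray \<circ> lift_from F)"
      by (rule continuous_map_compose[OF _ rcont])
  next
    fix \<rho> assume "\<rho> \<in> boundary V G"
    then obtain x where x: "x \<in> punctured_cone V G" "\<rho> = ray x" unfolding boundary_eq by blast
    have "n x \<in> limit_cone V G" using n(1)[OF x(1)] by (simp add: punctured_cone_def)
    then have "lift_from F (\<beta> \<rho>) = n x"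
      using lift_from_facts(1)[OF F] by (simp add: \<beta>_def x(2) s[OF x(1)] cone_proj_def)
    then show "(ray \<circ> lift_from F) (\<beta> \<rho>) = \<rho>" using n(5)[OF x(1)] by (simp add: x(2))
  next
    fix y assume y: "y \<in> \<Sigma>"
    then show "\<beta> ((ray \<circ> lift_from F) y) = y"
      using s[OF lift\<Sigma>(1)[OF y]] lift\<Sigma>(2)[OF y] lift_from_facts(3)[OF F, of y] \<Sigma>sub
      by (auto simp: \<beta>_def cone_proj_def)
  qed
  have img: "\<beta> ` boundary V G = \<Sigma>"
    using homeomorphic_imp_surjective_map[of "boundary_top V G" "subtopology (powertop_real F) \<Sigma>" \<beta>] hm
    unfolding homeomorphic_map_maps topspace_boundary_top top\<Sigma> by blast
  have poly: "polyhedral F \<Sigma>"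
  proof -
    obtain \<P> where P: "finite \<P>" "\<forall>P\<in>\<P>. convex_polyhedron F P" "finite_cone V F = \<Union>\<P>"
      by (rule finite_cone_polyhedra[OF f(2,3)])
    define Q :: "(('a \<Rightarrow> real) \<Rightarrow> real) set \<times> ('a \<Rightarrow> real) \<times> real \<Rightarrow> (('a \<Rightarrow> real) \<Rightarrow> real) set"
      where "Q = (\<lambda>(P, g, c). (P \<inter> {y \<in> F \<rightarrow>\<^sub>E UNIV. \<forall>i\<in>F. \<bar>y i - 0\<bar> \<le> 1}) \<inter> {y \<in> F \<rightarrow>\<^sub>E UNIV. y g = c})"
    define \<Q> where "\<Q> = Q ` (\<P> \<times> F \<times> {1, -1})"
    have iff: "y \<in> \<Sigma> \<longleftrightarrow> y \<in> \<Union>\<Q>" for y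
    proof
      assume y: "y \<in> \<Sigma>"
      then obtain P' where P': "P' \<in> \<P>" "y \<in> P'" using \<Sigma>sub P(3) by blast
      have Ny: "N y = 1" using y by (simp add: \<Sigma>_def N_def)
      then obtain g where g: "g \<in> F" "\<bar>y g\<bar> = 1" using Nat[of y] by auto
      then have "y g \<in> {1, -1}" by auto
      moreover have "\<forall>i\<in>F. \<bar>y i - 0\<bar> \<le> 1" using Nle[of _ y] Ny by simp
      moreover have "y \<in> F \<rightarrow>\<^sub>E UNIV" using y \<Sigma>sub finite_cone_sub[OF F] by blast
      ultimately have "y \<in> Q (P', g, y g)" "(P', g, y g) \<in> \<P> \<times> F \<times> {1, -1}" using P' g by (auto simp: Q_def)
      then show "y \<in> \<Union>\<Q>" unfolding \<Q>_def by blast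
    next
      assume "y \<in> \<Union>\<Q>"
      then obtain P' g c where y: "P' \<in> \<P>" "g \<in> F" "c \<in> {1, -1}" "y \<in> Q (P', g, c)" by (auto simp: \<Q>_def)
      then have yy: "y \<in> P'" "\<forall>i\<in>F. \<bar>y i\<bar> \<le> 1" "\<bar>y g\<bar> = 1" by (auto simp: Q_def)
      have "N y \<le> 1" using Nat[of y] yy(2) by auto
      then have "N y = 1" using Nle[OF y(2), of y] yy(3) by simp
      then show "y \<in> \<Sigma>" using yy(1) y(1) P(3) by (auto simp: \<Sigma>_def N_def)
    qed
    have "pl_on F {} \<Sigma> (\<lambda>y. y)"
    proof (rule pl_on_finite_union[of \<Q>])
      show "finite \<Q>" using P(1) f(2) by (simp add: \<Q>_def)
      show "\<Sigma> = \<Union>\<Q>" using iff by blast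
      show "affine_map_on F {} T (\<lambda>y. y)" for T by (simp add: affine_map_on_def)
      fix T assume "T \<in> \<Q>"
      then obtain P' g c where "P' \<in> \<P>" "g \<in> F" "T = Q (P', g, c)" by (auto simp: \<Q>_def)
      then have T: "P' \<in> \<P>" "g \<in> F" "T = P' \<inter> {y \<in> F \<rightarrow>\<^sub>E UNIV. \<forall>i\<in>F. \<bar>y i - 0\<bar> \<le> 1} \<inter> {y \<in> F \<rightarrow>\<^sub>E UNIV. y g = c}"
        unfolding Q_def prod.case by blast+
      show "convex_polyhedron F T"
        unfolding T(3)
        by (rule convex_polyhedron_Int[OF convex_polyhedron_Int[OF bspec[OF P(2) T(1)] convex_polyhedron_box[OF f(2)]]
              convex_polyhedron_coordinate[OF f(2) T(2)]])
    qed (rule f(2))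
    then show ?thesis by (rule pl_on_polyhedral)
  qed
  have openB: "openin (boundary_top V G) (boundary V G)"
    using openin_topspace[of "boundary_top V G"] unfolding topspace_boundary_top .
  have subB: "subtopology (boundary_top V G) (boundary V G) = boundary_top V G"
    using subtopology_topspace[of "boundary_top V G"] unfolding topspace_boundary_top .
  have "homeomorphic_map (boundary_top V G) (subtopology (powertop_real F) \<Sigma>) \<beta>"
    unfolding homeomorphic_map_maps using hm by (intro exI[of _ "ray \<circ> lift_from F"])
  then have chart: "is_pl_chart (boundary_top V G) (boundary V G, F, \<beta>)"
    unfolding is_pl_chart_def prod.case img subB using openB f(2) poly by blast
  let ?T = "compatible_charts (boundary_top V G) (boundary V G, F, \<beta>)"
  have "pl_structure (boundary_top V G) ?T"
    by (rule pl_structure_of_global_chart(1)[OF chart]) (simp add: topspace_boundary_top)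
  moreover have "pl_map (boundary_top V G) ?T (cone_top V G) (compatible_charts (cone_top V G) (cone_chart V G F)) s"
  proof -
    have "continuous_map (boundary_top V G) (cone_top V G) s"
      using scont by (auto simp: continuous_map_in_subtopology punctured_cone_def)
    moreover have "is_pl_chart (cone_top V G) (topspace (cone_top V G), F, cone_proj F)"
      using cone_chart_is_pl_chart[OF F] unfolding cone_chart_def topspace_cone_top .
    moreover have "is_pl_chart (boundary_top V G) (topspace (boundary_top V G), F, \<beta>)"
      using chart unfolding topspace_boundary_top .
    ultimately have "pl_map (boundary_top V G) (compatible_charts (boundary_top V G) (topspace (boundary_top V G), F, \<beta>))
        (cone_top V G) (compatible_charts (cone_top V G) (topspace (cone_top V G), F, cone_proj F)) s"
      by (intro pl_map_of_global_charts) (simp_all add: \<beta>_def)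
    then show ?thesis unfolding topspace_boundary_top topspace_cone_top cone_chart_def .
  qed
  ultimately show "\<exists>\<T>. boundary_structure_from_cone V G (compatible_charts (cone_top V G) (cone_chart V G F)) \<T>"
    unfolding boundary_structure_from_cone_def using sec by blast
qed

end

theorem proposition3p1:
  fixes V :: "(real ^ 'n) set" and G :: "(real ^ 'n \<Rightarrow> real) set"
  assumes "semialgebraic V"
    and "semialgebraic_family V G"
    and "proper_family V G"
    and "injective_families V G \<noteq> {}"
  shows "(\<forall>F\<in>injective_families V G.
            is_pl_chart (cone_top V G) (cone_chart V G F) \<and> cone_proj F ` limit_cone V G = finite_cone V F) \<and>
         (\<forall>F\<in>injective_families V G. \<forall>F'\<in>injective_families V G.
            pl_compatible (cone_chart V G F) (cone_chart V G F')) \<and>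
         (\<exists>!\<S>. pl_structure (cone_top V G) \<S> \<and> cone_chart V G ` injective_families V G \<subseteq> \<S>) \<and>
         (\<forall>\<S>. pl_structure (cone_top V G) \<S> \<and> cone_chart V G ` injective_families V G \<subseteq> \<S> \<longrightarrow>
            (\<exists>\<T>. boundary_structure_from_cone V G \<S> \<T>))"
proof -
  interpret cone_data V G by unfold_locales (rule assms)+
  obtain F where F: "F \<in> injective_families V G" using assms(4) by blast
  let ?S = "compatible_charts (cone_top V G) (cone_chart V G F)"
  note chart = cone_chart_is_pl_chart[OF F]
  have top: "fst (cone_chart V G F) = topspace (cone_top V G)"
    unfolding topspace_cone_top by (simp add: cone_chart_def)
  have charts: "cone_chart V G ` injective_families V G \<subseteq> ?S"
    using cone_chart_is_pl_chart cone_charts_compatible F by (auto simp: compatible_charts_def)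
  have unique: "\<S> = ?S" if "pl_structure (cone_top V G) \<S>" "cone_chart V G ` injective_families V G \<subseteq> \<S>" for \<S>
    using pl_structure_of_global_chart(3)[OF chart top that(1)] that(2) F by blast
  have "\<exists>!\<S>. pl_structure (cone_top V G) \<S> \<and> cone_chart V G ` injective_families V G \<subseteq> \<S>"
  proof (rule ex1I[of _ ?S])
    show "pl_structure (cone_top V G) ?S \<and> cone_chart V G ` injective_families V G \<subseteq> ?S"
      using pl_structure_of_global_chart(1)[OF chart top] charts by blast
  qed (use unique in blast)
  moreover have "\<exists>\<T>. boundary_structure_from_cone V G \<S> \<T>"
    if "pl_structure (cone_top V G) \<S>" "cone_chart V G ` injective_families V G \<subseteq> \<S>" for \<S>
    unfolding unique[OF that] by (rule boundary_structure_exists[OF F])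
  moreover have "cone_proj F' ` limit_cone V G = finite_cone V F'" if "F' \<in> injective_families V G" for F'
    by (rule cone_proj_image[OF injective_family_facts(1)[OF that]])
  ultimately show ?thesis
    by (intro conjI ballI allI impI cone_chart_is_pl_chart cone_charts_compatible) simp_all
qed

end
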